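(* Let $p=1$ and $\tfrac32<s<\tfrac52$, and let $u_0\in H^s(0,\tfrac12)$ with $u_0(0)=u_0(\tfrac12)=0$. Then there exist a maximal $T=T(u_0)\in(0,\infty]$ and a unique solution $u$ of the initial boundary value problem (IBVP-mHS) on $[0,T)$ with $$u\in C([0,T);H^s(0,\tfrac12))\cap C^1([0,T);H^{s-1}(0,\tfrac12)).$$ The solution depends continuously on the initial data, i.e. the map $u_0\mapsto u(\cdot,u_0)$ from $\{u_0\in H^s(0,\tfrac12): u_0(0)=u_0(\tfrac12)=0\}$ to $C([0,T);H^s(0,\tfrac12))\cap C^1([0,T);H^{s-1}(0,\tfrac12))$ is continuous. Moreover, $T$ is independent of $s$: if $u$ is such a solution and additionally $u_0\in H^{s'}(0,\tfrac12)$ with $\tfrac32<s'<\tfrac52$, $s'\neq s$, then $u\in C([0,T);H^{s'}(0,\tfrac12))\cap C^1([0,T);H^{s'-1}(0,\tfrac12))$ with the same $T$.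
   Context: $H^s(a,b)$ is the $L_2$-Sobolev space of order $s\ge0$ on the interval $(a,b)$. For an integer $p\ge1$, the initial boundary value problem (IBVP-mHS) for the modified Hunter–Saxton equation on $(0,\tfrac12)$ with initial datum $u_0$ is: $u(0,x)=u_0(x)$ for $x\in[0,\tfrac12]$, $u(t,0)=u(t,\tfrac12)=0$ for all $t$, and for $t>0$, $x\in(0,\tfrac12)$, $$u_t+u^pu_x=\frac p2\int_0^x\Big(u^{p-1}u_x^2(t,y)-2\int_0^{1/2}u^{p-1}u_x^2(t,z)\,dz\Big)\,dy,$$ (for $p=1$, $u^{p-1}\equiv1$). This is the nonlocal form of $(u_t+u^pu_x)_x=\tfrac p2u^{p-1}u_x^2-p\int_0^{1/2}u^{p-1}u_x^2\,dz$; it is exactly the restriction to $(0,\tfrac12)$ of the periodic equation $u_t+u^pu_x=\tfrac p2\partial_x^{-1}(u^{p-1}u_x^2-\int_0^1u^{p-1}u_x^2)$ for odd $1$-periodic $u$, where $\partial_x^{-1}$ is the zero-mean periodic antiderivative. *)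

theory Defs
  imports "HOL-Analysis.Analysis"
begin

definition L2_on :: "real \<Rightarrow> real \<Rightarrow> (real \<Rightarrow> real) \<Rightarrow> bool" where
  "L2_on a b g \<longleftrightarrow> set_borel_measurable lborel {a<..<b} g
      \<and> set_integrable lborel {a<..<b} (\<lambda>x. (g x)\<^sup>2)"

definition test_fun :: "real \<Rightarrow> real \<Rightarrow> (real \<Rightarrow> real) \<Rightarrow> bool" where
  "test_fun a b \<phi> \<longleftrightarrow> (\<forall>n x. ((deriv ^^ n) \<phi>) differentiable (at x))
      \<and> (\<exists>c d. a < c \<and> d < b \<and> (\<forall>x. x \<notin> {c..d} \<longrightarrow> \<phi> x = 0))"

definition weak_deriv :: "real \<Rightarrow> real \<Rightarrow> (real \<Rightarrow> real) \<Rightarrow> (real \<Rightarrow> real) \<Rightarrow> bool" where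
  "weak_deriv a b f g \<longleftrightarrow> (\<forall>\<phi>. test_fun a b \<phi> \<longrightarrow>
      set_lebesgue_integral lborel {a<..<b} (\<lambda>x. f x * deriv \<phi> x)
      = - set_lebesgue_integral lborel {a<..<b} (\<lambda>x. g x * \<phi> x))"

definition gagliardo_integrand :: "real \<Rightarrow> (real \<Rightarrow> real) \<Rightarrow> real \<times> real \<Rightarrow> real" where
  "gagliardo_integrand \<sigma> g z = (g (fst z) - g (snd z))\<^sup>2 / \<bar>fst z - snd z\<bar> powr (1 + 2 * \<sigma>)"

definition sobolev_rep :: "real \<Rightarrow> real \<Rightarrow> real \<Rightarrow> (real \<Rightarrow> real) \<Rightarrow> (nat \<Rightarrow> real \<Rightarrow> real) \<Rightarrow> bool" where
  "sobolev_rep s a b f gs \<longleftrightarrow> gs 0 = f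
      \<and> (\<forall>j \<le> nat \<lfloor>s\<rfloor>. L2_on a b (gs j))
      \<and> (\<forall>j < nat \<lfloor>s\<rfloor>. weak_deriv a b (gs j) (gs (Suc j)))
      \<and> (s - of_int \<lfloor>s\<rfloor> > 0 \<longrightarrow>
           set_integrable (lborel :: (real \<times> real) measure) ({a<..<b} \<times> {a<..<b})
             (gagliardo_integrand (s - of_int \<lfloor>s\<rfloor>) (gs (nat \<lfloor>s\<rfloor>))))"

definition sobolev_sq :: "real \<Rightarrow> real \<Rightarrow> real \<Rightarrow> (nat \<Rightarrow> real \<Rightarrow> real) \<Rightarrow> real" where
  "sobolev_sq s a b gs =
     (\<Sum>j \<le> nat \<lfloor>s\<rfloor>. set_lebesgue_integral lborel {a<..<b} (\<lambda>x. (gs j x)\<^sup>2))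
     + (if s - of_int \<lfloor>s\<rfloor> > 0 then
          set_lebesgue_integral (lborel :: (real \<times> real) measure) ({a<..<b} \<times> {a<..<b})
            (gagliardo_integrand (s - of_int \<lfloor>s\<rfloor>) (gs (nat \<lfloor>s\<rfloor>)))
        else 0)"

definition Hs :: "real \<Rightarrow> real \<Rightarrow> real \<Rightarrow> (real \<Rightarrow> real) set" where
  "Hs s a b = {f. \<exists>gs. sobolev_rep s a b f gs}"

text \<open>The H^s(a,b) norm (weak derivatives are unique a.e., so the infimum is attained by any
  representing chain).\<close>
definition Hs_norm :: "real \<Rightarrow> real \<Rightarrow> real \<Rightarrow> (real \<Rightarrow> real) \<Rightarrow> real" where
  "Hs_norm s a b f = Inf {sqrt (sobolev_sq s a b gs) | gs. sobolev_rep s a b f gs}"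

definition tint :: "ereal \<Rightarrow> real set" where
  "tint T = {t. 0 \<le> t \<and> ereal t < T}"

definition C_Hs :: "real \<Rightarrow> ereal \<Rightarrow> (real \<Rightarrow> real \<Rightarrow> real) \<Rightarrow> bool" where
  "C_Hs s T u \<longleftrightarrow> (\<forall>t \<in> tint T. u t \<in> Hs s 0 (1/2)
      \<and> (\<forall>\<epsilon>>0. \<exists>\<delta>>0. \<forall>t' \<in> tint T. \<bar>t' - t\<bar> < \<delta> \<longrightarrow>
           (\<lambda>x. u t' x - u t x) \<in> Hs s 0 (1/2) \<and> Hs_norm s 0 (1/2) (\<lambda>x. u t' x - u t x) < \<epsilon>))"

definition tderiv_Hs :: "real \<Rightarrow> ereal \<Rightarrow> (real \<Rightarrow> real \<Rightarrow> real) \<Rightarrow> (real \<Rightarrow> real \<Rightarrow> real) \<Rightarrow> bool" where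
  "tderiv_Hs r T u v \<longleftrightarrow> (\<forall>t \<in> tint T. \<forall>\<epsilon>>0. \<exists>\<delta>>0. \<forall>t' \<in> tint T. t' \<noteq> t \<and> \<bar>t' - t\<bar> < \<delta> \<longrightarrow>
       (\<lambda>x. (u t' x - u t x) / (t' - t) - v t x) \<in> Hs r 0 (1/2)
       \<and> Hs_norm r 0 (1/2) (\<lambda>x. (u t' x - u t x) / (t' - t) - v t x) < \<epsilon>)"

text \<open>u \<in> C([0,T); H^s) \<inter> C^1([0,T); H^{s-1}) with time derivative v; representatives are
  taken continuous on [0,1/2] (possible since s - 1 > 1/2).\<close>
definition sol_class :: "real \<Rightarrow> ereal \<Rightarrow> (real \<Rightarrow> real \<Rightarrow> real) \<Rightarrow> (real \<Rightarrow> real \<Rightarrow> real) \<Rightarrow> bool" where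
  "sol_class s T u v \<longleftrightarrow> C_Hs s T u \<and> C_Hs (s - 1) T v \<and> tderiv_Hs (s - 1) T u v
      \<and> (\<forall>t \<in> tint T. continuous_on {0..1/2} (u t) \<and> continuous_on {0..1/2} (v t))"

text \<open>Right-hand side of (IBVP-mHS) for general p (u^0 = 1).\<close>
definition mhs_rhs :: "nat \<Rightarrow> (real \<Rightarrow> real) \<Rightarrow> real \<Rightarrow> real" where
  "mhs_rhs p w x = (real p / 2) * integral {0..x} (\<lambda>y.
       w y ^ (p - 1) * (deriv w y)\<^sup>2
       - 2 * integral {0..1/2} (\<lambda>z. w z ^ (p - 1) * (deriv w z)\<^sup>2))"

definition mhs_solution :: "nat \<Rightarrow> real \<Rightarrow> (real \<Rightarrow> real) \<Rightarrow> ereal \<Rightarrow>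
    (real \<Rightarrow> real \<Rightarrow> real) \<Rightarrow> (real \<Rightarrow> real \<Rightarrow> real) \<Rightarrow> bool" where
  "mhs_solution p s u0 T u v \<longleftrightarrow> sol_class s T u v
      \<and> (\<forall>x \<in> {0..1/2}. u 0 x = u0 x)
      \<and> (\<forall>t \<in> tint T. u t 0 = 0 \<and> u t (1/2) = 0)
      \<and> (\<forall>t \<in> tint T. t > 0 \<longrightarrow> (\<forall>x \<in> {0<..<1/2}.
           v t x + u t x ^ p * deriv (u t) x = mhs_rhs p (u t) x))"

definition mhs_data :: "real \<Rightarrow> (real \<Rightarrow> real) set" where
  "mhs_data s = {f. f \<in> Hs s 0 (1/2) \<and> continuous_on {0..1/2} f \<and> f 0 = 0 \<and> f (1/2) = 0}"

end

theory Submission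
  imports Defs
begin

text \<open>
  The equation with p = 1 is solved explicitly along characteristics. Let a be the derivative of the
  initial datum and E the integral of its square over [0,1/2]. The energy E is conserved and the slope
  of a solution, followed along a characteristic, obeys the Riccati equation
  a' = - a^2/2 - E. Hence the square root q of the Jacobian of the flow map satisfies q'' = - (E/2) q, so
  q = c + d a with c = cos (sqrt (E/2) t) and d' = c/2, d = 0 at t = 0. The flow map, the velocity
  and the acceleration in Lagrangian coordinates are then polynomials in c, d, a and its
  antiderivatives, and the solution lives exactly as long as q > 0, a condition that does not involve s.

  Regularity in time and continuous dependence reduce to the continuity, in L2 and for the Gagliardo kernel, of
  composition with uniformly bi-Lipschitz maps. For uniqueness, any solution of the class is
  continuously differentiable, so it has a flow map and the computation above determines it; this also
  bounds its lifespan by the time at which q vanishes.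
\<close>

text \<open>Composition with the inverse flow depends continuously on the flow in these norms, but
  with no rate, so convergence is shown along sequences and by density. With
  \<open>s = k + 1 + \<sigma>\<close> two regimes arise. For \<open>k = 0\<close>,
  \<open>\<sigma> > 1/2\<close>, Lagrangian increments of \<open>u_x\<close> and \<open>u_t\<close>
  are a bounded multiple of increments of the initial slope plus at most a Lipschitz remainder. For
  \<open>k = 1\<close>, \<open>\<sigma> < 1/2\<close>, the coefficients in front of the slope's
  derivative are Hoelder of exponent 1/2. In both, the Hoelder exponent exceeds
  \<open>\<sigma>\<close>, which makes the remainder square integrable against the Gagliardo weight;
  this is where \<open>s < 5/2\<close> enters. The time derivative in norm is reached by writing a
  difference quotient as a mean of \<open>u_t\<close> over time, so no second time derivative
  occurs. For uniqueness \<open>u_x\<close> is merely continuous, and the Riccati equation comes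
  from differentiating the time-integrated velocity in the label of the characteristic. The identity
  \<open>c^2 + 2 E d^2 = 1\<close> serves twice: it keeps the endpoints fixed, and it is the
  determinant of the Moebius map from the initial slope to the current one.\<close>

abbreviation (input) BM :: "('a::topological_space => 'b::topological_space) set" where "BM \<equiv> borel_measurable borel"

subsection \<open>Square integrals and their continuity under composition\<close>

text \<open>Squared L2 norms take values in \<open>ennreal\<close>, so that Tonelli, monotonicity
  and dominated convergence need no integrability side conditions. The general domain type lets one
  set of rules serve functions on the line and kernels on the plane.\<close>

definition nsq :: "'a::euclidean_space set => ('a => real) => ennreal" where
 "nsq S f = (\<integral>\<^sup>+x. ennreal ((f x)\<^sup>2) * indicator S x \<partial>lborel)"

lemma nsq_mono_AE:
 assumes "AE x in lborel. x \<in> S \<longrightarrow> \<bar>f x\<bar> \<le> \<bar>g x\<bar>"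
 shows "nsq S f \<le> nsq S g"
 unfolding nsq_def
 by (rule nn_integral_mono_AE, use assms in eventually_elim)
   (auto simp: indicator_def abs_le_square_iff intro: ennreal_leI)

lemma nsq_mono: "(\<And>x. x \<in> S ==> \<bar>f x\<bar> \<le> \<bar>g x\<bar>) ==> nsq S f \<le> nsq S g"
 by (rule nsq_mono_AE) auto

lemma nsq_cong_AE:
 "AE x in lborel. x \<in> S \<longrightarrow> f x = g x ==> nsq S f = nsq S g"
 by (intro antisym nsq_mono_AE) (auto elim: eventually_mono)

lemma nsq_cong: "(\<And>x. x \<in> S ==> f x = g x) ==> nsq S f = nsq S g"
 by (rule nsq_cong_AE) auto

lemma nsq_cmult:
 assumes "f \<in> BM" "S \<in> sets borel"
 shows "nsq S (%x. c * f x) = ennreal (c\<^sup>2) * nsq S f"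
proof -
 have "nsq S (%x. c * f x) = (\<integral>\<^sup>+x. ennreal (c\<^sup>2) * (ennreal ((f x)\<^sup>2) * indicator S x) \<partial>lborel)"
  unfolding nsq_def by (intro nn_integral_cong) (simp add: power_mult_distrib ennreal_mult mult.assoc)
 also have "... = ennreal (c\<^sup>2) * nsq S f"
  unfolding nsq_def using assms by (intro nn_integral_cmult) auto
 finally show ?thesis .
qed

lemma nsq_mult_le:
 assumes "f \<in> BM" "S \<in> sets borel" "\<And>x. x \<in> S ==> \<bar>m x\<bar> \<le> B"
 shows "nsq S (%x. m x * f x) \<le> ennreal (B\<^sup>2) * nsq S f"
proof -
 have "nsq S (%x. m x * f x) \<le> nsq S (%x. B * f x)"
  by (rule nsq_mono) (simp add: abs_mult, use assms(3) in \<open>fastforce intro: mult_right_mono\<close>)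
 with nsq_cmult[OF assms(1,2)] show ?thesis by simp
qed

lemma nsq_add:
 assumes "f \<in> BM" "g \<in> BM" "S \<in> sets borel"
 shows "nsq S (%x. f x + g x) \<le> 2 * nsq S f + 2 * nsq S g"
proof -
 have "nsq S (%x. f x + g x) \<le> (\<integral>\<^sup>+x. 2 * (ennreal ((f x)\<^sup>2) * indicator S x) +
   2 * (ennreal ((g x)\<^sup>2) * indicator S x) \<partial>lborel)"
  unfolding nsq_def
 proof (rule nn_integral_mono)
  fix x
  have "(f x + g x)\<^sup>2 \<le> 2 * (f x)\<^sup>2 + 2 * (g x)\<^sup>2"
   using sum_squares_bound[of "f x" "g x"] by (simp add: power2_sum)
  then have "ennreal ((f x + g x)\<^sup>2) \<le> ennreal (2 * (f x)\<^sup>2 + 2 * (g x)\<^sup>2)" by (rule ennreal_leI)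
  also have "... = 2 * ennreal ((f x)\<^sup>2) + 2 * ennreal ((g x)\<^sup>2)"
   by (simp add: ennreal_mult ennreal_plus)
  finally show "ennreal ((f x + g x)\<^sup>2) * indicator S x \<le> 2 * (ennreal ((f x)\<^sup>2) * indicator S x) +
   2 * (ennreal ((g x)\<^sup>2) * indicator S x)" by (auto simp: indicator_def)
 qed
 also have "... = 2 * nsq S f + 2 * nsq S g"
  unfolding nsq_def using assms by (simp add: nn_integral_add nn_integral_cmult)
 finally show ?thesis .
qed

lemma nsq_add_finite:
 assumes "f \<in> BM" "g \<in> BM" "S \<in> sets borel"
  "nsq S f < \<infinity>" "nsq S g < \<infinity>"
 shows "nsq S (%x. f x + g x) < \<infinity>"
 by (rule le_less_trans[OF nsq_add[OF assms(1-3)]]) (use assms(4,5) in \<open>simp add: ennreal_mult_less_top\<close>)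

lemma nsq_const: "S \<in> sets borel ==> nsq S (%x. c) = ennreal (c\<^sup>2) * emeasure lborel S"
 unfolding nsq_def by (simp add: nn_integral_cmult_indicator)

lemma nsq_bounded_finite:
 assumes "S \<in> sets borel" "emeasure lborel S < \<infinity>" "\<And>x. x \<in> S ==> \<bar>f x\<bar> \<le> B"
 shows "nsq S f < \<infinity>"
proof -
 have "nsq S f \<le> nsq S (%x. B)" by (rule nsq_mono) (use assms(3) in force)
 also have "... < \<infinity>" using assms by (simp add: nsq_const ennreal_mult_less_top)
 finally show ?thesis .
qed

text \<open>Shape of a density argument: the approximation error \<open>e\<close> is fixed first,
  and the null sequence \<open>u\<close> may depend on it.\<close>

lemma tendsto_0_ennreal_approx:
 fixes x :: "nat => ennreal"
 assumes "\<And>e::real. e > 0 ==> \<exists>u. u \<longlonglongrightarrow> 0 \<and> (\<forall>n. x n \<le> ennreal e + u n)"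
 shows "x \<longlonglongrightarrow> 0"
proof (rule order_tendstoI)
 fix a :: ennreal assume "a < 0" then show "\<forall>\<^sub>F n in sequentially. a < x n" by simp
next
 fix a :: ennreal assume a: "0 < a"
 obtain b :: real where b: "0 < b" "ennreal b < a"
  using a by (metis dense ennreal_less_zero_iff ennreal_cases ennreal_neq_top top.extremum_strict)
 obtain u where u: "u \<longlonglongrightarrow> (0::ennreal)" "\<And>n. x n \<le> ennreal (b/2) + u n" using assms[of "b/2"] b by auto
 have "\<forall>\<^sub>F n in sequentially. u n < ennreal (b/2)" using u(1) b by (intro order_tendstoD) auto
 then show "\<forall>\<^sub>F n in sequentially. x n < a"
 proof eventually_elim
  case (elim n)
  have "x n \<le> ennreal (b/2) + u n" by (rule u)
  also have "... \<le> ennreal (b/2) + ennreal (b/2)" using elim by (intro add_left_mono) auto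
  also have "... = ennreal b" using b by (simp flip: ennreal_plus)
  finally show ?case using b by simp
 qed
qed

lemma tendsto_0_ennreal_le:
 fixes x :: "nat => ennreal"
 assumes "u \<longlonglongrightarrow> 0" "\<And>n. x n \<le> u n"
 shows "x \<longlonglongrightarrow> 0"
 by (rule tendsto_sandwich[OF _ _ tendsto_const assms(1)]) (auto simp: assms)

lemma tendsto_0_ennreal_cmult:
 fixes u :: "nat => ennreal"
 assumes "u \<longlonglongrightarrow> 0" "c < top"
 shows "(%n. c * u n) \<longlonglongrightarrow> 0"
 using ennreal_tendsto_cmult[OF assms(2,1)] by simp

lemma nsq_dominated_convergence:
 assumes "\<And>n. f n \<in> BM" "w \<in> BM" "S \<in> sets borel"
  and "\<And>n x. x \<in> S ==> \<bar>f n x\<bar> \<le> \<bar>w x\<bar>" "nsq S w < \<infinity>"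
  and "AE x in lborel. x \<in> S \<longrightarrow> (%n. f n x) \<longlonglongrightarrow> 0"
 shows "(%n. nsq S (f n)) \<longlonglongrightarrow> 0"
proof -
 note [measurable] = assms(1-3)
 have "(%n. nsq S (f n)) \<longlonglongrightarrow> (\<integral>\<^sup>+(x::'a). 0 \<partial>lborel)"
  unfolding nsq_def
 proof (rule nn_integral_dominated_convergence)
  show "(\<integral>\<^sup>+ x. ennreal ((w x)\<^sup>2) * indicator S x \<partial>lborel) < \<infinity>" using assms(5) unfolding nsq_def .
  show "AE x in lborel. (%i. ennreal ((f i x)\<^sup>2) * indicator S x) \<longlonglongrightarrow> 0"
   using assms(6)
  proof eventually_elim
   case (elim x)
   show ?case
   proof (cases "x \<in> S")
    case True
    then have "(%i. ennreal ((f i x)\<^sup>2)) \<longlonglongrightarrow> ennreal (0\<^sup>2)"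
     using elim by (intro tendsto_ennrealI tendsto_intros) auto
    with True show ?thesis by simp
   qed simp
  qed
 qed (auto intro!: AE_I2 simp: indicator_def assms(4) abs_le_square_iff[symmetric] intro!: ennreal_leI)
 then show ?thesis by simp
qed

lemma nsq_add_tendsto_0:
 assumes "\<And>n. f n \<in> BM" "\<And>n. g n \<in> BM" "S \<in> sets borel"
  "(%n. nsq S (f n)) \<longlonglongrightarrow> 0" "(%n. nsq S (g n)) \<longlonglongrightarrow> 0"
 shows "(%n. nsq S (%x. f n x + g n x)) \<longlonglongrightarrow> 0"
proof (rule tendsto_0_ennreal_le)
 have "(%n. 2 * nsq S (f n) + 2 * nsq S (g n)) \<longlonglongrightarrow> 0 + 0"
  by (intro tendsto_add tendsto_0_ennreal_cmult assms) auto
 then show "(%n. 2 * nsq S (f n) + 2 * nsq S (g n)) \<longlonglongrightarrow> 0" by simp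
qed (intro nsq_add assms)

text \<open>The notion \<open>measurable_on\<close> supplies continuous functions converging off a
  negligible set. Clipping them to \<open>[-B, B]\<close> keeps continuity, does not disturb the
  limit, and makes \<open>2 * B\<close> a dominating function on a set of finite measure.\<close>

lemma nsq_dense_bounded:
 assumes "f \<in> BM" "S \<in> sets borel" "emeasure lborel S < \<infinity>" "\<And>x. \<bar>f x\<bar> \<le> B"
  and "e > 0"
 shows "\<exists>\<phi>. continuous_on UNIV \<phi> \<and> (\<forall>x. \<bar>\<phi> x\<bar> \<le> B) \<and> nsq S (%x. f x - \<phi> x) < e"
proof -
 have "f measurable_on UNIV"
  using assms(1) by (intro lebesgue_measurable_imp_measurable_on_real) (auto intro: measurable_completion)
 then obtain N g where N: "negligible N" and g: "\<And>n::nat. continuous_on UNIV (g n)"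
  and lim: "\<And>x. x \<notin> N ==> (%n. g n x) \<longlonglongrightarrow> f x"
  unfolding measurable_on_def by auto
 have B: "0 \<le> B" using assms(4) by (meson abs_ge_zero order_trans)
 define \<phi> where "\<phi> = (%n x. max (-B) (min B (g n x)))"
 have c: "continuous_on UNIV (\<phi> n)" for n unfolding \<phi>_def by (intro continuous_intros g)
 have [measurable]: "\<phi> n \<in> BM" for n by (intro borel_measurable_continuous_onI c)
 note [measurable] = assms(1,2)
 have b: "\<bar>\<phi> n x\<bar> \<le> B" for n x unfolding \<phi>_def using B by auto
 have "AE x in lebesgue. x \<notin> N" using N by (simp add: AE_not_in negligible_iff_null_sets)
 then have ae: "AE x in lborel. x \<notin> N" by (simp add: AE_completion_iff)
 have "(%n. nsq S (%x. f x - \<phi> n x)) \<longlonglongrightarrow> 0"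
 proof (rule nsq_dominated_convergence)
  show "\<bar>f x - \<phi> n x\<bar> \<le> \<bar>2 * B\<bar>" for n x using assms(4)[of x] b[of n x] by linarith
  show "nsq S (%x. 2 * B) < \<infinity>" using assms(2,3) by (intro nsq_bounded_finite[of _ _ "2*B"]) (use B in auto)
  show "AE x in lborel. x \<in> S \<longrightarrow> (%n. f x - \<phi> n x) \<longlonglongrightarrow> 0"
   using ae
  proof eventually_elim
   case (elim x)
   have "(%n. f x - max (-B) (min B (g n x))) \<longlonglongrightarrow> f x - max (-B) (min B (f x))"
    by (intro tendsto_intros lim elim)
   moreover have "max (-B) (min B (f x)) = f x" using assms(4)[of x] by (auto simp: max_def min_def)
   ultimately show ?case by (simp add: \<phi>_def)
  qed
 qed auto
 then have "\<forall>\<^sub>F n in sequentially. nsq S (%x. f x - \<phi> n x) < e" using assms(5) by (rule order_tendstoD)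
 then obtain n where "nsq S (%x. f x - \<phi> n x) < e" by (auto simp: eventually_sequentially)
 then show ?thesis using c b by blast
qed

text \<open>Truncating \<open>f\<close> at height \<open>n\<close> converges in L2, dominated by
  \<open>f\<close> itself, and reduces the claim to bounded functions.\<close>

lemma nsq_dense:
 assumes "f \<in> BM" "S \<in> sets borel" "emeasure lborel S < \<infinity>" "nsq S f < \<infinity>"
  and e: "e > (0::real)"
 shows "\<exists>\<phi> B. continuous_on UNIV \<phi> \<and> (\<forall>x. \<bar>\<phi> x\<bar> \<le> B) \<and> nsq S (%x. f x - \<phi> x) < ennreal e"
proof -
 note [measurable] = assms(1,2)
 define g where "g = (%(n::nat) x. max (- real n) (min (real n) (f x)))"
 have gm[measurable]: "g n \<in> BM" for n unfolding g_def by measurable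
 have "(%n. nsq S (%x. f x - g n x)) \<longlonglongrightarrow> 0"
 proof (rule nsq_dominated_convergence)
  show "\<bar>f x - g n x\<bar> \<le> \<bar>f x\<bar>" for n x unfolding g_def by (auto simp: max_def min_def)
  show "AE x in lborel. x \<in> S \<longrightarrow> (%n. f x - g n x) \<longlonglongrightarrow> 0"
  proof (intro AE_I2 impI)
   fix x
   obtain N where "\<bar>f x\<bar> \<le> real N" using real_arch_simple by blast
   then have "\<forall>n\<ge>N. f x - g n x = 0" unfolding g_def by (auto simp: max_def min_def)
   then show "(%n. f x - g n x) \<longlonglongrightarrow> 0"
    by (intro tendsto_eventually) (auto simp: eventually_sequentially)
  qed
 qed (use assms(4) in auto)
 then have "\<forall>\<^sub>F n in sequentially. nsq S (%x. f x - g n x) < ennreal (e/4)"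
  using e by (intro order_tendstoD) auto
 then obtain n where n: "nsq S (%x. f x - g n x) < ennreal (e/4)" by (auto simp: eventually_sequentially)
 have "\<bar>g n x\<bar> \<le> real n" for x unfolding g_def by (auto simp: max_def min_def)
 from nsq_dense_bounded[OF gm assms(2,3) this, of "ennreal (e/4)"] e
 obtain \<phi> where \<phi>: "continuous_on UNIV \<phi>" "\<And>x. \<bar>\<phi> x\<bar> \<le> real n" "nsq S (%x. g n x - \<phi> x) < ennreal (e/4)" by auto
 have [measurable]: "\<phi> \<in> BM" by (intro borel_measurable_continuous_onI \<phi>)
 have "nsq S (%x. f x - \<phi> x) = nsq S (%x. (f x - g n x) + (g n x - \<phi> x))" by simp
 also have "... \<le> 2 * nsq S (%x. f x - g n x) + 2 * nsq S (%x. g n x - \<phi> x)" by (intro nsq_add) auto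
 also have "... < 2 * ennreal (e/4) + 2 * ennreal (e/4)"
  by (intro add_strict_mono ennreal_mult_strict_left_mono n \<phi>) auto
 also have "... = ennreal e" using e by (simp flip: ennreal_numeral ennreal_mult ennreal_plus)
 finally show ?thesis using \<phi> by blast
qed

text \<open>Three-term estimate: \<open>f\<close> is replaced by a bounded continuous
  \<open>\<phi>\<close>, for which dominated convergence applies, and the uniform bound
  \<open>C\<close> carries the error \<open>f - \<phi>\<close> through composition with every
  \<open>T n\<close> and with \<open>T'\<close>. The change of variable enters only through
  \<open>bd\<close> and \<open>bd'\<close>, so the lemma applies on the line and on the square
  alike.\<close>

lemma nsq_comp_tendsto:
 fixes T :: "nat => 'a::euclidean_space => 'a"
 assumes S: "S \<in> sets borel" "emeasure lborel S < \<infinity>"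
  and T: "\<And>n. T n \<in> BM" "T' \<in> BM"
  and bd: "\<And>n f. f \<in> BM ==> nsq S (%x. f (T n x)) \<le> ennreal C * nsq S f"
  and bd': "\<And>f. f \<in> BM ==> nsq S (%x. f (T' x)) \<le> ennreal C * nsq S f"
  and lim: "\<And>x. x \<in> S ==> (%n. T n x) \<longlonglongrightarrow> T' x"
  and f: "f \<in> BM" "nsq S f < \<infinity>"
 shows "(%n. nsq S (%x. f (T n x) - f (T' x))) \<longlonglongrightarrow> 0"
proof (rule tendsto_0_ennreal_approx)
 fix e :: real assume e: "e > 0"
 \<comment> \<open>Two nested uses of \<open>nsq_add\<close> turn two errors of size
   \<open>\<bar>C\<bar> * e'\<close> into \<open>8 * \<bar>C\<bar> * e'\<close>; the added 1 covers
   \<open>C = 0\<close>.\<close>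
 define e' where "e' = e / (8 * (\<bar>C\<bar> + 1))"
 have e': "e' > 0" unfolding e'_def using e by (intro divide_pos_pos) auto
 obtain \<phi> B where \<phi>: "continuous_on UNIV \<phi>" "\<And>x. \<bar>\<phi> x\<bar> \<le> B" "nsq S (%x. f x - \<phi> x) < ennreal e'"
  using nsq_dense[OF f(1) S f(2) e'] by auto
 note [measurable] = S(1) T f(1)
 have pm[measurable]: "\<phi> \<in> BM" by (intro borel_measurable_continuous_onI \<phi>)
 define u where "u = (%n. nsq S (%x. \<phi> (T n x) - \<phi> (T' x)))"
 have u: "u \<longlonglongrightarrow> 0" unfolding u_def
 proof (rule nsq_dominated_convergence)
  show "\<bar>\<phi> (T n x) - \<phi> (T' x)\<bar> \<le> \<bar>2 * B\<bar>" for n x using \<phi>(2)[of "T n x"] \<phi>(2)[of "T' x"] by linarith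
  show "nsq S (%x. 2 * B) < \<infinity>" using S by (intro nsq_bounded_finite[of _ _ "\<bar>2*B\<bar>"]) auto
  show "AE x in lborel. x \<in> S \<longrightarrow> (%n. \<phi> (T n x) - \<phi> (T' x)) \<longlonglongrightarrow> 0"
  proof (intro AE_I2 impI)
   fix x assume "x \<in> S"
   have "isCont \<phi> (T' x)" using \<phi>(1) by (simp add: continuous_on_eq_continuous_at)
   then have "(%n. \<phi> (T n x)) \<longlonglongrightarrow> \<phi> (T' x)" using lim[OF \<open>x \<in> S\<close>] by (rule isCont_tendsto_compose)
   then show "(%n. \<phi> (T n x) - \<phi> (T' x)) \<longlonglongrightarrow> 0" by (simp add: LIM_zero_iff)
  qed
 qed auto
 have "nsq S (%x. f (T n x) - f (T' x)) \<le> ennreal e + 2 * u n" for n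
 proof -
  have [measurable]: "(%x. f x - \<phi> x) \<in> BM" by measurable
  have C: "ennreal C * nsq S (%x. f x - \<phi> x) \<le> ennreal (\<bar>C\<bar>) * ennreal e'"
   using \<phi>(3) by (intro mult_mono ennreal_leI) auto
  have 1: "nsq S (%x. f (T n x) - \<phi> (T n x)) \<le> ennreal (\<bar>C\<bar>) * ennreal e'"
   by (rule order_trans[OF bd[of "%x. f x - \<phi> x" n] C]) measurable
  have "nsq S (%x. \<phi> (T' x) - f (T' x)) = nsq S (%x. f (T' x) - \<phi> (T' x))"
   unfolding nsq_def by (simp add: power2_commute)
  then have 2: "nsq S (%x. \<phi> (T' x) - f (T' x)) \<le> ennreal (\<bar>C\<bar>) * ennreal e'"
   using order_trans[OF bd'[of "%x. f x - \<phi> x"] C] by simp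
  have "nsq S (%x. f (T n x) - f (T' x)) =
    nsq S (%x. (\<phi> (T n x) - \<phi> (T' x)) + ((f (T n x) - \<phi> (T n x)) + (\<phi> (T' x) - f (T' x))))" by simp
  also have "... \<le> 2 * u n + 2 * nsq S (%x. (f (T n x) - \<phi> (T n x)) + (\<phi> (T' x) - f (T' x)))"
   unfolding u_def by (intro nsq_add) auto
  also have "... \<le> 2 * u n + 2 * (2 * nsq S (%x. f (T n x) - \<phi> (T n x)) + 2 * nsq S (%x. \<phi> (T' x) - f (T' x)))"
   by (intro add_left_mono mult_left_mono nsq_add) auto
  also have "... \<le> 2 * u n + 2 * (2 * (ennreal (\<bar>C\<bar>) * ennreal e') + 2 * (ennreal (\<bar>C\<bar>) * ennreal e'))"
   by (intro add_left_mono mult_left_mono add_mono 1 2) auto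
  also have "2 * (2 * (ennreal (\<bar>C\<bar>) * ennreal e') + 2 * (ennreal (\<bar>C\<bar>) * ennreal e')) = ennreal (8 * \<bar>C\<bar> * e')"
   using e' by (simp flip: ennreal_numeral ennreal_mult ennreal_plus)
  also have "... \<le> ennreal e"
  proof (rule ennreal_leI)
   have "8 * \<bar>C\<bar> * e' = e * (8 * \<bar>C\<bar> / (8 * (\<bar>C\<bar> + 1)))" unfolding e'_def by simp
   also have "... \<le> e * 1" using e by (intro mult_left_mono) (auto simp: field_simps)
   finally show "8 * \<bar>C\<bar> * e' \<le> e" by simp
  qed
  finally show ?thesis by (simp add: add.commute)
 qed
 moreover have "(%n. 2 * u n) \<longlonglongrightarrow> 0" by (intro tendsto_0_ennreal_cmult u) auto
 ultimately show "\<exists>u. u \<longlonglongrightarrow> 0 \<and> (\<forall>n. nsq S (%x. f (T n x) - f (T' x)) \<le> ennreal e + u n)"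
  by (intro exI[of _ "%n. 2 * u n"]) auto
qed

subsection \<open>Bi-Lipschitz changes of variable\<close>

text \<open>The varying factors are exchanged before composing: \<open>m n * F n - m' * F'\<close>
  tends to zero in L2, and the bound \<open>C\<close> transports this through \<open>T n\<close>.
  What remains is the fixed function \<open>m' * F'\<close>, covered by
  \<open>nsq_comp_tendsto\<close>. Convergence of the multipliers almost everywhere is enough, which
  leaves the diagonal of the square aside.\<close>

lemma nsq_comp_mult_tendsto:
 fixes T :: "nat => 'a::euclidean_space => 'a"
 assumes S: "S \<in> sets borel" "emeasure lborel S < \<infinity>"
  and T: "\<And>n. T n \<in> BM" "T' \<in> BM"
  and bd: "\<And>n f. f \<in> BM ==> nsq S (%x. f (T n x)) \<le> ennreal C * nsq S f"
  and bd': "\<And>f. f \<in> BM ==> nsq S (%x. f (T' x)) \<le> ennreal C * nsq S f"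
  and lim: "\<And>x. x \<in> S ==> (%n. T n x) \<longlonglongrightarrow> T' x"
  and F: "\<And>n. F n \<in> BM" "F' \<in> BM" "nsq S F' < \<infinity>"
   "(%n. nsq S (%x. F n x - F' x)) \<longlonglongrightarrow> 0"
  and m: "\<And>n. m n \<in> BM" "m' \<in> BM"
   "\<And>n x. x \<in> S ==> \<bar>m n x\<bar> \<le> B" "\<And>x. x \<in> S ==> \<bar>m' x\<bar> \<le> B"
   "AE x in lborel. x \<in> S \<longrightarrow> (%n. m n x) \<longlonglongrightarrow> m' x"
 shows "(%n. nsq S (%x. m n (T n x) * F n (T n x) - m' (T' x) * F' (T' x))) \<longlonglongrightarrow> 0"
proof -
 note [measurable] = S(1) T F(1,2) m(1,2)
 have fin: "nsq S (%x. m' x * F' x) < \<infinity>"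
  by (rule le_less_trans[OF nsq_mult_le[OF F(2) S(1) m(4)]]) (use F(3) in \<open>auto simp: ennreal_mult_less_top\<close>)
 define g where "g = (%n x. m n x * (F n x - F' x) + (m n x - m' x) * F' x)"
 have [measurable]: "g n \<in> BM" for n unfolding g_def by measurable
 have g0: "(%n. nsq S (g n)) \<longlonglongrightarrow> 0" unfolding g_def
 proof (rule nsq_add_tendsto_0)
  show "(%n. nsq S (%x. m n x * (F n x - F' x))) \<longlonglongrightarrow> 0"
  proof (rule tendsto_0_ennreal_le)
   show "(%n. ennreal (B\<^sup>2) * nsq S (%x. F n x - F' x)) \<longlonglongrightarrow> 0"
    by (intro tendsto_0_ennreal_cmult F(4)) auto
  qed (intro nsq_mult_le; use m(3) in auto)
  show "(%n. nsq S (%x. (m n x - m' x) * F' x)) \<longlonglongrightarrow> 0"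
  proof (rule nsq_dominated_convergence[where w="%x. 2 * B * F' x"])
   show "\<bar>(m n x - m' x) * F' x\<bar> \<le> \<bar>2 * B * F' x\<bar>" if "x \<in> S" for n x
   proof -
    have "\<bar>m n x - m' x\<bar> \<le> \<bar>2 * B\<bar>" using m(3)[OF that, of n] m(4)[OF that] by linarith
    then show ?thesis unfolding abs_mult[of "_ - _"] abs_mult[of "2 * B"] by (rule mult_right_mono) simp
   qed
   show "nsq S (%x. 2 * B * F' x) < \<infinity>" using F(3) by (simp add: nsq_cmult ennreal_mult_less_top)
   show "AE x in lborel. x \<in> S \<longrightarrow> (%n. (m n x - m' x) * F' x) \<longlonglongrightarrow> 0"
    using m(5) by eventually_elim (auto intro!: tendsto_mult_left_zero simp: LIM_zero)
  qed auto
 qed auto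
 have "(%n. nsq S (%x. g n (T n x) + (m' (T n x) * F' (T n x) - m' (T' x) * F' (T' x)))) \<longlonglongrightarrow> 0"
 proof (rule nsq_add_tendsto_0)
  show "(%n. nsq S (%x. g n (T n x))) \<longlonglongrightarrow> 0"
   by (rule tendsto_0_ennreal_le[OF tendsto_0_ennreal_cmult[OF g0, of "ennreal C"] bd]) auto
  show "(%n. nsq S (%x. m' (T n x) * F' (T n x) - m' (T' x) * F' (T' x))) \<longlonglongrightarrow> 0"
   by (rule nsq_comp_tendsto[OF S T bd bd' lim, where f="%x. m' x * F' x"]) (use fin in auto)
 qed auto
 then show ?thesis unfolding g_def by (simp add: algebra_simps)
qed

text \<open>Cauchy-Schwarz against the indicator of \<open>A\<close>. A non-integrable
  \<open>k\<close> has Bochner integral 0, for which the bound is trivial.\<close>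

lemma set_integral_sq_le:
 fixes k :: "'a => real"
 assumes k: "k \<in> borel_measurable M" and A: "A \<in> sets M"
 shows "ennreal ((set_lebesgue_integral M A k)\<^sup>2) \<le> emeasure M A * (\<integral>\<^sup>+x. ennreal ((k x)\<^sup>2) * indicator A x \<partial>M)"
proof (cases "set_integrable M A k")
 case False
 then show ?thesis by (simp add: set_lebesgue_integral_def set_integrable_def not_integrable_integral_eq)
next
 case True
 note [measurable] = k A
 have "ennreal \<bar>set_lebesgue_integral M A k\<bar> \<le> (\<integral>\<^sup>+x. ennreal (norm (indicator A x *\<^sub>R k x)) \<partial>M)"
  using integral_norm_bound_ennreal[OF True[unfolded set_integrable_def]]
  by (simp add: set_lebesgue_integral_def)
 also have "... = (\<integral>\<^sup>+x. indicator A x * (ennreal \<bar>k x\<bar> * indicator A x) \<partial>M)"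
  by (intro nn_integral_cong) (auto simp: indicator_def)
 finally have "(ennreal \<bar>set_lebesgue_integral M A k\<bar>)\<^sup>2 \<le> (\<integral>\<^sup>+x. indicator A x * (ennreal \<bar>k x\<bar> * indicator A x) \<partial>M)\<^sup>2"
  by (rule power_mono) auto
 also have "... \<le> (\<integral>\<^sup>+x. (indicator A x)\<^sup>2 \<partial>M) * (\<integral>\<^sup>+x. (ennreal \<bar>k x\<bar> * indicator A x)\<^sup>2 \<partial>M)"
  by (rule Cauchy_Schwarz_nn_integral) measurable
 also have "(\<integral>\<^sup>+x. (indicator A x)\<^sup>2 \<partial>M) = (\<integral>\<^sup>+x. indicator A x \<partial>M)"
  by (intro nn_integral_cong) (auto simp: indicator_def)
 also have "(\<integral>\<^sup>+x. (ennreal \<bar>k x\<bar> * indicator A x)\<^sup>2 \<partial>M) = (\<integral>\<^sup>+x. ennreal ((k x)\<^sup>2) * indicator A x \<partial>M)"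
  by (intro nn_integral_cong) (auto simp: indicator_def ennreal_power)
 finally show ?thesis using A by (simp add: ennreal_power)
qed

lemma nsq_integral_sq_le:
 assumes "f \<in> BM" "S \<in> sets borel"
 shows "ennreal ((LINT x:S|lborel. f x)\<^sup>2) \<le> emeasure lborel S * nsq S f"
 using set_integral_sq_le[of f lborel S] assms unfolding nsq_def by simp

lemma nsq_finite_imp_set_integrable_sq:
 assumes "f \<in> BM" "S \<in> sets borel" "nsq S f < \<infinity>"
 shows "set_integrable lborel S (%x. (f x)\<^sup>2)"
 unfolding set_integrable_def
proof (rule integrableI_nonneg)
 show "(%x. indicator S x *\<^sub>R (f x)\<^sup>2) \<in> borel_measurable lborel"
  using assms(1,2) by (intro borel_measurable_scaleR borel_measurable_power) auto
 have "(\<integral>\<^sup>+ x. ennreal (indicator S x *\<^sub>R (f x)\<^sup>2) \<partial>lborel) = nsq S f"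
  unfolding nsq_def by (intro nn_integral_cong) (simp add: indicator_def)
 then show "(\<integral>\<^sup>+ x. ennreal (indicator S x *\<^sub>R (f x)\<^sup>2) \<partial>lborel) < \<infinity>" using assms(3) by (simp only:)
qed simp

lemma nsq_set_integrable:
 assumes "f \<in> BM" "S \<in> sets borel" "emeasure lborel S < \<infinity>" "nsq S f < \<infinity>"
 shows "set_integrable lborel S f"
 unfolding set_integrable_def
proof (rule Bochner_Integration.integrable_bound)
 have "set_integrable lborel S (%x. 1::real)"
  unfolding set_integrable_def
  by (rule integrable_scaleR_left, rule integrable_real_indicator) (use assms(2,3) in simp_all)
 from set_integral_add(1)[OF this nsq_finite_imp_set_integrable_sq[OF assms(1,2,4)]]
 show "integrable lborel (%x. indicator S x *\<^sub>R (1 + (f x)\<^sup>2))"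
  unfolding set_integrable_def .
 show "(%x. indicator S x *\<^sub>R f x) \<in> borel_measurable lborel"
  using assms(1,2) by (intro borel_measurable_scaleR) auto
 show "AE x in lborel. norm (indicator S x *\<^sub>R f x) \<le> norm (indicator S x *\<^sub>R (1 + (f x)\<^sup>2))"
 proof (rule AE_I2)
  fix x
  have "\<bar>f x\<bar> \<le> 1 + (f x)\<^sup>2" using sum_squares_bound[of 1 "\<bar>f x\<bar>"] by simp
  then show "norm (indicator S x *\<^sub>R f x) \<le> norm (indicator S x *\<^sub>R (1 + (f x)\<^sup>2))" by (simp add: indicator_def)
 qed
qed

text \<open>Cauchy-Schwarz in \<open>\<tau>\<close> followed by Tonelli: the squared norm of a mean
  is at most the mean of the squared norms. Since \<open>z\<close> ranges over any Euclidean space,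
  the same bound serves functions and Gagliardo kernels.\<close>

lemma nsq_average_le:
 fixes k :: "real => 'a::euclidean_space => real"
 assumes k: "(%(\<tau>,z). k \<tau> z) \<in> borel_measurable (borel \<Otimes>\<^sub>M borel)" and S: "S \<in> sets borel"
  and lh: "lo < hi" and B: "\<And>\<tau>. \<tau> \<in> {lo..hi} ==> nsq S (k \<tau>) \<le> B"
 shows "nsq S (%z. (LINT \<tau>:{lo..hi}|lborel. k \<tau> z) / (hi - lo)) \<le> B"
proof -
 note [measurable] = S
 have k': "(%x. k (fst x) (snd x)) \<in> borel_measurable (lborel \<Otimes>\<^sub>M lborel)"
  using k unfolding case_prod_beta' lborel_prod borel_prod by simp
 have k'': "(%x. k (snd x) (fst x)) \<in> borel_measurable (lborel \<Otimes>\<^sub>M lborel)"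
  using measurable_compose[OF measurable_Pair[OF measurable_snd measurable_fst] k'] by (simp only: fst_conv snd_conv)
 have km: "(%\<tau>. k \<tau> z) \<in> borel_measurable lborel" for z
 proof -
  have "(%\<tau>. (\<tau>, z)) \<in> lborel \<rightarrow>\<^sub>M lborel \<Otimes>\<^sub>M lborel"
   by (intro measurable_Pair measurable_ident_sets measurable_const) auto
  from measurable_compose[OF this k'] show ?thesis by (simp only: fst_conv snd_conv)
 qed
 have G: "(%x. ennreal ((k (snd x) (fst x))\<^sup>2) * indicator S (fst x) * indicator {lo..hi} (snd x))
   \<in> borel_measurable (lborel \<Otimes>\<^sub>M lborel)"
  by (intro borel_measurable_times_ennreal measurable_compose[OF k''] measurable_compose[OF measurable_fst]
    measurable_compose[OF measurable_snd]) auto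
 have "ennreal (((LINT \<tau>:{lo..hi}|lborel. k \<tau> z) / (hi - lo))\<^sup>2) * indicator S z \<le>
   ennreal (1 / (hi - lo)) * (\<integral>\<^sup>+\<tau>. ennreal ((k \<tau> z)\<^sup>2) * indicator S z * indicator {lo..hi} \<tau> \<partial>lborel)" for z
 proof -
  have "ennreal (((LINT \<tau>:{lo..hi}|lborel. k \<tau> z) / (hi - lo))\<^sup>2) =
    ennreal (1 / (hi - lo)^2) * ennreal ((LINT \<tau>:{lo..hi}|lborel. k \<tau> z)\<^sup>2)"
   by (simp add: power_divide flip: ennreal_mult)
  also have "... \<le> ennreal (1 / (hi - lo)^2) * (emeasure lborel {lo..hi} * (\<integral>\<^sup>+\<tau>. ennreal ((k \<tau> z)\<^sup>2) * indicator {lo..hi} \<tau> \<partial>lborel))"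
   by (intro mult_left_mono set_integral_sq_le km) auto
  also have "... = ennreal (1 / (hi - lo)) * (\<integral>\<^sup>+\<tau>. ennreal ((k \<tau> z)\<^sup>2) * indicator {lo..hi} \<tau> \<partial>lborel)"
  proof -
   have "ennreal (1 / (hi - lo)^2) * emeasure lborel {lo..hi} = ennreal (1 / (hi - lo))"
    using lh by (simp add: power2_eq_square flip: ennreal_mult)
   then show ?thesis by (simp only: mult.assoc[symmetric])
  qed
  finally show ?thesis by (cases "z \<in> S") simp_all
 qed
 then have "nsq S (%z. (LINT \<tau>:{lo..hi}|lborel. k \<tau> z) / (hi - lo)) \<le>
   (\<integral>\<^sup>+z. ennreal (1 / (hi - lo)) * (\<integral>\<^sup>+\<tau>. ennreal ((k \<tau> z)\<^sup>2) * indicator S z * indicator {lo..hi} \<tau> \<partial>lborel) \<partial>lborel)"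
  unfolding nsq_def by (intro nn_integral_mono)
 also have "... = ennreal (1 / (hi - lo)) * (\<integral>\<^sup>+z. (\<integral>\<^sup>+\<tau>. ennreal ((k \<tau> z)\<^sup>2) * indicator S z * indicator {lo..hi} \<tau> \<partial>lborel) \<partial>lborel)"
  using lborel.borel_measurable_nn_integral_fst[OF G] by (intro nn_integral_cmult) simp
 also have "(\<integral>\<^sup>+z. (\<integral>\<^sup>+\<tau>. ennreal ((k \<tau> z)\<^sup>2) * indicator S z * indicator {lo..hi} \<tau> \<partial>lborel) \<partial>lborel) =
   (\<integral>\<^sup>+\<tau>. (\<integral>\<^sup>+z. ennreal ((k \<tau> z)\<^sup>2) * indicator S z * indicator {lo..hi} \<tau> \<partial>lborel) \<partial>lborel)"
  using lborel_pair.Fubini[OF G] by simp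
 also have "... \<le> (\<integral>\<^sup>+\<tau>. B * indicator {lo..hi} \<tau> \<partial>lborel)"
 proof (rule nn_integral_mono)
  fix \<tau>
  show "(\<integral>\<^sup>+z. ennreal ((k \<tau> z)\<^sup>2) * indicator S z * indicator {lo..hi} \<tau> \<partial>lborel) \<le> B * indicator {lo..hi} \<tau>"
   using B[of \<tau>] by (cases "\<tau> \<in> {lo..hi}") (simp_all only: nsq_def indicator_simps mult_1_right mult_zero_right nn_integral_const mult_zero_left, simp_all)
 qed
 also have "... = B * ennreal (hi - lo)" using lh by (simp add: nn_integral_cmult_indicator)
 finally have "nsq S (%z. (LINT \<tau>:{lo..hi}|lborel. k \<tau> z) / (hi - lo)) \<le> ennreal (1 / (hi - lo)) * (B * ennreal (hi - lo))"
  by (simp add: mult_left_mono)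
 also have "... = (ennreal (1 / (hi - lo)) * ennreal (hi - lo)) * B" by (simp add: ac_simps)
 also have "ennreal (1 / (hi - lo)) * ennreal (hi - lo) = 1" using lh by (simp flip: ennreal_mult)
 finally show ?thesis by simp
qed

section \<open>The interval, the square, and flow maps on them\<close>

abbreviation (input) J :: "real set" where "J \<equiv> {0..1/2}"
abbreviation (input) JJ :: "(real \<times> real) set" where "JJ \<equiv> J \<times> J"

text \<open>Sobolev norms are defined on the open interval, whereas compactness arguments want the
  closed one; the difference is a null set.\<close>

lemma nsq_Ioo_J: "nsq {0<..<1/2} f = nsq J f"
proof -
 have "AE x in lborel. x \<noteq> 0" "AE x in lborel. x \<noteq> 1/2" by (auto intro: AE_lborel_singleton)
 then show ?thesis unfolding nsq_def
  by (intro nn_integral_cong_AE, eventually_elim) (auto simp: indicator_def)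
qed

lemma AE_lborel_fst:
 assumes "AE x in lborel. P x"
 shows "AE z in (lborel :: (real \<times> real) measure). P (fst z)"
proof -
 obtain N where N: "{x. \<not> P x} \<subseteq> N" "N \<in> null_sets lborel" using assms by (auto simp: eventually_ae_filter)
 have "N \<in> sets borel" using N(2) by auto
 then have "N \<times> UNIV \<in> sets (lborel \<Otimes>\<^sub>M (lborel :: real measure))" by (intro pair_measureI) auto
 moreover have "emeasure (lborel \<Otimes>\<^sub>M lborel) (N \<times> (UNIV::real set)) = 0"
  using N(2) by (subst lborel.emeasure_pair_measure_Times) auto
 ultimately have "N \<times> UNIV \<in> null_sets (lborel :: (real \<times> real) measure)"
  by (intro null_setsI) (simp_all only: lborel_prod)
 then show ?thesis by (rule AE_I') (use N(1) in auto)
qed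

lemma AE_lborel_snd:
 assumes "AE x in lborel. P x"
 shows "AE z in (lborel :: (real \<times> real) measure). P (snd z)"
proof -
 obtain N where N: "{x. \<not> P x} \<subseteq> N" "N \<in> null_sets lborel" using assms by (auto simp: eventually_ae_filter)
 have "N \<in> sets borel" using N(2) by auto
 then have "UNIV \<times> N \<in> sets ((lborel :: real measure) \<Otimes>\<^sub>M lborel)" by (intro pair_measureI) auto
 moreover have "emeasure (lborel \<Otimes>\<^sub>M lborel) ((UNIV::real set) \<times> N) = 0"
  using N(2) by (subst lborel.emeasure_pair_measure_Times) auto
 ultimately have "UNIV \<times> N \<in> null_sets (lborel :: (real \<times> real) measure)"
  by (intro null_setsI) (simp_all only: lborel_prod)
 then show ?thesis by (rule AE_I') (use N(1) in auto)
qed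

lemma nsq_Ioo_JJ: "nsq ({0<..<1/2} \<times> {0<..<1/2}) f = nsq JJ f"
proof -
 have 1: "AE x in lborel. (x::real) \<noteq> 0 \<and> x \<noteq> 1/2" by (intro AE_conjI AE_lborel_singleton)
 from AE_lborel_fst[OF this] AE_lborel_snd[OF this]
 show ?thesis unfolding nsq_def
  by (intro nn_integral_cong_AE, eventually_elim) (auto simp: indicator_def)
qed

text \<open>Flow maps are taken as bijections of the whole line with derivative between positive
  constants. This is possible because slopes are extended by constants outside \<open>J\<close>, and
  it makes \<open>\<eta>\<close> a total inverse without domain conditions; fixing both endpoints
  makes \<open>J\<close> invariant.\<close>

locale flowmap =
 fixes \<gamma> \<eta> p :: "real => real" and m M :: real
 assumes deriv: "\<And>x. (\<gamma> has_real_derivative p x) (at x)" and cont_p: "continuous_on UNIV p"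
  and m: "0 < m" and p: "\<And>x. m \<le> p x" "\<And>x. p x \<le> M"
  and ends: "\<gamma> 0 = 0" "\<gamma> (1/2) = 1/2"
  and inv: "\<And>x. \<eta> (\<gamma> x) = x" "\<And>y. \<gamma> (\<eta> y) = y"
begin

lemma mvt_le: assumes "x < y" shows "m * (y - x) \<le> \<gamma> y - \<gamma> x" "\<gamma> y - \<gamma> x \<le> M * (y - x)"
proof -
 obtain z where "\<gamma> y - \<gamma> x = (y - x) * p z" using MVT2[OF assms, of \<gamma> p] deriv by auto
 with p[of z] assms show "m * (y - x) \<le> \<gamma> y - \<gamma> x" "\<gamma> y - \<gamma> x \<le> M * (y - x)"
  by (simp_all add: mult.commute)
qed

lemma gamma_dist: "m * \<bar>x - y\<bar> \<le> \<bar>\<gamma> x - \<gamma> y\<bar>" "\<bar>\<gamma> x - \<gamma> y\<bar> \<le> M * \<bar>x - y\<bar>"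
proof -
 have "m * \<bar>x - y\<bar> \<le> \<bar>\<gamma> x - \<gamma> y\<bar> \<and> \<bar>\<gamma> x - \<gamma> y\<bar> \<le> M * \<bar>x - y\<bar>"
 proof (induct x y rule: linorder_wlog)
  case (le a b)
  show ?case
  proof (cases "a = b")
   case False
   with le have ab: "a < b" by simp
   have "0 \<le> m * (b - a)" using ab m by simp
   with mvt_le[OF ab] ab show ?thesis by (simp add: abs_if)
  qed simp
 qed (simp add: abs_minus_commute)
 then show "m * \<bar>x - y\<bar> \<le> \<bar>\<gamma> x - \<gamma> y\<bar>" "\<bar>\<gamma> x - \<gamma> y\<bar> \<le> M * \<bar>x - y\<bar>" by auto
qed

lemma gamma_less: "x < y ==> \<gamma> x < \<gamma> y"
 using mvt_le(1)[of x y] m by (smt (verit) mult_pos_pos)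

lemma gamma_le_iff: "\<gamma> x \<le> \<gamma> y \<longleftrightarrow> x \<le> y"
 by (metis gamma_less linorder_not_less order_le_less)

lemma eta_dist: "\<bar>\<eta> x - \<eta> y\<bar> \<le> \<bar>x - y\<bar> / m"
 using gamma_dist(1)[of "\<eta> x" "\<eta> y"] m by (simp add: inv field_simps)

lemma eta_cont: "continuous_on UNIV \<eta>"
proof (rule lipschitz_on_continuous_on)
 show "(1/m)-lipschitz_on UNIV \<eta>" using eta_dist m by (auto simp: lipschitz_on_def dist_real_def)
qed

lemma eta_measurable [measurable]: "\<eta> \<in> BM"
 by (intro borel_measurable_continuous_onI eta_cont)

lemma eta_0: "\<eta> 0 = 0" and eta_half: "\<eta> (1/2) = 1/2"
 using inv(1)[of 0] inv(1)[of "1/2"] ends by auto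

lemma eta_mem_J: "y \<in> J \<longleftrightarrow> \<eta> y \<in> J"
 using gamma_le_iff[of 0 "\<eta> y"] gamma_le_iff[of "\<eta> y" "1/2"] by (simp add: ends inv)

lemma nn_subst:
 fixes f :: "real => ennreal"
 assumes [measurable]: "f \<in> BM"
 shows "(\<integral>\<^sup>+y. f (\<eta> y) * indicator J y \<partial>lborel) = (\<integral>\<^sup>+x. f x * ennreal (p x) * indicator J x \<partial>lborel)"
proof -
 have "(\<integral>\<^sup>+y. f (\<eta> y) * indicator {\<gamma> 0..\<gamma> (1/2)} y \<partial>lborel) = (\<integral>\<^sup>+x. f (\<eta> (\<gamma> x)) * ennreal (p x) * indicator {0..1/2} x \<partial>lborel)"
 proof (rule nn_integral_substitution_aux[where g=\<gamma>])
  show "continuous_on {0..1/2} p" by (rule continuous_on_subset[OF cont_p]) simp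
  show "0 \<le> p x" for x using p(1)[of x] m by linarith
 qed (auto intro: deriv)
 then show ?thesis by (simp only: inv ends)
qed

lemma nn_subst_le:
 fixes f :: "real => ennreal"
 assumes [measurable]: "f \<in> BM"
 shows "(\<integral>\<^sup>+y. f (\<eta> y) * indicator J y \<partial>lborel) \<le> ennreal M * (\<integral>\<^sup>+x. f x * indicator J x \<partial>lborel)"
proof -
 have "(\<integral>\<^sup>+y. f (\<eta> y) * indicator J y \<partial>lborel) \<le> (\<integral>\<^sup>+x. ennreal M * (f x * indicator J x) \<partial>lborel)"
  unfolding nn_subst[OF assms]
  by (intro nn_integral_mono) (auto simp: indicator_def mult.commute[of "f _"] intro!: mult_right_mono ennreal_leI p)
 also have "... = ennreal M * (\<integral>\<^sup>+x. f x * indicator J x \<partial>lborel)"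
  by (intro nn_integral_cmult) measurable
 finally show ?thesis .
qed

lemma nsq_comp_le:
 assumes [measurable]: "f \<in> BM"
 shows "nsq J (%y. f (\<eta> y)) \<le> ennreal M * nsq J f"
 using nn_subst_le[of "%x. ennreal ((f x)\<^sup>2)"] unfolding nsq_def by simp

text \<open>One-dimensional substitution in each variable in turn, by Tonelli; hence the constant
  \<open>M * M\<close>.\<close>

lemma nsq_comp2_le:
 assumes f: "f \<in> BM"
 shows "nsq JJ (%z. f (\<eta> (fst z), \<eta> (snd z))) \<le> ennreal (M * M) * nsq JJ f"
proof -
 have [measurable]: "f \<in> borel_measurable (borel \<Otimes>\<^sub>M borel)" using f by (simp add: borel_prod)
 have ip: "indicator JJ (x, y) = (indicator J x * indicator J y :: ennreal)" for x y by (auto simp: indicator_def)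
 have M: "0 \<le> M" using p[of 0] m by linarith
 have "nsq JJ (%z. f (\<eta> (fst z), \<eta> (snd z))) =
   (\<integral>\<^sup>+x. \<integral>\<^sup>+y. ennreal ((f (\<eta> x, \<eta> y))\<^sup>2) * (indicator J x * indicator J y) \<partial>lborel \<partial>lborel)"
  unfolding nsq_def by (subst lborel_prod[symmetric], subst lborel.nn_integral_fst[symmetric]) (auto simp: ip)
 also have "... = (\<integral>\<^sup>+x. (\<integral>\<^sup>+y. ennreal ((f (\<eta> x, \<eta> y))\<^sup>2) * indicator J y \<partial>lborel) * indicator J x \<partial>lborel)"
  by (intro nn_integral_cong) (auto simp: indicator_def)
 also have "... \<le> (\<integral>\<^sup>+x. (ennreal M * (\<integral>\<^sup>+y. ennreal ((f (\<eta> x, y))\<^sup>2) * indicator J y \<partial>lborel)) * indicator J x \<partial>lborel)"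
  by (intro nn_integral_mono mult_right_mono nn_subst_le) measurable
 also have "... \<le> ennreal M * (\<integral>\<^sup>+x. (ennreal M * (\<integral>\<^sup>+y. ennreal ((f (x, y))\<^sup>2) * indicator J y \<partial>lborel)) * indicator J x \<partial>lborel)"
  by (rule nn_subst_le[of "%x. ennreal M * (\<integral>\<^sup>+y. ennreal ((f (x, y))\<^sup>2) * indicator J y \<partial>lborel)"]) measurable
 also have "... = ennreal M * (ennreal M * (\<integral>\<^sup>+x. (\<integral>\<^sup>+y. ennreal ((f (x, y))\<^sup>2) * indicator J y \<partial>lborel) * indicator J x \<partial>lborel))"
  by (subst nn_integral_cmult[symmetric]) (auto simp: mult.assoc)
 also have "(\<integral>\<^sup>+x. (\<integral>\<^sup>+y. ennreal ((f (x, y))\<^sup>2) * indicator J y \<partial>lborel) * indicator J x \<partial>lborel) = nsq JJ f"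
  unfolding nsq_def by (subst lborel_prod[symmetric], subst lborel.nn_integral_fst[symmetric])
   (auto simp: ip intro!: nn_integral_cong, auto simp: indicator_def)
 finally show ?thesis using M by (simp add: ennreal_mult mult.assoc)
qed

lemma set_integral_subst:
 fixes h :: "real => real"
 assumes "set_integrable lborel J (%y. h (\<eta> y))" "y \<in> J"
 shows "(LINT y':{0..y}|lborel. h (\<eta> y')) = (LINT x:{0..\<eta> y}|lborel. h x * p x)"
proof -
 have y: "0 \<le> \<eta> y" using eta_mem_J assms(2) by auto
 have "(LBINT y'. h (\<eta> y') * indicator {\<gamma> 0..\<gamma> (\<eta> y)} y') = (LBINT x. h (\<eta> (\<gamma> x)) * p x * indicator {0..\<eta> y} x)"
 proof (rule integral_substitution(2))
  show "set_integrable lborel {\<gamma> 0..\<gamma> (\<eta> y)} (%y'. h (\<eta> y'))"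
   by (rule set_integrable_subset[OF assms(1)]) (use assms(2) in \<open>auto simp: inv ends\<close>)
  show "continuous_on {0..\<eta> y} p" by (rule continuous_on_subset[OF cont_p]) simp
  show "0 \<le> p x" for x using p(1)[of x] m by linarith
 qed (use y in \<open>auto intro: deriv\<close>)
 then show ?thesis by (simp add: inv ends set_lebesgue_integral_def mult.commute)
qed

end

subsection \<open>The Gagliardo kernel\<close>

text \<open>A square root of \<open>gagliardo_integrand\<close>, chosen because it is linear in
  \<open>g\<close>: the Gagliardo seminorm becomes an L2 norm on the square, to which the rules for
  \<open>nsq\<close> apply. On the diagonal its value is 0.\<close>

definition FK :: "real => (real => real) => real \<times> real => real" where
 "FK \<sigma> g z = (g (fst z) - g (snd z)) / \<bar>fst z - snd z\<bar> powr (1/2 + \<sigma>)"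

text \<open>The kernel left over when a function \<open>B\<close> is multiplied by a coefficient of
  Hoelder exponent \<open>\<beta>\<close>: dividing \<open>\<bar>x - y\<bar> powr \<beta>\<close> by
  the weight in \<open>FK\<close> leaves the exponent
  \<open>\<theta> = \<beta> - 1/2 - \<sigma>\<close>.\<close>

definition KW :: "real => (real => real) => real \<times> real => real" where
 "KW \<theta> B z = B (snd z) * \<bar>fst z - snd z\<bar> powr \<theta>"

lemma FK_sq: "(FK \<sigma> g z)\<^sup>2 = gagliardo_integrand \<sigma> g z"
 unfolding FK_def gagliardo_integrand_def
 by (simp add: power_divide power2_eq_square flip: powr_add)

lemma borel_measurable_fst_comp:
 fixes g :: "real => real"
 assumes "g \<in> BM"
 shows "(%z::real\<times>real. g (fst z)) \<in> BM"
 using measurable_compose[OF borel_measurable_continuous_onI[of fst] assms] by (simp add: continuous_on_fst)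

lemma borel_measurable_snd_comp:
 fixes g :: "real => real"
 assumes "g \<in> BM"
 shows "(%z::real\<times>real. g (snd z)) \<in> BM"
 using measurable_compose[OF borel_measurable_continuous_onI[of snd] assms] by (simp add: continuous_on_snd)

lemma borel_measurable_abs_diff_powr:
 "(%z::real\<times>real. \<bar>fst z - snd z\<bar> powr \<theta>) \<in> BM"
proof -
 have "(%z::real\<times>real. \<bar>fst z - snd z\<bar>) \<in> BM"
  by (intro borel_measurable_continuous_onI continuous_intros)
 then show ?thesis by measurable
qed

lemma FK_measurable: "g \<in> BM ==> FK \<sigma> g \<in> BM"
 unfolding FK_def
 by (intro borel_measurable_divide borel_measurable_diff borel_measurable_fst_comp
   borel_measurable_snd_comp borel_measurable_abs_diff_powr)

lemma KW_measurable: "g \<in> BM ==> KW \<sigma> g \<in> BM"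
 unfolding KW_def
 by (intro borel_measurable_times borel_measurable_snd_comp borel_measurable_abs_diff_powr)

lemma FK_diff: "FK \<sigma> (%x. f x - g x) z = FK \<sigma> f z - FK \<sigma> g z"
 unfolding FK_def by (simp add: diff_divide_distrib)

lemma AE_off_diagonal: "AE z in (lborel :: (real \<times> real) measure). fst z \<noteq> snd z"
proof -
 have "open {z::real\<times>real. fst z \<noteq> snd z}" by (intro open_Collect_neq continuous_intros)
 then have "{z::real\<times>real. fst z \<noteq> snd z} \<in> sets borel" by (rule borel_open)
 then have "{z \<in> space (lborel \<Otimes>\<^sub>M lborel). fst z \<noteq> (snd z :: real)} \<in> sets (lborel \<Otimes>\<^sub>M lborel)"
  unfolding lborel_prod by simp
 moreover have "AE x in lborel. AE y in lborel. x \<noteq> (y::real)"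
 proof (rule AE_I2)
  fix x :: real
  show "AE y in lborel. x \<noteq> y" using AE_lborel_singleton[of x] by eventually_elim auto
 qed
 ultimately have "AE z in lborel \<Otimes>\<^sub>M lborel. fst z \<noteq> (snd z :: real)"
  by (intro lborel_pair.AE_pair_measure) auto
 then show ?thesis unfolding lborel_prod .
qed

text \<open>The singularity is cut at \<open>y\<close>; each half is dominated by a translate or a
  reflection of \<open>x powr \<kappa>\<close> on \<open>J\<close>, whose integral is explicit, so
  the bound is uniform in \<open>y\<close>.\<close>

lemma nn_integral_abs_powr_finite:
 assumes "\<kappa> > -1"
 obtains C where "C \<ge> 0" "\<And>y. y \<in> J ==> (\<integral>\<^sup>+x. ennreal (\<bar>x - y\<bar> powr \<kappa>) * indicator J x \<partial>lborel) \<le> ennreal C"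
proof -
 define C where "C = (1/2) powr (\<kappa>+1) / (\<kappa>+1)"
 have C: "C \<ge> 0" unfolding C_def using assms by simp
 have "((%x. x powr \<kappa>) has_integral C) {0..1/2}"
  unfolding C_def by (rule has_integral_powr_from_0) (use assms in auto)
 from nn_integral_has_integral_lebesgue[OF _ this]
 have I: "(\<integral>\<^sup>+x. ennreal (indicator J x * x powr \<kappa>) \<partial>lborel) = ennreal C" by simp
 show thesis
 proof (rule that[of "2 * C"])
  fix y :: real assume y: "y \<in> J"
  define \<phi> where "\<phi> = (%x::real. ennreal (indicator J x * x powr \<kappa>))"
  have m[measurable]: "\<phi> \<in> BM" unfolding \<phi>_def by measurable
  have "(\<integral>\<^sup>+x. ennreal (\<bar>x - y\<bar> powr \<kappa>) * indicator J x \<partial>lborel) \<le> (\<integral>\<^sup>+x. \<phi> (-y + 1 * x) + \<phi> (y + (-1) * x) \<partial>lborel)"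
   by (intro nn_integral_mono) (use y in \<open>auto simp: \<phi>_def indicator_def abs_if\<close>)
  also have "... = (\<integral>\<^sup>+x. \<phi> (-y + 1 * x) \<partial>lborel) + (\<integral>\<^sup>+x. \<phi> (y + (-1) * x) \<partial>lborel)"
   by (intro nn_integral_add) measurable
  also have "... = ennreal C + ennreal C"
   using nn_integral_real_affine[OF m, of 1 "-y"] nn_integral_real_affine[OF m, of "-1" y] I
   by (simp add: \<phi>_def)
  also have "... = ennreal (2 * C)" using C by (simp flip: ennreal_plus)
  finally show "(\<integral>\<^sup>+x. ennreal (\<bar>x - y\<bar> powr \<kappa>) * indicator J x \<partial>lborel) \<le> ennreal (2 * C)" .
 qed (use C in simp)
qed

lemma JJ_sets [measurable, simp]: "JJ \<in> sets (borel :: (real \<times> real) measure)"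
 by (intro borel_closed closed_Times) auto

lemma emeasure_JJ_finite: "emeasure lborel JJ < \<infinity>"
 by (intro emeasure_bounded_finite bounded_Times) auto

lemma emeasure_J_finite: "emeasure lborel J < \<infinity>"
 by (intro emeasure_bounded_finite) auto

text \<open>Integrating first in \<open>fst z\<close> leaves
  \<open>\<bar>x - y\<bar> powr (2 * \<theta>)\<close>, whose exponent exceeds -1 by the assumption
  on \<open>\<theta>\<close>, so it is integrable uniformly in \<open>y\<close>.\<close>

lemma nsq_KW_le:
 assumes "\<theta> > -1/2"
 obtains C where "\<And>B. B \<in> BM ==> nsq JJ (KW \<theta> B) \<le> ennreal C * nsq J B"
proof -
 obtain C where C: "C \<ge> 0" "\<And>y. y \<in> J ==> (\<integral>\<^sup>+x. ennreal (\<bar>x - y\<bar> powr (2*\<theta>)) * indicator J x \<partial>lborel) \<le> ennreal C"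
  using nn_integral_abs_powr_finite[of "2*\<theta>"] assms by auto
 show thesis
 proof (rule that)
  fix B :: "real => real" assume B[measurable]: "B \<in> BM"
  have sq: "(KW \<theta> B z)\<^sup>2 = (B (snd z))\<^sup>2 * \<bar>fst z - snd z\<bar> powr (2*\<theta>)" for z
   unfolding KW_def by (simp add: power_mult_distrib power2_eq_square flip: powr_add)
  have ip: "indicator JJ (x, y) = (indicator J x * indicator J y :: ennreal)" for x y by (auto simp: indicator_def)
  have meas: "(%z. ennreal ((KW \<theta> B z)\<^sup>2) * indicator JJ z) \<in> borel_measurable (lborel \<Otimes>\<^sub>M lborel)"
   unfolding lborel_prod using KW_measurable[OF B] by simp
  have "nsq JJ (KW \<theta> B) = (\<integral>\<^sup>+y. \<integral>\<^sup>+x. ennreal ((KW \<theta> B (x, y))\<^sup>2) * indicator JJ (x, y) \<partial>lborel \<partial>lborel)"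
   unfolding nsq_def using lborel_pair.nn_integral_snd[OF meas] by (simp add: lborel_prod)
  also have "... \<le> (\<integral>\<^sup>+y. ennreal C * (ennreal ((B y)\<^sup>2) * indicator J y) \<partial>lborel)"
  proof (rule nn_integral_mono)
   fix y
   have "(\<integral>\<^sup>+x. ennreal ((KW \<theta> B (x, y))\<^sup>2) * indicator JJ (x, y) \<partial>lborel) =
    (\<integral>\<^sup>+x. (ennreal ((B y)\<^sup>2) * indicator J y) * (ennreal (\<bar>x - y\<bar> powr (2*\<theta>)) * indicator J x) \<partial>lborel)"
    by (intro nn_integral_cong) (simp add: sq ip ennreal_mult' ac_simps)
   also have "... = (ennreal ((B y)\<^sup>2) * indicator J y) * (\<integral>\<^sup>+x. ennreal (\<bar>x - y\<bar> powr (2*\<theta>)) * indicator J x \<partial>lborel)"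
    by (intro nn_integral_cmult) measurable
   also have "... \<le> ennreal C * (ennreal ((B y)\<^sup>2) * indicator J y)"
    using C(2)[of y] by (cases "y \<in> J") (auto simp: mult.commute[of "ennreal C"] intro!: mult_left_mono)
   finally show "(\<integral>\<^sup>+x. ennreal ((KW \<theta> B (x, y))\<^sup>2) * indicator JJ (x, y) \<partial>lborel) \<le>
    ennreal C * (ennreal ((B y)\<^sup>2) * indicator J y)" .
  qed
  also have "... = ennreal C * nsq J B" unfolding nsq_def by (intro nn_integral_cmult) measurable
  finally show "nsq JJ (KW \<theta> B) \<le> ennreal C * nsq J B" .
 qed
qed


lemma flowmap_pair_measurable:
 assumes "flowmap \<gamma> \<eta> p m M"
 shows "(%z::real\<times>real. (\<eta> (fst z), \<eta> (snd z))) \<in> BM"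
proof -
 interpret flowmap \<gamma> \<eta> p m M by fact
 show ?thesis
  by (intro borel_measurable_continuous_onI continuous_on_Pair continuous_on_compose2[OF eta_cont] continuous_intros) auto
qed

lemma nsq_flow_tendsto:
 assumes fl: "\<And>n. flowmap (\<gamma> n) (\<eta> n) (p n) m M" and fl': "flowmap \<gamma>' \<eta>' p' m M"
  and eta: "\<And>y. y \<in> J ==> (%n. \<eta> n y) \<longlonglongrightarrow> \<eta>' y"
  and F: "\<And>n. F n \<in> BM" "F' \<in> BM" "nsq J F' < \<infinity>"
   "(%n. nsq J (%x. F n x - F' x)) \<longlonglongrightarrow> 0"
  and h: "\<And>n. h n \<in> BM" "h' \<in> BM"
   "\<And>n x. x \<in> J ==> \<bar>h n x\<bar> \<le> B" "\<And>x. x \<in> J ==> \<bar>h' x\<bar> \<le> B"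
   "\<And>x. x \<in> J ==> (%n. h n x) \<longlonglongrightarrow> h' x"
 shows "(%n. nsq J (%y. h n (\<eta> n y) * F n (\<eta> n y) - h' (\<eta>' y) * F' (\<eta>' y))) \<longlonglongrightarrow> 0"
 by (rule nsq_comp_mult_tendsto[OF _ emeasure_J_finite _ _ flowmap.nsq_comp_le[OF fl] flowmap.nsq_comp_le[OF fl'] eta F h(1-4)])
   (use h(5) in \<open>auto intro: flowmap.eta_measurable[OF fl] flowmap.eta_measurable[OF fl']\<close>)

lemma nsq_flow2_tendsto:
 assumes fl: "\<And>n. flowmap (\<gamma> n) (\<eta> n) (p n) m M" and fl': "flowmap \<gamma>' \<eta>' p' m M"
  and eta: "\<And>y. y \<in> J ==> (%n. \<eta> n y) \<longlonglongrightarrow> \<eta>' y"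
  and F: "\<And>n. F n \<in> BM" "F' \<in> BM" "nsq JJ F' < \<infinity>"
   "(%n. nsq JJ (%x. F n x - F' x)) \<longlonglongrightarrow> 0"
  and h: "\<And>n. h n \<in> BM" "h' \<in> BM"
   "\<And>n z. z \<in> J\<times>J ==> \<bar>h n z\<bar> \<le> B" "\<And>z. z \<in> J\<times>J ==> \<bar>h' z\<bar> \<le> B"
   "\<And>z. z \<in> J\<times>J ==> fst z \<noteq> snd z ==> (%n. h n z) \<longlonglongrightarrow> h' z"
 shows "(%n. nsq JJ (%z. h n (\<eta> n (fst z), \<eta> n (snd z)) * F n (\<eta> n (fst z), \<eta> n (snd z))
    - h' (\<eta>' (fst z), \<eta>' (snd z)) * F' (\<eta>' (fst z), \<eta>' (snd z)))) \<longlonglongrightarrow> 0"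
proof (rule nsq_comp_mult_tendsto[OF JJ_sets emeasure_JJ_finite flowmap_pair_measurable[OF fl] flowmap_pair_measurable[OF fl']
   flowmap.nsq_comp2_le[OF fl] flowmap.nsq_comp2_le[OF fl'] _ F h(1-4)])
 show "(%n. (\<eta> n (fst z), \<eta> n (snd z))) \<longlonglongrightarrow> (\<eta>' (fst z), \<eta>' (snd z))" if "z \<in> J \<times> J" for z
  using that by (intro tendsto_Pair eta) (auto simp: mem_Times_iff)
 show "AE z in lborel. z \<in> J \<times> J \<longrightarrow> (%n. h n z) \<longlonglongrightarrow> h' z"
  using AE_off_diagonal by eventually_elim (use h(5) in blast)
qed

text \<open>The factor by which the Gagliardo weight changes under the flow: the quotient of the
  weights at the labels and at the positions. It is bounded because the flow is bi-Lipschitz. On the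
  diagonal, a null set, it has the default value 0.\<close>

definition stretch :: "real => (real => real) => real \<times> real => real" where
 "stretch \<sigma> \<gamma> z = (\<bar>fst z - snd z\<bar> / \<bar>\<gamma> (fst z) - \<gamma> (snd z)\<bar>) powr (1/2 + \<sigma>)"

lemma stretch_bound:
 assumes "flowmap \<gamma> \<eta> p m M" "\<sigma> > 0"
 shows "\<bar>stretch \<sigma> \<gamma> z\<bar> \<le> (1/m) powr (1/2 + \<sigma>)"
proof -
 interpret flowmap \<gamma> \<eta> p m M by fact
 have "\<bar>fst z - snd z\<bar> / \<bar>\<gamma> (fst z) - \<gamma> (snd z)\<bar> \<le> 1/m"
 proof (cases "fst z = snd z")
  case False
  then have "\<bar>\<gamma> (fst z) - \<gamma> (snd z)\<bar> > 0" using gamma_dist(1)[of "fst z" "snd z"] m by (smt (verit) mult_pos_pos)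
  then show ?thesis using gamma_dist(1)[of "fst z" "snd z"] m by (simp add: field_simps)
 qed (use m in simp)
 then show ?thesis unfolding stretch_def using assms(2) by (simp add: powr_mono2)
qed

lemma stretch_measurable:
 assumes "flowmap \<gamma> \<eta> p m M"
 shows "stretch \<sigma> \<gamma> \<in> BM"
proof -
 interpret flowmap \<gamma> \<eta> p m M by fact
 have c: "continuous_on UNIV \<gamma>" using deriv by (meson DERIV_isCont continuous_at_imp_continuous_on)
 have [measurable]: "(%z. \<bar>fst z - snd z\<bar>) \<in> borel_measurable (borel :: (real\<times>real) measure)"
  "(%z. \<bar>\<gamma> (fst z) - \<gamma> (snd z)\<bar>) \<in> borel_measurable (borel :: (real\<times>real) measure)"
  by (intro borel_measurable_continuous_onI continuous_intros continuous_on_compose2[OF c]; simp)+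
 show ?thesis unfolding stretch_def by measurable
qed

text \<open>The assumed form of an increment separates a rough part, proportional to increments of
  \<open>\<alpha>\<close>, from a part carrying the Hoelder factor
  \<open>\<bar>x - y\<bar> powr \<beta>\<close>. Dividing by the weight turns them into
  \<open>FK\<close> of \<open>\<alpha>\<close> and into \<open>KW\<close> kernels, each with its own
  multiplier and evaluated at the pair of labels \<open>w\<close>.\<close>

lemma FK_comp_eq:
 assumes "flowmap \<gamma> \<eta> p m M"
  and "\<And>x y. x \<in> J ==> y \<in> J ==>
   G x - G y = P (x,y) * (\<alpha> x - \<alpha> y) + \<bar>x - y\<bar> powr \<beta> * (Q (x,y) * B y + Q2 (x,y))"
  and z: "z \<in> J \<times> J" and w: "w = (\<eta> (fst z), \<eta> (snd z))"
 shows "FK \<sigma> (%y. G (\<eta> y)) z = stretch \<sigma> \<gamma> w * P w * FK \<sigma> \<alpha> w + (stretch \<sigma> \<gamma> w * Q w * KW (\<beta> - 1/2 - \<sigma>) B w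
   + stretch \<sigma> \<gamma> w * Q2 w * KW (\<beta> - 1/2 - \<sigma>) (%_. 1) w)"
proof -
 interpret flowmap \<gamma> \<eta> p m M by fact
 define x y where "x = \<eta> (fst z)" and "y = \<eta> (snd z)"
 have xy: "x \<in> J" "y \<in> J" using z eta_mem_J[of "fst z"] eta_mem_J[of "snd z"] unfolding x_def y_def mem_Times_iff by blast+
 have g: "\<gamma> x = fst z" "\<gamma> y = snd z" unfolding x_def y_def by (simp_all add: inv)
 show ?thesis
 proof (cases "x = y")
  case True
  then have "fst z = snd z" using g by simp
  then show ?thesis by (simp add: w FK_def stretch_def)
 next
  case False
  then have d: "\<bar>x - y\<bar> > 0" and d': "\<bar>fst z - snd z\<bar> > 0" using gamma_dist(1)[of x y] m g by (auto simp: mult_le_0_iff)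
  define D where "D = \<bar>x - y\<bar> powr (1/2 + \<sigma>)"
  have D: "D > 0" unfolding D_def using d by simp
  have st: "stretch \<sigma> \<gamma> w = D / \<bar>fst z - snd z\<bar> powr (1/2+\<sigma>)"
   unfolding stretch_def w D_def by (simp add: x_def[symmetric] y_def[symmetric] g powr_divide)
  have kw: "\<bar>x - y\<bar> powr (\<beta> - 1/2 - \<sigma>) = \<bar>x - y\<bar> powr \<beta> / D"
   unfolding D_def by (simp add: powr_diff powr_add)
  have "FK \<sigma> (%y. G (\<eta> y)) z = (G x - G y) / \<bar>fst z - snd z\<bar> powr (1/2+\<sigma>)"
   unfolding FK_def x_def y_def by simp
  also have "... = stretch \<sigma> \<gamma> w * ((G x - G y) / D)" unfolding st using D by simp
  also have "... = stretch \<sigma> \<gamma> w * (P w * ((\<alpha> x - \<alpha> y) / D) + \<bar>x - y\<bar> powr \<beta> / D * (Q w * B y + Q2 w))"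
   unfolding assms(2)[OF xy] by (simp add: w x_def y_def add_divide_distrib)
  also have "... = stretch \<sigma> \<gamma> w * (P w * FK \<sigma> \<alpha> w + (Q w * KW (\<beta> - 1/2 - \<sigma>) B w + Q2 w * KW (\<beta> - 1/2 - \<sigma>) (%_. 1) w))"
  proof -
   have "FK \<sigma> \<alpha> w = (\<alpha> x - \<alpha> y) / D" unfolding FK_def w D_def x_def y_def by simp
   moreover have "KW (\<beta> - 1/2 - \<sigma>) B w = B y * (\<bar>x - y\<bar> powr \<beta> / D)" "KW (\<beta> - 1/2 - \<sigma>) (%_. 1) w = \<bar>x - y\<bar> powr \<beta> / D"
    using kw unfolding KW_def w x_def y_def by simp_all
   ultimately show ?thesis by (simp add: algebra_simps add_divide_distrib)
  qed
  finally show ?thesis by (simp add: algebra_simps)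
 qed
qed

text \<open>Common source of the Gagliardo convergence of \<open>u_x\<close>, \<open>u_xx\<close>,
  \<open>u_t\<close> and \<open>u_tx\<close>. The three products of \<open>FK_comp_eq\<close> each
  have a bounded multiplier converging off the diagonal and a kernel converging in L2, so
  \<open>nsq_flow2_tendsto\<close> treats them one by one.\<close>

lemma FK_flow_tendsto:
 assumes fl: "\<And>n. flowmap (\<gamma> n) (\<eta> n) (p n) m M" and fl': "flowmap \<gamma>' \<eta>' p' m M"
  and gam: "\<And>x. x \<in> J ==> (%n. \<gamma> n x) \<longlonglongrightarrow> \<gamma>' x" and eta: "\<And>y. y \<in> J ==> (%n. \<eta> n y) \<longlonglongrightarrow> \<eta>' y"
  and s: "0 < \<sigma>" "\<sigma> < \<beta>"
  and G: "\<And>n x y. x \<in> J ==> y \<in> J ==>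
   G n x - G n y = P n (x,y) * (\<alpha> n x - \<alpha> n y) + \<bar>x - y\<bar> powr \<beta> * (Q n (x,y) * B n y + Q2 n (x,y))"
  and G': "\<And>x y. x \<in> J ==> y \<in> J ==>
   G' x - G' y = P' (x,y) * (\<alpha>' x - \<alpha>' y) + \<bar>x - y\<bar> powr \<beta> * (Q' (x,y) * B' y + Q2' (x,y))"
  and P: "\<And>n. P n \<in> BM" "P' \<in> BM"
   "\<And>n z. z \<in> J\<times>J ==> \<bar>P n z\<bar> \<le> K" "\<And>z. z \<in> J\<times>J ==> \<bar>P' z\<bar> \<le> K"
   "\<And>z. z \<in> J\<times>J ==> fst z \<noteq> snd z ==> (%n. P n z) \<longlonglongrightarrow> P' z"
  and Q: "\<And>n. Q n \<in> BM" "Q' \<in> BM"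
   "\<And>n z. z \<in> J\<times>J ==> \<bar>Q n z\<bar> \<le> K" "\<And>z. z \<in> J\<times>J ==> \<bar>Q' z\<bar> \<le> K"
   "\<And>z. z \<in> J\<times>J ==> fst z \<noteq> snd z ==> (%n. Q n z) \<longlonglongrightarrow> Q' z"
  and Q2: "\<And>n. Q2 n \<in> BM" "Q2' \<in> BM"
   "\<And>n z. z \<in> J\<times>J ==> \<bar>Q2 n z\<bar> \<le> K" "\<And>z. z \<in> J\<times>J ==> \<bar>Q2' z\<bar> \<le> K"
   "\<And>z. z \<in> J\<times>J ==> fst z \<noteq> snd z ==> (%n. Q2 n z) \<longlonglongrightarrow> Q2' z"
  and \<alpha>: "\<And>n. \<alpha> n \<in> BM" "\<alpha>' \<in> BM" "nsq JJ (FK \<sigma> \<alpha>') < \<infinity>"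
   "(%n. nsq JJ (FK \<sigma> (%x. \<alpha> n x - \<alpha>' x))) \<longlonglongrightarrow> 0"
  and B: "\<And>n. B n \<in> BM" "B' \<in> BM" "nsq J B' < \<infinity>"
   "(%n. nsq J (%x. B n x - B' x)) \<longlonglongrightarrow> 0"
 shows "(%n. nsq JJ (FK \<sigma> (%y. G n (\<eta> n y) - G' (\<eta>' y)))) \<longlonglongrightarrow> 0" (is ?A)
  and "nsq JJ (FK \<sigma> (%y. G' (\<eta>' y))) < \<infinity>" (is ?B)
proof -
 \<comment> \<open>The requirement \<open>\<theta> > -1/2\<close> of \<open>nsq_KW_le\<close> is the
   assumption \<open>\<sigma> < \<beta>\<close>.\<close>
 define \<theta> where "\<theta> = \<beta> - 1/2 - \<sigma>"
 have \<theta>: "\<theta> > -1/2" unfolding \<theta>_def using s by simp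
 obtain C where C: "\<And>B. B \<in> BM ==> nsq JJ (KW \<theta> B) \<le> ennreal C * nsq J B"
  using nsq_KW_le[OF \<theta>] by blast
 define L where "L = (1/m) powr (1/2 + \<sigma>)"
 define T where "T = (%n (z::real\<times>real). (\<eta> n (fst z), \<eta> n (snd z)))"
 define T' where "T' = (%(z::real\<times>real). (\<eta>' (fst z), \<eta>' (snd z)))"
 have Tm[measurable]: "T n \<in> BM" "T' \<in> BM" for n
  unfolding T_def T'_def by (rule flowmap_pair_measurable[OF fl] flowmap_pair_measurable[OF fl'])+
 have sm[measurable]: "stretch \<sigma> (\<gamma> n) \<in> BM" "stretch \<sigma> \<gamma>' \<in> BM" for n
  by (rule stretch_measurable[OF fl] stretch_measurable[OF fl'])+
 have km[measurable]: "KW \<theta> (B n) \<in> BM" "KW \<theta> B' \<in> BM"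
  "KW \<theta> (%_. 1) \<in> BM"
  "FK \<sigma> (\<alpha> n) \<in> BM" "FK \<sigma> \<alpha>' \<in> BM" for n
  using \<alpha> B by (auto intro: KW_measurable FK_measurable)
 have L: "0 \<le> L" unfolding L_def by simp
 note [measurable] = P(1,2) Q(1,2) Q2(1,2)
 have bound: "\<bar>stretch \<sigma> g z * X z\<bar> \<le> L * K" if "flowmap g e p0 m M" "\<bar>X z\<bar> \<le> K" for g e p0 X z
  unfolding abs_mult using stretch_bound[OF that(1) s(1), of z] that(2) L unfolding L_def[symmetric]
  by (intro mult_mono) auto
 have st: "(%n. stretch \<sigma> (\<gamma> n) z) \<longlonglongrightarrow> stretch \<sigma> \<gamma>' z" if zJ: "z \<in> J \<times> J" and "fst z \<noteq> snd z" for z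
 proof -
  interpret f: flowmap \<gamma>' \<eta>' p' m M by (rule fl')
  have "\<bar>\<gamma>' (fst z) - \<gamma>' (snd z)\<bar> > 0" using f.gamma_dist(1)[of "fst z" "snd z"] f.m that(2) by (smt (verit) mult_pos_pos)
  then show ?thesis unfolding stretch_def using that s by (intro tendsto_intros gam) (auto simp: mem_Times_iff)
 qed
 have k1: "nsq JJ (KW \<theta> B') < \<infinity>"
  by (rule le_less_trans[OF C[OF B(2)]]) (use B(3) in \<open>simp add: ennreal_mult_less_top\<close>)
 have k2: "nsq JJ (KW \<theta> (%_. 1)) < \<infinity>"
  by (rule le_less_trans[OF C]) (use nsq_bounded_finite[OF _ emeasure_J_finite, of "%_. 1" 1] in \<open>simp_all add: ennreal_mult_less_top\<close>)
 have k3: "(%n. nsq JJ (%z. KW \<theta> (B n) z - KW \<theta> B' z)) \<longlonglongrightarrow> 0"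
 proof (rule tendsto_0_ennreal_le)
  show "(%n. ennreal C * nsq J (%x. B n x - B' x)) \<longlonglongrightarrow> 0" by (intro tendsto_0_ennreal_cmult B) auto
  show "nsq JJ (%z. KW \<theta> (B n) z - KW \<theta> B' z) \<le> ennreal C * nsq J (%x. B n x - B' x)" for n
  proof -
   have "(%z. KW \<theta> (B n) z - KW \<theta> B' z) = KW \<theta> (%x. B n x - B' x)" by (auto simp: KW_def left_diff_distrib)
   then show ?thesis using C[of "%x. B n x - B' x"] B(1,2) by simp
  qed
 qed
 define t1 t1' where "t1 = (%n z. stretch \<sigma> (\<gamma> n) z * P n z)" and "t1' = (%z. stretch \<sigma> \<gamma>' z * P' z)"
 define t2 t2' where "t2 = (%n z. stretch \<sigma> (\<gamma> n) z * Q n z)" and "t2' = (%z. stretch \<sigma> \<gamma>' z * Q' z)"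
 define t3 t3' where "t3 = (%n z. stretch \<sigma> (\<gamma> n) z * Q2 n z)" and "t3' = (%z. stretch \<sigma> \<gamma>' z * Q2' z)"
 have tm[measurable]: "t1 n \<in> BM" "t1' \<in> BM"
  "t2 n \<in> BM" "t2' \<in> BM"
  "t3 n \<in> BM" "t3' \<in> BM" for n
  unfolding t1_def t1'_def t2_def t2'_def t3_def t3'_def by measurable
 have a4: "(%n. nsq JJ (%z. FK \<sigma> (\<alpha> n) z - FK \<sigma> \<alpha>' z)) \<longlonglongrightarrow> 0"
  using \<alpha>(4) unfolding FK_diff[abs_def] .
 have 1: "(%n. nsq JJ (%z. t1 n (T n z) * FK \<sigma> (\<alpha> n) (T n z) - t1' (T' z) * FK \<sigma> \<alpha>' (T' z))) \<longlonglongrightarrow> 0"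
  unfolding T_def T'_def
  by (rule nsq_flow2_tendsto[OF fl fl' eta km(4,5) \<alpha>(3) a4 tm(1,2), where B="L*K"])
    (use P in \<open>auto simp: t1_def t1'_def intro!: bound[OF fl] bound[OF fl'] tendsto_mult st\<close>)
 have 2: "(%n. nsq JJ (%z. t2 n (T n z) * KW \<theta> (B n) (T n z) - t2' (T' z) * KW \<theta> B' (T' z))) \<longlonglongrightarrow> 0"
  unfolding T_def T'_def
  by (rule nsq_flow2_tendsto[OF fl fl' eta km(1,2) k1 k3 tm(3,4), where B="L*K"])
    (use Q in \<open>auto simp: t2_def t2'_def intro!: bound[OF fl] bound[OF fl'] tendsto_mult st\<close>)
 have 3: "(%n. nsq JJ (%z. t3 n (T n z) * KW \<theta> (%_. 1) (T n z) - t3' (T' z) * KW \<theta> (%_. 1) (T' z))) \<longlonglongrightarrow> 0"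
  unfolding T_def T'_def
  by (rule nsq_flow2_tendsto[OF fl fl' eta km(3,3) k2 _ tm(5,6), where B="L*K"])
    (use Q2 in \<open>auto simp: nsq_const t3_def t3'_def intro!: bound[OF fl] bound[OF fl'] tendsto_mult st\<close>)
 note 4 = nsq_add_tendsto_0[OF _ _ JJ_sets 1 nsq_add_tendsto_0[OF _ _ JJ_sets 2 3]]
 have e: "FK \<sigma> (%y. G n (\<eta> n y)) z = t1 n (T n z) * FK \<sigma> (\<alpha> n) (T n z) + (t2 n (T n z) * KW \<theta> (B n) (T n z) + t3 n (T n z) * KW \<theta> (%_. 1) (T n z))"
  if "z \<in> J\<times>J" for n z
  unfolding t1_def t2_def t3_def \<theta>_def by (rule FK_comp_eq[OF fl G that]) (simp_all add: T_def)
 have e': "FK \<sigma> (%y. G' (\<eta>' y)) z = t1' (T' z) * FK \<sigma> \<alpha>' (T' z) + (t2' (T' z) * KW \<theta> B' (T' z) + t3' (T' z) * KW \<theta> (%_. 1) (T' z))"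
  if "z \<in> J\<times>J" for z
  unfolding t1'_def t2'_def t3'_def \<theta>_def by (rule FK_comp_eq[OF fl' G' that]) (simp_all add: T'_def)
 have "nsq JJ (FK \<sigma> (%y. G n (\<eta> n y) - G' (\<eta>' y))) = nsq JJ (%z.
   (t1 n (T n z) * FK \<sigma> (\<alpha> n) (T n z) - t1' (T' z) * FK \<sigma> \<alpha>' (T' z)) +
   ((t2 n (T n z) * KW \<theta> (B n) (T n z) - t2' (T' z) * KW \<theta> B' (T' z)) +
   (t3 n (T n z) * KW \<theta> (%_. 1) (T n z) - t3' (T' z) * KW \<theta> (%_. 1) (T' z))))" for n
  by (rule nsq_cong) (simp only: FK_diff e e' algebra_simps)
 then show ?A using 4 by simp
 have fin: "nsq JJ (%z. X (T' z) * Y (T' z)) < \<infinity>"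
  if "X \<in> BM" "Y \<in> BM" "\<And>z. z \<in> J\<times>J ==> \<bar>X z\<bar> \<le> L * K" "nsq JJ Y < \<infinity>" for X Y
 proof -
  have "nsq JJ (%z. X (T' z) * Y (T' z)) \<le> ennreal (M * M) * nsq JJ (%z. X z * Y z)"
   unfolding T'_def by (rule flowmap.nsq_comp2_le[OF fl', of "%z. X z * Y z"]) (use that in measurable)
  also have "... \<le> ennreal (M * M) * (ennreal ((L*K)\<^sup>2) * nsq JJ Y)"
   by (intro mult_left_mono nsq_mult_le that) auto
  also have "... < \<infinity>" using that(4) by (simp add: ennreal_mult_less_top)
  finally show ?thesis .
 qed
 have "nsq JJ (FK \<sigma> (%y. G' (\<eta>' y))) = nsq JJ (%z. t1' (T' z) * FK \<sigma> \<alpha>' (T' z) + (t2' (T' z) * KW \<theta> B' (T' z) + t3' (T' z) * KW \<theta> (%_. 1) (T' z)))"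
  by (rule nsq_cong) (rule e')
 also have "... < \<infinity>"
  by (intro nsq_add_finite fin k1 k2 \<alpha>(3) JJ_sets)
    (auto simp: t1'_def t2'_def t3'_def intro!: bound[OF fl'] P Q Q2)
 finally show ?B .
qed

subsection \<open>Test functions and weak derivatives\<close>

text \<open>One derivative is peeled off at a time and the function changes with it. Closure under
  sums, products and affine substitution then follows by induction on \<open>n\<close> with the
  function generalised; \<open>smooth_iff_ndiff\<close> leads back to the iterates of
  \<open>deriv\<close>.\<close>

fun ndiff :: "nat => (real => real) => bool" where
 "ndiff 0 f = (\<forall>x. f differentiable (at x))"
| "ndiff (Suc n) f = ((\<forall>x. f differentiable (at x)) \<and> ndiff n (deriv f))"

lemma ndiff_differentiable: "ndiff n f ==> f differentiable (at x)"
 by (cases n) auto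

lemma ndiff_DERIV: "ndiff n f ==> (f has_real_derivative deriv f x) (at x)"
 using ndiff_differentiable[of n f x] by (simp add: DERIV_deriv_iff_real_differentiable)

lemma ndiff_SucD: "ndiff (Suc n) f ==> ndiff n f"
 by (induction n arbitrary: f) auto

lemma smooth_iff_ndiff: "(\<forall>n x. ((deriv ^^ n) f) differentiable (at x)) \<longleftrightarrow> (\<forall>n. ndiff n f)"
proof -
 have "ndiff n f \<longleftrightarrow> (\<forall>j\<le>n. \<forall>x. ((deriv ^^ j) f) differentiable (at x))" for n
 proof (induction n arbitrary: f)
  case (Suc n)
  have "(\<forall>j\<le>Suc n. \<forall>x. ((deriv ^^ j) f) differentiable (at x)) \<longleftrightarrow>
   (\<forall>x. f differentiable (at x)) \<and> (\<forall>j\<le>n. \<forall>x. ((deriv ^^ Suc j) f) differentiable (at x))"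
   by (metis (no_types, lifting) Suc_le_mono funpow_0 le0 not0_implies_Suc)
  then show ?case using Suc[of "deriv f"] by (simp only: ndiff.simps funpow_Suc_right o_apply)
 qed auto
 then show ?thesis by blast
qed

lemma ndiffI:
 assumes "\<And>x. (f has_real_derivative f' x) (at x)" "ndiff n f'"
 shows "ndiff (Suc n) f"
proof -
 have "deriv f = f'" using assms(1) by (auto intro: DERIV_imp_deriv)
 then show ?thesis using assms by (auto simp: real_differentiable_def)
qed

lemma ndiff_cmult: "ndiff n f ==> ndiff n (%x. c * f x)"
proof (induction n arbitrary: f)
 case (Suc n)
 show ?case
  by (rule ndiffI[where f'="%x. c * deriv f x"]) (use Suc ndiff_DERIV[OF Suc.prems] in \<open>auto intro!: DERIV_cmult\<close>)
qed (auto intro: differentiable_mult)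

lemma ndiff_add: "ndiff n f ==> ndiff n g ==> ndiff n (%x. f x + g x)"
proof (induction n arbitrary: f g)
 case (Suc n)
 show ?case
  by (rule ndiffI[where f'="%x. deriv f x + deriv g x"])
    (use Suc ndiff_DERIV[OF Suc.prems(1)] ndiff_DERIV[OF Suc.prems(2)] in \<open>auto intro!: DERIV_add\<close>)
qed (auto intro: differentiable_add)

lemma ndiff_mult: "ndiff n f ==> ndiff n g ==> ndiff n (%x. f x * g x)"
proof (induction n arbitrary: f g)
 case (Suc n)
 show ?case
 proof (rule ndiffI[where f'="%x. f x * deriv g x + deriv f x * g x"])
  show "((%x. f x * g x) has_real_derivative f x * deriv g x + deriv f x * g x) (at x)" for x
   by (rule DERIV_mult') (auto intro: ndiff_DERIV Suc.prems)
  show "ndiff n (%x. f x * deriv g x + deriv f x * g x)"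
   by (intro ndiff_add Suc.IH) (use Suc.prems ndiff_SucD[OF Suc.prems(1)] ndiff_SucD[OF Suc.prems(2)] in auto)
 qed
qed (auto intro: differentiable_mult)

lemma ndiff_affine: "ndiff n f ==> ndiff n (%x. f (a * x + b))"
proof (induction n arbitrary: f)
 case 0
 have "((%x. f (a * x + b)) has_real_derivative deriv f (a * x + b) * a) (at x)" for x
  by (rule DERIV_chain2[of f]) (auto intro!: ndiff_DERIV[OF 0] derivative_eq_intros)
 then show ?case by (auto simp: real_differentiable_def)
next
 case (Suc n)
 show ?case
 proof (rule ndiffI[where f'="%x. a * deriv f (a * x + b)"])
  show "((%x. f (a * x + b)) has_real_derivative a * deriv f (a * x + b)) (at x)" for x
   by (subst mult.commute, rule DERIV_chain2[of f]) (auto intro!: ndiff_DERIV[OF Suc.prems] derivative_eq_intros)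
  show "ndiff n (%x. a * deriv f (a * x + b))"
   by (intro ndiff_cmult Suc.IH) (use Suc.prems in auto)
 qed
qed

section \<open>Smooth bump functions and test functions\<close>

definition flat :: "nat => real => real" where
 "flat k x = (if x > 0 then inverse x ^ k * exp (- inverse x) else 0)"

lemma flat_tendsto_0: "(flat k \<longlongrightarrow> 0) (at 0)"
 unfolding filterlim_at_split
proof
 show "(flat k \<longlongrightarrow> 0) (at_left 0)"
  by (rule tendsto_eventually) (auto simp: flat_def eventually_at_filter)
 have "((%x. inverse x ^ k / exp (inverse x)) \<longlongrightarrow> (0::real)) (at_right 0)"
  by (rule filterlim_compose[OF tendsto_power_div_exp_0 filterlim_inverse_at_top_right])
 then show "(flat k \<longlongrightarrow> 0) (at_right 0)"
  by (rule Lim_transform_eventually) (auto simp: flat_def eventually_at_filter exp_minus field_simps)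
qed

text \<open>\<open>flat 0\<close> is the classical function \<open>exp (- 1/x)\<close> extended by
  zero. The powers of \<open>1/x\<close> are included because differentiation produces them: the
  family is closed under derivatives up to linear combinations, which gives smoothness by induction.
  At the origin the difference quotient of \<open>flat k\<close> is
  \<open>flat (Suc k)\<close>.\<close>

lemma flat_DERIV: "(flat k has_real_derivative (- real k) * flat (k+1) x + flat (k+2) x) (at x)"
proof -
 consider "x > 0" | "x < 0" | "x = 0" by linarith
 then show ?thesis
 proof cases
  case 1
  have d1: "((%x. inverse x ^ k) has_real_derivative (- real k) * inverse x ^ (k+1)) (at x)"
  proof (induction k)
   case (Suc k)
   have "x \<noteq> 0" using 1 by simp
   from DERIV_mult'[OF DERIV_inverse[OF this] Suc] show ?case by (simp add: algebra_simps)
  qed simp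
  have d2: "((%x. exp (- inverse x)) has_real_derivative exp (- inverse x) * inverse x ^ 2) (at x)"
   using 1 by (auto intro!: derivative_eq_intros simp: power2_eq_square)
  have "((%x. inverse x ^ k * exp (- inverse x)) has_real_derivative (- real k) * flat (k+1) x + flat (k+2) x) (at x)"
   using DERIV_mult'[OF d1 d2] 1 by (simp add: flat_def algebra_simps power2_eq_square)
  then show ?thesis
   by (rule has_field_derivative_transform_within_open[of _ _ _ "{0<..}"]) (use 1 in \<open>auto simp: flat_def\<close>)
 next
  case 2
  have "((%x. 0) has_real_derivative (- real k) * flat (k+1) x + flat (k+2) x) (at x)"
   using 2 by (auto simp: flat_def)
  then show ?thesis
   by (rule has_field_derivative_transform_within_open[of _ _ _ "{..<0}"]) (use 2 in \<open>auto simp: flat_def\<close>)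
 next
  case 3
  have "((%h. (flat k (0 + h) - flat k 0) / h) \<longlongrightarrow> 0) (at 0)"
   by (rule Lim_transform_eventually[OF flat_tendsto_0[of "Suc k"]])
     (auto simp: flat_def eventually_at_filter field_simps)
  then show ?thesis using 3 by (simp add: DERIV_def flat_def)
 qed
qed

lemma flat_ndiff: "ndiff n (flat k)"
proof (induction n arbitrary: k)
 case 0
 then show ?case using flat_DERIV by (auto simp: real_differentiable_def)
next
 case (Suc n)
 show ?case by (rule ndiffI[OF flat_DERIV]) (intro ndiff_add ndiff_cmult Suc)
qed

definition bump :: "real => real => real => real" where
 "bump c d x = flat 0 (1 * x + (- c)) * flat 0 ((-1) * x + d)"

lemma bump_ndiff: "ndiff n (bump c d)"
 unfolding bump_def by (intro ndiff_mult ndiff_affine flat_ndiff)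

lemma bump_pos_iff: "bump c d x > 0 \<longleftrightarrow> c < x \<and> x < d" and bump_nonneg: "bump c d x \<ge> 0"
 and bump_eq_0: "x \<notin> {c<..<d} ==> bump c d x = 0"
 by (auto simp: bump_def flat_def)

lemma test_fun_iff: "test_fun a b \<phi> \<longleftrightarrow> (\<forall>n. ndiff n \<phi>) \<and> (\<exists>c d. a < c \<and> d < b \<and> (\<forall>x. x \<notin> {c..d} \<longrightarrow> \<phi> x = 0))"
 unfolding test_fun_def smooth_iff_ndiff by simp

lemma test_fun_bump: "a < c ==> d < b ==> test_fun a b (bump c d)"
 unfolding test_fun_iff using bump_ndiff bump_eq_0[of _ c d]
 by (metis atLeastAtMost_iff greaterThanLessThan_iff order_less_imp_le)

lemma test_fun_DERIV: "test_fun a b \<phi> ==> (\<phi> has_real_derivative deriv \<phi> x) (at x)"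
 unfolding test_fun_iff using ndiff_DERIV by blast

lemma test_fun_continuous: "test_fun a b \<phi> ==> continuous_on S \<phi>"
 using test_fun_DERIV by (meson DERIV_isCont continuous_at_imp_continuous_on)

lemma test_fun_deriv: assumes "test_fun a b \<phi>" shows "test_fun a b (deriv \<phi>)"
proof -
 obtain c d where cd: "a < c" "d < b" "\<And>x. x \<notin> {c..d} ==> \<phi> x = 0" using assms unfolding test_fun_iff by auto
 have "deriv \<phi> x = 0" if "x \<notin> {c..d}" for x
 proof (rule DERIV_imp_deriv)
  have "((%x. 0) has_real_derivative 0) (at x)" by simp
  then show "(\<phi> has_real_derivative 0) (at x)"
   by (rule has_field_derivative_transform_within_open[of _ _ _ "- {c..d}"]) (use that cd(3) in auto)
 qed
 moreover have "ndiff n (deriv \<phi>)" for n using assms unfolding test_fun_iff by (metis ndiff.simps(2))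
 ultimately show ?thesis using cd unfolding test_fun_iff by blast
qed

lemma test_fun_ends: assumes "test_fun a b \<phi>" shows "\<phi> a = 0" "\<phi> b = 0"
 using assms unfolding test_fun_iff by (metis atLeastAtMost_iff linorder_not_less)+

lemma test_fun_add: assumes "test_fun a b \<phi>" "test_fun a b \<psi>" shows "test_fun a b (%x. \<phi> x + r * \<psi> x)"
proof -
 obtain c d where 1: "a < c" "d < b" "\<And>x. x \<notin> {c..d} ==> \<phi> x = 0" using assms unfolding test_fun_iff by auto
 obtain c' d' where 2: "a < c'" "d' < b" "\<And>x. x \<notin> {c'..d'} ==> \<psi> x = 0" using assms unfolding test_fun_iff by auto
 have "\<forall>n. ndiff n (%x. \<phi> x + r * \<psi> x)" using assms unfolding test_fun_iff by (auto intro!: ndiff_add ndiff_cmult)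
 moreover have "a < min c c' \<and> max d d' < b \<and> (\<forall>x. x \<notin> {min c c'..max d d'} \<longrightarrow> \<phi> x + r * \<psi> x = 0)"
  using 1 2 by (auto simp: min_def max_def split: if_splits)
 ultimately show ?thesis unfolding test_fun_iff by blast
qed

text \<open>At each \<open>x\<close> at least one of the two integrals is over an empty or one-point
  interval and vanishes. The result is the antiderivative from 0 with the right sign on both sides,
  so it can be differentiated on the whole line with no one-sided derivative at 0.\<close>

definition AD :: "(real => real) => real => real" where
 "AD f x = integral {0..x} f - integral {x..0} f"

lemma AD_DERIV:
 assumes "continuous_on UNIV f"
 shows "(AD f has_real_derivative f x) (at x)"
proof -
 define c where "c = min 0 x - 1"
 have i: "f integrable_on {a..b}" for a b
  by (intro integrable_continuous_interval continuous_on_subset[OF assms]) auto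
 have eq: "AD f y = integral {c..y} f - integral {c..0} f" if "c < y" for y
 proof (cases "0 \<le> y")
  case True
  have "integral {c..0} f + integral {0..y} f = integral {c..y} f"
   by (rule Henstock_Kurzweil_Integration.integral_combine) (use True i in \<open>auto simp: c_def\<close>)
  moreover have "integral {y..0} f = 0" using True by (cases "y = 0") auto
  ultimately show ?thesis by (simp add: AD_def)
 next
  case False
  have "integral {c..y} f + integral {y..0} f = integral {c..0} f"
   by (rule Henstock_Kurzweil_Integration.integral_combine) (use False that i in auto)
  then show ?thesis using False by (simp add: AD_def)
 qed
 define d where "d = max 0 x + 1"
 have "((%y. integral {c..y} f) has_real_derivative f x) (at x within {c..d})"
  by (rule integral_has_real_derivative) (auto simp: c_def d_def intro: continuous_on_subset[OF assms])
 then have "((%y. integral {c..y} f) has_real_derivative f x) (at x)"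
  by (subst (asm) at_within_interior) (auto simp: c_def d_def)
 then have "((%y. integral {c..y} f - integral {c..0} f) has_real_derivative f x) (at x)"
  by (auto intro!: derivative_eq_intros)
 then show ?thesis
  by (rule has_field_derivative_transform_within_open[of _ _ _ "{c<..}"]) (auto simp: eq, auto simp: c_def)
qed

lemma AD_0 [simp]: "AD f 0 = 0" by (simp add: AD_def)

lemma AD_nonneg_eq: "0 \<le> x ==> AD f x = integral {0..x} f"
 by (cases "x = 0") (auto simp: AD_def)

text \<open>The primitive vanishes to the left of the support; the zero mean makes it vanish to the
  right as well.\<close>

lemma test_fun_antideriv:
 assumes t: "test_fun 0 (1/2) \<psi>" and z: "integral J \<psi> = 0"
 shows "\<exists>\<phi>. test_fun 0 (1/2) \<phi> \<and> deriv \<phi> = \<psi>"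
proof -
 obtain c d where cd: "0 < c" "d < 1/2" "\<And>x. x \<notin> {c..d} ==> \<psi> x = 0" using t unfolding test_fun_iff by auto
 define \<phi> where "\<phi> = AD \<psi>"
 have D: "(\<phi> has_real_derivative \<psi> x) (at x)" for x
  unfolding \<phi>_def by (rule AD_DERIV[OF test_fun_continuous[OF t]])
 have nd: "ndiff n \<phi>" for n
 proof (cases n)
  case 0 then show ?thesis using D by (auto simp: real_differentiable_def)
 next
  case (Suc m) then show ?thesis using ndiffI[OF D, of m] t by (simp add: test_fun_iff)
 qed
 have c1: "\<phi> x = \<phi> y" if "x < y" "\<And>z. x < z ==> z < y ==> \<psi> z = 0" for x y
 proof -
  have "\<exists>z. x < z \<and> z < y \<and> \<phi> y - \<phi> x = (y - x) * \<psi> z" by (rule MVT2) (use that D in auto)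
  then show ?thesis using that by auto
 qed
 have e: "\<phi> (1/2) = 0" unfolding \<phi>_def using z by (simp add: AD_nonneg_eq)
 have "\<phi> x = 0" if "x \<notin> {c..d}" for x
 proof (cases "x < c")
  case True
  consider "x = 0" | "x < 0" | "0 < x" by linarith
  then show ?thesis
   using c1[of x 0] c1[of 0 x] cd True by cases (auto simp: \<phi>_def)
 next
  case False
  then have "d < x" using that by auto
  consider "x = 1/2" | "x < 1/2" | "1/2 < x" by linarith
  then show ?thesis
  proof cases
   case 1 then show ?thesis using e by blast
  next
   case 2 then show ?thesis using c1[of x "1/2"] cd \<open>d < x\<close> e by auto
  next
   case 3 then show ?thesis using c1[of "1/2" x] cd e by auto
  qed
 qed
 then have "test_fun 0 (1/2) \<phi>" unfolding test_fun_iff using nd cd by blast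
 moreover have "deriv \<phi> = \<psi>" using D by (auto intro: DERIV_imp_deriv)
 ultimately show ?thesis by blast
qed

lemma set_integral_Ioo_J:
 assumes "f \<in> BM"
 shows "(LINT x:{0<..<1/2}|lborel. f x) = (LINT x:J|lborel. (f x::real))"
proof -
 have "AE x in lborel. (x::real) \<noteq> 0 \<and> x \<noteq> 1/2" by (intro AE_conjI AE_lborel_singleton)
 then have "AE x in lborel. indicator {0<..<1/2} x *\<^sub>R f x = indicator J x *\<^sub>R f x"
  by eventually_elim (auto simp: indicator_def)
 then show ?thesis unfolding set_lebesgue_integral_def by (intro integral_cong_AE) (use assms in auto)
qed

lemma set_integral_J_continuous:
 fixes f :: "real => real"
 assumes "continuous_on {a..b} f"
 shows "(LINT x:{a..b}|lborel. f x) = integral {a..b} f" "set_integrable lborel {a..b} f"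
proof -
 show i: "set_integrable lborel {a..b} f" by (rule borel_integrable_compact[OF compact_Icc assms, folded set_integrable_def])
 show "(LINT x:{a..b}|lborel. f x) = integral {a..b} f" by (rule set_borel_integral_eq_integral(2)[OF i])
qed


lemma nsq_subset: "A \<subseteq> B ==> nsq A f \<le> nsq B f"
 unfolding nsq_def by (intro nn_integral_mono) (auto simp: indicator_def)

lemma set_integrable_nsq_J:
 assumes "f \<in> BM" "nsq J f < \<infinity>"
 shows "set_integrable lborel J f"
 by (rule nsq_set_integrable) (use assms emeasure_J_finite in auto)

lemma enn2real_inj: "x \<noteq> top ==> y \<noteq> top ==> enn2real x = enn2real y ==> x = y"
 by (metis ennreal_enn2real less_top)

text \<open>The positive and negative parts of \<open>h\<close> on \<open>J\<close> are densities of
  two measures that agree on all half-lines \<open>{x<..}\<close> and hence on all Borel sets.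
  Testing on \<open>{x. h x > 0}\<close> and \<open>{x. h x < 0}\<close> shows that both parts
  vanish.\<close>

lemma set_integral_zero_imp_AE_zero:
 fixes h :: "real => real"
 assumes hm: "h \<in> BM" and i: "set_integrable lborel J h"
  and z: "\<And>x. x \<in> J ==> (LINT y:{0..x}|lborel. h y) = 0"
 shows "AE x in lborel. x \<in> J \<longrightarrow> h x = 0"
proof -
 note [measurable] = hm
 define f g where "f = (%x. ennreal (h x) * indicator J x)" and "g = (%x. ennreal (- h x) * indicator J x)"
 have fm[measurable]: "f \<in> BM" "g \<in> BM" unfolding f_def g_def by measurable
 have eq: "(\<integral>\<^sup>+x. f x * indicator A x \<partial>lborel) = (\<integral>\<^sup>+x. g x * indicator A x \<partial>lborel)"
  and fin: "(\<integral>\<^sup>+x. f x * indicator A x \<partial>lborel) < \<infinity>"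
  if A: "A \<in> sets borel" "(LINT y:A \<inter> J|lborel. h y) = 0" for A
 proof -
  have ii: "integrable lborel (%x. indicator (A \<inter> J) x *\<^sub>R h x)"
   using set_integrable_subset[OF i, of "A \<inter> J"] A(1) by (simp add: set_integrable_def)
  have e1: "(\<integral>\<^sup>+x. f x * indicator A x \<partial>lborel) = (\<integral>\<^sup>+x. ennreal (indicator (A \<inter> J) x *\<^sub>R h x) \<partial>lborel)"
   by (intro nn_integral_cong) (auto simp: f_def indicator_def)
  have e2: "(\<integral>\<^sup>+x. g x * indicator A x \<partial>lborel) = (\<integral>\<^sup>+x. ennreal (- (indicator (A \<inter> J) x *\<^sub>R h x)) \<partial>lborel)"
   by (intro nn_integral_cong) (auto simp: g_def indicator_def)
  have f1: "(\<integral>\<^sup>+x. ennreal (indicator (A \<inter> J) x *\<^sub>R h x) \<partial>lborel) \<noteq> \<infinity>"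
   and f2: "(\<integral>\<^sup>+x. ennreal (- (indicator (A \<inter> J) x *\<^sub>R h x)) \<partial>lborel) \<noteq> \<infinity>"
   using ii unfolding real_integrable_def by auto
  from real_lebesgue_integral_def[OF ii] A(2)
  have "enn2real (\<integral>\<^sup>+x. ennreal (indicator (A \<inter> J) x *\<^sub>R h x) \<partial>lborel) =
    enn2real (\<integral>\<^sup>+x. ennreal (- (indicator (A \<inter> J) x *\<^sub>R h x)) \<partial>lborel)"
   unfolding set_lebesgue_integral_def by simp
  then show "(\<integral>\<^sup>+x. f x * indicator A x \<partial>lborel) = (\<integral>\<^sup>+x. g x * indicator A x \<partial>lborel)"
   unfolding e1 e2 using f1 f2 by (simp add: enn2real_inj)
  show "(\<integral>\<^sup>+x. f x * indicator A x \<partial>lborel) < \<infinity>" unfolding e1 using f1 by (simp add: less_top)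
 qed
 have zz: "(LINT y:{x<..} \<inter> J|lborel. h y) = 0" for x :: real
 proof -
  consider "x < 0" | "1/2 \<le> x" | "0 \<le> x" "x < 1/2" by linarith
  then show ?thesis
  proof cases
   case 1
   then have "{x<..} \<inter> J = J" by auto
   then show ?thesis using z[of "1/2"] by simp
  next
   case 2
   then have "{x<..} \<inter> J = {}" by auto
   then show ?thesis by (simp add: set_lebesgue_integral_def)
  next
   case 3
   then have s: "{x<..} \<inter> J = J - {0..x}" by auto
   have "J = {0..x} \<union> (J - {0..x})" using 3 by auto
   then have "(LINT y:J|lborel. h y) = (LINT y:{0..x} \<union> (J - {0..x})|lborel. h y)" by simp
   also have "... = (LINT y:{0..x}|lborel. h y) + (LINT y:J - {0..x}|lborel. h y)"
    by (rule set_integral_Un) (use 3 in \<open>auto intro!: set_integrable_subset[OF i]\<close>)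
   finally show ?thesis using z[of x] z[of "1/2"] 3 s by simp
  qed
 qed
 have dd: "density lborel f = density lborel g"
  by (rule measure_eqI_lessThan) (use eq fin zz in \<open>auto simp: emeasure_density\<close>)
 have *: "(\<integral>\<^sup>+x. f x * indicator A x \<partial>lborel) = (\<integral>\<^sup>+x. g x * indicator A x \<partial>lborel)" if "A \<in> sets borel" for A
  using that arg_cong[of _ _ "%M. emeasure M A", OF dd]
  by (simp add: emeasure_density)
 have A: "{x. h x > 0} \<in> sets borel" "{x. h x < 0} \<in> sets borel" by measurable
 have "(\<integral>\<^sup>+x. g x * indicator {x. h x > 0} x \<partial>lborel) = (\<integral>\<^sup>+(x::real). 0 \<partial>lborel)"
  by (intro nn_integral_cong) (auto simp: g_def indicator_def ennreal_neg)
 then have "(\<integral>\<^sup>+x. f x * indicator {x. h x > 0} x \<partial>lborel) = 0" using *[OF A(1)] by simp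
 then have a1: "AE x in lborel. f x * indicator {x. h x > 0} x = 0" by (subst (asm) nn_integral_0_iff_AE) auto
 have "(\<integral>\<^sup>+x. f x * indicator {x. h x < 0} x \<partial>lborel) = (\<integral>\<^sup>+(x::real). 0 \<partial>lborel)"
  by (intro nn_integral_cong) (auto simp: f_def indicator_def ennreal_neg)
 then have "(\<integral>\<^sup>+x. g x * indicator {x. h x < 0} x \<partial>lborel) = 0" using *[OF A(2)] by simp
 then have a2: "AE x in lborel. g x * indicator {x. h x < 0} x = 0" by (subst (asm) nn_integral_0_iff_AE) auto
 from a1 a2 show ?thesis
  by eventually_elim (auto simp: f_def g_def indicator_def ennreal_eq_0_iff split: if_splits)
qed

lemma set_integral_Fubini:
 fixes k :: "real => real => real"
 assumes k: "(%(x,y). k x y) \<in> borel_measurable (borel \<Otimes>\<^sub>M borel)" and [measurable]: "A \<in> sets borel" "B \<in> sets borel"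
  and fin: "(\<integral>\<^sup>+x. (\<integral>\<^sup>+y. ennreal \<bar>k x y\<bar> * indicator B y \<partial>lborel) * indicator A x \<partial>lborel) < \<infinity>"
 shows "(LINT x:A|lborel. LINT y:B|lborel. k x y) = (LINT y:B|lborel. LINT x:A|lborel. k x y)"
proof -
 define f where "f = (%(x,y). indicator A x * (indicator B y * k x y))"
 have k': "(%x. k (fst x) (snd x)) \<in> borel_measurable (lborel \<Otimes>\<^sub>M lborel)"
  using k unfolding case_prod_beta' lborel_prod borel_prod by simp
 have fm: "f \<in> borel_measurable (lborel \<Otimes>\<^sub>M lborel)"
  unfolding f_def case_prod_beta'
  by (intro borel_measurable_times k' measurable_compose[OF measurable_fst] measurable_compose[OF measurable_snd]) auto
 have i: "integrable (lborel \<Otimes>\<^sub>M lborel) f"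
 proof (rule integrableI_bounded[OF fm])
  have "(\<integral>\<^sup>+z. ennreal (norm (f z)) \<partial>(lborel \<Otimes>\<^sub>M lborel)) = (\<integral>\<^sup>+x. \<integral>\<^sup>+y. ennreal (norm (f (x,y))) \<partial>lborel \<partial>lborel)"
   by (rule lborel.nn_integral_fst[symmetric]) (use fm in measurable)
  also have "... = (\<integral>\<^sup>+x. (\<integral>\<^sup>+y. ennreal \<bar>k x y\<bar> * indicator B y \<partial>lborel) * indicator A x \<partial>lborel)"
  proof (rule nn_integral_cong)
   fix x
   show "(\<integral>\<^sup>+y. ennreal (norm (f (x,y))) \<partial>lborel) = (\<integral>\<^sup>+y. ennreal \<bar>k x y\<bar> * indicator B y \<partial>lborel) * indicator A x"
    by (cases "x \<in> A") (auto simp: f_def indicator_def intro!: nn_integral_cong)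
  qed
  finally show "(\<integral>\<^sup>+z. ennreal (norm (f z)) \<partial>(lborel \<Otimes>\<^sub>M lborel)) < \<infinity>" using fin by simp
 qed
 have "(LINT y|lborel. LINT x|lborel. f (x,y)) = (LINT x|lborel. LINT y|lborel. f (x,y))"
  by (rule lborel_pair.Fubini_integral[of "%x y. f (x,y)"]) (use i in simp)
 moreover have "(LINT x|lborel. f (x,y)) = indicator B y * (LINT x|lborel. indicator A x * k x y)" for y
  unfolding f_def by (simp add: mult.left_commute[of "indicator A _"])
 moreover have "(LINT y|lborel. f (x,y)) = indicator A x * (LINT y|lborel. indicator B y * k x y)" for x
  unfolding f_def by simp
 ultimately show ?thesis unfolding set_lebesgue_integral_def by simp
qed

text \<open>Fubini over the triangle \<open>y \<le> x\<close>, encoded in the kernel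
  \<open>k\<close>: integrating \<open>deriv \<phi>\<close> from \<open>y\<close> to
  \<open>1/2\<close> gives \<open>- \<phi> y\<close>, since \<open>\<phi>\<close> vanishes at
  \<open>1/2\<close>. The constant \<open>c\<close> is removed by the same formula at
  \<open>y = 0\<close>.\<close>

lemma weak_deriv_integral:
 assumes g: "g \<in> BM" "nsq J g < \<infinity>"
  and f: "\<And>x. x \<in> {0<..<1/2} ==> f x = c + (LINT y:{0..x}|lborel. g y)"
 shows "weak_deriv 0 (1/2) f g"
 unfolding weak_deriv_def
proof (intro allI impI)
 fix \<phi> assume t: "test_fun 0 (1/2) \<phi>"
 note gi = set_integrable_nsq_J[OF g]
 have [measurable]: "\<phi> \<in> BM" "deriv \<phi> \<in> BM" "g \<in> BM"
  using g test_fun_continuous[OF t] test_fun_continuous[OF test_fun_deriv[OF t]] by (auto intro: borel_measurable_continuous_onI)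
 have ftc: "(LINT x:{y..1/2}|lborel. deriv \<phi> x) = - \<phi> y" if "y \<in> J" for y
 proof -
  have "(deriv \<phi> has_integral \<phi> (1/2) - \<phi> y) {y..1/2}"
   by (rule fundamental_theorem_of_calculus)
     (use that test_fun_DERIV[OF t] in \<open>auto simp: has_real_derivative_iff_has_vector_derivative[symmetric] intro: has_field_derivative_at_within\<close>)
  then show ?thesis
   using set_integral_J_continuous(1)[OF test_fun_continuous[OF test_fun_deriv[OF t]], of y "1/2"] test_fun_ends[OF t]
   by (simp add: integral_unique)
 qed
 obtain K where K: "\<And>x. x \<in> J ==> \<bar>deriv \<phi> x\<bar> \<le> K"
  using compact_imp_bounded[OF compact_continuous_image[OF test_fun_continuous[OF test_fun_deriv[OF t]] compact_Icc, of 0 "1/2"]]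
  unfolding bounded_iff by (metis imageI real_norm_def)
 define k where "k = (%x y. (if y \<le> x then 1 else 0) * (g y * deriv \<phi> x))"
 have km: "(%(x,y). k x y) \<in> borel_measurable (borel \<Otimes>\<^sub>M borel)" unfolding k_def by measurable
 have swap: "(LINT x:J|lborel. LINT y:J|lborel. k x y) = (LINT y:J|lborel. LINT x:J|lborel. k x y)"
 proof (rule set_integral_Fubini[OF km])
  have G: "(\<integral>\<^sup>+y. ennreal \<bar>g y\<bar> * indicator J y \<partial>lborel) < \<infinity>"
  proof -
   have "(\<integral>\<^sup>+y. ennreal (norm (indicator J y *\<^sub>R g y)) \<partial>lborel) < \<infinity>"
    using gi unfolding set_integrable_def integrable_iff_bounded by blast
   also have "(\<integral>\<^sup>+y. ennreal (norm (indicator J y *\<^sub>R g y)) \<partial>lborel) = (\<integral>\<^sup>+y. ennreal \<bar>g y\<bar> * indicator J y \<partial>lborel)"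
    by (intro nn_integral_cong) (auto simp: indicator_def)
   finally show ?thesis .
  qed
  have "(\<integral>\<^sup>+x. (\<integral>\<^sup>+y. ennreal \<bar>k x y\<bar> * indicator J y \<partial>lborel) * indicator J x \<partial>lborel) \<le>
    (\<integral>\<^sup>+x. (ennreal \<bar>K\<bar> * (\<integral>\<^sup>+y. ennreal \<bar>g y\<bar> * indicator J y \<partial>lborel)) * indicator J x \<partial>lborel)"
  proof (rule nn_integral_mono)
   fix x :: real
   show "(\<integral>\<^sup>+y. ennreal \<bar>k x y\<bar> * indicator J y \<partial>lborel) * indicator J x \<le>
    (ennreal \<bar>K\<bar> * (\<integral>\<^sup>+y. ennreal \<bar>g y\<bar> * indicator J y \<partial>lborel)) * indicator J x"
   proof (cases "x \<in> J")
    case True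
    have "\<bar>k x y\<bar> \<le> \<bar>K\<bar> * \<bar>g y\<bar>" for y
     using K[OF True] mult_left_mono[of "\<bar>deriv \<phi> x\<bar>" "\<bar>K\<bar>" "\<bar>g y\<bar>"] by (auto simp: k_def abs_mult mult.commute)
    then have "(\<integral>\<^sup>+y. ennreal \<bar>k x y\<bar> * indicator J y \<partial>lborel) \<le> (\<integral>\<^sup>+y. ennreal \<bar>K\<bar> * (ennreal \<bar>g y\<bar> * indicator J y) \<partial>lborel)"
     by (intro nn_integral_mono) (auto simp: indicator_def ennreal_mult[symmetric] intro!: ennreal_leI)
    also have "... = ennreal \<bar>K\<bar> * (\<integral>\<^sup>+y. ennreal \<bar>g y\<bar> * indicator J y \<partial>lborel)"
     by (rule nn_integral_cmult) measurable
    finally show ?thesis using True by simp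
   qed simp
  qed
  also have "... = (ennreal \<bar>K\<bar> * (\<integral>\<^sup>+y. ennreal \<bar>g y\<bar> * indicator J y \<partial>lborel)) * emeasure lborel J"
   by (rule nn_integral_cmult_indicator) simp
  also have "... < \<infinity>" using G emeasure_J_finite by (simp add: ennreal_mult_less_top)
  finally show "(\<integral>\<^sup>+x. (\<integral>\<^sup>+y. ennreal \<bar>k x y\<bar> * indicator J y \<partial>lborel) * indicator J x \<partial>lborel) < \<infinity>" .
 qed auto
 have L: "(LINT y:J|lborel. k x y) = (LINT y:{0..x}|lborel. g y) * deriv \<phi> x" if "x \<in> J" for x
 proof -
  have "(LINT y:J|lborel. k x y) = (LINT y:{0..x}|lborel. g y * deriv \<phi> x)"
   unfolding set_lebesgue_integral_def
   by (intro Bochner_Integration.integral_cong) (use that in \<open>auto simp: k_def indicator_def\<close>)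
  then show ?thesis by simp
 qed
 have R: "(LINT x:J|lborel. k x y) = - (g y * \<phi> y)" if "y \<in> J" for y
 proof -
  have "(LINT x:J|lborel. k x y) = (LINT x:{y..1/2}|lborel. g y * deriv \<phi> x)"
   unfolding set_lebesgue_integral_def
   by (intro Bochner_Integration.integral_cong) (use that in \<open>auto simp: k_def indicator_def\<close>)
  then show ?thesis using ftc[OF that] by simp
 qed
 have Gi: "set_integrable lborel J (%x. (LINT y:{0..x}|lborel. g y) * deriv \<phi> x)"
 proof (rule set_integral_J_continuous(2))
  have "(%x. LINT y:{0..x}|lborel. g y) = (%x. LINT y:{0..x}|lborel. g y)" ..
  have "integral {0..x} g = (LINT y:{0..x}|lborel. g y)" if "x \<in> J" for x
   by (rule set_borel_integral_eq_integral(2)[symmetric], rule set_integrable_subset[OF gi]) (use that in auto)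
  moreover have "continuous_on J (%x. integral {0..x} g)"
   by (rule indefinite_integral_continuous_1) (rule set_borel_integral_eq_integral(1)[OF gi])
  ultimately have "continuous_on J (%x. LINT y:{0..x}|lborel. g y)" by (metis (no_types, lifting) continuous_on_cong)
  then show "continuous_on J (%x. (LINT y:{0..x}|lborel. g y) * deriv \<phi> x)"
   by (intro continuous_intros test_fun_continuous[OF test_fun_deriv[OF t]])
 qed
 have di: "set_integrable lborel J (%x. c * deriv \<phi> x)"
  by (intro set_integral_J_continuous continuous_intros test_fun_continuous[OF test_fun_deriv[OF t]])
 have sub: "A \<subseteq> J ==> set_integrable lborel J F ==> A \<in> sets borel ==> set_integrable lborel A F" for A and F :: "real => real"
  by (rule set_integrable_subset) auto
 have swI: "(LINT x:{0<..<1/2}|lborel. F x) = (LINT x:J|lborel. F x)" if "set_integrable lborel J F" for F :: "real => real"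
 proof -
  have m: "(%x. indicator J x *\<^sub>R F x) \<in> BM" using that unfolding set_integrable_def by auto
  have "(LINT x:{0<..<1/2}|lborel. F x) = (LINT x:{0<..<1/2}|lborel. indicator J x *\<^sub>R F x)"
   by (rule set_lebesgue_integral_cong) (auto simp: indicator_def)
  also have "... = (LINT x:J|lborel. indicator J x *\<^sub>R F x)" by (rule set_integral_Ioo_J[OF m])
  also have "... = (LINT x:J|lborel. F x)" by (rule set_lebesgue_integral_cong) (auto simp: indicator_def)
  finally show ?thesis .
 qed
 have "(LINT x:{0<..<1/2}|lborel. f x * deriv \<phi> x) = (LINT x:{0<..<1/2}|lborel. c * deriv \<phi> x + (LINT y:{0..x}|lborel. g y) * deriv \<phi> x)"
  by (rule set_lebesgue_integral_cong) (auto simp: f algebra_simps)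
 also have "... = (LINT x:J|lborel. c * deriv \<phi> x + (LINT y:{0..x}|lborel. g y) * deriv \<phi> x)"
  by (rule swI, rule set_integral_add(1)[OF di Gi])
 also have "... = (LINT x:J|lborel. c * deriv \<phi> x) + (LINT x:J|lborel. (LINT y:{0..x}|lborel. g y) * deriv \<phi> x)"
  by (rule set_integral_add(2)[OF di Gi])
 also have "(LINT x:J|lborel. c * deriv \<phi> x) = 0" using ftc[of 0] test_fun_ends[OF t] by simp
 also have "(LINT x:J|lborel. (LINT y:{0..x}|lborel. g y) * deriv \<phi> x) = (LINT x:J|lborel. LINT y:J|lborel. k x y)"
  by (rule set_lebesgue_integral_cong) (auto simp: L)
 also have "... = (LINT y:J|lborel. - (g y * \<phi> y))" unfolding swap
  by (rule set_lebesgue_integral_cong) (auto simp: R)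
 also have "... = - (LINT y:J|lborel. g y * \<phi> y)" by (simp add: set_lebesgue_integral_def)
 also have "(LINT y:J|lborel. g y * \<phi> y) = (LINT y:{0<..<1/2}|lborel. g y * \<phi> y)"
  by (rule set_integral_Ioo_J[symmetric]) measurable
 finally show "(LINT x:{0<..<1/2}|lborel. f x * deriv \<phi> x) = - (LINT y:{0<..<1/2}|lborel. g y * \<phi> y)" by simp
qed


lemma set_integrable_mult_continuous:
 fixes H \<psi> :: "real => real"
 assumes H: "set_integrable lborel J H" and \<psi>: "continuous_on UNIV \<psi>"
 shows "set_integrable lborel {0<..<1/2} (%x. H x * \<psi> x)"
proof -
 obtain K where K: "\<And>x. x \<in> J ==> \<bar>\<psi> x\<bar> \<le> K"
  using compact_imp_bounded[OF compact_continuous_image[OF continuous_on_subset[OF \<psi>] compact_Icc, of 0 "1/2"]]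
  unfolding bounded_iff by (metis imageI real_norm_def subset_UNIV)
 have m: "\<psi> \<in> BM" "(%x. indicator J x *\<^sub>R H x) \<in> BM"
  using H \<psi> unfolding set_integrable_def by (auto intro: borel_measurable_continuous_onI)
 have "set_integrable lborel J (%x. H x * \<psi> x)"
  unfolding set_integrable_def
 proof (rule Bochner_Integration.integrable_bound)
  show "integrable lborel (%x. K * (indicator J x *\<^sub>R H x))" using H unfolding set_integrable_def by simp
  have "(%x. indicator J x *\<^sub>R (H x * \<psi> x)) = (%x. (indicator J x *\<^sub>R H x) * \<psi> x)" by auto
  then show "(%x. indicator J x *\<^sub>R (H x * \<psi> x)) \<in> borel_measurable lborel" using m by simp
  have "\<bar>H x\<bar> * \<bar>\<psi> x\<bar> \<le> \<bar>K\<bar> * \<bar>H x\<bar>" if "x \<in> J" for x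
   using K[OF that] by (subst mult.commute, intro mult_right_mono) auto
  then show "AE x in lborel. norm (indicator J x *\<^sub>R (H x * \<psi> x)) \<le> norm (K * (indicator J x *\<^sub>R H x))"
   by (intro AE_I2) (simp add: indicator_def abs_mult)
 qed
 then show ?thesis by (rule set_integrable_subset) auto
qed

text \<open>Modulo derivatives of test functions the space of test functions is one-dimensional:
  subtracting the multiple of a fixed bump with the same integral leaves a function of zero mean,
  which is such a derivative by \<open>test_fun_antideriv\<close>.\<close>

lemma test_functional_constant:
 assumes H: "set_integrable lborel J H"
  and z: "\<And>\<phi>. test_fun 0 (1/2) \<phi> ==> (LINT x:{0<..<1/2}|lborel. H x * deriv \<phi> x) = 0"
 shows "\<exists>c. \<forall>\<psi>. test_fun 0 (1/2) \<psi> \<longrightarrow> (LINT x:{0<..<1/2}|lborel. H x * \<psi> x) = c * integral J \<psi>"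
proof -
 define \<psi>0 where "\<psi>0 = bump (1/8) (3/8)"
 have t0: "test_fun 0 (1/2) \<psi>0" unfolding \<psi>0_def by (rule test_fun_bump) auto
 define K where "K = integral J \<psi>0"
 have ii: "test_fun 0 (1/2) \<psi> ==> \<psi> integrable_on J" for \<psi>
  by (intro integrable_continuous_interval test_fun_continuous)
 have K: "K \<noteq> 0"
 proof
  assume "K = 0"
  then have "\<forall>x\<in>J. \<psi>0 x = 0"
   unfolding K_def using integral_eq_0_iff[OF test_fun_continuous[OF t0], of 0 "1/2"]
   by (auto simp: \<psi>0_def bump_nonneg)
  then have "\<psi>0 (1/4) = 0" by simp
  moreover have "\<psi>0 (1/4) > 0" unfolding \<psi>0_def bump_pos_iff by simp
  ultimately show False by simp
 qed
 have "(LINT x:{0<..<1/2}|lborel. H x * \<psi> x) = (LINT x:{0<..<1/2}|lborel. H x * \<psi>0 x) / K * integral J \<psi>" if t: "test_fun 0 (1/2) \<psi>" for \<psi>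
 proof -
  define r where "r = - (integral J \<psi> / K)"
  have t1: "test_fun 0 (1/2) (%x. \<psi> x + r * \<psi>0 x)" by (rule test_fun_add[OF t t0])
  have "integral J (%x. \<psi> x + r * \<psi>0 x) = integral J \<psi> + integral J (%x. r * \<psi>0 x)"
   by (intro Henstock_Kurzweil_Integration.integral_add ii[OF t] integrable_on_mult_right ii[OF t0])
  also have "... = integral J \<psi> + r * K" unfolding K_def by simp
  also have "... = 0" unfolding r_def using K by simp
  finally obtain \<phi> where \<phi>: "test_fun 0 (1/2) \<phi>" "deriv \<phi> = (%x. \<psi> x + r * \<psi>0 x)" using test_fun_antideriv[OF t1] by blast
  have i1: "set_integrable lborel {0<..<1/2} (%x. H x * \<psi> x)" "set_integrable lborel {0<..<1/2} (%x. H x * \<psi>0 x)"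
   by (rule set_integrable_mult_continuous[OF H test_fun_continuous[OF t]]
     set_integrable_mult_continuous[OF H test_fun_continuous[OF t0]])+
  have "0 = (LINT x:{0<..<1/2}|lborel. H x * (\<psi> x + r * \<psi>0 x))" using z[OF \<phi>(1)] \<phi>(2) by simp
  also have "... = (LINT x:{0<..<1/2}|lborel. H x * \<psi> x + r * (H x * \<psi>0 x))" by (simp add: algebra_simps)
  also have "... = (LINT x:{0<..<1/2}|lborel. H x * \<psi> x) + (LINT x:{0<..<1/2}|lborel. r * (H x * \<psi>0 x))"
   by (rule set_integral_add(2)[OF i1(1)]) (use i1(2) in simp)
  also have "... = (LINT x:{0<..<1/2}|lborel. H x * \<psi> x) + r * (LINT x:{0<..<1/2}|lborel. H x * \<psi>0 x)" by simp
  finally show ?thesis unfolding r_def by (simp add: field_simps)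
 qed
 then show ?thesis by blast
qed

text \<open>Near an interior point where \<open>h\<close> is nonzero a narrow bump would give a
  nonzero integral; the endpoints follow by continuity.\<close>

lemma continuous_test_zero:
 assumes h: "continuous_on J h" and z: "\<And>\<psi>. test_fun 0 (1/2) \<psi> ==> (LINT x:{0<..<1/2}|lborel. h x * \<psi> x) = 0"
  and x: "x \<in> J"
 shows "h x = (0::real)"
proof -
 have key: False if g: "continuous_on J g" and z: "\<And>\<psi>. test_fun 0 (1/2) \<psi> ==> (LINT x:{0<..<1/2}|lborel. g x * \<psi> x) = 0"
  and x: "x \<in> {0<..<1/2}" and pos: "g x > 0" for g x
 proof -
  have "continuous (at x) g" using g x by (metis at_within_interior continuous_on_eq_continuous_within interior_atLeastAtMost_real greaterThanLessThan_subseteq_atLeastAtMost_iff order.refl subsetD)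
  then obtain e where e: "e > 0" "\<And>y. \<bar>y - x\<bar> < e ==> g y > 0"
   using pos unfolding continuous_at_eps_delta dist_real_def by (metis abs_diff_less_iff diff_self)
  define d where "d = min e (min x (1/2 - x)) / 2"
  have d: "d > 0" "d < e" "d < x" "x + d < 1/2" using e x unfolding d_def by (auto simp: min_def)
  define \<psi> where "\<psi> = bump (x - d) (x + d)"
  have t: "test_fun 0 (1/2) \<psi>" unfolding \<psi>_def by (rule test_fun_bump) (use d in auto)
  have c: "continuous_on J (%y. g y * \<psi> y)" by (intro continuous_intros g test_fun_continuous[OF t])
  have nn: "0 \<le> g y * \<psi> y" for y
  proof (cases "y \<in> {x-d<..<x+d}")
   case True then have "g y > 0" using e(2)[of y] d by (auto simp: abs_less_iff)
   then show ?thesis by (simp add: \<psi>_def bump_nonneg)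
  next
   case False then show ?thesis by (simp add: \<psi>_def bump_eq_0)
  qed
  have mJ: "(%y. indicator J y * (g y * \<psi> y)) \<in> BM"
   using set_integral_J_continuous(2)[OF c] unfolding set_integrable_def by auto
  have "integral J (%y. g y * \<psi> y) = (LINT y:J|lborel. g y * \<psi> y)" by (rule set_integral_J_continuous(1)[OF c, symmetric])
  also have "... = (LINT y:J|lborel. indicator J y * (g y * \<psi> y))" by (rule set_lebesgue_integral_cong) auto
  also have "... = (LINT y:{0<..<1/2}|lborel. indicator J y * (g y * \<psi> y))" by (rule set_integral_Ioo_J[OF mJ, symmetric])
  also have "... = (LINT y:{0<..<1/2}|lborel. g y * \<psi> y)" by (rule set_lebesgue_integral_cong) auto
  also have "... = 0" by (rule z[OF t])
  finally have "g x * \<psi> x = 0" using integral_eq_0_iff[OF c] nn x by auto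
  moreover have "\<psi> x > 0" unfolding \<psi>_def bump_pos_iff using d by simp
  ultimately show False using pos by simp
 qed
 have "h x = 0" if "x \<in> {0<..<1/2}" for x
 proof (rule ccontr)
  assume "h x \<noteq> 0"
  then consider "h x > 0" | "- h x > 0" by linarith
  then show False
  proof cases
   case 1 then show ?thesis using key[OF h z that] by blast
  next
   case 2
   show ?thesis using key[of "%x. - h x" x, OF continuous_on_minus[OF h] _ that 2] z
    by (simp add: set_lebesgue_integral_def)
  qed
 qed
 then show ?thesis using continuous_constant_on_closure[of "{0<..<1/2}" h 0 x] h x by simp
qed

text \<open>The primitive \<open>G\<close> of \<open>g\<close> has the same weak derivative as
  \<open>f\<close>, so \<open>f - G\<close> annihilates all derivatives of test functions and acts
  as a constant \<open>c\<close>. To turn this into an almost everywhere statement,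
  \<open>k = f - G - c\<close> is itself integrated: its primitive is continuous and again
  annihilates derivatives, hence is constant at every point, hence zero, and then \<open>k\<close>
  vanishes almost everywhere.\<close>

lemma du_Bois_Reymond:
 assumes f: "f \<in> BM" "nsq J f < \<infinity>" and g: "g \<in> BM" "nsq J g < \<infinity>"
  and w: "weak_deriv 0 (1/2) f g"
 shows "\<exists>c. AE x in lborel. x \<in> J \<longrightarrow> f x = c + (LINT y:{0..x}|lborel. g y)"
proof -
 define clamp where "clamp = (%x::real. max 0 (min (1/2) x))"
 have cl: "x \<in> J ==> clamp x = x" "clamp x \<in> J" for x unfolding clamp_def by (auto simp: max_def min_def)
 have ccl: "continuous_on UNIV clamp" unfolding clamp_def by (intro continuous_intros)
 have intcont: "continuous_on UNIV (%x. LINT y:{0..clamp x}|lborel. k y)" if k: "set_integrable lborel J k" for k :: "real => real"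
 proof -
  have "integral {0..x} k = (LINT y:{0..x}|lborel. k y)" if "x \<in> J" for x
   by (rule set_borel_integral_eq_integral(2)[symmetric], rule set_integrable_subset[OF k]) (use that in auto)
  moreover have "continuous_on J (%x. integral {0..x} k)"
   by (rule indefinite_integral_continuous_1) (rule set_borel_integral_eq_integral(1)[OF k])
  ultimately have "continuous_on J (%x. LINT y:{0..x}|lborel. k y)" by (metis (no_types, lifting) continuous_on_cong)
  from continuous_on_compose2[OF this ccl] show ?thesis using cl(2) by blast
 qed
 note fi = set_integrable_nsq_J[OF f] note gi = set_integrable_nsq_J[OF g]
 define G where "G = (%x. LINT y:{0..clamp x}|lborel. g y)"
 have Gc: "continuous_on UNIV G" unfolding G_def by (rule intcont[OF gi])
 have Gm[measurable]: "G \<in> BM" by (intro borel_measurable_continuous_onI Gc)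
 have bdd: "nsq J F < \<infinity>" if Fc: "continuous_on UNIV F" for F :: "real => real"
 proof -
  obtain K where "\<And>x. x \<in> J ==> \<bar>F x\<bar> \<le> K"
   using compact_imp_bounded[OF compact_continuous_image[OF continuous_on_subset[OF Fc] compact_Icc, of 0 "1/2"]]
   unfolding bounded_iff by (metis imageI real_norm_def subset_UNIV)
  then show ?thesis by (intro nsq_bounded_finite) (use emeasure_J_finite in auto)
 qed
 have wG: "weak_deriv 0 (1/2) G g"
  by (rule weak_deriv_integral[OF g, of _ 0]) (simp add: G_def cl)
 define H where "H = (%x. f x - G x)"
 have Gi: "set_integrable lborel J G" by (rule set_integrable_nsq_J[OF Gm bdd[OF Gc]])
 have Hm[measurable]: "H \<in> BM" unfolding H_def using f(1) by measurable
 have Hi: "set_integrable lborel J H" unfolding H_def by (rule set_integral_diff(1)[OF fi Gi])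
 have z: "(LINT x:{0<..<1/2}|lborel. H x * deriv \<phi> x) = 0" if t: "test_fun 0 (1/2) \<phi>" for \<phi>
 proof -
  note tc = test_fun_continuous[OF test_fun_deriv[OF t]]
  have "(LINT x:{0<..<1/2}|lborel. H x * deriv \<phi> x) = (LINT x:{0<..<1/2}|lborel. f x * deriv \<phi> x - G x * deriv \<phi> x)"
   unfolding H_def by (simp add: left_diff_distrib)
  also have "... = (LINT x:{0<..<1/2}|lborel. f x * deriv \<phi> x) - (LINT x:{0<..<1/2}|lborel. G x * deriv \<phi> x)"
   by (intro set_integral_diff(2) set_integrable_mult_continuous fi Gi tc)
  also have "... = 0" using w wG t unfolding weak_deriv_def by simp
  finally show ?thesis .
 qed
 obtain c where c: "\<And>\<psi>. test_fun 0 (1/2) \<psi> ==> (LINT x:{0<..<1/2}|lborel. H x * \<psi> x) = c * integral J \<psi>"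
  using test_functional_constant[OF Hi z] by blast
 define k where "k = (%x. H x - c)"
 have ci: "set_integrable lborel J (%x. c)" by (rule set_integral_J_continuous) simp
 have ki: "set_integrable lborel J k" unfolding k_def by (rule set_integral_diff(1)[OF Hi ci])
 have km: "k \<in> BM" unfolding k_def by measurable
 have kf: "nsq J k < \<infinity>"
 proof -
  have "nsq J (%x. f x + (- G x - c)) < \<infinity>"
   by (intro nsq_add_finite f bdd continuous_intros Gc) (auto intro: borel_measurable_diff)
  moreover have "(%x. f x + (- G x - c)) = k" unfolding k_def H_def by auto
  ultimately show ?thesis by simp
 qed
 define K where "K = (%x. LINT y:{0..clamp x}|lborel. k y)"
 have Kc: "continuous_on UNIV K" unfolding K_def by (rule intcont[OF ki])
 have Ki: "set_integrable lborel J K" by (rule set_integral_J_continuous(2)[OF continuous_on_subset[OF Kc]]) simp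
 have wK: "weak_deriv 0 (1/2) K k" by (rule weak_deriv_integral[OF km kf, of _ 0]) (simp add: K_def cl)
 have "(LINT x:{0<..<1/2}|lborel. K x * deriv \<phi> x) = 0" if t: "test_fun 0 (1/2) \<phi>" for \<phi>
 proof -
  note tc = test_fun_continuous[OF t]
  have "(LINT x:{0<..<1/2}|lborel. k x * \<phi> x) = (LINT x:{0<..<1/2}|lborel. H x * \<phi> x - c * \<phi> x)"
   unfolding k_def by (simp add: left_diff_distrib)
  also have "... = (LINT x:{0<..<1/2}|lborel. H x * \<phi> x) - (LINT x:{0<..<1/2}|lborel. c * \<phi> x)"
   by (intro set_integral_diff(2) set_integrable_mult_continuous Hi ci tc)
  also have "(LINT x:{0<..<1/2}|lborel. c * \<phi> x) = c * integral J \<phi>"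
   using set_integral_Ioo_J[OF borel_measurable_continuous_onI[OF tc]] set_integral_J_continuous(1)[OF tc, of 0 "1/2"] by simp
  finally have "(LINT x:{0<..<1/2}|lborel. k x * \<phi> x) = 0" using c[OF t] by simp
  then show ?thesis using wK t unfolding weak_deriv_def by simp
 qed
 from test_functional_constant[OF Ki this] obtain c2 where
  c2: "\<And>\<psi>. test_fun 0 (1/2) \<psi> ==> (LINT x:{0<..<1/2}|lborel. K x * \<psi> x) = c2 * integral J \<psi>" by blast
 have "K x - c2 = 0" if "x \<in> J" for x
 proof (rule continuous_test_zero[OF _ _ that])
  show "continuous_on J (%x. K x - c2)" by (intro continuous_intros continuous_on_subset[OF Kc]) simp
  fix \<psi> assume t: "test_fun 0 (1/2) \<psi>"
  note tc = test_fun_continuous[OF t]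
  have c2i: "set_integrable lborel J (%x. c2)" by (rule set_integral_J_continuous) simp
  have "(LINT x:{0<..<1/2}|lborel. (K x - c2) * \<psi> x) = (LINT x:{0<..<1/2}|lborel. K x * \<psi> x - c2 * \<psi> x)"
   by (simp add: left_diff_distrib)
  also have "... = (LINT x:{0<..<1/2}|lborel. K x * \<psi> x) - (LINT x:{0<..<1/2}|lborel. c2 * \<psi> x)"
   by (intro set_integral_diff(2) set_integrable_mult_continuous Ki c2i tc)
  also have "(LINT x:{0<..<1/2}|lborel. c2 * \<psi> x) = c2 * integral J \<psi>"
   using set_integral_Ioo_J[OF borel_measurable_continuous_onI[OF tc]] set_integral_J_continuous(1)[OF tc, of 0 "1/2"] by simp
  finally show "(LINT x:{0<..<1/2}|lborel. (K x - c2) * \<psi> x) = 0" using c2[OF t] by simp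
 qed
 moreover have "K 0 = 0"
 proof -
  have "AE x in lborel. indicator {0..0} x *\<^sub>R k x = 0"
   using AE_lborel_singleton[of "0::real"] by eventually_elim auto
  then show ?thesis unfolding K_def set_lebesgue_integral_def clamp_def
   by (simp add: integral_eq_zero_AE)
 qed
 ultimately have "K x = 0" if "x \<in> J" for x using that by (metis atLeastAtMost_iff diff_0 eq_iff_diff_eq_0 half_gt_zero_iff neg_equal_0_iff_equal order_less_imp_le order_refl zero_less_one)
 then have "(LINT y:{0..x}|lborel. k y) = 0" if "x \<in> J" for x using that cl unfolding K_def by force
 from set_integral_zero_imp_AE_zero[OF km ki this] have "AE x in lborel. x \<in> J \<longrightarrow> k x = 0" by simp
 then have "AE x in lborel. x \<in> J \<longrightarrow> f x = c + (LINT y:{0..x}|lborel. g y)"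
  by eventually_elim (auto simp: k_def H_def G_def cl)
 then show ?thesis by blast
qed

subsection \<open>The Morrey embedding\<close>

lemma FK_times_powr: "g (fst z) - g (snd z) = FK \<sigma> g z * \<bar>fst z - snd z\<bar> powr (1/2 + \<sigma>)"
 by (cases "fst z = snd z") (auto simp: FK_def)

lemma average_sq_le:
 assumes g: "g \<in> BM" "set_integrable lborel {a..b} g" and ab: "a < b"
 shows "ennreal (((LINT x:{a..b}|lborel. g x) / (b - a) - c)\<^sup>2) \<le> ennreal (1 / (b - a)) * nsq {a..b} (%x. g x - c)"
proof -
 have ci: "set_integrable lborel {a..b} (%x. c)" by (rule set_integral_J_continuous) simp
 have "(LINT x:{a..b}|lborel. g x - c) = (LINT x:{a..b}|lborel. g x) - (LINT x:{a..b}|lborel. c)"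
  by (rule set_integral_diff(2)[OF g(2) ci])
 also have "(LINT x:{a..b}|lborel. c) = c * (b - a)" using ab by (simp add: set_lebesgue_integral_def)
 finally have "(LINT x:{a..b}|lborel. g x) / (b - a) - c = (LINT x:{a..b}|lborel. g x - c) / (b - a)"
  using ab by (simp add: field_simps)
 then have "ennreal (((LINT x:{a..b}|lborel. g x) / (b - a) - c)\<^sup>2) = ennreal (1 / (b - a)^2) * ennreal ((LINT x:{a..b}|lborel. g x - c)\<^sup>2)"
  by (simp add: power_divide flip: ennreal_mult)
 also have "... \<le> ennreal (1 / (b - a)^2) * (emeasure lborel {a..b} * nsq {a..b} (%x. g x - c))"
  by (intro mult_left_mono nsq_integral_sq_le) (use g in auto)
 also have "... = ennreal (1 / (b - a)) * nsq {a..b} (%x. g x - c)"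
 proof -
  have "ennreal (1 / (b - a)^2) * emeasure lborel {a..b} = ennreal (1 / (b - a))"
   using ab by (simp add: power2_eq_square flip: ennreal_mult)
  then show ?thesis by (simp only: mult.assoc[symmetric])
 qed
 finally show ?thesis .
qed

text \<open>Where \<open>\<bar>x - y\<bar> \<le> d\<close>, the squared increment of
  \<open>g\<close> is at most \<open>d powr (1 + 2*\<sigma>)\<close> times the squared kernel. The
  set \<open>Q x\<close> may depend on \<open>x\<close>, which allows averaging windows that move
  with the point.\<close>

lemma iterated_diff_le_FK:
 assumes g: "g \<in> BM" and Q: "\<And>x. x \<in> J ==> Q x \<subseteq> J"
  and P: "P \<subseteq> J" and d: "\<And>x y. x \<in> P ==> y \<in> Q x ==> \<bar>x - y\<bar> \<le> d" and s: "0 < \<sigma>"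
 shows "(\<integral>\<^sup>+x. nsq (Q x) (%y. g y - g x) * indicator P x \<partial>lborel) \<le> ennreal (d powr (1 + 2*\<sigma>)) * nsq JJ (FK \<sigma> g)"
proof -
 have FKm: "(%z. ennreal ((FK \<sigma> g z)\<^sup>2) * indicator JJ z) \<in> borel_measurable (lborel \<Otimes>\<^sub>M lborel)"
  unfolding lborel_prod using FK_measurable[OF g] by simp
 have "(\<integral>\<^sup>+x. nsq (Q x) (%y. g y - g x) * indicator P x \<partial>lborel) \<le>
   (\<integral>\<^sup>+x. ennreal (d powr (1 + 2*\<sigma>)) * (\<integral>\<^sup>+y. ennreal ((FK \<sigma> g (x,y))\<^sup>2) * indicator JJ (x,y) \<partial>lborel) \<partial>lborel)"
 proof (rule nn_integral_mono)
  fix x :: real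
  show "nsq (Q x) (%y. g y - g x) * indicator P x \<le> ennreal (d powr (1 + 2*\<sigma>)) * (\<integral>\<^sup>+y. ennreal ((FK \<sigma> g (x,y))\<^sup>2) * indicator JJ (x,y) \<partial>lborel)"
  proof (cases "x \<in> P")
   case True
   have "nsq (Q x) (%y. g y - g x) \<le> (\<integral>\<^sup>+y. ennreal (d powr (1 + 2*\<sigma>)) * (ennreal ((FK \<sigma> g (x,y))\<^sup>2) * indicator JJ (x,y)) \<partial>lborel)"
    unfolding nsq_def
   proof (rule nn_integral_mono)
    fix y :: real
    show "ennreal ((g y - g x)\<^sup>2) * indicator (Q x) y \<le> ennreal (d powr (1 + 2*\<sigma>)) * (ennreal ((FK \<sigma> g (x,y))\<^sup>2) * indicator JJ (x,y))"
    proof (cases "y \<in> Q x")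
     case y: True
     have "(g y - g x)\<^sup>2 = (g x - g y)\<^sup>2" by (simp add: power2_commute)
     also have "... = (FK \<sigma> g (x,y))\<^sup>2 * (\<bar>x - y\<bar> powr (1/2 + \<sigma>))\<^sup>2"
      using FK_times_powr[of g "(x,y)" \<sigma>] by (simp add: power_mult_distrib)
     also have "(\<bar>x - y\<bar> powr (1/2 + \<sigma>))\<^sup>2 = \<bar>x - y\<bar> powr (1 + 2*\<sigma>)"
      by (simp add: power2_eq_square flip: powr_add)
     also have "(FK \<sigma> g (x,y))\<^sup>2 * \<bar>x - y\<bar> powr (1 + 2*\<sigma>) \<le> (FK \<sigma> g (x,y))\<^sup>2 * d powr (1 + 2*\<sigma>)"
      by (intro mult_left_mono powr_mono2) (use d[OF True y] s in auto)
     finally have "ennreal ((g y - g x)\<^sup>2) \<le> ennreal (d powr (1 + 2*\<sigma>)) * ennreal ((FK \<sigma> g (x,y))\<^sup>2)"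
      by (simp add: mult.commute ennreal_leI flip: ennreal_mult)
     moreover have "x \<in> J" "y \<in> J" using True P Q[of x] y by blast+
     ultimately show ?thesis using y by (simp add: indicator_def)
    qed simp
   qed
   also have "... = ennreal (d powr (1 + 2*\<sigma>)) * (\<integral>\<^sup>+y. ennreal ((FK \<sigma> g (x,y))\<^sup>2) * indicator JJ (x,y) \<partial>lborel)"
    by (rule nn_integral_cmult) (rule measurable_compose[OF measurable_Pair1' FKm], simp)
   finally show ?thesis using True by simp
  qed simp
 qed
 also have "... = ennreal (d powr (1 + 2*\<sigma>)) * (\<integral>\<^sup>+x. \<integral>\<^sup>+y. ennreal ((FK \<sigma> g (x,y))\<^sup>2) * indicator JJ (x,y) \<partial>lborel \<partial>lborel)"
  by (rule nn_integral_cmult) (use lborel.borel_measurable_nn_integral_fst[OF FKm] in simp)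
 also have "(\<integral>\<^sup>+x. \<integral>\<^sup>+y. ennreal ((FK \<sigma> g (x,y))\<^sup>2) * indicator JJ (x,y) \<partial>lborel \<partial>lborel) = nsq JJ (FK \<sigma> g)"
  unfolding nsq_def using lborel.nn_integral_fst[OF FKm] by (simp add: lborel_prod)
 finally show ?thesis .
qed

text \<open>Cauchy-Schwarz in each of the two intervals bounds the squared difference of the means
  by the mean squared increment, to which \<open>iterated_diff_le_FK\<close> applies.\<close>

lemma average_diff_le_FK:
 assumes g: "g \<in> BM" "set_integrable lborel J g"
  and ab: "a < b" "{a..b} \<subseteq> J" and ab': "a' < b'" "{a'..b'} \<subseteq> J"
  and d: "\<And>x y. x \<in> {a..b} ==> y \<in> {a'..b'} ==> \<bar>x - y\<bar> \<le> d" and s: "0 < \<sigma>"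
 shows "ennreal (((LINT x:{a..b}|lborel. g x) / (b - a) - (LINT x:{a'..b'}|lborel. g x) / (b' - a'))\<^sup>2)
  \<le> ennreal (d powr (1 + 2*\<sigma>) / ((b - a) * (b' - a'))) * nsq JJ (FK \<sigma> g)"
proof -
 have i: "set_integrable lborel {a..b} g" "set_integrable lborel {a'..b'} g"
  by (rule set_integrable_subset[OF g(2)]; use ab ab' in simp)+
 define A where "A = (LINT x:{a'..b'}|lborel. g x) / (b' - a')"
 have "ennreal (((LINT x:{a..b}|lborel. g x) / (b - a) - A)\<^sup>2) \<le> ennreal (1 / (b - a)) * nsq {a..b} (%x. g x - A)"
  by (rule average_sq_le[OF g(1) i(1) ab(1)])
 also have "nsq {a..b} (%x. g x - A) \<le> (\<integral>\<^sup>+x. ennreal (1 / (b' - a')) * (nsq {a'..b'} (%y. g y - g x) * indicator {a..b} x) \<partial>lborel)"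
  unfolding nsq_def[of "{a..b}"]
 proof (rule nn_integral_mono)
  fix x
  show "ennreal ((g x - A)\<^sup>2) * indicator {a..b} x \<le> ennreal (1 / (b' - a')) * (nsq {a'..b'} (%y. g y - g x) * indicator {a..b} x)"
   using average_sq_le[OF g(1) i(2) ab'(1), of "g x"] unfolding A_def by (auto simp: power2_commute indicator_def)
 qed
 also have "... = ennreal (1 / (b' - a')) * (\<integral>\<^sup>+x. nsq {a'..b'} (%y. g y - g x) * indicator {a..b} x \<partial>lborel)"
 proof (rule nn_integral_cmult)
  have "(%z. ennreal ((g (snd z) - g (fst z))\<^sup>2) * indicator {a'..b'} (snd z)) \<in> borel_measurable (lborel \<Otimes>\<^sub>M lborel)"
   using g(1) by measurable
  from lborel.borel_measurable_nn_integral_fst[OF this]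
  show "(%x. nsq {a'..b'} (%y. g y - g x) * indicator {a..b} x) \<in> borel_measurable lborel" unfolding nsq_def by simp
 qed
 also have "(\<integral>\<^sup>+x. nsq {a'..b'} (%y. g y - g x) * indicator {a..b} x \<partial>lborel) \<le> ennreal (d powr (1 + 2*\<sigma>)) * nsq JJ (FK \<sigma> g)"
  by (rule iterated_diff_le_FK[OF g(1) ab'(2) ab(2) d s])
 finally have "ennreal (((LINT x:{a..b}|lborel. g x) / (b - a) - A)\<^sup>2) \<le>
   ennreal (1 / (b - a)) * (ennreal (1 / (b' - a')) * (ennreal (d powr (1 + 2*\<sigma>)) * nsq JJ (FK \<sigma> g)))"
  by (simp add: mult_left_mono)
 also have "... = ennreal (d powr (1 + 2*\<sigma>) / ((b - a) * (b' - a'))) * nsq JJ (FK \<sigma> g)"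
  using ab ab' by (simp add: mult.assoc[symmetric] field_simps flip: ennreal_mult)
 finally show ?thesis unfolding A_def .
qed

lemma continuous_on_set_integral:
 assumes k: "set_integrable lborel J (k :: real => real)"
 shows "continuous_on J (%x. LINT y:{0..x}|lborel. k y)"
proof -
 have "integral {0..x} k = (LINT y:{0..x}|lborel. k y)" if "x \<in> J" for x
  by (rule set_borel_integral_eq_integral(2)[symmetric], rule set_integrable_subset[OF k]) (use that in auto)
 moreover have "continuous_on J (%x. integral {0..x} k)"
  by (rule indefinite_integral_continuous_1) (rule set_borel_integral_eq_integral(1)[OF k])
 ultimately show ?thesis by (metis (no_types, lifting) continuous_on_cong)
qed

lemma set_integral_split:
 assumes k: "set_integrable lborel J (k :: real => real)" and x: "0 \<le> x" "x \<le> y" "y \<le> 1/2"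
 shows "(LINT z:{x..y}|lborel. k z) = (LINT z:{0..y}|lborel. k z) - (LINT z:{0..x}|lborel. k z)"
proof -
 have i: "set_integrable lborel A k" if "A \<subseteq> J" "A \<in> sets borel" for A
  by (rule set_integrable_subset[OF k]) (use that in auto)
 have e: "(LINT z:A|lborel. k z) = integral A k" if "A \<subseteq> J" "A \<in> sets borel" for A
  by (rule set_borel_integral_eq_integral(2)[OF i[OF that]])
 have "integral {0..x} k + integral {x..y} k = integral {0..y} k"
  by (rule Henstock_Kurzweil_Integration.integral_combine) (use x in \<open>auto intro!: set_borel_integral_eq_integral(1) i\<close>)
 then show ?thesis using e[of "{0..x}"] e[of "{x..y}"] e[of "{0..y}"] x by auto
qed

lemma nsq_eq_0_imp_AE:
 assumes "f \<in> BM" "S \<in> sets borel" "nsq S f = 0"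
 shows "AE x in lborel. x \<in> S \<longrightarrow> f x = 0"
proof -
 have "AE x in lborel. ennreal ((f x)\<^sup>2) * indicator S x = 0"
  using assms unfolding nsq_def by (subst (asm) nn_integral_0_iff_AE) auto
 then show ?thesis by eventually_elim (auto simp: indicator_def split: if_splits)
qed

text \<open>Campanato's argument: means of \<open>g\<close> over dyadically shrinking windows around
  \<open>x\<close> change by geometrically decreasing amounts from one scale to the next, so they
  converge uniformly to a continuous function. It agrees with \<open>g\<close> almost everywhere
  because the means also converge to \<open>g\<close> in L2.\<close>

lemma Morrey_embedding:
 assumes s: "1/2 < \<sigma>" "\<sigma> < 1"
 shows "\<exists>C\<ge>0. \<forall>g. g \<in> BM \<and> nsq J g < \<infinity> \<and> nsq JJ (FK \<sigma> g) < \<infinity> \<longrightarrow>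
   (\<exists>g'. continuous_on J g' \<and> (AE x in lborel. x \<in> J \<longrightarrow> g x = g' x) \<and>
    (\<forall>x\<in>J. ennreal ((g' x)\<^sup>2) \<le> ennreal C * (nsq J g + nsq JJ (FK \<sigma> g))))"
proof -
 \<comment> \<open>Each halving of the window gains a factor \<open>r\<close>, because the change of
   the mean scales like \<open>h k powr (\<sigma> - 1/2)\<close>; that \<open>r < 1\<close> is the
   condition \<open>\<sigma> > 1/2\<close>.\<close>
 define r where "r = (1/2::real) powr (\<sigma> - 1/2)"
 have r: "0 < r" "r < 1" unfolding r_def using powr01_less_one[of "1/2" "\<sigma> - 1/2"] s by simp_all
 \<comment> \<open>\<open>C0 * sqrt S\<close> is the sum of the bounds \<open>M k\<close> introduced
   further on. In \<open>C\<close>, the 4 pays for the mean over all of \<open>J\<close> and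
   \<open>2 * C0\<^sup>2\<close> for the series.\<close>
 define C0 where "C0 = 2 powr (1 + \<sigma>) * (r / (1 - r))"
 have C0: "C0 \<ge> 0" unfolding C0_def using r by simp
 define C where "C = 2 * C0\<^sup>2 + 4"
 define hf :: real where "hf = 1/2"
 have hf: "hf > 0" "hf = 1/2" unfolding hf_def by simp_all
 have emJ: "emeasure lborel J = ennreal hf" unfolding hf(2) by simp
 show ?thesis
 proof (intro exI[of _ C] conjI allI impI)
  show "0 \<le> C" unfolding C_def by simp
  fix g :: "real => real" assume "g \<in> BM \<and> nsq J g < \<infinity> \<and> nsq JJ (FK \<sigma> g) < \<infinity>"
  then have g: "g \<in> BM" "nsq J g < \<infinity>" "nsq JJ (FK \<sigma> g) < \<infinity>" by auto
  note gi = set_integrable_nsq_J[OF g(1,2)]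
  obtain S where S: "0 \<le> S" "nsq JJ (FK \<sigma> g) = ennreal S" using g(3) by (cases "nsq JJ (FK \<sigma> g)") auto
  obtain N where N: "0 \<le> N" "nsq J g = ennreal N" using g(2) by (cases "nsq J g") auto
  define h where "h = (%k::nat. (1/2::real)^Suc k)"
  have h: "0 < h k" "h k \<le> 1/2" "h (Suc k) = h k / 2" for k
   unfolding h_def by (auto simp: power_le_one)
  \<comment> \<open>The left end of the window of length \<open>h k\<close> slides from 0 to
    \<open>1/2 - h k\<close> as \<open>x\<close> runs through \<open>J\<close>: the window depends
    continuously on \<open>x\<close>, contains \<open>x\<close> and never leaves \<open>J\<close>.
    For \<open>k = 0\<close> it is \<open>J\<close> itself.\<close>
  define L where "L = (%k (x::real). x * (1 - 2 * h k))"
  have L: "0 \<le> L k x" "L k x + h k \<le> 1/2" "L k x \<le> x" "x \<le> L k x + h k" if "x \<in> J" for k x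
  proof -
   have x: "0 \<le> x" "x \<le> 1/2" using that by auto
   have p1: "0 \<le> x * h k" "x * h k \<le> 1/2 * h k" using h[of k] x by (auto intro: mult_right_mono)
   have p2: "x * (2 * h k) \<le> x * 1" using h[of k] x by (intro mult_left_mono) auto
   have p3: "(1/2 - x) * (1 - 2 * h k) \<ge> 0" using h[of k] x by (intro mult_nonneg_nonneg) auto
   show "0 \<le> L k x" "L k x \<le> x" "x \<le> L k x + h k" using p1 p2 unfolding L_def by (simp_all add: algebra_simps)
   show "L k x + h k \<le> 1/2" using p3 unfolding L_def by (simp add: algebra_simps)
  qed
  define A where "A = (%k x. (LINT y:{L k x..L k x + h k}|lborel. g y) / h k)"
  define \<Gamma> where "\<Gamma> = (%x. LINT y:{0..x}|lborel. g y)"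
  have \<Gamma>: "continuous_on J \<Gamma>" unfolding \<Gamma>_def by (rule continuous_on_set_integral[OF gi])
  have Aeq: "A k x = (\<Gamma> (L k x + h k) - \<Gamma> (L k x)) / h k" if "x \<in> J" for k x
   unfolding A_def \<Gamma>_def by (subst set_integral_split[OF gi]) (use L[OF that, of k] h[of k] in auto)
  have Ac: "continuous_on J (A k)" for k
  proof -
   have "continuous_on J (%x. (\<Gamma> (L k x + h k) - \<Gamma> (L k x)) / h k)"
   proof (intro continuous_intros)
    have Lc: "continuous_on J (L k)" "continuous_on J (%x. L k x + h k)"
     unfolding L_def by (intro continuous_intros)+
    show "continuous_on J (%x. \<Gamma> (L k x + h k))"
     by (rule continuous_on_compose2[OF \<Gamma> Lc(2)]) (use L(1,2)[of _ k] h[of k] in force)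
    show "continuous_on J (%x. \<Gamma> (L k x))"
     by (rule continuous_on_compose2[OF \<Gamma> Lc(1)]) (use L(1,2)[of _ k] h[of k] in force)
   qed (use h[of k] in auto)
   then show ?thesis using Aeq by (subst continuous_on_cong[OF refl Aeq]) auto
  qed
  \<comment> \<open>Consecutive windows both contain \<open>x\<close>, so their points are within
    \<open>2 * h k\<close> of each other; \<open>average_diff_le_FK\<close> with this distance gives
    exactly the square of \<open>M k\<close>.\<close>
  define M where "M = (%k. 2 powr (1 + \<sigma>) * sqrt S * r ^ Suc k)"
  have step: "\<bar>A (Suc k) x - A k x\<bar> \<le> M k" if x: "x \<in> J" for k x
  proof -
   have "ennreal ((A k x - A (Suc k) x)\<^sup>2) \<le> ennreal ((2 * h k) powr (1 + 2*\<sigma>) / (h k * h (Suc k))) * nsq JJ (FK \<sigma> g)"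
   proof -
    have "ennreal (((LINT y:{L k x..L k x + h k}|lborel. g y) / (L k x + h k - L k x) - (LINT y:{L (Suc k) x..L (Suc k) x + h (Suc k)}|lborel. g y) / (L (Suc k) x + h (Suc k) - L (Suc k) x))\<^sup>2)
     \<le> ennreal ((2 * h k) powr (1 + 2*\<sigma>) / ((L k x + h k - L k x) * (L (Suc k) x + h (Suc k) - L (Suc k) x))) * nsq JJ (FK \<sigma> g)"
    proof (rule average_diff_le_FK[OF g(1) gi])
     show "{L k x..L k x + h k} \<subseteq> J" "{L (Suc k) x..L (Suc k) x + h (Suc k)} \<subseteq> J"
      using L[OF x, of k] L[OF x, of "Suc k"] by auto
     show "\<bar>\<xi> - \<zeta>\<bar> \<le> 2 * h k" if "\<xi> \<in> {L k x..L k x + h k}" "\<zeta> \<in> {L (Suc k) x..L (Suc k) x + h (Suc k)}" for \<xi> \<zeta>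
      using that L[OF x, of k] L[OF x, of "Suc k"] h[of k] unfolding abs_le_iff by auto
    qed (use h[of k] h[of "Suc k"] s in auto)
    then show ?thesis unfolding A_def by simp
   qed
   also have "... = ennreal ((2 * h k) powr (1 + 2*\<sigma>) / (h k * h (Suc k)) * S)"
    unfolding S using h[of k] h[of "Suc k"] S(1) by (simp flip: ennreal_mult)
   finally have "(A k x - A (Suc k) x)\<^sup>2 \<le> (2 * h k) powr (1 + 2*\<sigma>) / (h k * h (Suc k)) * S"
    by (subst (asm) ennreal_le_iff) (use h(1)[of k] h(1)[of "Suc k"] S(1) in auto)
   also have "... = (M k)\<^sup>2"
   proof -
    have rh: "r ^ Suc k = h k powr (\<sigma> - 1/2)"
     unfolding r_def h_def by (simp add: powr_powr powr_realpow[symmetric] mult.commute del: power_Suc)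
    have "(r ^ Suc k)\<^sup>2 = h k powr (2*\<sigma> - 1)" unfolding rh by (simp add: power2_eq_square flip: powr_add)
    also have "... = h k powr (1 + 2*\<sigma>) / (h k * h k)"
    proof -
     have "h k powr (2*\<sigma> - 1) = h k powr ((1 + 2*\<sigma>) - 2)" by simp
     also have "... = h k powr (1 + 2*\<sigma>) / h k powr 2" by (rule powr_diff)
     also have "h k powr 2 = h k * h k" using h[of k] by (simp add: powr_numeral power2_eq_square)
     finally show ?thesis .
    qed
    finally have q: "(r ^ Suc k)\<^sup>2 = h k powr (1 + 2*\<sigma>) / (h k * h k)" .
    have "(2 powr (1 + \<sigma>))\<^sup>2 = 2 powr (2 + 2*\<sigma>)" by (simp add: power2_eq_square flip: powr_add)
    also have "... = 2 * 2 powr (1 + 2*\<sigma>)"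
     using powr_add[of 2 1 "1 + 2*\<sigma>"] by simp
    finally have q2: "(2 powr (1 + \<sigma>))\<^sup>2 = 2 * 2 powr (1 + 2*\<sigma>)" .
    have "(M k)\<^sup>2 = (2 powr (1 + \<sigma>))\<^sup>2 * S * (r ^ Suc k)\<^sup>2"
     unfolding M_def using S(1) by (simp only: power_mult_distrib real_sqrt_pow2)
    also have "... = 2 * 2 powr (1 + 2*\<sigma>) * S * (h k powr (1 + 2*\<sigma>) / (h k * h k))" unfolding q q2 by simp
    also have "... = (2 * h k) powr (1 + 2*\<sigma>) / (h k * h (Suc k)) * S"
     using h(1)[of k] by (simp add: powr_mult h(3))
    finally show ?thesis by simp
   qed
   finally have "\<bar>A k x - A (Suc k) x\<bar> \<le> \<bar>M k\<bar>" by (simp add: abs_le_square_iff)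
   moreover have "M k \<ge> 0" unfolding M_def using r S(1) by simp
   ultimately show ?thesis by (simp add: abs_minus_commute)
  qed
  have sumM: "M sums (C0 * sqrt S)"
  proof -
   have "(%k. 2 powr (1 + \<sigma>) * sqrt S * r * r ^ k) sums (2 powr (1 + \<sigma>) * sqrt S * r * (1 / (1 - r)))"
    by (intro sums_mult geometric_sums) (use r in auto)
   then show ?thesis unfolding M_def C0_def by (simp add: ac_simps)
  qed
  define D where "D = (%k x. A (Suc k) x - A k x)"
  define g' where "g' = (%x. A 0 x + (\<Sum>k. D k x))"
  have tele: "(\<Sum>k<n. D k x) = A n x - A 0 x" for n x unfolding D_def by (rule sum_lessThan_telescope)
  have "uniform_limit J (%n x. \<Sum>k<n. D k x) (%x. \<Sum>k. D k x) sequentially"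
   by (rule Weierstrass_m_test[where M=M]) (use step sumM in \<open>auto simp: D_def sums_iff\<close>)
  then have "uniform_limit J (%n x. A n x - A 0 x) (%x. \<Sum>k. D k x) sequentially" unfolding tele .
  then have "uniform_limit J (%n x. A 0 x + (A n x - A 0 x)) (%x. A 0 x + (\<Sum>k. D k x)) sequentially"
   by (intro uniform_limit_add uniform_limit_const)
  then have ul: "uniform_limit J A g' sequentially" unfolding g'_def by simp
  have g'c: "continuous_on J g'"
   by (rule uniform_limit_theorem[OF _ ul]) (auto intro: Ac always_eventually)
  have g'bound: "ennreal ((g' x)\<^sup>2) \<le> ennreal C * (nsq J g + nsq JJ (FK \<sigma> g))" if x: "x \<in> J" for x
  proof -
   have "\<bar>\<Sum>k. D k x\<bar> \<le> C0 * sqrt S"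
   proof -
    have sD: "summable (%k. \<bar>D k x\<bar>)"
     by (rule summable_comparison_test[of _ M]) (use step[OF x] sumM in \<open>auto simp: D_def sums_iff\<close>)
    have "\<bar>\<Sum>k. D k x\<bar> \<le> (\<Sum>k. \<bar>D k x\<bar>)" by (rule summable_rabs[OF sD])
    also have "... \<le> (\<Sum>k. M k)" by (intro suminf_le) (use step[OF x] sumM sD in \<open>auto simp: D_def sums_iff\<close>)
    finally show ?thesis using sumM by (simp add: sums_iff)
   qed
   moreover have "(A 0 x)\<^sup>2 \<le> 2 * N"
   proof -
    have "A 0 x = 2 * (LINT y:J|lborel. g y)" unfolding A_def L_def h_def by simp
    then have "ennreal ((A 0 x)\<^sup>2) = 4 * ennreal ((LINT y:J|lborel. g y)\<^sup>2)" by (simp add: power_mult_distrib ennreal_mult)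
    also have "... \<le> 4 * (emeasure lborel J * nsq J g)" by (intro mult_left_mono nsq_integral_sq_le) (use g in auto)
    also have "emeasure lborel J = ennreal hf" by (rule emJ)
    also have "4 * (ennreal hf * nsq J g) = ennreal (4 * (hf * N))" unfolding N using N(1) hf(1)
     by (simp flip: ennreal_mult ennreal_numeral)
    also have "4 * (hf * N) = 2 * N" using hf(2) by simp
    finally show ?thesis using N(1) by (simp add: ennreal_le_iff)
   qed
   ultimately have "(g' x)\<^sup>2 \<le> 2 * (2 * N) + 2 * (C0\<^sup>2 * S)"
   proof -
    have "(\<Sum>k. D k x)\<^sup>2 \<le> (C0 * sqrt S)\<^sup>2" using \<open>\<bar>\<Sum>k. D k x\<bar> \<le> C0 * sqrt S\<close> by (metis abs_ge_zero power2_abs power_mono)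
    also have "... = C0\<^sup>2 * S" using S(1) by (simp add: power_mult_distrib)
    finally have 1: "(\<Sum>k. D k x)\<^sup>2 \<le> C0\<^sup>2 * S" .
    have "(g' x)\<^sup>2 \<le> 2 * (A 0 x)\<^sup>2 + 2 * (\<Sum>k. D k x)\<^sup>2"
     unfolding g'_def using sum_squares_bound[of "A 0 x" "\<Sum>k. D k x"] by (simp add: power2_sum)
    then show ?thesis using 1 \<open>(A 0 x)\<^sup>2 \<le> 2 * N\<close> by linarith
   qed
   also have "... \<le> C * (N + S)" unfolding C_def using N(1) S(1) by (simp add: algebra_simps)
   finally show ?thesis unfolding N S using N(1) S(1) \<open>0 \<le> C\<close>
    by (simp add: ennreal_leI flip: ennreal_mult ennreal_plus)
  qed
  have ae: "AE x in lborel. x \<in> J \<longrightarrow> g x = g' x"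
  proof -
   define cl where "cl = (%x::real. max 0 (min (1/2) x))"
   have cl: "x \<in> J ==> cl x = x" "cl x \<in> J" for x unfolding cl_def by (auto simp: max_def min_def)
   have ccl: "continuous_on UNIV cl" unfolding cl_def by (intro continuous_intros)
   have cm: "(%x. F (cl x)) \<in> BM" if "continuous_on J F" for F :: "real => real"
    by (intro borel_measurable_continuous_onI continuous_on_compose2[OF that ccl]) (use cl(2) in blast)
   have [measurable]: "(%x. A k (cl x)) \<in> BM" "(%x. g' (cl x)) \<in> BM"
    "g \<in> BM" for k
    using cm[OF Ac] cm[OF g'c] g(1) by auto
   have 1: "(%k. nsq J (%x. A k (cl x) - g' (cl x))) \<longlonglongrightarrow> 0"
   proof (rule tendsto_0_ennreal_approx)
    fix e :: real assume e: "e > 0"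
    then have "\<forall>\<^sub>F n in sequentially. \<forall>x\<in>J. dist (A n x) (g' x) < sqrt e" using ul by (intro uniform_limitD) auto
    then obtain n0 where n0: "\<And>n x. n \<ge> n0 ==> x \<in> J ==> \<bar>A n x - g' x\<bar> < sqrt e"
     unfolding eventually_sequentially dist_real_def by blast
    define u :: "nat => ennreal" where "u = (%n. if n < n0 then \<infinity> else 0)"
    have "u \<longlonglongrightarrow> 0" by (rule tendsto_eventually) (auto simp: u_def eventually_sequentially intro!: exI[of _ n0])
    moreover have "nsq J (%x. A n (cl x) - g' (cl x)) \<le> ennreal e + u n" for n
    proof (cases "n < n0")
     case False
     have "nsq J (%x. A n (cl x) - g' (cl x)) \<le> nsq J (%x. sqrt e)"
      by (rule nsq_mono) (use n0[of n] False cl e in \<open>force simp: abs_of_pos\<close>)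
     also have "... = ennreal (e * hf)" using e hf(1) by (simp add: nsq_const emJ flip: ennreal_mult)
     also have "... \<le> ennreal e" using e hf(2) by (intro ennreal_leI) simp
     finally show ?thesis using False by (simp add: u_def)
    qed (simp add: u_def)
    ultimately show "\<exists>u. u \<longlonglongrightarrow> 0 \<and> (\<forall>n. nsq J (%x. A n (cl x) - g' (cl x)) \<le> ennreal e + u n)" by blast
   qed
   have 2: "(%k. nsq J (%x. g x - A k (cl x))) \<longlonglongrightarrow> 0"
   proof (rule tendsto_0_ennreal_le)
    show "nsq J (%x. g x - A k (cl x)) \<le> ennreal (h k powr (2*\<sigma>) * S)" for k
    proof -
     have "nsq J (%x. g x - A k (cl x)) \<le> (\<integral>\<^sup>+x. ennreal (1 / h k) * (nsq {L k x..L k x + h k} (%y. g y - g x) * indicator J x) \<partial>lborel)"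
      unfolding nsq_def[of J]
     proof (rule nn_integral_mono)
      fix x
      show "ennreal ((g x - A k (cl x))\<^sup>2) * indicator J x \<le> ennreal (1 / h k) * (nsq {L k x..L k x + h k} (%y. g y - g x) * indicator J x)"
      proof (cases "x \<in> J")
       case True
       have i: "set_integrable lborel {L k x..L k x + h k} g"
        by (rule set_integrable_subset[OF gi]) (use L[OF True, of k] in auto)
       show ?thesis using average_sq_le[OF g(1) i, of "g x"] h[of k] cl(1)[OF True] True
        by (simp add: A_def power2_commute)
      qed simp
     qed
     also have "... = ennreal (1 / h k) * (\<integral>\<^sup>+x. nsq {L k x..L k x + h k} (%y. g y - g x) * indicator J x \<partial>lborel)"
     proof (rule nn_integral_cmult)
      have "{z::real\<times>real. L k (fst z) \<le> snd z \<and> snd z \<le> L k (fst z) + h k} \<in> sets borel"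
       unfolding L_def by (intro borel_closed closed_Collect_conj closed_Collect_le continuous_intros)
      then have "(%z::real\<times>real. indicator {z. L k (fst z) \<le> snd z \<and> snd z \<le> L k (fst z) + h k} z :: ennreal) \<in> borel_measurable (lborel \<Otimes>\<^sub>M lborel)"
       unfolding lborel_prod by simp
      moreover have "(%z. ennreal ((g (snd z) - g (fst z))\<^sup>2)) \<in> borel_measurable (lborel \<Otimes>\<^sub>M lborel)" by measurable
      ultimately have "(%z. ennreal ((g (snd z) - g (fst z))\<^sup>2) * indicator {z. L k (fst z) \<le> snd z \<and> snd z \<le> L k (fst z) + h k} z) \<in> borel_measurable (lborel \<Otimes>\<^sub>M lborel)"
       by measurable
      from lborel.borel_measurable_nn_integral_fst[OF this]
      show "(%x. nsq {L k x..L k x + h k} (%y. g y - g x) * indicator J x) \<in> borel_measurable lborel"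
       unfolding nsq_def by (simp add: indicator_def)
     qed
     also have "... \<le> ennreal (1 / h k) * (ennreal (h k powr (1 + 2*\<sigma>)) * nsq JJ (FK \<sigma> g))"
     proof (intro mult_left_mono iterated_diff_le_FK)
      show "{L k x..L k x + h k} \<subseteq> J" if "x \<in> J" for x using L[OF that, of k] by auto
      show "\<bar>x - y\<bar> \<le> h k" if "x \<in> J" "y \<in> {L k x..L k x + h k}" for x y
       using L[OF that(1), of k] that(2) unfolding abs_le_iff by auto
     qed (use s g in auto)
     also have "... = ennreal (1 / h k * (h k powr (1 + 2*\<sigma>) * S))"
      unfolding S using h[of k] S(1) by (simp flip: ennreal_mult)
     also have "1 / h k * (h k powr (1 + 2*\<sigma>) * S) = h k powr (2*\<sigma>) * S" using h[of k] by (simp add: powr_add)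
     finally show ?thesis .
    qed
    have "h \<longlonglongrightarrow> 0" unfolding h_def by (rule LIMSEQ_Suc, rule LIMSEQ_power_zero) simp
    then have "(%k. h k powr (2*\<sigma>) * S) \<longlonglongrightarrow> 0 powr (2*\<sigma>) * S"
     by (intro tendsto_intros tendsto_powr') (use h(1) s in \<open>auto intro!: always_eventually less_imp_le\<close>)
    then show "(%k. ennreal (h k powr (2*\<sigma>) * S)) \<longlonglongrightarrow> 0"
     using tendsto_ennrealI by fastforce
   qed
   have "(%k. nsq J (%x. (g x - A k (cl x)) + (A k (cl x) - g' (cl x)))) \<longlonglongrightarrow> 0"
    by (intro nsq_add_tendsto_0 1 2) auto
   then have "nsq J (%x. g x - g' (cl x)) = 0" by (simp add: LIMSEQ_const_iff)
   then have "AE x in lborel. x \<in> J \<longrightarrow> g x - g' (cl x) = 0" by (intro nsq_eq_0_imp_AE) auto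
   then show ?thesis by eventually_elim (auto simp: cl)
  qed
  show "\<exists>g'. continuous_on J g' \<and> (AE x in lborel. x \<in> J \<longrightarrow> g x = g' x) \<and>
    (\<forall>x\<in>J. ennreal ((g' x)\<^sup>2) \<le> ennreal C * (nsq J g + nsq JJ (FK \<sigma> g)))"
   using g'c ae g'bound by blast
 qed
qed

subsection \<open>Sobolev functions as chains of integrals\<close>

text \<open>The retraction of the line onto \<open>J\<close>. Composing with it extends a function
  by its boundary values, which keeps continuity and makes continuous functions given on
  \<open>J\<close> Borel on the line.\<close>

definition clmp :: "real => real" where "clmp x = max 0 (min (1/2) x)"

lemma clmp_J [simp]: "x \<in> J ==> clmp x = x" and clmp_mem: "clmp x \<in> J"
 unfolding clmp_def by (auto simp: max_def min_def)

lemma clmp_continuous: "continuous_on S clmp"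
 unfolding clmp_def by (intro continuous_intros)

lemma clmp_clmp [simp]: "clmp (clmp x) = clmp x"
 using clmp_mem by (intro clmp_J)

lemma continuous_on_clmp:
 assumes "continuous_on J F" shows "continuous_on UNIV (%x. F (clmp x))"
 by (rule continuous_on_compose2[OF assms clmp_continuous]) (use clmp_mem in blast)

lemma continuous_AE_eq:
 fixes f g :: "real => real"
 assumes "continuous_on J f" "continuous_on J g" "AE x in lborel. x \<in> J \<longrightarrow> f x = g x" "x \<in> J"
 shows "f x = g x"
proof -
 have "f x - g x = 0"
 proof (rule continuous_test_zero[OF _ _ assms(4)])
  show "continuous_on J (%x. f x - g x)" by (intro continuous_intros assms)
  fix \<psi> assume "test_fun 0 (1/2) \<psi>"
  have "AE x in lborel. indicator {0<..<1/2} x *\<^sub>R ((f x - g x) * \<psi> x) = 0"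
   using assms(3) by eventually_elim (auto simp: indicator_def)
  then show "(LINT x:{0<..<1/2}|lborel. (f x - g x) * \<psi> x) = 0"
   unfolding set_lebesgue_integral_def by (rule integral_eq_zero_AE)
 qed
 then show ?thesis by simp
qed

lemma set_integral_sq_eq_nsq:
 assumes "f \<in> BM" "S \<in> sets borel" "nsq S f < \<infinity>"
 shows "ennreal (LINT x:S|lborel. (f x)\<^sup>2) = nsq S f" "0 \<le> (LINT x:S|lborel. (f x)\<^sup>2)"
proof -
 have i: "integrable lborel (%x. indicator S x *\<^sub>R (f x)\<^sup>2)"
  using nsq_finite_imp_set_integrable_sq[OF assms] by (simp add: set_integrable_def)
 have "(\<integral>\<^sup>+x. ennreal (indicator S x *\<^sub>R (f x)\<^sup>2) \<partial>lborel) = ennreal (LINT x:S|lborel. (f x)\<^sup>2)"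
  unfolding set_lebesgue_integral_def by (rule nn_integral_eq_integral[OF i]) auto
 moreover have "(\<integral>\<^sup>+x. ennreal (indicator S x *\<^sub>R (f x)\<^sup>2) \<partial>lborel) = nsq S f"
  unfolding nsq_def by (intro nn_integral_cong) (simp add: indicator_def)
 ultimately show "ennreal (LINT x:S|lborel. (f x)\<^sup>2) = nsq S f" by simp
 show "0 \<le> (LINT x:S|lborel. (f x)\<^sup>2)" unfolding set_lebesgue_integral_def by (rule Bochner_Integration.integral_nonneg) simp
qed

lemma set_integrable_sq_imp_nsq:
 assumes "set_integrable lborel S (%x. (f x)\<^sup>2)"
 shows "ennreal (LINT x:S|lborel. (f x)\<^sup>2) = nsq S f" "nsq S f < \<infinity>"
proof -
 have "(\<integral>\<^sup>+x. ennreal (indicator S x *\<^sub>R (f x)\<^sup>2) \<partial>lborel) = ennreal (LINT x:S|lborel. (f x)\<^sup>2)"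
  unfolding set_lebesgue_integral_def by (rule nn_integral_eq_integral) (use assms in \<open>auto simp: set_integrable_def\<close>)
 moreover have "(\<integral>\<^sup>+x. ennreal (indicator S x *\<^sub>R (f x)\<^sup>2) \<partial>lborel) = nsq S f"
  unfolding nsq_def by (intro nn_integral_cong) (simp add: indicator_def)
 ultimately show "ennreal (LINT x:S|lborel. (f x)\<^sup>2) = nsq S f" by simp
 then show "nsq S f < \<infinity>" by (metis ennreal_less_top infinity_ennreal_def)
qed

text \<open>The working form of a Sobolev function: weak derivatives are replaced by integral
  representations valid at every point of \<open>J\<close>, and the entries are Borel on the whole
  line. The last entry is the only one not pinned down pointwise by another.\<close>

definition chain :: "nat => (nat => real => real) => bool" where
 "chain k hs \<longleftrightarrow> (\<forall>j\<le>k. hs j \<in> BM \<and> nsq J (hs j) < \<infinity>) \<and>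
   (\<forall>j<k. \<forall>x\<in>J. hs j x = hs j 0 + (LINT y:{0..x}|lborel. hs (Suc j) y))"

definition HN :: "real => nat => (nat => real => real) => ennreal" where
 "HN \<sigma> k hs = (\<Sum>j\<le>k. nsq J (hs j)) + (if \<sigma> > 0 then nsq JJ (FK \<sigma> (hs k)) else 0)"

lemma chain_eq: "chain k hs ==> j < k ==> x \<in> J ==> hs j x = hs j 0 + (LINT y:{0..x}|lborel. hs (Suc j) y)"
 unfolding chain_def by blast

lemma chain_measurable: "chain k hs ==> j \<le> k ==> hs j \<in> BM"
 and chain_finite: "chain k hs ==> j \<le> k ==> nsq J (hs j) < \<infinity>"
 unfolding chain_def by blast+

text \<open>The norm is an infimum over representing chains, so any single chain bounds it from
  above.\<close>

lemma chain_imp_Hs: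
 assumes ch: "chain k hs" and s: "0 \<le> \<sigma>" "\<sigma> < 1" and f: "\<And>x. x \<in> {0<..<1/2} ==> f x = hs 0 x"
  and e: "HN \<sigma> k hs \<le> ennreal (e\<^sup>2)" "0 \<le> e"
 shows "f \<in> Hs (real k + \<sigma>) 0 (1/2)" "Hs_norm (real k + \<sigma>) 0 (1/2) f \<le> e"
proof -
 define I where "I = {0<..<1/2::real}"
 have fl: "\<lfloor>real k + \<sigma>\<rfloor> = int k" using s by (simp add: floor_eq_iff)
 have nfl: "nat \<lfloor>real k + \<sigma>\<rfloor> = k" "real k + \<sigma> - of_int \<lfloor>real k + \<sigma>\<rfloor> = \<sigma>" using fl by auto
 \<comment> \<open>\<open>sobolev_rep\<close> asks for \<open>gs 0 = f\<close> on the whole line,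
   while \<open>hs 0\<close> agrees with \<open>f\<close> only on the open interval; hence the
   bottom entry is \<open>f\<close> itself.\<close>
 define gs where "gs = (%j. if j = 0 then f else hs j)"
 have gI: "gs j x = hs j x" if "x \<in> I" for j x using that f unfolding gs_def I_def by auto
 have m: "hs j \<in> BM" "nsq I (hs j) < \<infinity>" if "j \<le> k" for j
  using chain_measurable[OF ch that] chain_finite[OF ch that] unfolding I_def nsq_Ioo_J by simp_all
 have IS: "I \<in> sets borel" unfolding I_def by simp
 have fin: "nsq (I\<times>I) (FK \<sigma> (hs k)) < \<infinity>" if "\<sigma> > 0"
 proof -
  have "nsq JJ (FK \<sigma> (hs k)) \<le> HN \<sigma> k hs" unfolding HN_def using that by simp
  also have "... < \<infinity>" using e(1) by (metis ennreal_less_top infinity_ennreal_def order_le_less_trans)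
  finally show ?thesis unfolding I_def nsq_Ioo_JJ .
 qed
 have II: "I \<times> I \<in> sets (borel :: (real\<times>real) measure)" unfolding I_def by (intro borel_open open_Times) auto
 have sq: "set_integrable lborel I (%x. (gs j x)\<^sup>2)" "(LINT x:I|lborel. (gs j x)\<^sup>2) = (LINT x:I|lborel. (hs j x)\<^sup>2)" if "j \<le> k" for j
 proof -
  have "set_integrable lborel I (%x. (gs j x)\<^sup>2) = set_integrable lborel I (%x. (hs j x)\<^sup>2)"
   by (rule set_integrable_cong) (auto simp: gI)
  then show "set_integrable lborel I (%x. (gs j x)\<^sup>2)" using nsq_finite_imp_set_integrable_sq[OF m(1)[OF that] IS m(2)[OF that]] by simp
  show "(LINT x:I|lborel. (gs j x)\<^sup>2) = (LINT x:I|lborel. (hs j x)\<^sup>2)"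
   by (rule set_lebesgue_integral_cong) (use IS in \<open>auto simp: gI\<close>)
 qed
 have gag: "gagliardo_integrand \<sigma> (gs k) z = (FK \<sigma> (hs k) z)\<^sup>2" if "z \<in> I\<times>I" for z
  using that unfolding FK_sq gagliardo_integrand_def by (auto simp: gI)
 have rep: "sobolev_rep (real k + \<sigma>) 0 (1/2) f gs"
  unfolding sobolev_rep_def nfl
 proof (intro conjI allI impI)
  show "gs 0 = f" by (simp add: gs_def)
  show "L2_on 0 (1/2) (gs j)" if "j \<le> k" for j
  proof -
   have "(%x. indicator I x *\<^sub>R gs j x) = (%x. indicator I x *\<^sub>R hs j x)" by (auto simp: indicator_def gI)
   then have "set_borel_measurable lborel I (gs j)" unfolding set_borel_measurable_def using m(1)[OF that] IS by simp
   then show ?thesis using sq(1)[OF that] unfolding L2_on_def I_def by simp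
  qed
  show "weak_deriv 0 (1/2) (gs j) (gs (Suc j))" if "j < k" for j
  proof -
   have "weak_deriv 0 (1/2) (gs j) (hs (Suc j))"
   proof (rule weak_deriv_integral)
    show "hs (Suc j) \<in> BM" "nsq J (hs (Suc j)) < \<infinity>"
     using chain_measurable[OF ch] chain_finite[OF ch] that by simp_all
    show "gs j x = hs j 0 + (LINT y:{0..x}|lborel. hs (Suc j) y)" if "x \<in> {0<..<1/2}" for x
    proof -
     have "x \<in> J" "x \<in> I" using that unfolding I_def by auto
     then show ?thesis by (metis gI chain_eq[OF ch \<open>j < k\<close>])
    qed
   qed
   then show ?thesis by (simp add: gs_def)
  qed
  show "set_integrable lborel ({0<..<1/2} \<times> {0<..<1/2}) (gagliardo_integrand \<sigma> (gs k))" if "0 < \<sigma>"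
  proof -
   have "set_integrable lborel (I\<times>I) (gagliardo_integrand \<sigma> (gs k)) = set_integrable lborel (I\<times>I) (%z. (FK \<sigma> (hs k) z)\<^sup>2)"
    by (rule set_integrable_cong) (auto simp only: gag)
   then show ?thesis using nsq_finite_imp_set_integrable_sq[OF FK_measurable[OF m(1)[OF order_refl]] II fin[OF that]] unfolding I_def by simp
  qed
 qed
 then show "f \<in> Hs (real k + \<sigma>) 0 (1/2)" unfolding Hs_def by blast
 have "ennreal (sobolev_sq (real k + \<sigma>) 0 (1/2) gs) = HN \<sigma> k hs \<and> 0 \<le> sobolev_sq (real k + \<sigma>) 0 (1/2) gs"
 proof -
  define S1 where "S1 = (\<Sum>j\<le>k. LINT x:I|lborel. (gs j x)\<^sup>2)"
  define S2 where "S2 = (if \<sigma> > 0 then LINT z:I\<times>I|lborel. gagliardo_integrand \<sigma> (gs k) z else 0)"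
  have p: "0 \<le> (LINT x:I|lborel. (gs j x)\<^sup>2)" "ennreal (LINT x:I|lborel. (gs j x)\<^sup>2) = nsq J (hs j)" if "j \<le> k" for j
   unfolding sq(2)[OF that] using set_integral_sq_eq_nsq[OF m(1)[OF that] IS m(2)[OF that]] nsq_Ioo_J unfolding I_def by auto
  have 1: "0 \<le> S1" unfolding S1_def by (intro sum_nonneg) (use p in auto)
  have "ennreal S1 = (\<Sum>j\<le>k. ennreal (LINT x:I|lborel. (gs j x)\<^sup>2))" unfolding S1_def
   by (rule sum_ennreal[symmetric]) (use p in auto)
  also have "... = (\<Sum>j\<le>k. nsq J (hs j))" by (intro sum.cong) (use p in auto)
  finally have e1: "ennreal S1 = (\<Sum>j\<le>k. nsq J (hs j))" .
  have q: "(LINT z:I\<times>I|lborel. gagliardo_integrand \<sigma> (gs k) z) = (LINT z:I\<times>I|lborel. (FK \<sigma> (hs k) z)\<^sup>2)"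
   by (rule set_lebesgue_integral_cong) (use II gag in auto)
  have 2: "0 \<le> S2" "ennreal S2 = (if \<sigma> > 0 then nsq JJ (FK \<sigma> (hs k)) else 0)"
   using set_integral_sq_eq_nsq[OF FK_measurable[OF m(1)[OF order_refl]] II fin] nsq_Ioo_JJ q unfolding S2_def I_def by auto
  have "sobolev_sq (real k + \<sigma>) 0 (1/2) gs = S1 + S2" unfolding sobolev_sq_def nfl S1_def S2_def I_def by simp
  then show ?thesis using 1 2 e1 unfolding HN_def by (simp add: ennreal_plus)
 qed
 then have "sobolev_sq (real k + \<sigma>) 0 (1/2) gs \<le> e\<^sup>2" using e(1) by (metis ennreal_le_iff zero_le_power2)
 then have "sqrt (sobolev_sq (real k + \<sigma>) 0 (1/2) gs) \<le> e" using e(2) real_le_lsqrt by force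
 moreover have "Hs_norm (real k + \<sigma>) 0 (1/2) f \<le> sqrt (sobolev_sq (real k + \<sigma>) 0 (1/2) gs)"
  unfolding Hs_norm_def
 proof (rule cInf_lower)
  show "sqrt (sobolev_sq (real k + \<sigma>) 0 (1/2) gs) \<in> {sqrt (sobolev_sq (real k + \<sigma>) 0 (1/2) gs) |gs. sobolev_rep (real k + \<sigma>) 0 (1/2) f gs}"
   using rep by blast
  have "0 \<le> sobolev_sq (real k + \<sigma>) 0 (1/2) gs'" for gs'
   unfolding sobolev_sq_def set_lebesgue_integral_def
   by (auto intro!: add_nonneg_nonneg sum_nonneg Bochner_Integration.integral_nonneg simp: gagliardo_integrand_def)
  then show "bdd_below {sqrt (sobolev_sq (real k + \<sigma>) 0 (1/2) gs) |gs. sobolev_rep (real k + \<sigma>) 0 (1/2) f gs}"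
   by (intro bdd_belowI[of _ 0]) auto
 qed
 ultimately show "Hs_norm (real k + \<sigma>) 0 (1/2) f \<le> e" by linarith
qed

lemma set_integral_cong_AE_J:
 assumes "f \<in> BM" "g \<in> BM" "AE x in lborel. x \<in> J \<longrightarrow> f x = g x" "y \<in> J"
 shows "(LINT x:{0..y}|lborel. f x) = (LINT x:{0..y}|lborel. (g x :: real))"
proof -
 have "AE x in lborel. indicator {0..y} x *\<^sub>R f x = indicator {0..y} x *\<^sub>R g x"
  using assms(3) by eventually_elim (use assms(4) in \<open>auto simp: indicator_def\<close>)
 then show ?thesis unfolding set_lebesgue_integral_def by (intro integral_cong_AE) (use assms in auto)
qed

lemma nsq_FK_cong_AE:
 assumes "AE x in lborel. x \<in> J \<longrightarrow> f x = g x"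
 shows "nsq JJ (FK \<sigma> f) = nsq JJ (FK \<sigma> g)"
 by (rule nsq_cong_AE, use AE_lborel_fst[OF assms] AE_lborel_snd[OF assms] in eventually_elim) (auto simp: FK_def)

lemma set_integral_singleton: "(LINT x:{a}|lborel. f x) = (0::real)"
proof -
 have "AE x in lborel. indicator {a} x *\<^sub>R f x = 0"
  using AE_lborel_singleton[of a] by eventually_elim auto
 then show ?thesis unfolding set_lebesgue_integral_def by (rule integral_eq_zero_AE)
qed

text \<open>The converse passage. A weak chain with norm below \<open>e\<close> is repaired by du
  Bois-Reymond: each entry but the last is replaced by a primitive of the next one, and the last by
  its continuous version from \<open>Morrey_embedding\<close> when \<open>\<sigma> > 1/2\<close>.
  The condition on \<open>k\<close> and \<open>\<sigma>\<close> guarantees that the bottom entry is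
  continuous, so it coincides with \<open>f\<close> at every point of \<open>J\<close> and not just
  almost everywhere.\<close>

lemma Hs_imp_chain:
 assumes fH: "f \<in> Hs (real k + \<sigma>) 0 (1/2)" and fc: "continuous_on J f" and fe: "Hs_norm (real k + \<sigma>) 0 (1/2) f < e"
  and s: "0 \<le> \<sigma>" "\<sigma> < 1" and ks: "k \<ge> 1 \<or> \<sigma> > 1/2"
 shows "\<exists>hs. chain k hs \<and> (\<forall>x\<in>J. hs 0 x = f x) \<and> HN \<sigma> k hs < ennreal (e\<^sup>2) \<and>
   (\<forall>j<k. continuous_on UNIV (hs j)) \<and> (\<sigma> > 1/2 \<longrightarrow> continuous_on UNIV (hs k))"
proof -
 define I where "I = {0<..<1/2::real}"
 have IS: "I \<in> sets borel" unfolding I_def by simp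
 have fl: "\<lfloor>real k + \<sigma>\<rfloor> = int k" using s by (simp add: floor_eq_iff)
 have nfl: "nat \<lfloor>real k + \<sigma>\<rfloor> = k" "real k + \<sigma> - of_int \<lfloor>real k + \<sigma>\<rfloor> = \<sigma>" using fl by auto
 have ne: "{sqrt (sobolev_sq (real k + \<sigma>) 0 (1/2) gs) |gs. sobolev_rep (real k + \<sigma>) 0 (1/2) f gs} \<noteq> {}"
  using fH unfolding Hs_def by blast
 obtain gs where rep: "sobolev_rep (real k + \<sigma>) 0 (1/2) f gs" and lt: "sqrt (sobolev_sq (real k + \<sigma>) 0 (1/2) gs) < e"
  using cInf_lessD[OF ne fe[unfolded Hs_norm_def]] by auto
 have nn: "0 \<le> sobolev_sq (real k + \<sigma>) 0 (1/2) gs"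
  unfolding sobolev_sq_def set_lebesgue_integral_def
  by (auto intro!: add_nonneg_nonneg sum_nonneg Bochner_Integration.integral_nonneg simp: gagliardo_integrand_def)
 have lt2: "sobolev_sq (real k + \<sigma>) 0 (1/2) gs < e\<^sup>2" using lt nn
  by (smt (verit) real_sqrt_ge_zero real_sqrt_pow2 power_strict_mono pos2)
 \<comment> \<open>Weak chains are measurable on the open interval only; extension by zero makes the
   entries Borel on the line.\<close>
 define g where "g = (%j x. indicator I x *\<^sub>R gs j x)"
 have gI: "g j x = gs j x" if "x \<in> I" for j x using that by (simp add: g_def)
 have L2: "L2_on 0 (1/2) (gs j)" if "j \<le> k" for j using rep that unfolding sobolev_rep_def nfl by blast
 have gm: "g j \<in> BM" if "j \<le> k" for j
  using L2[OF that] unfolding L2_on_def set_borel_measurable_def g_def I_def by simp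
 have gn: "nsq J (g j) < \<infinity>" "ennreal (LINT x:I|lborel. (gs j x)\<^sup>2) = nsq J (g j)" if "j \<le> k" for j
 proof -
  have "set_integrable lborel I (%x. (gs j x)\<^sup>2)" using L2[OF that] unfolding L2_on_def I_def by simp
  from set_integrable_sq_imp_nsq[OF this] have "ennreal (LINT x:I|lborel. (gs j x)\<^sup>2) = nsq I (gs j)" "nsq I (gs j) < \<infinity>" by auto
  moreover have "nsq I (gs j) = nsq J (g j)"
   unfolding nsq_Ioo_J[symmetric] I_def[symmetric] by (rule nsq_cong) (simp add: gI)
  ultimately show "nsq J (g j) < \<infinity>" "ennreal (LINT x:I|lborel. (gs j x)\<^sup>2) = nsq J (g j)" by auto
 qed
 have wd: "weak_deriv 0 (1/2) (g j) (g (Suc j))" if "j < k" for j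
 proof -
  have w: "weak_deriv 0 (1/2) (gs j) (gs (Suc j))" using rep that unfolding sobolev_rep_def nfl by blast
  have "(LINT x:I|lborel. g i x * \<phi> x) = (LINT x:I|lborel. gs i x * \<phi> x)" for i \<phi>
   by (rule set_lebesgue_integral_cong) (use IS in \<open>auto simp: gI\<close>)
  then show ?thesis using w unfolding weak_deriv_def I_def by simp
 qed
 have gag: "nsq JJ (FK \<sigma> (g k)) < \<infinity>" "ennreal (LINT z:I\<times>I|lborel. gagliardo_integrand \<sigma> (gs k) z) = nsq JJ (FK \<sigma> (g k))" if "\<sigma> > 0"
 proof -
  have "set_integrable lborel (I\<times>I) (%z. (FK \<sigma> (gs k) z)\<^sup>2)" using rep that unfolding sobolev_rep_def nfl I_def FK_sq by blast
  from set_integrable_sq_imp_nsq[OF this] have "ennreal (LINT z:I\<times>I|lborel. gagliardo_integrand \<sigma> (gs k) z) = nsq (I\<times>I) (FK \<sigma> (gs k))" "nsq (I\<times>I) (FK \<sigma> (gs k)) < \<infinity>"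
   by (auto simp: FK_sq)
  moreover have "nsq (I\<times>I) (FK \<sigma> (gs k)) = nsq JJ (FK \<sigma> (g k))"
   unfolding nsq_Ioo_JJ[symmetric] I_def[symmetric] by (rule nsq_cong) (auto simp: gI FK_def)
  ultimately show "nsq JJ (FK \<sigma> (g k)) < \<infinity>" "ennreal (LINT z:I\<times>I|lborel. gagliardo_integrand \<sigma> (gs k) z) = nsq JJ (FK \<sigma> (g k))" by auto
 qed
 have HNg: "HN \<sigma> k g < ennreal (e\<^sup>2)"
 proof -
  define S1 where "S1 = (\<Sum>j\<le>k. LINT x:I|lborel. (gs j x)\<^sup>2)"
  define S2 where "S2 = (if \<sigma> > 0 then LINT z:I\<times>I|lborel. gagliardo_integrand \<sigma> (gs k) z else 0)"
  have p: "0 \<le> (LINT x:I|lborel. (gs j x)\<^sup>2)" for j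
   unfolding set_lebesgue_integral_def by (rule Bochner_Integration.integral_nonneg) simp
  have 1: "0 \<le> S1" unfolding S1_def by (intro sum_nonneg p)
  have "ennreal S1 = (\<Sum>j\<le>k. ennreal (LINT x:I|lborel. (gs j x)\<^sup>2))" unfolding S1_def
   by (rule sum_ennreal[symmetric]) (rule p)
  also have "... = (\<Sum>j\<le>k. nsq J (g j))" by (intro sum.cong) (use gn in auto)
  finally have e1: "ennreal S1 = (\<Sum>j\<le>k. nsq J (g j))" .
  have 2: "0 \<le> S2" unfolding S2_def set_lebesgue_integral_def
   by (auto intro!: Bochner_Integration.integral_nonneg simp: gagliardo_integrand_def)
  have e2: "ennreal S2 = (if \<sigma> > 0 then nsq JJ (FK \<sigma> (g k)) else 0)" unfolding S2_def using gag by simp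
  have "sobolev_sq (real k + \<sigma>) 0 (1/2) gs = S1 + S2" unfolding sobolev_sq_def nfl S1_def S2_def I_def by simp
  then have "ennreal (sobolev_sq (real k + \<sigma>) 0 (1/2) gs) = HN \<sigma> k g" using 1 2 e1 e2 unfolding HN_def by (simp add: ennreal_plus)
  then show ?thesis using lt2 nn by (metis ennreal_lessI le_less_trans)
 qed
 have "\<forall>j<k. \<exists>c. AE x in lborel. x \<in> J \<longrightarrow> g j x = c + (LINT y:{0..x}|lborel. g (Suc j) y)"
  using du_Bois_Reymond[OF gm gn(1) gm gn(1) wd] by auto
 then obtain c where c: "\<And>j. j < k ==> AE x in lborel. x \<in> J \<longrightarrow> g j x = c j + (LINT y:{0..x}|lborel. g (Suc j) y)" by metis
 obtain top where top: "top \<in> BM" "AE x in lborel. x \<in> J \<longrightarrow> g k x = top x" "\<sigma> > 1/2 \<longrightarrow> continuous_on UNIV top"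
 proof (cases "\<sigma> > 1/2")
  case True
  obtain g' where g': "continuous_on J g'" "AE x in lborel. x \<in> J \<longrightarrow> g k x = g' x"
   using Morrey_embedding[OF True s(2)] gm[of k] gn(1)[of k] gag True by auto
  show ?thesis
  proof (rule that[of "%x. g' (clmp x)"])
   show "AE x in lborel. x \<in> J \<longrightarrow> g k x = g' (clmp x)" using g'(2) by eventually_elim (metis clmp_J)
   show "(%x. g' (clmp x)) \<in> BM" by (intro borel_measurable_continuous_onI continuous_on_clmp g')
   show "1/2 < \<sigma> \<longrightarrow> continuous_on UNIV (%x. g' (clmp x))" using continuous_on_clmp[OF g'(1)] by blast
  qed
 next
  case False
  then show ?thesis using that[of "g k"] gm by auto
 qed
 define hs where "hs = (%j x. if j < k then c j + (LINT y:{0..clmp x}|lborel. g (Suc j) y) else top x)"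
 have hc: "continuous_on UNIV (hs j)" if "j < k" for j
 proof -
  have "continuous_on UNIV (%x. c j + (LINT y:{0..clmp x}|lborel. g (Suc j) y))"
   by (intro continuous_intros continuous_on_clmp continuous_on_set_integral set_integrable_nsq_J gm gn) (use that in auto)
  then show ?thesis using that unfolding hs_def by simp
 qed
 have hm: "hs j \<in> BM" for j
  by (cases "j < k") (use hc top(1) in \<open>auto intro: borel_measurable_continuous_onI simp: hs_def\<close>)
 have hae: "AE x in lborel. x \<in> J \<longrightarrow> g j x = hs j x" if "j \<le> k" for j
 proof (cases "j < k")
  case True
  then show ?thesis using c[OF True] by (auto elim!: eventually_mono simp: hs_def simp del: atLeastAtMost_iff)
 next
  case False
  then have "j = k" using that by simp
  then show ?thesis using top(2) unfolding hs_def by simp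
 qed
 have hn: "nsq J (hs j) = nsq J (g j)" if "j \<le> k" for j
  using nsq_cong_AE[OF hae[OF that]] by simp
 have "chain k hs" unfolding chain_def
 proof (intro conjI allI impI ballI)
  show "hs j \<in> BM" for j by (rule hm)
  show "nsq J (hs j) < \<infinity>" if "j \<le> k" for j using hn[OF that] gn(1)[OF that] by simp
  fix j x assume j: "j < k" and x: "x \<in> J"
  have "(LINT y:{0..x}|lborel. hs (Suc j) y) = (LINT y:{0..x}|lborel. g (Suc j) y)"
   using set_integral_cong_AE_J[OF gm hm hae x, of "Suc j"] j by simp
  moreover have "clmp 0 = 0" by (simp add: clmp_def)
  ultimately show "hs j x = hs j 0 + (LINT y:{0..x}|lborel. hs (Suc j) y)"
   using j clmp_J[OF x] unfolding hs_def by (simp add: set_integral_singleton)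
 qed
 moreover have "HN \<sigma> k hs < ennreal (e\<^sup>2)"
  using HNg nsq_FK_cong_AE[OF hae[OF order_refl], of \<sigma>] hn unfolding HN_def by (cases "0 < \<sigma>") auto
 moreover have "hs 0 x = f x" if "x \<in> J" for x
 proof (rule continuous_AE_eq[OF _ fc _ that])
  show "continuous_on J (hs 0)"
  proof (cases "k = 0")
   case True
   then have "\<sigma> > 1/2" using ks by simp
   then show ?thesis using top(3) True unfolding hs_def by (auto intro: continuous_on_subset)
  next
   case False then show ?thesis using continuous_on_subset[OF hc[of 0]] by auto
  qed
  have "AE x in lborel. (x::real) \<noteq> 0 \<and> x \<noteq> 1/2" by (intro AE_conjI AE_lborel_singleton)
  moreover have "gs 0 = f" using rep unfolding sobolev_rep_def by blast
  ultimately show "AE x in lborel. x \<in> J \<longrightarrow> hs 0 x = f x"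
   using hae[of 0] by (auto elim!: eventually_elim2 simp: g_def I_def)
 qed
 moreover have "\<sigma> > 1/2 \<longrightarrow> continuous_on UNIV (hs k)" using top(3) unfolding hs_def by simp
 ultimately show ?thesis using hc by blast
qed

subsection \<open>The explicit flow\<close>

text \<open>Cauchy-Schwarz for the integral of \<open>hs 1\<close> between the two points: the
  embedding of H^1 into the Hoelder functions of exponent 1/2.\<close>

lemma chain_holder:
 assumes ch: "chain 1 hs" and N: "nsq J (hs 1) \<le> ennreal N" "0 \<le> N" and x: "x \<in> J" "y \<in> J"
 shows "\<bar>hs 0 x - hs 0 y\<bar> \<le> sqrt N * \<bar>x - y\<bar> powr (1/2)"
proof -
 have m: "hs 1 \<in> BM" "nsq J (hs 1) < \<infinity>" using chain_measurable[OF ch] chain_finite[OF ch] by auto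
 note i = set_integrable_nsq_J[OF m]
 have le: "\<bar>hs 0 y - hs 0 x\<bar> \<le> sqrt N * \<bar>y - x\<bar> powr (1/2)" if "x \<le> y" "x \<in> J" "y \<in> J" for x y
 proof -
  have e: "hs 0 y - hs 0 x = (LINT z:{x..y}|lborel. hs 1 z)"
   using chain_eq[OF ch, of 0 x] chain_eq[OF ch, of 0 y] set_integral_split[OF i, of x y] that by auto
  have "ennreal ((hs 0 y - hs 0 x)\<^sup>2) \<le> emeasure lborel {x..y} * nsq {x..y} (hs 1)"
   unfolding e by (rule nsq_integral_sq_le) (use m in auto)
  also have "... \<le> ennreal (y - x) * ennreal N"
   using that N(1) nsq_subset[of "{x..y}" J "hs 1"] by (intro mult_mono) auto
  also have "... = ennreal ((y - x) * N)" using that N by (simp add: ennreal_mult)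
  finally have "(hs 0 y - hs 0 x)\<^sup>2 \<le> (y - x) * N" using that N by (simp add: ennreal_le_iff)
  then have "\<bar>hs 0 y - hs 0 x\<bar> \<le> sqrt ((y - x) * N)" by (metis real_sqrt_abs real_sqrt_le_mono)
  then show ?thesis using that by (simp add: real_sqrt_mult powr_half_sqrt mult.commute)
 qed
 show ?thesis using le[of x y] le[of y x] x by (cases "x \<le> y") (auto simp: abs_minus_commute)
qed

text \<open>Makes smallness in norm uniform on \<open>J\<close>. For \<open>k = 0\<close> it is the
  bound of \<open>Morrey_embedding\<close>; for \<open>k = 1\<close> the oscillation of
  \<open>hs 0\<close> is at most \<open>sqrt N1\<close>, and averaging over \<open>y\<close> brings
  in the L2 norm of \<open>hs 0\<close>.\<close>

lemma chain_sup_bound: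
 assumes "(k = 0 \<and> 1/2 < \<sigma> \<and> \<sigma> < 1) \<or> k = 1"
 shows "\<exists>C>0. \<forall>hs. chain k hs \<and> (k = 0 \<longrightarrow> continuous_on J (hs 0)) \<longrightarrow> (\<forall>x\<in>J. ennreal ((hs 0 x)\<^sup>2) \<le> ennreal C * HN \<sigma> k hs)"
 using assms
proof
 assume k: "k = 0 \<and> 1/2 < \<sigma> \<and> \<sigma> < 1"
 obtain C where C: "C \<ge> 0" "\<And>g. g \<in> BM ==> nsq J g < \<infinity> ==> nsq JJ (FK \<sigma> g) < \<infinity> ==>
   (\<exists>g'. continuous_on J g' \<and> (AE x in lborel. x \<in> J \<longrightarrow> g x = g' x) \<and>
    (\<forall>x\<in>J. ennreal ((g' x)\<^sup>2) \<le> ennreal C * (nsq J g + nsq JJ (FK \<sigma> g))))"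
  using Morrey_embedding[of \<sigma>] k by blast
 show ?thesis
 proof (intro exI[of _ "C + 1"] conjI allI impI ballI)
  show "0 < C + 1" using C by simp
  fix hs x assume hs: "chain k hs \<and> (k = 0 \<longrightarrow> continuous_on J (hs 0))" and x: "x \<in> J"
  have HN: "HN \<sigma> k hs = nsq J (hs 0) + nsq JJ (FK \<sigma> (hs 0))" using k by (simp add: HN_def)
  have m: "hs 0 \<in> BM" "nsq J (hs 0) < \<infinity>" using hs k chain_measurable[of 0 hs 0] chain_finite[of 0 hs 0] by auto
  show "ennreal ((hs 0 x)\<^sup>2) \<le> ennreal (C + 1) * HN \<sigma> k hs"
  proof (cases "nsq JJ (FK \<sigma> (hs 0)) < \<infinity>")
   case True
   obtain g' where g': "continuous_on J g'" "AE x in lborel. x \<in> J \<longrightarrow> hs 0 x = g' x"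
    "\<And>x. x \<in> J ==> ennreal ((g' x)\<^sup>2) \<le> ennreal C * HN \<sigma> k hs" using C(2)[OF m True] unfolding HN by blast
   have "hs 0 x = g' x" using continuous_AE_eq[OF _ g'(1,2) x] hs k by blast
   then have "ennreal ((hs 0 x)\<^sup>2) \<le> ennreal C * HN \<sigma> k hs" using g'(3)[OF x] by simp
   also have "... \<le> ennreal (C + 1) * HN \<sigma> k hs" by (intro mult_right_mono ennreal_leI) auto
   finally show ?thesis .
  next
   case False
   then have "nsq JJ (FK \<sigma> (hs 0)) = top" by (metis infinity_ennreal_def less_top)
   then have "HN \<sigma> k hs = top" unfolding HN by simp
   then have "ennreal (C + 1) * HN \<sigma> k hs = top" using C(1) by (simp add: ennreal_mult_top)
   then show ?thesis by simp
  qed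
 qed
next
 assume k: "k = 1"
 define hf :: real where "hf = 1/2"
 have hf: "hf > 0" "hf = 1/2" unfolding hf_def by simp_all
 have emJ: "emeasure lborel J = ennreal hf" unfolding hf(2) by simp
 show ?thesis
 \<comment> \<open>The averaging gives \<open>4 * N0 + 2 * N1\<close>, so 8 is a generous
   constant.\<close>
 proof (intro exI[of _ 8] conjI allI impI ballI)
  fix hs x assume hs: "chain k hs \<and> (k = 0 \<longrightarrow> continuous_on J (hs 0))" and x: "x \<in> J"
  have ch: "chain 1 hs" using hs k by simp
  have m: "hs 0 \<in> BM" "nsq J (hs 0) < \<infinity>" "nsq J (hs 1) < \<infinity>"
   using chain_measurable[OF ch, of 0] chain_finite[OF ch, of 0] chain_finite[OF ch, of 1] by auto
  obtain N0 where N0: "0 \<le> N0" "nsq J (hs 0) = ennreal N0" using m by (cases "nsq J (hs 0)") auto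
  obtain N1 where N1: "0 \<le> N1" "nsq J (hs 1) = ennreal N1" using m by (cases "nsq J (hs 1)") auto
  have "nsq J (%y. hs 0 x - hs 0 y) \<le> nsq J (%y. sqrt N1)"
  proof (rule nsq_mono)
   fix y :: real assume y: "y \<in> J"
   have "\<bar>hs 0 x - hs 0 y\<bar> \<le> sqrt N1 * \<bar>x - y\<bar> powr (1/2)" by (rule chain_holder[OF ch]) (use N1 x y in auto)
   also have "... \<le> sqrt N1 * 1"
    by (intro mult_left_mono) (use N1 x y in \<open>auto simp: powr_half_sqrt intro!: real_sqrt_le_1_iff[THEN iffD2]\<close>)
   finally show "\<bar>hs 0 x - hs 0 y\<bar> \<le> \<bar>sqrt N1\<bar>" using N1 by simp
  qed
  also have "... = ennreal (N1 * hf)" using N1 hf by (simp add: nsq_const emJ flip: ennreal_mult)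
  finally have 1: "nsq J (%y. hs 0 x - hs 0 y) \<le> ennreal (N1 * hf)" .
  have "ennreal ((hs 0 x)\<^sup>2 * hf) = nsq J (%y. (hs 0 x - hs 0 y) + hs 0 y)"
   using hf by (simp add: nsq_const emJ ennreal_mult)
  also have "... \<le> 2 * nsq J (%y. hs 0 x - hs 0 y) + 2 * nsq J (hs 0)" by (rule nsq_add) (use m in auto)
  also have "... \<le> 2 * ennreal (N1 * hf) + 2 * ennreal N0" unfolding N0 by (intro add_mono mult_left_mono 1) auto
  also have "... = ennreal (2 * (N1 * hf) + 2 * N0)" using N0 N1 hf(1) by (simp add: ennreal_mult ennreal_plus)
  finally have "(hs 0 x)\<^sup>2 * hf \<le> 2 * (N1 * hf) + 2 * N0" by (subst (asm) ennreal_le_iff) (use N0 N1 hf(1) in auto)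
  then have "(hs 0 x)\<^sup>2 \<le> 8 * (N0 + N1)" using N0(1) N1(1) unfolding hf(2) by simp
  then have "ennreal ((hs 0 x)\<^sup>2) \<le> ennreal (8 * (N0 + N1))" by (rule ennreal_leI)
  also have "... = ennreal 8 * (ennreal N0 + ennreal N1)" using N0(1) N1(1) by (subst ennreal_mult) (auto simp: ennreal_plus)
  also have "... \<le> ennreal 8 * HN \<sigma> k hs" unfolding HN_def k using N0(2) N1(2) by (intro mult_left_mono) (auto simp: add_increasing2)
  finally show "ennreal ((hs 0 x)\<^sup>2) \<le> ennreal 8 * HN \<sigma> k hs" .
 qed simp
qed

section \<open>Closed form of the flow\<close>

definition sinc :: "real => real" where "sinc x = (if x = 0 then 1 else sin x / x)"
definition cc :: "real => real => real" where "cc e t = cos (sqrt (e/2) * t)"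
text \<open>With \<open>\<omega> = sqrt (e/2)\<close> this is
  \<open>sin (\<omega> * t) / (2 * \<omega>)\<close>, the solution of \<open>d'' = - (e/2) d\<close>
  with value 0 and derivative \<open>1/2\<close> at time 0. Writing it with \<open>sinc\<close>
  includes \<open>e = 0\<close>, where it is \<open>t/2\<close>, and gives joint continuity in
  \<open>e\<close> and \<open>t\<close>.\<close>

definition dd :: "real => real => real" where "dd e t = t/2 * sinc (sqrt (e/2) * t)"

lemma isCont_sinc: "isCont sinc x"
proof (cases "x = 0")
 case True
 have "((%h. (sin (0 + h) - sin 0) / h) \<longlongrightarrow> 1) (at (0::real))" using DERIV_sin[of "0::real"] unfolding DERIV_def by simp
 then have "((%h::real. sin h / h) \<longlongrightarrow> 1) (at 0)" by simp
 then have "(sinc \<longlongrightarrow> 1) (at 0)" by (rule Lim_transform_eventually) (auto simp: sinc_def eventually_at_filter)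
 then show ?thesis using True by (simp add: isCont_def sinc_def)
next
 case False
 have "isCont (%x. sin x / x) x" using False by (intro continuous_intros) auto
 moreover have "\<forall>\<^sub>F y in nhds x. sin y / y = sinc y"
  using t1_space_nhds[OF False] by eventually_elim (simp add: sinc_def)
 ultimately show ?thesis using isCont_cong[of "%y. sin y / y" sinc x] by simp
qed

lemma dd_sin: "2 * sqrt (e/2) * dd e t = sin (sqrt (e/2) * t)"
 unfolding dd_def sinc_def by auto

text \<open>Pythagoras for the angle \<open>sqrt (e/2) * t\<close>: the second term is the squared
  sine.\<close>

lemma cc_dd_identity: "0 \<le> e ==> (cc e t)\<^sup>2 + 2 * e * (dd e t)\<^sup>2 = 1"
proof -
 assume e: "0 \<le> e"
 have "2 * e * (dd e t)\<^sup>2 = (2 * sqrt (e/2) * dd e t)\<^sup>2" using e by (simp add: power_mult_distrib)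
 then show ?thesis unfolding dd_sin cc_def by simp
qed

lemma cc_DERIV: assumes e: "0 \<le> e" shows "(cc e has_real_derivative - e * dd e t) (at t)"
proof -
 have "sqrt (e/2) * sqrt (e/2) = e/2" using e by (intro real_sqrt_mult_self[THEN trans]) simp
 then have "e = sqrt (e/2) * 2 * sqrt (e/2)" by linarith
 then have "e * dd e t = sqrt (e/2) * (2 * sqrt (e/2) * dd e t)" by (metis mult.assoc)
 also have "... = sqrt (e/2) * sin (sqrt (e/2) * t)" unfolding dd_sin ..
 finally show ?thesis unfolding cc_def[abs_def] by (auto intro!: derivative_eq_intros simp: cc_def)
qed

lemma dd_DERIV: assumes e: "0 \<le> e" shows "(dd e has_real_derivative cc e t / 2) (at t)"
proof (cases "e = 0")
 case True
 then show ?thesis unfolding dd_def[abs_def] cc_def sinc_def by (auto intro!: derivative_eq_intros)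
next
 case False
 then have s: "sqrt (e/2) > 0" using e by simp
 have "dd e = (%t. sin (sqrt (e/2) * t) / (2 * sqrt (e/2)))"
  using s dd_sin[of e] by (auto simp: field_simps)
 then show ?thesis using s by (auto intro!: derivative_eq_intros simp: cc_def)
qed

lemma cc_0 [simp]: "cc e 0 = 1" and dd_0 [simp]: "dd e 0 = 0" by (simp_all add: cc_def dd_def)

lemma tendsto_cc:
 assumes "(e \<longlongrightarrow> e') F" "(t \<longlongrightarrow> t') F"
 shows "((%n. cc (e n) (t n)) \<longlongrightarrow> cc e' t') F"
proof -
 have "((%n. sqrt (e n / 2) * t n) \<longlongrightarrow> sqrt (e' / 2) * t') F"
  by (intro tendsto_mult tendsto_real_sqrt tendsto_divide tendsto_const assms) auto
 from isCont_tendsto_compose[OF isCont_cos this] show ?thesis unfolding cc_def .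
qed

lemma tendsto_dd:
 assumes "(e \<longlongrightarrow> e') F" "(t \<longlongrightarrow> t') F"
 shows "((%n. dd (e n) (t n)) \<longlongrightarrow> dd e' t') F"
proof -
 have "((%n. sqrt (e n / 2) * t n) \<longlongrightarrow> sqrt (e' / 2) * t') F"
  by (intro tendsto_mult tendsto_real_sqrt tendsto_divide tendsto_const assms) auto
 from isCont_tendsto_compose[OF isCont_sinc this] show ?thesis
  unfolding dd_def by (intro tendsto_mult tendsto_divide tendsto_const assms) auto
qed

text \<open>An admissible slope is extended by its boundary values beyond \<open>J\<close>, so that
  bounds on \<open>J\<close> are global. The zero mean over \<open>J\<close> is the boundary
  condition at \<open>1/2\<close> of the datum \<open>AD a\<close>.\<close>

definition adm :: "(real => real) => bool" where
 "adm a \<longleftrightarrow> continuous_on UNIV a \<and> (\<forall>x. a (clmp x) = a x) \<and> AD a (1/2) = 0"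

definition En :: "(real => real) => real" where "En a = AD (%x. (a x)\<^sup>2) (1/2)"
definition cE where "cE a t = cc (En a) t"
definition dE where "dE a t = dd (En a) t"
text \<open>The cosine of the doubled angle; it arises as the time derivative of
  \<open>2 * cE a t * dE a t\<close>.\<close>

definition rE where "rE a t = (cE a t)\<^sup>2 - 2 * En a * (dE a t)\<^sup>2"
definition qq where "qq a t x = cE a t + dE a t * a x"
text \<open>The integral of the square of \<open>qq\<close> from 0 to \<open>x\<close>, expanded in
  the primitives of 1, \<open>a\<close> and the square of \<open>a\<close>, which do not depend on
  time. \<open>ll\<close> and \<open>kk\<close> are its first and second time derivatives, that is,
  velocity and acceleration at the label \<open>x\<close>.\<close>

definition gam where "gam a t x = (cE a t)\<^sup>2 * x + 2 * cE a t * dE a t * AD a x + (dE a t)\<^sup>2 * AD (%x. (a x)\<^sup>2) x"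
definition ll where "ll a t x = - 2 * En a * cE a t * dE a t * x + rE a t * AD a x + cE a t * dE a t * AD (%x. (a x)\<^sup>2) x"
definition kk where "kk a t x = - En a * rE a t * x - 4 * En a * cE a t * dE a t * AD a x + rE a t / 2 * AD (%x. (a x)\<^sup>2) x"
text \<open>The slope \<open>u_x\<close> at the label \<open>x\<close>, computed as twice the
  logarithmic time derivative of \<open>qq\<close>.\<close>

definition Phi where "Phi a t x = (cE a t * a x - 2 * En a * dE a t) / qq a t x"
definition eta where "eta a t = inv (gam a t)"
definition Pos where "Pos a = {t. \<forall>x\<in>J. 0 < qq a t x}"
definition UU where "UU a t y = ll a t (eta a t y)"
definition UX where "UX a t y = Phi a t (eta a t y)"
text \<open>The time derivative of \<open>u\<close> at a fixed position, obtained as acceleration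
  minus \<open>u * u_x\<close>.\<close>

definition VV where "VV a t y = kk a t (eta a t y) - Phi a t (eta a t y) * ll a t (eta a t y)"

lemma adm_cont: "adm a ==> continuous_on S a"
 unfolding adm_def using continuous_on_subset by blast

lemma adm_cont_sq: "adm a ==> continuous_on S (%x. (a x)\<^sup>2)"
 by (intro continuous_intros adm_cont)

lemma En_nonneg: "0 \<le> En a"
proof -
 have "En a = integral {0..1/2} (%x. (a x)\<^sup>2)" unfolding En_def by (simp add: AD_nonneg_eq)
 also have "... \<ge> 0"
  by (cases "(%x. (a x)\<^sup>2) integrable_on J") (auto intro!: Henstock_Kurzweil_Integration.integral_nonneg simp: not_integrable_integral)
 finally show ?thesis .
qed

lemma cE_DERIV: "(cE a has_real_derivative - En a * dE a t) (at t)"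
 unfolding cE_def[abs_def] dE_def by (rule cc_DERIV[OF En_nonneg])

lemma dE_DERIV: "(dE a has_real_derivative cE a t / 2) (at t)"
 unfolding cE_def dE_def[abs_def] by (rule dd_DERIV[OF En_nonneg])

lemma cE_dE_identity: "(cE a t)\<^sup>2 + 2 * En a * (dE a t)\<^sup>2 = 1"
 unfolding cE_def dE_def by (rule cc_dd_identity[OF En_nonneg])

lemma gam_DERIV_t: "((%t. gam a t x) has_real_derivative ll a t x) (at t)"
 unfolding gam_def ll_def rE_def
 by (rule derivative_eq_intros cE_DERIV dE_DERIV refl)+ (simp only: power2_eq_square, simp add: algebra_simps)

lemma ll_DERIV_t: "((%t. ll a t x) has_real_derivative kk a t x) (at t)"
 unfolding kk_def ll_def rE_def
 by (rule derivative_eq_intros cE_DERIV dE_DERIV refl)+ (simp only: power2_eq_square, simp add: field_simps)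

lemma gam_DERIV_x: assumes a: "adm a" shows "(gam a t has_real_derivative (qq a t x)\<^sup>2) (at x)"
 unfolding gam_def[abs_def] qq_def
 by (rule derivative_eq_intros AD_DERIV[OF adm_cont[OF a]] AD_DERIV[OF adm_cont_sq[OF a]] refl)+ (simp add: algebra_simps power2_eq_square)

lemma ll_DERIV_x: assumes a: "adm a" shows "(ll a t has_real_derivative (cE a t * a x - 2 * En a * dE a t) * qq a t x) (at x)"
 unfolding ll_def[abs_def] qq_def rE_def
 by (rule derivative_eq_intros AD_DERIV[OF adm_cont[OF a]] AD_DERIV[OF adm_cont_sq[OF a]] refl)+ (simp add: algebra_simps power2_eq_square)

lemma kk_DERIV_x: assumes a: "adm a"
 shows "(kk a t has_real_derivative (cE a t * a x - 2 * En a * dE a t)\<^sup>2 / 2 - En a * (qq a t x)\<^sup>2) (at x)"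
 unfolding kk_def[abs_def] qq_def rE_def
 by (rule derivative_eq_intros AD_DERIV[OF adm_cont[OF a]] AD_DERIV[OF adm_cont_sq[OF a]] refl)+ (simp add: field_simps power2_eq_square)

text \<open>At \<open>1/2\<close> the terms with \<open>AD a\<close> drop out by the zero mean, and
  the primitive of the squared slope becomes \<open>En a\<close>. For \<open>gam\<close> the rest is
  half of \<open>cE_dE_identity\<close>; for \<open>ll\<close> and \<open>kk\<close> it
  cancels.\<close>

lemma gam_ends: assumes "adm a" shows "gam a t 0 = 0" "gam a t (1/2) = 1/2"
 and "ll a t 0 = 0" "ll a t (1/2) = 0" "kk a t 0 = 0" "kk a t (1/2) = 0"
 using assms cE_dE_identity[of a t] unfolding gam_def ll_def kk_def adm_def En_def[symmetric] by (auto simp: algebra_simps)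

lemma qq_cont: "adm a ==> continuous_on S (qq a t)"
 unfolding qq_def[abs_def] by (intro continuous_intros adm_cont)

lemma qq_clmp: "adm a ==> qq a t (clmp x) = qq a t x" unfolding qq_def adm_def by simp

lemma qq_pos: "adm a ==> t \<in> Pos a ==> 0 < qq a t x"
 unfolding Pos_def using clmp_mem[of x] qq_clmp[of a t x] by fastforce

lemma flowmap_gam:
 assumes a: "adm a" and q: "0 < q0" "\<And>x. x \<in> J ==> q0 \<le> qq a t x" "\<And>x. x \<in> J ==> qq a t x \<le> Q"
 shows "flowmap (gam a t) (eta a t) (%x. (qq a t x)\<^sup>2) (q0\<^sup>2) (Q\<^sup>2)"
proof -
 have q': "q0 \<le> qq a t x" "qq a t x \<le> Q" for x
  using q(2)[OF clmp_mem[of x]] q(3)[OF clmp_mem[of x]] qq_clmp[OF a, of t x] by simp_all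
 have p: "q0\<^sup>2 \<le> (qq a t x)\<^sup>2" "(qq a t x)\<^sup>2 \<le> Q\<^sup>2" for x
  using q'[of x] q(1) by (auto intro!: power_mono)
 have mono: "q0\<^sup>2 * (y - x) \<le> gam a t y - gam a t x" if "x \<le> y" for x y
 proof (cases "x = y")
  case False
  then have "x < y" using that by simp
  then obtain z where "gam a t y - gam a t x = (y - x) * (qq a t z)\<^sup>2"
   using MVT2[of x y "gam a t" "%x. (qq a t x)\<^sup>2"] gam_DERIV_x[OF a] by auto
  then show ?thesis using p(1)[of z] that by (simp add: mult.commute mult_left_mono)
 qed simp
 have inj: "inj (gam a t)"
 proof (rule injI)
  fix x y assume e: "gam a t x = gam a t y"
  have q2: "q0\<^sup>2 > 0" using q(1) by simp
  have *: "v \<le> u" if "u \<le> v" "gam a t u = gam a t v" for u v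
  proof -
   have "q0\<^sup>2 * (v - u) \<le> q0\<^sup>2 * 0" using mono[OF that(1)] unfolding that(2) by simp
   then have "v - u \<le> 0" using mult_le_cancel_left_pos[OF q2] by blast
   then show ?thesis by simp
  qed
  show "x = y"
  proof (cases "x \<le> y")
   case True then show ?thesis using *[OF True e] by simp
  next
   case False then have "y \<le> x" by simp
   then show ?thesis using *[OF _ e[symmetric]] by simp
  qed
 qed
 have surj: "\<exists>x. gam a t x = y" for y
 proof -
  define x where "x = \<bar>y\<bar> / q0\<^sup>2"
  have x: "0 \<le> x" "q0\<^sup>2 * x = \<bar>y\<bar>" unfolding x_def using q(1) by auto
  have "gam a t (-x) \<le> y" "y \<le> gam a t x"
   using mono[of 0 x] mono[of "-x" 0] x gam_ends(1)[OF a, of t] by auto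
  moreover have "continuous_on {-x..x} (gam a t)"
   using gam_DERIV_x[OF a] by (meson DERIV_isCont continuous_at_imp_continuous_on)
  ultimately show ?thesis using IVT'[of "gam a t" "-x" y x] x(1) by auto
 qed
 show ?thesis
 proof
  show "(gam a t has_real_derivative (qq a t x)\<^sup>2) (at x)" for x by (rule gam_DERIV_x[OF a])
  show "continuous_on UNIV (%x. (qq a t x)\<^sup>2)" by (intro continuous_intros qq_cont a)
  show "eta a t (gam a t x) = x" for x unfolding eta_def using inj by simp
  show "gam a t (eta a t y) = y" for y unfolding eta_def using surj[of y] by (metis f_inv_into_f rangeI)
 qed (use p q(1) gam_ends[OF a] in auto)
qed

lemma Pos_bounds:
 assumes a: "adm a" and t: "t \<in> Pos a"
 obtains q0 Q where "0 < q0" "\<And>x. q0 \<le> qq a t x" "\<And>x. qq a t x \<le> Q"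
proof -
 have c: "continuous_on J (qq a t)" by (rule qq_cont[OF a])
 obtain x1 where x1: "x1 \<in> J" "\<forall>y\<in>J. qq a t x1 \<le> qq a t y" using continuous_attains_inf[OF compact_Icc _ c] by auto
 obtain x2 where x2: "x2 \<in> J" "\<forall>y\<in>J. qq a t y \<le> qq a t x2" using continuous_attains_sup[OF compact_Icc _ c] by auto
 have "qq a t x1 \<le> qq a t x" "qq a t x \<le> qq a t x2" for x
  using x1(2) x2(2) clmp_mem[of x] qq_clmp[OF a, of t x] by metis+
 then show thesis using that[of "qq a t x1" "qq a t x2"] qq_pos[OF a t] by blast
qed

lemma flowmap_Pos:
 assumes "adm a" "t \<in> Pos a"
 obtains m M where "flowmap (gam a t) (eta a t) (%x. (qq a t x)\<^sup>2) m M"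
proof -
 from Pos_bounds[OF assms] obtain q0 Q where "0 < q0" "\<And>x. q0 \<le> qq a t x" "\<And>x. qq a t x \<le> Q" by blast
 then show thesis using flowmap_gam[OF assms(1), of q0 t Q] that by blast
qed

text \<open>For fixed \<open>t\<close>, \<open>Phi\<close> is a Moebius function of the value
  \<open>a x\<close> with denominator \<open>qq\<close>, and its determinant is 1 by
  \<open>cE_dE_identity\<close>. This exact formula, free of remainder, lets a rough slope pass
  through \<open>Phi\<close> in the Gagliardo norm.\<close>

lemma Phi_diff:
 assumes "adm a" "t \<in> Pos a"
 shows "Phi a t x - Phi a t y = (a x - a y) / (qq a t x * qq a t y)"
proof -
 have q: "qq a t x \<noteq> 0" "qq a t y \<noteq> 0" using qq_pos[OF assms] by (metis less_irrefl)+
 have "Phi a t x - Phi a t y = ((cE a t * a x - 2 * En a * dE a t) * qq a t y - (cE a t * a y - 2 * En a * dE a t) * qq a t x) / (qq a t x * qq a t y)"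
  unfolding Phi_def using q by (simp add: field_simps)
 also have "(cE a t * a x - 2 * En a * dE a t) * qq a t y - (cE a t * a y - 2 * En a * dE a t) * qq a t x = ((cE a t)\<^sup>2 + 2 * En a * (dE a t)\<^sup>2) * (a x - a y)"
  unfolding qq_def by (simp add: algebra_simps power2_eq_square)
 finally show ?thesis unfolding cE_dE_identity by simp
qed

lemma Phi_qq: "adm a ==> t \<in> Pos a ==> cE a t * a x - 2 * En a * dE a t = Phi a t x * qq a t x"
 unfolding Phi_def using qq_pos[of a t x] by simp

lemma Phi_cont: "adm a ==> t \<in> Pos a ==> continuous_on S (Phi a t)"
 unfolding Phi_def[abs_def] using qq_pos[of a t] by (intro continuous_intros adm_cont qq_cont) (auto simp: less_imp_neq[THEN not_sym])

lemma ll_cont: "adm a ==> continuous_on S (ll a t)"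
 using ll_DERIV_x by (meson DERIV_isCont continuous_at_imp_continuous_on)

lemma kk_cont: "adm a ==> continuous_on S (kk a t)"
 using kk_DERIV_x by (meson DERIV_isCont continuous_at_imp_continuous_on)

subsection \<open>Continuity of the flow in the data\<close>

text \<open>Bookkeeping for coefficients: uniform convergence on \<open>J\<close> of functions
  continuous on the line. It is closed under the operations that build \<open>qq\<close>,
  \<open>gam\<close>, \<open>ll\<close>, \<open>kk\<close> and \<open>Phi\<close>, so their
  convergence follows by applying rules to the defining terms.\<close>

definition ulim :: "(nat => real => real) => (real => real) => bool" where
 "ulim F f \<longleftrightarrow> (\<forall>n. continuous_on UNIV (F n)) \<and> continuous_on UNIV f \<and> uniform_limit J F f sequentially"

lemma ulim_measurable: "ulim F f ==> F n \<in> BM" "ulim F f ==> f \<in> BM"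
 unfolding ulim_def by (auto intro: borel_measurable_continuous_onI)

lemma ulim_tendsto: "ulim F f ==> x \<in> J ==> (%n. F n x) \<longlonglongrightarrow> f x"
 unfolding ulim_def by (elim conjE) (rule tendsto_uniform_limitI)

lemma continuous_bounded_J:
 assumes "continuous_on UNIV (f :: real => real)"
 obtains K where "0 \<le> K" "\<And>x. x \<in> J ==> \<bar>f x\<bar> \<le> K"
proof -
 obtain K where "\<And>x. x \<in> J ==> \<bar>f x\<bar> \<le> K"
  using compact_imp_bounded[OF compact_continuous_image[OF continuous_on_subset[OF assms] compact_Icc, of 0 "1/2"]]
  unfolding bounded_iff by (metis imageI real_norm_def subset_UNIV)
 then show thesis using that[of "\<bar>K\<bar>"] by force
qed

lemma ulim_bounded:
 assumes "ulim F f"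
 obtains K where "0 \<le> K" "\<And>n x. x \<in> J ==> \<bar>F n x\<bar> \<le> K" "\<And>x. x \<in> J ==> \<bar>f x\<bar> \<le> K"
proof -
 have c: "continuous_on UNIV (F n)" "continuous_on UNIV f" for n using assms unfolding ulim_def by auto
 obtain k0 where k0: "0 \<le> k0" "\<And>x. x \<in> J ==> \<bar>f x\<bar> \<le> k0" using continuous_bounded_J[OF c(2)] by metis
 have "\<forall>n. \<exists>K. 0 \<le> K \<and> (\<forall>x\<in>J. \<bar>F n x\<bar> \<le> K)" using continuous_bounded_J[OF c(1)] by metis
 then obtain k where k: "\<And>n. 0 \<le> k n" "\<And>n x. x \<in> J ==> \<bar>F n x\<bar> \<le> k n" by metis
 have "\<forall>\<^sub>F n in sequentially. \<forall>x\<in>J. dist (F n x) (f x) < 1"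
  using assms unfolding ulim_def by (intro uniform_limitD) auto
 then obtain N where N: "\<And>n x. n \<ge> N ==> x \<in> J ==> \<bar>F n x - f x\<bar> < 1"
  unfolding eventually_sequentially dist_real_def by blast
 define K where "K = k0 + 1 + (\<Sum>n<N. k n)"
 have s: "0 \<le> (\<Sum>n<N. k n)" by (intro sum_nonneg k)
 have "\<bar>F n x\<bar> \<le> K" if x: "x \<in> J" for n x
 proof (cases "n < N")
  case True
  have "\<bar>F n x\<bar> \<le> k n" by (rule k(2)[OF x])
  also have "k n \<le> (\<Sum>n<N. k n)" using True by (intro member_le_sum) (auto simp: k)
  finally show ?thesis unfolding K_def using k0(1) by linarith
 next
  case False
  then have "\<bar>F n x - f x\<bar> < 1" using N x by simp
  then show ?thesis unfolding K_def using k0(2)[OF x] s by linarith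
 qed
 moreover have "\<bar>f x\<bar> \<le> K" if "x \<in> J" for x using k0(2)[OF that] s unfolding K_def by linarith
 moreover have "0 \<le> K" unfolding K_def using k0(1) s by simp
 ultimately show thesis using that by blast
qed

lemma ulim_const: "c \<longlonglongrightarrow> c' ==> ulim (%n x. c n) (%x. c')"
 unfolding ulim_def uniform_limit_iff by (auto dest: tendstoD)

lemma ulim_id: "ulim (%n x. x) (%x. x)"
 unfolding ulim_def by (auto intro: uniform_limit_const)

lemma ulim_add: "ulim F f ==> ulim G g ==> ulim (%n x. F n x + G n x) (%x. f x + g x)"
 unfolding ulim_def by (auto intro!: continuous_intros uniform_limit_add)

lemma ulim_minus: "ulim F f ==> ulim (%n x. - F n x) (%x. - f x)"
 unfolding ulim_def by (auto intro!: continuous_intros uniform_limit_uminus)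

lemma ulim_diff: "ulim F f ==> ulim G g ==> ulim (%n x. F n x - G n x) (%x. f x - g x)"
 using ulim_add[OF _ ulim_minus, of F f G g] by simp

lemma ulim_mult: assumes "ulim F f" "ulim G g" shows "ulim (%n x. F n x * G n x) (%x. f x * g x)"
proof -
 obtain K1 where "\<And>x. x \<in> J ==> \<bar>f x\<bar> \<le> K1" using ulim_bounded[OF assms(1)] by metis
 moreover obtain K2 where "\<And>x. x \<in> J ==> \<bar>g x\<bar> \<le> K2" using ulim_bounded[OF assms(2)] by metis
 ultimately have "bounded (f ` J)" "bounded (g ` J)" unfolding bounded_iff by (metis imageE real_norm_def)+
 then show ?thesis using assms unfolding ulim_def
  by (auto intro!: continuous_intros uniform_lim_mult)
qed

lemma ulim_power: "ulim F f ==> ulim (%n x. F n x ^ k) (%x. f x ^ k)"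
 by (induction k) (auto intro: ulim_const ulim_mult)

lemma ulim_inverse:
 assumes "ulim F f" "0 < q0" "\<And>n x. q0 \<le> F n x" "\<And>x. q0 \<le> f x"
 shows "ulim (%n x. inverse (F n x)) (%x. inverse (f x))"
proof -
 have nz: "F n x \<noteq> 0" "f x \<noteq> 0" for n x using assms(2) assms(3)[of n x] assms(4)[of x] by auto
 have "uniform_limit J (%n x. inverse (F n x)) (%x. inverse (f x)) sequentially"
 proof -
  have "uniform_limit J (%n x. inverse (F n x)) (inverse \<circ> f) sequentially"
  proof (rule uniform_lim_inverse)
   show "uniform_limit J F f sequentially" using assms(1) unfolding ulim_def by blast
   show "q0 \<le> norm (f x)" for x using assms(4)[of x] by simp
  qed fact
  then show ?thesis by (simp add: o_def)
 qed
 then show ?thesis using assms(1) nz unfolding ulim_def by (auto intro!: continuous_intros)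
qed

lemma AD_diff:
 assumes "continuous_on UNIV f" "continuous_on UNIV g" "x \<in> J" "\<And>y. y \<in> J ==> \<bar>f y - g y\<bar> \<le> e"
 shows "\<bar>AD f x - AD g x\<bar> \<le> e * x"
proof -
 have i: "f integrable_on {0..x}" "g integrable_on {0..x}"
  by (intro integrable_continuous_interval continuous_on_subset[OF assms(1)] continuous_on_subset[OF assms(2)]; simp)+
 have "AD f x - AD g x = integral {0..x} (%y. f y - g y)"
  using assms(3) i by (simp add: AD_nonneg_eq Henstock_Kurzweil_Integration.integral_diff)
 also have "norm \<dots> \<le> e * (x - 0)"
  by (rule integral_bound) (use assms in \<open>auto intro!: continuous_intros intro: continuous_on_subset\<close>)
 finally show ?thesis by simp
qed

lemma AD_cont: "continuous_on UNIV f ==> continuous_on S (AD f)"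
 using AD_DERIV by (meson DERIV_isCont continuous_at_imp_continuous_on)

lemma ulim_AD: assumes "ulim F f" shows "ulim (%n. AD (F n)) (AD f)"
proof -
 have c: "continuous_on UNIV (F n)" "continuous_on UNIV f" for n using assms unfolding ulim_def by auto
 have "uniform_limit J (%n. AD (F n)) (AD f) sequentially"
  unfolding uniform_limit_iff
 proof (intro allI impI)
  fix e :: real assume e: "e > 0"
  have "\<forall>\<^sub>F n in sequentially. \<forall>x\<in>J. dist (F n x) (f x) < e"
   using assms e unfolding ulim_def by (intro uniform_limitD) auto
  then show "\<forall>\<^sub>F n in sequentially. \<forall>x\<in>J. dist (AD (F n) x) (AD f x) < e"
  proof eventually_elim
   case (elim n)
   show ?case
   proof
    fix x assume x: "x \<in> J"
    have "\<bar>AD (F n) x - AD f x\<bar> \<le> e * x"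
     by (rule AD_diff[OF c x]) (use elim in \<open>auto simp: dist_real_def intro: less_imp_le\<close>)
    also have "... \<le> e * (1/2)" using x e by (intro mult_left_mono) auto
    finally show "dist (AD (F n) x) (AD f x) < e" using e by (simp add: dist_real_def)
   qed
  qed
 qed
 then show ?thesis unfolding ulim_def using c AD_cont by blast
qed

text \<open>A common Hoelder constant is required, but not convergence in the Hoelder norm. The
  difference quotients are then uniformly bounded and converge off the diagonal, which is what
  \<open>FK_flow_tendsto\<close> asks of its multipliers.\<close>

definition uhol :: "(nat => real => real) => (real => real) => bool" where
 "uhol F f \<longleftrightarrow> ulim F f \<and> (\<exists>K\<ge>0. \<forall>n. \<forall>x\<in>J. \<forall>y\<in>J. \<bar>F n x - F n y\<bar> \<le> K * \<bar>x - y\<bar> powr (1/2))"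

lemma uhol_ulim: "uhol F f ==> ulim F f" unfolding uhol_def by blast

lemma uholE:
 assumes "uhol F f"
 obtains K where "0 \<le> K" "\<And>n x y. x \<in> J ==> y \<in> J ==> \<bar>F n x - F n y\<bar> \<le> K * \<bar>x - y\<bar> powr (1/2)"
  "\<And>x y. x \<in> J ==> y \<in> J ==> \<bar>f x - f y\<bar> \<le> K * \<bar>x - y\<bar> powr (1/2)"
proof -
 obtain K where K: "0 \<le> K" "\<And>n x y. x \<in> J ==> y \<in> J ==> \<bar>F n x - F n y\<bar> \<le> K * \<bar>x - y\<bar> powr (1/2)"
  using assms unfolding uhol_def by blast
 have "\<bar>f x - f y\<bar> \<le> K * \<bar>x - y\<bar> powr (1/2)" if "x \<in> J" "y \<in> J" for x y
 proof (rule LIMSEQ_le_const2)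
  show "(%n. \<bar>F n x - F n y\<bar>) \<longlonglongrightarrow> \<bar>f x - f y\<bar>"
   by (intro tendsto_intros ulim_tendsto[OF uhol_ulim[OF assms]] that)
 qed (use K(2)[OF that] in auto)
 with K show thesis using that by blast
qed

lemma uhol_const: "c \<longlonglongrightarrow> c' ==> uhol (%n x. c n) (%x. c')"
 unfolding uhol_def by (auto intro: ulim_const)

lemma uhol_add: assumes "uhol F f" "uhol G g" shows "uhol (%n x. F n x + G n x) (%x. f x + g x)"
proof -
 obtain K where K: "0 \<le> K" "\<And>n x y. x \<in> J ==> y \<in> J ==> \<bar>F n x - F n y\<bar> \<le> K * \<bar>x - y\<bar> powr (1/2)" using uholE[OF assms(1)] by metis
 obtain L where L: "0 \<le> L" "\<And>n x y. x \<in> J ==> y \<in> J ==> \<bar>G n x - G n y\<bar> \<le> L * \<bar>x - y\<bar> powr (1/2)" using uholE[OF assms(2)] by metis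
 have "\<bar>(F n x + G n x) - (F n y + G n y)\<bar> \<le> (K + L) * \<bar>x - y\<bar> powr (1/2)" if "x \<in> J" "y \<in> J" for n x y
  using K(2)[OF that, of n] L(2)[OF that, of n] unfolding distrib_right by linarith
 then show ?thesis using K(1) L(1) ulim_add[OF assms[THEN uhol_ulim]] unfolding uhol_def by (intro conjI exI[of _ "K+L"]) auto
qed

lemma uhol_mult: assumes "uhol F f" "uhol G g" shows "uhol (%n x. F n x * G n x) (%x. f x * g x)"
proof -
 obtain K where K: "0 \<le> K" "\<And>n x y. x \<in> J ==> y \<in> J ==> \<bar>F n x - F n y\<bar> \<le> K * \<bar>x - y\<bar> powr (1/2)" using uholE[OF assms(1)] by metis
 obtain L where L: "0 \<le> L" "\<And>n x y. x \<in> J ==> y \<in> J ==> \<bar>G n x - G n y\<bar> \<le> L * \<bar>x - y\<bar> powr (1/2)" using uholE[OF assms(2)] by metis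
 obtain M where M: "0 \<le> M" "\<And>n x. x \<in> J ==> \<bar>F n x\<bar> \<le> M" using ulim_bounded[OF uhol_ulim[OF assms(1)]] by metis
 obtain N where N: "0 \<le> N" "\<And>n x. x \<in> J ==> \<bar>G n x\<bar> \<le> N" using ulim_bounded[OF uhol_ulim[OF assms(2)]] by metis
 have "\<bar>F n x * G n x - F n y * G n y\<bar> \<le> (M * L + N * K) * \<bar>x - y\<bar> powr (1/2)" if xy: "x \<in> J" "y \<in> J" for n x y
 proof -
  have "F n x * G n x - F n y * G n y = F n x * (G n x - G n y) + G n y * (F n x - F n y)" by (simp add: algebra_simps)
  then have "\<bar>F n x * G n x - F n y * G n y\<bar> \<le> \<bar>F n x\<bar> * \<bar>G n x - G n y\<bar> + \<bar>G n y\<bar> * \<bar>F n x - F n y\<bar>"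
   by (metis abs_mult abs_triangle_ineq)
  also have "... \<le> M * (L * \<bar>x - y\<bar> powr (1/2)) + N * (K * \<bar>x - y\<bar> powr (1/2))"
   by (intro add_mono mult_mono K L M N xy) auto
  finally show ?thesis by (simp add: algebra_simps)
 qed
 then show ?thesis using K(1) L(1) M(1) N(1) ulim_mult[OF assms[THEN uhol_ulim]] unfolding uhol_def
  by (intro conjI exI[of _ "M * L + N * K"]) auto
qed

lemma uhol_power: "uhol F f ==> uhol (%n x. F n x ^ k) (%x. f x ^ k)"
 by (induction k) (auto intro: uhol_const uhol_mult)

lemma uhol_inverse:
 assumes "uhol F f" "0 < q0" "\<And>n x. q0 \<le> F n x" "\<And>x. q0 \<le> f x"
 shows "uhol (%n x. inverse (F n x)) (%x. inverse (f x))"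
proof -
 obtain K where K: "0 \<le> K" "\<And>n x y. x \<in> J ==> y \<in> J ==> \<bar>F n x - F n y\<bar> \<le> K * \<bar>x - y\<bar> powr (1/2)" using uholE[OF assms(1)] by metis
 have "\<bar>inverse (F n x) - inverse (F n y)\<bar> \<le> (K / (q0 * q0)) * \<bar>x - y\<bar> powr (1/2)" if xy: "x \<in> J" "y \<in> J" for n x y
 proof -
  have p: "0 < F n x" "0 < F n y" using assms(2) assms(3)[of n x] assms(3)[of n y] by auto
  have "\<bar>inverse (F n x) - inverse (F n y)\<bar> = \<bar>F n x - F n y\<bar> / (F n x * F n y)"
   using p by (simp add: abs_if field_simps)
  also have "... \<le> (K * \<bar>x - y\<bar> powr (1/2)) / (q0 * q0)"
   using assms(2,3) p by (intro frac_le K xy mult_mono) (auto intro!: mult_nonneg_nonneg K mult_pos_pos)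
  finally show ?thesis by simp
 qed
 then show ?thesis using K(1) ulim_inverse[OF uhol_ulim[OF assms(1)] assms(2-4)] assms(2) unfolding uhol_def
  by (intro conjI exI[of _ "K / (q0 * q0)"]) auto
qed

lemma lipschitz_from_deriv:
 assumes "ulim D d" "\<And>n x. (F n has_real_derivative D n x) (at x)" "\<And>x. (f has_real_derivative d x) (at x)"
 obtains K where "0 \<le> K" "\<And>n x y. x \<in> J ==> y \<in> J ==> \<bar>F n x - F n y\<bar> \<le> K * \<bar>x - y\<bar>"
  "\<And>x y. x \<in> J ==> y \<in> J ==> \<bar>f x - f y\<bar> \<le> K * \<bar>x - y\<bar>"
proof -
 obtain K where K: "0 \<le> K" "\<And>n x. x \<in> J ==> \<bar>D n x\<bar> \<le> K" "\<And>x. x \<in> J ==> \<bar>d x\<bar> \<le> K" using ulim_bounded[OF assms(1)] by metis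
 have gen: "\<bar>g x - g y\<bar> \<le> K * \<bar>x - y\<bar>" if "\<And>x. (g has_real_derivative g' x) (at x)" "\<And>x. x \<in> J ==> \<bar>g' x\<bar> \<le> K" "x \<in> J" "y \<in> J" for g g' x y
  using field_differentiable_bound[of J g g' K x y] that by (auto intro: has_field_derivative_at_within simp: norm_minus_commute)
 show thesis
  by (rule that[OF K(1) gen[OF assms(2) K(2)] gen[OF assms(3) K(3)]])
qed

lemma abs_le_powr_half: "x \<in> J ==> y \<in> J ==> \<bar>x - y\<bar> \<le> \<bar>x - y\<bar> powr (1/2)"
proof -
 assume "x \<in> J" "y \<in> J"
 then have "\<bar>x - y\<bar> \<le> 1" by auto
 then have "sqrt \<bar>x - y\<bar> * sqrt \<bar>x - y\<bar> \<le> sqrt \<bar>x - y\<bar> * 1" by (intro mult_left_mono) auto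
 then show ?thesis by (simp add: powr_half_sqrt)
qed

lemma uhol_from_deriv:
 assumes "ulim F f" "ulim D d" "\<And>n x. (F n has_real_derivative D n x) (at x)" "\<And>x. (f has_real_derivative d x) (at x)"
 shows "uhol F f"
proof -
 obtain K where K: "0 \<le> K" "\<And>n x y. x \<in> J ==> y \<in> J ==> \<bar>F n x - F n y\<bar> \<le> K * \<bar>x - y\<bar>"
  using lipschitz_from_deriv[OF assms(2-4)] by metis
 have "\<bar>F n x - F n y\<bar> \<le> K * \<bar>x - y\<bar> powr (1/2)" if "x \<in> J" "y \<in> J" for n x y
  using K(2)[OF that, of n] mult_left_mono[OF abs_le_powr_half[OF that] K(1)] by linarith
 then show ?thesis using assms(1) K(1) unfolding uhol_def by blast
qed

text \<open>Slopes and times vary together: constant slopes give continuity in time, varying slopes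
  give dependence on the data, and the joint version gives uniformity in time by
  compactness.\<close>

locale dataseq =
 fixes A :: "nat => real => real" and a :: "real => real" and t :: "nat => real" and t' :: real
 assumes admA: "\<And>n. adm (A n)" and adma: "adm a" and ul: "uniform_limit J A a sequentially" and tt: "t \<longlonglongrightarrow> t'"
begin

lemma uA: "ulim A a"
 unfolding ulim_def using ul adm_cont[OF admA] adm_cont[OF adma] by blast

lemma uP: "ulim (%n. AD (A n)) (AD a)" by (rule ulim_AD[OF uA])
lemma uA2: "ulim (%n x. (A n x)\<^sup>2) (%x. (a x)\<^sup>2)" by (rule ulim_power[OF uA])
lemma uR: "ulim (%n. AD (%x. (A n x)\<^sup>2)) (AD (%x. (a x)\<^sup>2))" by (rule ulim_AD[OF uA2])

lemma lim_En: "(%n. En (A n)) \<longlonglongrightarrow> En a" unfolding En_def by (rule ulim_tendsto[OF uR]) simp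
lemma lim_c: "(%n. cE (A n) (t n)) \<longlonglongrightarrow> cE a t'" unfolding cE_def by (rule tendsto_cc[OF lim_En tt])
lemma lim_d: "(%n. dE (A n) (t n)) \<longlonglongrightarrow> dE a t'" unfolding dE_def by (rule tendsto_dd[OF lim_En tt])
lemma lim_r: "(%n. rE (A n) (t n)) \<longlonglongrightarrow> rE a t'" unfolding rE_def by (intro tendsto_intros lim_En lim_c lim_d)

lemmas uscal = ulim_const[OF lim_En] ulim_const[OF lim_c] ulim_const[OF lim_d] ulim_const[OF lim_r] ulim_const[OF tendsto_const]

lemma uq: "ulim (%n. qq (A n) (t n)) (qq a t')"
 unfolding qq_def[abs_def] by (intro ulim_add ulim_mult uscal uA)
lemma ugam: "ulim (%n. gam (A n) (t n)) (gam a t')"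
 unfolding gam_def[abs_def] by (intro ulim_add ulim_mult ulim_power uscal uA uP uR ulim_id)
lemma ull: "ulim (%n. ll (A n) (t n)) (ll a t')"
 unfolding ll_def[abs_def] by (intro ulim_add ulim_mult ulim_power uscal uA uP uR ulim_id ulim_const tendsto_intros lim_En)
lemma ukk: "ulim (%n. kk (A n) (t n)) (kk a t')"
 unfolding kk_def[abs_def] by (intro ulim_add ulim_diff ulim_mult ulim_power uscal uA uP uR ulim_id ulim_const tendsto_intros lim_En lim_r) auto
end

text \<open>The added two-sided bounds on \<open>qq\<close> are common to the sequence and its
  limit; their squares are the bi-Lipschitz constants that the composition lemmas need to be
  uniform.\<close>

locale flowseq = dataseq +
 fixes q0 Q :: real
 assumes q0: "0 < q0" and qA: "\<And>n x. q0 \<le> qq (A n) (t n) x" "\<And>n x. qq (A n) (t n) x \<le> Q"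
  and qa: "\<And>x. q0 \<le> qq a t' x" "\<And>x. qq a t' x \<le> Q"
begin

lemma uiq: "ulim (%n x. inverse (qq (A n) (t n) x)) (%x. inverse (qq a t' x))"
 by (rule ulim_inverse[OF uq q0 qA(1) qa(1)])
lemma uPhi: "ulim (%n. Phi (A n) (t n)) (Phi a t')"
 unfolding Phi_def[abs_def] divide_inverse by (intro ulim_mult ulim_diff uscal uA uiq)

lemma fl: "flowmap (gam (A n) (t n)) (eta (A n) (t n)) (%x. (qq (A n) (t n) x)\<^sup>2) (q0\<^sup>2) (Q\<^sup>2)"
 by (rule flowmap_gam[OF admA q0 qA])
lemma fl': "flowmap (gam a t') (eta a t') (%x. (qq a t' x)\<^sup>2) (q0\<^sup>2) (Q\<^sup>2)"
 by (rule flowmap_gam[OF adma q0 qa])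

lemma PosA: "t n \<in> Pos (A n)" "t' \<in> Pos a"
 unfolding Pos_def using q0 qA(1)[of n] qa(1) by (auto intro: less_le_trans)

lemma lim_gam: "x \<in> J ==> (%n. gam (A n) (t n) x) \<longlonglongrightarrow> gam a t' x"
 by (rule ulim_tendsto[OF ugam])

text \<open>With \<open>x\<close> the limiting label of \<open>y\<close>, the point
  \<open>gam (A n) (t n) x\<close> tends to \<open>y\<close>, and the common Lipschitz constant of
  the inverse maps transfers this to the labels.\<close>

lemma lim_eta: assumes y: "y \<in> J" shows "(%n. eta (A n) (t n) y) \<longlonglongrightarrow> eta a t' y"
proof -
 interpret f': flowmap "gam a t'" "eta a t'" "%x. (qq a t' x)\<^sup>2" "q0\<^sup>2" "Q\<^sup>2" by (rule fl')
 define x where "x = eta a t' y"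
 have x: "x \<in> J" "gam a t' x = y" unfolding x_def using f'.eta_mem_J[of y] y f'.inv by blast+
 have "(%n. \<bar>gam (A n) (t n) x - y\<bar> / q0\<^sup>2) \<longlonglongrightarrow> \<bar>gam a t' x - y\<bar> / q0\<^sup>2"
  by (intro tendsto_intros lim_gam x) (use q0 in auto)
 then have *: "(%n. \<bar>gam (A n) (t n) x - y\<bar> / q0\<^sup>2) \<longlonglongrightarrow> 0" using x by simp
 have "(%n. eta (A n) (t n) y - x) \<longlonglongrightarrow> 0"
 proof (rule Lim_null_comparison[OF _ *], rule always_eventually, rule allI)
  fix n
  interpret f: flowmap "gam (A n) (t n)" "eta (A n) (t n)" "%x. (qq (A n) (t n) x)\<^sup>2" "q0\<^sup>2" "Q\<^sup>2" by (rule fl)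
  show "norm (eta (A n) (t n) y - x) \<le> \<bar>gam (A n) (t n) x - y\<bar> / q0\<^sup>2"
   using f.eta_dist[of y "gam (A n) (t n) x"] by (simp add: f.inv abs_minus_commute)
 qed
 then show ?thesis unfolding x_def by (rule LIM_zero_cancel)
qed

lemma nsq_mult_tendsto:
 assumes H: "ulim H h" and B: "\<And>n. B n \<in> BM" "b \<in> BM" "nsq J b < \<infinity>"
  "(%n. nsq J (%x. B n x - b x)) \<longlonglongrightarrow> 0"
 shows "(%n. nsq J (%y. H n (eta (A n) (t n) y) * B n (eta (A n) (t n) y) - h (eta a t' y) * b (eta a t' y))) \<longlonglongrightarrow> 0"
  "nsq J (%y. h (eta a t' y) * b (eta a t' y)) < \<infinity>"
proof -
 obtain K where K: "0 \<le> K" "\<And>n x. x \<in> J ==> \<bar>H n x\<bar> \<le> K" "\<And>x. x \<in> J ==> \<bar>h x\<bar> \<le> K" using ulim_bounded[OF H] by metis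
 show "(%n. nsq J (%y. H n (eta (A n) (t n) y) * B n (eta (A n) (t n) y) - h (eta a t' y) * b (eta a t' y))) \<longlonglongrightarrow> 0"
  by (rule nsq_flow_tendsto[OF fl fl' lim_eta B ulim_measurable[OF H] K(2,3) ulim_tendsto[OF H]])
 have "nsq J (%y. h (eta a t' y) * b (eta a t' y)) \<le> ennreal (Q\<^sup>2) * nsq J (%x. h x * b x)"
  by (rule flowmap.nsq_comp_le[OF fl', of "%x. h x * b x"]) (use ulim_measurable[OF H] B in measurable)
 also have "... \<le> ennreal (Q\<^sup>2) * (ennreal (K\<^sup>2) * nsq J b)" by (intro mult_left_mono nsq_mult_le B K) auto
 also have "... < \<infinity>" using B(3) by (simp add: ennreal_mult_less_top)
 finally show "nsq J (%y. h (eta a t' y) * b (eta a t' y)) < \<infinity>" .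
qed

lemma nsq_J_1: "nsq J (%_. 1) < \<infinity>" "nsq J (%_. 0) < \<infinity>"
 by (rule nsq_bounded_finite[OF _ emeasure_J_finite, of _ 1]; simp)+

lemma nsq_tendsto:
 assumes H: "ulim H h"
 shows "(%n. nsq J (%y. H n (eta (A n) (t n) y) - h (eta a t' y))) \<longlonglongrightarrow> 0" "nsq J (%y. h (eta a t' y)) < \<infinity>"
 using nsq_mult_tendsto[OF H, of "%_ _. 1" "%_. 1"] nsq_J_1 by (auto simp: nsq_def)

lemma eta_measurable_all: "eta (A n) (t n) \<in> BM" "eta a t' \<in> BM"
 by (rule flowmap.eta_measurable[OF fl] flowmap.eta_measurable[OF fl'])+

lemma nsq_affine_tendsto:
 assumes G: "ulim G g" and H: "ulim H h" and B: "\<And>n. B n \<in> BM" "b \<in> BM" "nsq J b < \<infinity>"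
  "(%n. nsq J (%x. B n x - b x)) \<longlonglongrightarrow> 0"
 shows "(%n. nsq J (%y. (G n (eta (A n) (t n) y) + H n (eta (A n) (t n) y) * B n (eta (A n) (t n) y))
    - (g (eta a t' y) + h (eta a t' y) * b (eta a t' y)))) \<longlonglongrightarrow> 0"
  "nsq J (%y. g (eta a t' y) + h (eta a t' y) * b (eta a t' y)) < \<infinity>"
proof -
 note [measurable] = eta_measurable_all ulim_measurable[OF G] ulim_measurable[OF H] B(1,2)
 have "(%n. nsq J (%y. (G n (eta (A n) (t n) y) - g (eta a t' y)) +
   (H n (eta (A n) (t n) y) * B n (eta (A n) (t n) y) - h (eta a t' y) * b (eta a t' y)))) \<longlonglongrightarrow> 0"
  by (rule nsq_add_tendsto_0[OF _ _ _ nsq_tendsto(1)[OF G] nsq_mult_tendsto(1)[OF H B]]) measurable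
 then show "(%n. nsq J (%y. (G n (eta (A n) (t n) y) + H n (eta (A n) (t n) y) * B n (eta (A n) (t n) y))
    - (g (eta a t' y) + h (eta a t' y) * b (eta a t' y)))) \<longlonglongrightarrow> 0"
  by (simp add: algebra_simps)
 show "nsq J (%y. g (eta a t' y) + h (eta a t' y) * b (eta a t' y)) < \<infinity>"
  by (rule nsq_add_finite[OF _ _ _ nsq_tendsto(2)[OF G] nsq_mult_tendsto(2)[OF H B]]) measurable
qed

text \<open>Used for \<open>k = 1\<close>, with \<open>B n\<close> the derivative of the slope. The
  product rule for increments moves the Hoelder quotients of the coefficients into \<open>Q\<close>
  and \<open>Q2\<close> with \<open>\<beta> = 1/2\<close>, whence the restriction
  \<open>\<sigma> < 1/2\<close>.\<close>

lemma FK_affine_tendsto: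
 assumes G: "uhol G g" and H: "uhol H h" and s: "0 < \<sigma>" "\<sigma> < 1/2"
  and B: "\<And>n. B n \<in> BM" "b \<in> BM" "nsq J b < \<infinity>"
   "(%n. nsq J (%x. B n x - b x)) \<longlonglongrightarrow> 0"
   "nsq JJ (FK \<sigma> b) < \<infinity>" "(%n. nsq JJ (FK \<sigma> (%x. B n x - b x))) \<longlonglongrightarrow> 0"
 shows "(%n. nsq JJ (FK \<sigma> (%y. (G n (eta (A n) (t n) y) + H n (eta (A n) (t n) y) * B n (eta (A n) (t n) y))
    - (g (eta a t' y) + h (eta a t' y) * b (eta a t' y))))) \<longlonglongrightarrow> 0" (is ?A)
  "nsq JJ (FK \<sigma> (%y. g (eta a t' y) + h (eta a t' y) * b (eta a t' y))) < \<infinity>" (is ?B)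
proof -
 obtain K1 where K1: "0 \<le> K1" "\<And>n x y. x \<in> J ==> y \<in> J ==> \<bar>G n x - G n y\<bar> \<le> K1 * \<bar>x - y\<bar> powr (1/2)"
  "\<And>x y. x \<in> J ==> y \<in> J ==> \<bar>g x - g y\<bar> \<le> K1 * \<bar>x - y\<bar> powr (1/2)" using uholE[OF G] by metis
 obtain K2 where K2: "0 \<le> K2" "\<And>n x y. x \<in> J ==> y \<in> J ==> \<bar>H n x - H n y\<bar> \<le> K2 * \<bar>x - y\<bar> powr (1/2)"
  "\<And>x y. x \<in> J ==> y \<in> J ==> \<bar>h x - h y\<bar> \<le> K2 * \<bar>x - y\<bar> powr (1/2)" using uholE[OF H] by metis
 obtain K3 where K3: "0 \<le> K3" "\<And>n x. x \<in> J ==> \<bar>H n x\<bar> \<le> K3" "\<And>x. x \<in> J ==> \<bar>h x\<bar> \<le> K3" using ulim_bounded[OF uhol_ulim[OF H]] by metis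
 define K where "K = K1 + K2 + K3"
 define DQ where "DQ = (%(f::real=>real) (z::real\<times>real). (f (fst z) - f (snd z)) / \<bar>fst z - snd z\<bar> powr (1/2))"
 have DQm: "DQ f \<in> BM" if "f \<in> BM" for f
  unfolding DQ_def using that
  by (intro borel_measurable_divide borel_measurable_diff borel_measurable_fst_comp borel_measurable_snd_comp borel_measurable_abs_diff_powr)
 have DQb: "\<bar>DQ f z\<bar> \<le> L" if "\<And>x y. x \<in> J ==> y \<in> J ==> \<bar>f x - f y\<bar> \<le> L * \<bar>x - y\<bar> powr (1/2)" "0 \<le> L" "z \<in> J\<times>J" for f z L
 proof (cases "fst z = snd z")
  case False
  then have "\<bar>fst z - snd z\<bar> powr (1/2) > 0" by simp
  then show ?thesis using that(1)[of "fst z" "snd z"] that(3) unfolding DQ_def by (auto simp: field_simps mem_Times_iff)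
 qed (use that in \<open>simp add: DQ_def\<close>)
 have DQt: "(%n. DQ (F n) z) \<longlonglongrightarrow> DQ f z" if "ulim F f" "z \<in> J\<times>J" "fst z \<noteq> snd z" for F f z
  unfolding DQ_def using that by (intro tendsto_intros ulim_tendsto[OF that(1)]) (auto simp: mem_Times_iff)
 have dec: "(f0 x + f1 x * c x) - (f0 y + f1 y * c y) = (%z. f1 (fst z)) (x,y) * (c x - c y) +
   \<bar>x - y\<bar> powr (1/2) * (DQ f1 (x,y) * c y + DQ f0 (x,y))" for f0 f1 c :: "real => real" and x y
  by (cases "x = y") (auto simp: DQ_def field_simps)
 have dG: "(G n x + H n x * B n x) - (G n y + H n y * B n y) = H n (fst (x,y)) * (B n x - B n y) +
   \<bar>x - y\<bar> powr (1/2) * (DQ (H n) (x,y) * B n y + DQ (G n) (x,y))" if "x \<in> J" "y \<in> J" for n x y by (rule dec)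
 have dg: "(g x + h x * b x) - (g y + h y * b y) = h (fst (x,y)) * (b x - b y) +
   \<bar>x - y\<bar> powr (1/2) * (DQ h (x,y) * b y + DQ g (x,y))" if "x \<in> J" "y \<in> J" for x y by (rule dec)
 note mG = ulim_measurable[OF uhol_ulim[OF G]] and mH = ulim_measurable[OF uhol_ulim[OF H]]
 have Kle: "K1 \<le> K" "K2 \<le> K" "K3 \<le> K" unfolding K_def using K1(1) K2(1) K3(1) by auto
 have P3: "\<bar>H n (fst z)\<bar> \<le> K" "\<bar>h (fst z)\<bar> \<le> K" if "z \<in> J\<times>J" for n z
  using K3(2)[of "fst z" n] K3(3)[of "fst z"] that Kle by (auto simp: mem_Times_iff)
 have P5: "(%n. H n (fst z)) \<longlonglongrightarrow> h (fst z)" if "z \<in> J\<times>J" "fst z \<noteq> snd z" for z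
  using ulim_tendsto[OF uhol_ulim[OF H]] that by (auto simp: mem_Times_iff)
 have Q3: "\<bar>DQ (H n) z\<bar> \<le> K" "\<bar>DQ h z\<bar> \<le> K" "\<bar>DQ (G n) z\<bar> \<le> K" "\<bar>DQ g z\<bar> \<le> K" if "z \<in> J\<times>J" for n z
  using DQb[OF K2(2) K2(1) that, of n] DQb[OF K2(3) K2(1) that] DQb[OF K1(2) K1(1) that, of n] DQb[OF K1(3) K1(1) that] Kle
  by linarith+
 note FT' = FK_flow_tendsto[where G="%n x. G n x + H n x * B n x" and G'="%x. g x + h x * b x"
   and P="%n z. H n (fst z)" and P'="%z. h (fst z)" and \<alpha>=B and \<alpha>'=b and B=B and B'=b
   and Q="%n. DQ (H n)" and Q'="DQ h" and ?Q2.0="%n. DQ (G n)" and Q2'="DQ g" and K=K,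
   OF fl fl' lim_gam lim_eta s dG dg borel_measurable_fst_comp[OF mH(1)] borel_measurable_fst_comp[OF mH(2)] P3 P5
   DQm[OF mH(1)] DQm[OF mH(2)] Q3(1,2) DQt[OF uhol_ulim[OF H]] DQm[OF mG(1)] DQm[OF mG(2)] Q3(3,4) DQt[OF uhol_ulim[OF G]]
   B(1,2,5,6) B(1-4)]
 show ?A by (rule FT'(1))
 show ?B by (rule FT'(2))
qed

text \<open>By \<open>Phi_diff\<close> the increment has no remainder. The terms with
  \<open>Q\<close> and \<open>Q2\<close> are set to zero, and any \<open>\<beta>\<close> above
  \<open>\<sigma>\<close>, here 1, will do.\<close>

lemma FK_UX_tendsto:
 assumes s: "0 < \<sigma>" "\<sigma> < 1" and fin: "nsq JJ (FK \<sigma> a) < \<infinity>"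
  and lim: "(%n. nsq JJ (FK \<sigma> (%x. A n x - a x))) \<longlonglongrightarrow> 0"
 shows "(%n. nsq JJ (FK \<sigma> (%y. UX (A n) (t n) y - UX a t' y))) \<longlonglongrightarrow> 0" (is ?A)
  "nsq JJ (FK \<sigma> (UX a t')) < \<infinity>" (is ?B)
proof -
 obtain K where K: "0 \<le> K" "\<And>n x. x \<in> J ==> \<bar>inverse (qq (A n) (t n) x)\<bar> \<le> K" "\<And>x. x \<in> J ==> \<bar>inverse (qq a t' x)\<bar> \<le> K" using ulim_bounded[OF uiq] by metis
 define P where "P = (%n z. inverse (qq (A n) (t n) (fst z)) * inverse (qq (A n) (t n) (snd z)))"
 define P' where "P' = (%z. inverse (qq a t' (fst z)) * inverse (qq a t' (snd z)))"
 have dG: "Phi (A n) (t n) x - Phi (A n) (t n) y = P n (x,y) * (A n x - A n y) + \<bar>x - y\<bar> powr 1 * (0 * 0 + 0)" for n x y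
  unfolding P_def by (simp add: Phi_diff[OF admA PosA(1)] divide_inverse)
 have dg: "Phi a t' x - Phi a t' y = P' (x,y) * (a x - a y) + \<bar>x - y\<bar> powr 1 * (0 * 0 + 0)" for x y
  unfolding P'_def by (simp add: Phi_diff[OF adma PosA(2)] divide_inverse)
 have Pm: "P n \<in> BM" "P' \<in> BM" for n
  unfolding P_def P'_def
  by (intro borel_measurable_times borel_measurable_fst_comp borel_measurable_snd_comp ulim_measurable(1)[OF uiq] ulim_measurable(2)[OF uiq])+
 have Pb: "\<bar>P n z\<bar> \<le> K * K" "\<bar>P' z\<bar> \<le> K * K" if "z \<in> J\<times>J" for n z
 proof -
  have z: "fst z \<in> J" "snd z \<in> J" using that by (auto simp: mem_Times_iff)
  show "\<bar>P n z\<bar> \<le> K * K" "\<bar>P' z\<bar> \<le> K * K"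
   unfolding P_def P'_def abs_mult by (rule mult_mono[OF K(2)[OF z(1)] K(2)[OF z(2)] K(1) abs_ge_zero]
     mult_mono[OF K(3)[OF z(1)] K(3)[OF z(2)] K(1) abs_ge_zero])+
 qed
 have Pt: "(%n. P n z) \<longlonglongrightarrow> P' z" if "z \<in> J\<times>J" "fst z \<noteq> snd z" for z
  unfolding P_def P'_def using that by (intro tendsto_mult ulim_tendsto[OF uiq]) (auto simp: mem_Times_iff)
 have z: "\<bar>0\<bar> \<le> K * K" using K(1) by simp
 note mA = ulim_measurable[OF uA]
 have o: "(%n. nsq J (%x. 0 - 0)) \<longlonglongrightarrow> 0" by (simp add: nsq_def)
 note FT' = FK_flow_tendsto[where G="%n. Phi (A n) (t n)" and G'="Phi a t'"
   and P=P and P'=P' and \<alpha>=A and \<alpha>'=a and B="%n x. 0" and B'="%x. 0"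
   and Q="%n z. 0" and Q'="%z. 0" and ?Q2.0="%n z. 0" and Q2'="%z. 0" and K="K * K",
   OF fl fl' lim_gam lim_eta s dG dg Pm Pb Pt
   borel_measurable_const borel_measurable_const z z tendsto_const borel_measurable_const borel_measurable_const z z tendsto_const
   mA fin lim borel_measurable_const borel_measurable_const nsq_J_1(2) o, folded UX_def]
 show ?A by (rule FT'(1))
 show ?B using FT'(2) unfolding UX_def[abs_def] by blast
qed

text \<open>Velocity and acceleration are built from primitives of the slope and of its square, so
  they are continuously differentiable in the label even for a merely continuous slope, with
  derivatives bounded along the sequence.\<close>

lemma lipschitz_ll_kk:
 obtains K where "0 \<le> K"
  "\<And>n x y. x \<in> J ==> y \<in> J ==> \<bar>ll (A n) (t n) x - ll (A n) (t n) y\<bar> \<le> K * \<bar>x - y\<bar>"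
  "\<And>x y. x \<in> J ==> y \<in> J ==> \<bar>ll a t' x - ll a t' y\<bar> \<le> K * \<bar>x - y\<bar>"
  "\<And>n x y. x \<in> J ==> y \<in> J ==> \<bar>kk (A n) (t n) x - kk (A n) (t n) y\<bar> \<le> K * \<bar>x - y\<bar>"
  "\<And>x y. x \<in> J ==> y \<in> J ==> \<bar>kk a t' x - kk a t' y\<bar> \<le> K * \<bar>x - y\<bar>"
proof -
 have u1: "ulim (%n x. (cE (A n) (t n) * A n x - 2 * En (A n) * dE (A n) (t n)) * qq (A n) (t n) x)
   (%x. (cE a t' * a x - 2 * En a * dE a t') * qq a t' x)"
  by (intro ulim_mult ulim_diff uscal uA uq)
 obtain K1 where K1: "0 \<le> K1" "\<And>n x y. x \<in> J ==> y \<in> J ==> \<bar>ll (A n) (t n) x - ll (A n) (t n) y\<bar> \<le> K1 * \<bar>x - y\<bar>"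
  "\<And>x y. x \<in> J ==> y \<in> J ==> \<bar>ll a t' x - ll a t' y\<bar> \<le> K1 * \<bar>x - y\<bar>"
  using lipschitz_from_deriv[OF u1 ll_DERIV_x[OF admA] ll_DERIV_x[OF adma]] by metis
 have u2: "ulim (%n x. (cE (A n) (t n) * A n x - 2 * En (A n) * dE (A n) (t n))\<^sup>2 / 2 - En (A n) * (qq (A n) (t n) x)\<^sup>2)
   (%x. (cE a t' * a x - 2 * En a * dE a t')\<^sup>2 / 2 - En a * (qq a t' x)\<^sup>2)"
  unfolding divide_inverse by (intro ulim_mult ulim_diff ulim_power uscal uA uq)
 obtain K2 where K2: "0 \<le> K2" "\<And>n x y. x \<in> J ==> y \<in> J ==> \<bar>kk (A n) (t n) x - kk (A n) (t n) y\<bar> \<le> K2 * \<bar>x - y\<bar>"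
  "\<And>x y. x \<in> J ==> y \<in> J ==> \<bar>kk a t' x - kk a t' y\<bar> \<le> K2 * \<bar>x - y\<bar>"
  using lipschitz_from_deriv[OF u2 kk_DERIV_x[OF admA] kk_DERIV_x[OF adma]] by metis
 have le: "v \<le> (K1 + K2) * w" if "v \<le> K1 * w" "0 \<le> w" for v w
  using that K2(1) by (smt (verit) distrib_right mult_nonneg_nonneg)
 have le2: "v \<le> (K1 + K2) * w" if "v \<le> K2 * w" "0 \<le> w" for v w
  using that K1(1) by (smt (verit) distrib_right mult_nonneg_nonneg)
 show thesis
 proof (rule that[of "K1 + K2"])
  show "0 \<le> K1 + K2" using K1(1) K2(1) by simp
 qed (rule le[OF K1(2)] le[OF K1(3)] le2[OF K2(2)] le2[OF K2(3)]; simp)+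
qed

text \<open>In the label, the increment of \<open>kk - Phi * ll\<close> is \<open>- ll\<close> times
  the increment of \<open>Phi\<close>, given exactly by \<open>Phi_diff\<close>, plus increments of
  \<open>kk\<close> and \<open>ll\<close>, which are Lipschitz. Hence
  \<open>\<beta> = 1\<close>.\<close>

lemma FK_VV_tendsto:
 assumes s: "0 < \<sigma>" "\<sigma> < 1" and fin: "nsq JJ (FK \<sigma> a) < \<infinity>"
  and lim: "(%n. nsq JJ (FK \<sigma> (%x. A n x - a x))) \<longlonglongrightarrow> 0"
 shows "(%n. nsq JJ (FK \<sigma> (%y. VV (A n) (t n) y - VV a t' y))) \<longlonglongrightarrow> 0" (is ?A)
  "nsq JJ (FK \<sigma> (VV a t')) < \<infinity>" (is ?B)
proof -
 obtain K where K: "0 \<le> K" "\<And>n x. x \<in> J ==> \<bar>inverse (qq (A n) (t n) x)\<bar> \<le> K" "\<And>x. x \<in> J ==> \<bar>inverse (qq a t' x)\<bar> \<le> K" using ulim_bounded[OF uiq] by metis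
 obtain M where M: "0 \<le> M" "\<And>n x. x \<in> J ==> \<bar>ll (A n) (t n) x\<bar> \<le> M" "\<And>x. x \<in> J ==> \<bar>ll a t' x\<bar> \<le> M" using ulim_bounded[OF ull] by metis
 obtain N where N: "0 \<le> N" "\<And>n x. x \<in> J ==> \<bar>Phi (A n) (t n) x\<bar> \<le> N" "\<And>x. x \<in> J ==> \<bar>Phi a t' x\<bar> \<le> N" using ulim_bounded[OF uPhi] by metis
 obtain L where L: "0 \<le> L"
  "\<And>n x y. x \<in> J ==> y \<in> J ==> \<bar>ll (A n) (t n) x - ll (A n) (t n) y\<bar> \<le> L * \<bar>x - y\<bar>"
  "\<And>x y. x \<in> J ==> y \<in> J ==> \<bar>ll a t' x - ll a t' y\<bar> \<le> L * \<bar>x - y\<bar>"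
  "\<And>n x y. x \<in> J ==> y \<in> J ==> \<bar>kk (A n) (t n) x - kk (A n) (t n) y\<bar> \<le> L * \<bar>x - y\<bar>"
  "\<And>x y. x \<in> J ==> y \<in> J ==> \<bar>kk a t' x - kk a t' y\<bar> \<le> L * \<bar>x - y\<bar>"
  using lipschitz_ll_kk by blast
 \<comment> \<open>\<open>Pf\<close> is the multiplier of the slope increment and \<open>Rf\<close>
   the Lipschitz quotient of the remainder.\<close>
 define Pf where "Pf = (%q l (z::real\<times>real). - (l (fst z) * (inverse (q (fst z)) * inverse (q (snd z)))) :: real)"
 define Rf where "Rf = (%k l f (z::real\<times>real). ((k (fst z) - k (snd z)) - f (snd z) * (l (fst z) - l (snd z))) / \<bar>fst z - snd z\<bar> powr 1 :: real)"
 define G where "G = (%k l f (x::real). k x - f x * l x :: real)"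
 have dec: "G k l f x - G k l f y = Pf q l (x,y) * (\<alpha> x - \<alpha> y) + \<bar>x - y\<bar> powr 1 * (0 * 0 + Rf k l f (x,y))"
  if "f x - f y = (\<alpha> x - \<alpha> y) * (inverse (q x) * inverse (q y))" for k l f q \<alpha> :: "real => real" and x y
 proof -
  have "\<bar>x - y\<bar> powr 1 * Rf k l f (x,y) = (k x - k y) - f y * (l x - l y)"
   by (cases "x = y") (auto simp: Rf_def)
  moreover have "Pf q l (x,y) * (\<alpha> x - \<alpha> y) = - l x * (f x - f y)" unfolding that Pf_def by simp
  ultimately show ?thesis unfolding G_def by (simp add: algebra_simps)
 qed
 have dG: "G (kk (A n) (t n)) (ll (A n) (t n)) (Phi (A n) (t n)) x - G (kk (A n) (t n)) (ll (A n) (t n)) (Phi (A n) (t n)) y =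
   Pf (qq (A n) (t n)) (ll (A n) (t n)) (x,y) * (A n x - A n y) + \<bar>x - y\<bar> powr 1 * (0 * 0 + Rf (kk (A n) (t n)) (ll (A n) (t n)) (Phi (A n) (t n)) (x,y))" for n x y
  by (rule dec) (simp add: Phi_diff[OF admA PosA(1)] divide_inverse)
 have dg: "G (kk a t') (ll a t') (Phi a t') x - G (kk a t') (ll a t') (Phi a t') y =
   Pf (qq a t') (ll a t') (x,y) * (a x - a y) + \<bar>x - y\<bar> powr 1 * (0 * 0 + Rf (kk a t') (ll a t') (Phi a t') (x,y))" for x y
  by (rule dec) (simp add: Phi_diff[OF adma PosA(2)] divide_inverse)
 have Pm: "Pf q l \<in> BM" if "(%x. inverse (q x)) \<in> BM" "l \<in> BM" for q l
  unfolding Pf_def using that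
  by (intro borel_measurable_uminus borel_measurable_times borel_measurable_fst_comp borel_measurable_snd_comp
    borel_measurable_fst_comp[of "%x. inverse (q x)"] borel_measurable_snd_comp[of "%x. inverse (q x)"])
 have Rm: "Rf k l f \<in> BM" if "k \<in> BM" "l \<in> BM" "f \<in> BM" for k l f
  unfolding Rf_def using that
  by (intro borel_measurable_divide borel_measurable_diff borel_measurable_times borel_measurable_fst_comp borel_measurable_snd_comp borel_measurable_abs_diff_powr)
 define KK where "KK = M * (K * K) + (L + N * L)"
 have Pb: "\<bar>Pf q l z\<bar> \<le> KK" if "\<And>x. x \<in> J ==> \<bar>inverse (q x)\<bar> \<le> K" "\<And>x. x \<in> J ==> \<bar>l x\<bar> \<le> M" "z \<in> J\<times>J" for q l z
 proof -
  have "\<bar>Pf q l z\<bar> \<le> M * (K * K)" unfolding Pf_def abs_minus_cancel abs_mult using that K(1) M(1)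
   by (intro mult_mono) (auto simp: mem_Times_iff)
  then show ?thesis unfolding KK_def using L(1) N(1) by (smt (verit) mult_nonneg_nonneg)
 qed
 have Rb: "\<bar>Rf k l f z\<bar> \<le> KK" if "\<And>x y. x \<in> J ==> y \<in> J ==> \<bar>k x - k y\<bar> \<le> L * \<bar>x - y\<bar>"
  "\<And>x y. x \<in> J ==> y \<in> J ==> \<bar>l x - l y\<bar> \<le> L * \<bar>x - y\<bar>" "\<And>x. x \<in> J ==> \<bar>f x\<bar> \<le> N" "z \<in> J\<times>J" for k l f z
 proof -
  have z: "fst z \<in> J" "snd z \<in> J" using that(4) by (auto simp: mem_Times_iff)
  have "\<bar>(k (fst z) - k (snd z)) - f (snd z) * (l (fst z) - l (snd z))\<bar> \<le> \<bar>k (fst z) - k (snd z)\<bar> + \<bar>f (snd z)\<bar> * \<bar>l (fst z) - l (snd z)\<bar>"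
   by (metis abs_mult abs_triangle_ineq4)
  also have "... \<le> L * \<bar>fst z - snd z\<bar> + N * (L * \<bar>fst z - snd z\<bar>)"
   by (intro add_mono mult_mono that z) (use N(1) in auto)
  finally have "\<bar>(k (fst z) - k (snd z)) - f (snd z) * (l (fst z) - l (snd z))\<bar> \<le> (L + N * L) * \<bar>fst z - snd z\<bar>" by (simp add: algebra_simps)
  then have "\<bar>Rf k l f z\<bar> \<le> L + N * L"
   using L(1) N(1) by (cases "fst z = snd z") (auto simp: Rf_def field_simps)
  then show ?thesis unfolding KK_def using K(1) M(1) by (smt (verit) mult_nonneg_nonneg)
 qed
 have Pt: "(%n. Pf (qq (A n) (t n)) (ll (A n) (t n)) z) \<longlonglongrightarrow> Pf (qq a t') (ll a t') z" if "z \<in> J\<times>J" "fst z \<noteq> snd z" for z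
  unfolding Pf_def using that by (intro tendsto_minus tendsto_mult ulim_tendsto[OF uiq] ulim_tendsto[OF ull]) (auto simp: mem_Times_iff)
 have Rt: "(%n. Rf (kk (A n) (t n)) (ll (A n) (t n)) (Phi (A n) (t n)) z) \<longlonglongrightarrow> Rf (kk a t') (ll a t') (Phi a t') z" if "z \<in> J\<times>J" "fst z \<noteq> snd z" for z
  unfolding Rf_def using that
  by (intro tendsto_divide tendsto_diff tendsto_mult tendsto_const ulim_tendsto[OF ukk] ulim_tendsto[OF ull] ulim_tendsto[OF uPhi]) (auto simp: mem_Times_iff)
 have KK0: "0 \<le> KK" unfolding KK_def using K(1) L(1) M(1) N(1) by simp
 then have z: "\<bar>0\<bar> \<le> KK" by simp
 have o: "(%n. nsq J (%x. 0 - 0)) \<longlonglongrightarrow> 0" by (simp add: nsq_def)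
 note FT' = FK_flow_tendsto[where G="%n. G (kk (A n) (t n)) (ll (A n) (t n)) (Phi (A n) (t n))" and G'="G (kk a t') (ll a t') (Phi a t')"
   and P="%n. Pf (qq (A n) (t n)) (ll (A n) (t n))" and P'="Pf (qq a t') (ll a t')" and \<alpha>=A and \<alpha>'=a and B="%n x. 0" and B'="%x. 0"
   and Q="%n z. 0" and Q'="%z. 0" and ?Q2.0="%n. Rf (kk (A n) (t n)) (ll (A n) (t n)) (Phi (A n) (t n))" and Q2'="Rf (kk a t') (ll a t') (Phi a t')" and K=KK,
   OF fl fl' lim_gam lim_eta s dG dg Pm[OF ulim_measurable(1)[OF uiq] ulim_measurable(1)[OF ull]] Pm[OF ulim_measurable(2)[OF uiq] ulim_measurable(2)[OF ull]]
   Pb[OF K(2) M(2)] Pb[OF K(3) M(3)] Pt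
   borel_measurable_const borel_measurable_const z z tendsto_const
   Rm[OF ulim_measurable(1)[OF ukk] ulim_measurable(1)[OF ull] ulim_measurable(1)[OF uPhi]]
   Rm[OF ulim_measurable(2)[OF ukk] ulim_measurable(2)[OF ull] ulim_measurable(2)[OF uPhi]]
   Rb[OF L(4) L(2) N(2)] Rb[OF L(5) L(3) N(3)] Rt
   ulim_measurable[OF uA] fin lim borel_measurable_const borel_measurable_const nsq_J_1(2) o]
 have e: "VV (A n) (t n) y = G (kk (A n) (t n)) (ll (A n) (t n)) (Phi (A n) (t n)) (eta (A n) (t n) y)" for n y
  unfolding VV_def G_def ..
 have e': "VV a t' = (%y. G (kk a t') (ll a t') (Phi a t') (eta a t' y))" unfolding VV_def[abs_def] G_def ..
 show ?A unfolding e e' by (rule FT'(1))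
 show ?B unfolding e' by (rule FT'(2))
qed

end

subsection \<open>Convergence of the flow in Sobolev norms\<close>

text \<open>Positivity at the limit is stable: uniform convergence of \<open>qq\<close> gives the
  bounds \<open>q0/2\<close> and \<open>Q + q0\<close> from some index on, and the terms before it
  are shifted away.\<close>

lemma (in dataseq) eventually_flowseq:
 assumes t': "t' \<in> Pos a"
 obtains N q0 Q where "flowseq (%n. A (n + N)) a (%n. t (n + N)) t' q0 Q"
proof -
 obtain q0 Q where q: "0 < q0" "\<And>x. q0 \<le> qq a t' x" "\<And>x. qq a t' x \<le> Q" using Pos_bounds[OF adma t'] by metis
 have "\<forall>\<^sub>F n in sequentially. \<forall>x\<in>J. dist (qq (A n) (t n) x) (qq a t' x) < q0/2"
  using uq q(1) unfolding ulim_def by (intro uniform_limitD) auto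
 then obtain N where N: "\<And>n x. n \<ge> N ==> x \<in> J ==> \<bar>qq (A n) (t n) x - qq a t' x\<bar> < q0/2"
  unfolding eventually_sequentially dist_real_def by blast
 have N': "\<bar>qq (A n) (t n) x - qq a t' x\<bar> < q0/2" if "n \<ge> N" for n x
  using N[OF that clmp_mem[of x]] qq_clmp[OF admA, of n "t n" x] qq_clmp[OF adma, of t' x] by simp
 have "flowseq (%n. A (n + N)) a (%n. t (n + N)) t' (q0/2) (Q + q0)"
 proof unfold_locales
  show "uniform_limit J (%n. A (n + N)) a sequentially"
   using ul unfolding uniform_limit_iff by (auto simp: eventually_sequentially) (metis trans_le_add1)
  show "(%n. t (n + N)) \<longlonglongrightarrow> t'" using tt by (rule LIMSEQ_ignore_initial_segment)
  show "q0/2 \<le> qq (A (n + N)) (t (n + N)) x" for n x using N'[of "n+N" x, OF le_add2] q(2)[of x] by linarith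
  show "qq (A (n + N)) (t (n + N)) x \<le> Q + q0" for n x using N'[of "n+N" x, OF le_add2] q(3)[of x] q(1) by linarith
  show "q0/2 \<le> qq a t' x" for x using q(2)[of x] q(1) by simp
  show "qq a t' x \<le> Q + q0" for x using q(3)[of x] q(1) by simp
 qed (use admA adma q(1) in auto)
 then show thesis using that by blast
qed

lemma dataseq_const: "adm a ==> t \<longlonglongrightarrow> t' ==> dataseq (%_. a) a t t'"
 by unfold_locales (auto intro: uniform_limit_const)

lemma ulim_tendsto_seq:
 assumes "ulim F f" "x \<longlonglongrightarrow> x'" "\<And>n. x n \<in> J"
 shows "(%n. F n (x n)) \<longlonglongrightarrow> f x'"
proof -
 have c: "continuous_on UNIV f" and ul: "uniform_limit J F f sequentially" using assms(1) unfolding ulim_def by auto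
 have "(%n. F n (x n) - f (x n)) \<longlonglongrightarrow> 0"
 proof (rule LIMSEQ_I)
  fix r :: real assume "0 < r"
  then have "\<forall>\<^sub>F n in sequentially. \<forall>x\<in>J. dist (F n x) (f x) < r" using ul by (intro uniform_limitD)
  then show "\<exists>no. \<forall>n\<ge>no. norm (F n (x n) - f (x n) - 0) < r"
   using assms(3) unfolding eventually_sequentially dist_norm diff_zero by blast
 qed
 moreover have "(%n. f (x n)) \<longlonglongrightarrow> f x'"
  by (rule isCont_tendsto_compose[OF _ assms(2)]) (use c in \<open>simp add: continuous_on_eq_continuous_at\<close>)
 ultimately have "(%n. (F n (x n) - f (x n)) + f (x n)) \<longlonglongrightarrow> 0 + f x'" by (rule tendsto_add)
 then show ?thesis by simp
qed

text \<open>The second space derivative: the label derivative of \<open>Phi\<close> is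
  \<open>b\<close> over the square of \<open>qq\<close>, and passing to positions divides by the
  Jacobian, the same square, once more. The leading \<open>0 +\<close> gives the shape
  \<open>G + H * B\<close> of \<open>nsq_affine_tendsto\<close>.\<close>

definition UXX where "UXX a b t y = 0 + inverse (qq a t (eta a t y)) ^ 4 * b (eta a t y)"
text \<open>The mixed derivative, read off from the equation differentiated in space:
  \<open>u_tx = - u_x^2/2 - E - u * u_xx\<close>.\<close>

definition VX where "VX a b t y = (- ((Phi a t (eta a t y))\<^sup>2 * (1/2)) + - En a)
  + - (ll a t (eta a t y) * inverse (qq a t (eta a t y)) ^ 4) * b (eta a t y)"

lemma ennreal_tendsto_0_bounded:
 fixes x :: "nat => ennreal"
 assumes "x \<longlonglongrightarrow> 0" "\<And>n. x n < \<infinity>"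
 obtains K where "0 \<le> K" "\<And>n. x n \<le> ennreal K"
proof -
 have "\<forall>\<^sub>F n in sequentially. x n < 1" using assms(1) by (intro order_tendstoD) auto
 then obtain N where N: "\<And>n. n \<ge> N ==> x n < 1" unfolding eventually_sequentially by blast
 define K where "K = 1 + (\<Sum>n<N. enn2real (x n))"
 have s: "0 \<le> (\<Sum>n<N. enn2real (x n))" by (intro sum_nonneg) auto
 have "x n \<le> ennreal K" for n
 proof (cases "n < N")
  case True
  have "x n = ennreal (enn2real (x n))" using assms(2)[of n] by simp
  also have "... \<le> ennreal (\<Sum>n<N. enn2real (x n))" using True by (intro ennreal_leI member_le_sum) auto
  also have "... \<le> ennreal K" unfolding K_def by (intro ennreal_leI) simp
  finally show ?thesis .
 next
  case False
  then have "x n \<le> ennreal 1" using N[of n] by simp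
  also have "... \<le> ennreal K" unfolding K_def using s by (intro ennreal_leI) simp
  finally show ?thesis .
 qed
 then show thesis using that[of K] s unfolding K_def by simp
qed

locale flowseqB = flowseq +
 fixes B :: "nat => real => real" and b :: "real => real"
 assumes Bm: "\<And>n. B n \<in> BM" "b \<in> BM"
  and Bf: "\<And>n. nsq J (B n) < \<infinity>" "nsq J b < \<infinity>"
  and rep: "\<And>n x. x \<in> J ==> A n x = A n 0 + (LINT y:{0..x}|lborel. B n y)"
  and Bl: "(%n. nsq J (%x. B n x - b x)) \<longlonglongrightarrow> 0"
begin

text \<open>L2 convergence of finite norms bounds all \<open>B n\<close> by one constant, and
  \<open>chain_holder\<close> turns this into a common Hoelder constant for the slopes.\<close>

lemma uhA: "uhol A a"
proof -
 have fin: "nsq J (%x. B n x - b x) < \<infinity>" for n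
 proof -
  have "nsq J (%x. - b x) = nsq J b" by (simp add: nsq_def)
  then have "nsq J (%x. B n x + - b x) < \<infinity>" by (intro nsq_add_finite) (use Bm Bf in auto)
  then show ?thesis by simp
 qed
 obtain K0 where K0: "0 \<le> K0" "\<And>n. nsq J (%x. B n x - b x) \<le> ennreal K0" using ennreal_tendsto_0_bounded[OF Bl fin] by metis
 obtain N0 where N0: "0 \<le> N0" "nsq J b = ennreal N0" using Bf(2) by (cases "nsq J b") auto
 define N where "N = 2 * K0 + 2 * N0"
 have N: "0 \<le> N" "nsq J (B n) \<le> ennreal N" for n
 proof -
  show "0 \<le> N" unfolding N_def using K0 N0 by simp
  have "nsq J (%x. (B n x - b x) + b x) \<le> 2 * nsq J (%x. B n x - b x) + 2 * nsq J b" by (rule nsq_add) (use Bm in auto)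
  also have "... \<le> 2 * ennreal K0 + 2 * ennreal N0" using K0(2)[of n] N0(2) by (intro add_mono mult_left_mono) auto
  also have "... = ennreal N" unfolding N_def using K0 N0 by (simp add: ennreal_mult ennreal_plus)
  finally show "nsq J (B n) \<le> ennreal N" by simp
 qed
 have "\<bar>A n x - A n y\<bar> \<le> sqrt N * \<bar>x - y\<bar> powr (1/2)" if "x \<in> J" "y \<in> J" for n x y
 proof -
  define hs where "hs = (%j::nat. if j = 0 then A n else B n)"
  have "nsq J (A n) < \<infinity>"
  proof -
   obtain K where "\<And>x. x \<in> J ==> \<bar>A n x\<bar> \<le> K" using continuous_bounded_J[OF adm_cont[OF admA]] by metis
   then show ?thesis by (intro nsq_bounded_finite[OF _ emeasure_J_finite]) auto
  qed
  then have "chain 1 hs" unfolding chain_def hs_def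
   using Bm(1)[of n] Bf(1)[of n] ulim_measurable(1)[OF uA, of n] rep by (intro conjI allI impI ballI) (auto simp only: less_one if_True if_False split: if_split)
  from chain_holder[OF this, of N x y] N that show ?thesis by (simp add: hs_def)
 qed
 then show ?thesis using uA N(1) unfolding uhol_def by (intro conjI exI[of _ "sqrt N"]) auto
qed

lemmas uhscal = uhol_const[OF lim_En] uhol_const[OF lim_c] uhol_const[OF lim_d] uhol_const[OF lim_r] uhol_const[OF tendsto_const]

lemma uhq: "uhol (%n. qq (A n) (t n)) (qq a t')"
 unfolding qq_def[abs_def] by (intro uhol_add uhol_mult uhscal uhA)
lemma uhiq: "uhol (%n x. inverse (qq (A n) (t n) x)) (%x. inverse (qq a t' x))"
 by (rule uhol_inverse[OF uhq q0 qA(1) qa(1)])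
lemma uhminus: "uhol F f ==> uhol (%n x. - F n x) (%x. - f x)"
 using uhol_mult[OF uhol_const[OF tendsto_const, of "-1"], of F f] by simp
lemma uhPhi: "uhol (%n. Phi (A n) (t n)) (Phi a t')"
proof -
 have "uhol (%n x. (cE (A n) (t n) * A n x + - (2 * En (A n) * dE (A n) (t n))) * inverse (qq (A n) (t n) x))
  (%x. (cE a t' * a x + - (2 * En a * dE a t')) * inverse (qq a t' x))"
  by (intro uhol_mult uhol_add uhminus uhscal uhA uhiq)
 then show ?thesis unfolding Phi_def[abs_def] divide_inverse by simp
qed
lemma uhll: "uhol (%n. ll (A n) (t n)) (ll a t')"
 by (rule uhol_from_deriv[OF ull _ ll_DERIV_x[OF admA] ll_DERIV_x[OF adma]]) (intro ulim_mult ulim_diff uscal uA uq)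

lemma uhg: "uhol (%n x. - ((Phi (A n) (t n) x)\<^sup>2 * (1/2)) + - En (A n)) (%x. - ((Phi a t' x)\<^sup>2 * (1/2)) + - En a)"
 by (intro uhol_add uhminus uhol_mult uhol_power uhPhi uhscal)
lemma uhh: "uhol (%n x. - (ll (A n) (t n) x * inverse (qq (A n) (t n) x) ^ 4)) (%x. - (ll a t' x * inverse (qq a t' x) ^ 4))"
 by (intro uhminus uhol_mult uhol_power uhll uhiq)
lemma uh0: "uhol (%n x. 0) (%x. 0)" by (rule uhscal)
lemma uhi4: "uhol (%n x. inverse (qq (A n) (t n) x) ^ 4) (%x. inverse (qq a t' x) ^ 4)"
 by (intro uhol_power uhiq)

lemma nsq_UXX: "(%n. nsq J (%y. UXX (A n) (B n) (t n) y - UXX a b t' y)) \<longlonglongrightarrow> 0" "nsq J (UXX a b t') < \<infinity>"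
 unfolding UXX_def[abs_def] by (rule nsq_affine_tendsto[OF uhol_ulim[OF uh0] uhol_ulim[OF uhi4] Bm Bf(2) Bl])+

lemma nsq_VX: "(%n. nsq J (%y. VX (A n) (B n) (t n) y - VX a b t' y)) \<longlonglongrightarrow> 0" "nsq J (VX a b t') < \<infinity>"
 unfolding VX_def[abs_def] by (rule nsq_affine_tendsto[OF uhol_ulim[OF uhg] uhol_ulim[OF uhh] Bm Bf(2) Bl])+

lemma FK_UXX_VX:
 assumes "0 < \<sigma>" "\<sigma> < 1/2" "nsq JJ (FK \<sigma> b) < \<infinity>" "(%n. nsq JJ (FK \<sigma> (%x. B n x - b x))) \<longlonglongrightarrow> 0"
 shows "(%n. nsq JJ (FK \<sigma> (%y. UXX (A n) (B n) (t n) y - UXX a b t' y))) \<longlonglongrightarrow> 0" "nsq JJ (FK \<sigma> (UXX a b t')) < \<infinity>"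
  "(%n. nsq JJ (FK \<sigma> (%y. VX (A n) (B n) (t n) y - VX a b t' y))) \<longlonglongrightarrow> 0" "nsq JJ (FK \<sigma> (VX a b t')) < \<infinity>"
 unfolding UXX_def[abs_def] VX_def[abs_def]
 by (rule FK_affine_tendsto[OF uh0 uhi4 assms(1,2) Bm Bf(2) Bl assms(3,4)] FK_affine_tendsto[OF uhg uhh assms(1,2) Bm Bf(2) Bl assms(3,4)])+

end

definition dch where "dch a b (j::nat) = (if j = 0 then a else b :: real => real)"
definition cU where "cU a b t (j::nat) = (if j = 0 then UU a t else if j = 1 then UX a t else UXX a b t)"
definition cV where "cV a b t (j::nat) = (if j = 0 then VV a t else VX a b t)"

text \<open>With \<open>s = Suc k + \<sigma>\<close> the first alternative is
  \<open>3/2 < s < 2\<close> and the second \<open>2 \<le> s < 5/2\<close>; the slope has regularity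
  \<open>k + \<sigma>\<close>. The value \<open>s = 2\<close> is \<open>k = 1\<close>,
  \<open>\<sigma> = 0\<close>, where the norm has no Gagliardo term.\<close>

definition kcase :: "nat => real => bool" where
 "kcase k \<sigma> \<longleftrightarrow> (k = 0 \<and> 1/2 < \<sigma> \<and> \<sigma> < 1) \<or> (k = 1 \<and> 0 \<le> \<sigma> \<and> \<sigma> < 1/2)"

definition good :: "nat => real => (real => real) => (real => real) => bool" where
 "good k \<sigma> a b \<longleftrightarrow> adm a \<and> chain k (dch a b) \<and> HN \<sigma> k (dch a b) < \<infinity>"

lemma tendsto_0_ennreal_sandwich:
 fixes x y :: "nat => ennreal"
 assumes "(%n. x n + y n) \<longlonglongrightarrow> 0" shows "x \<longlonglongrightarrow> 0" "y \<longlonglongrightarrow> 0"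
 by (rule tendsto_0_ennreal_le[OF assms], simp add: add_increasing2, rule tendsto_0_ennreal_le[OF assms], simp add: add_increasing)

lemma tendsto_0_ennreal_add:
 fixes x y :: "nat => ennreal"
 assumes "x \<longlonglongrightarrow> 0" "y \<longlonglongrightarrow> 0" shows "(%n. x n + y n) \<longlonglongrightarrow> 0"
 using tendsto_add[OF assms] by simp

lemma HN_0: "HN \<sigma> 0 hs = nsq J (hs 0) + (if \<sigma> > 0 then nsq JJ (FK \<sigma> (hs 0)) else 0)"
 and HN_1: "HN \<sigma> 1 hs = nsq J (hs 0) + (nsq J (hs 1) + (if \<sigma> > 0 then nsq JJ (FK \<sigma> (hs 1)) else 0))"
 and HN_2: "HN \<sigma> 2 hs = nsq J (hs 0) + (nsq J (hs 1) + (nsq J (hs 2) + (if \<sigma> > 0 then nsq JJ (FK \<sigma> (hs 2)) else 0)))"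
 unfolding HN_def by (simp_all add: numeral_2_eq_2 add.assoc)

text \<open>The tail supplied by \<open>eventually_flowseq\<close> carries the uniform bounds. On it
  every entry of the chains of \<open>u\<close> and \<open>u_t\<close> is a composite covered by one
  of the composition lemmas, and \<open>LIMSEQ_offset\<close> undoes the shift.\<close>

theorem flow_tendsto:
 assumes ks: "kcase k \<sigma>" and ds: "dataseq A a t t'" and t': "t' \<in> Pos a"
  and gA: "\<And>n. good k \<sigma> (A n) (B n)" and ga: "good k \<sigma> a b"
  and lim: "(%n. HN \<sigma> k (%j x. dch (A n) (B n) j x - dch a b j x)) \<longlonglongrightarrow> 0"
 shows "(%n. HN \<sigma> (Suc k) (%j x. cU (A n) (B n) (t n) j x - cU a b t' j x)) \<longlonglongrightarrow> 0"
  "(%n. HN \<sigma> k (%j x. cV (A n) (B n) (t n) j x - cV a b t' j x)) \<longlonglongrightarrow> 0"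
  "HN \<sigma> (Suc k) (cU a b t') < \<infinity>" "HN \<sigma> k (cV a b t') < \<infinity>"
  "\<forall>\<^sub>F n in sequentially. t n \<in> Pos (A n)"
  "\<And>y. y \<in> J ==> (%n. VV (A n) (t n) y) \<longlonglongrightarrow> VV a t' y"
proof -
 obtain N q0 Q where fs: "flowseq (%n. A (n + N)) a (%n. t (n + N)) t' q0 Q"
  using dataseq.eventually_flowseq[OF ds t'] by metis
 interpret f: flowseq "%n. A (n + N)" a "%n. t (n + N)" t' q0 Q by (rule fs)
 note off = LIMSEQ_offset[of _ N]
 have s: "(%n. HN \<sigma> k (%j x. dch (A (n+N)) (B (n+N)) j x - dch a b j x)) \<longlonglongrightarrow> 0"
  using LIMSEQ_ignore_initial_segment[OF lim] .
 have uV: "ulim (%n x. kk (A (n+N)) (t (n+N)) x - Phi (A (n+N)) (t (n+N)) x * ll (A (n+N)) (t (n+N)) x)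
   (%x. kk a t' x - Phi a t' x * ll a t' x)"
  by (intro ulim_diff ulim_mult f.ukk f.uPhi f.ull)
 have u0: "(%n. nsq J (%y. UU (A (n+N)) (t (n+N)) y - UU a t' y)) \<longlonglongrightarrow> 0" "nsq J (UU a t') < \<infinity>"
  "(%n. nsq J (%y. UX (A (n+N)) (t (n+N)) y - UX a t' y)) \<longlonglongrightarrow> 0" "nsq J (UX a t') < \<infinity>"
  "(%n. nsq J (%y. VV (A (n+N)) (t (n+N)) y - VV a t' y)) \<longlonglongrightarrow> 0" "nsq J (VV a t') < \<infinity>"
  using f.nsq_tendsto[OF f.ull] f.nsq_tendsto[OF f.uPhi] f.nsq_tendsto[OF uV]
  unfolding UU_def[abs_def] UX_def[abs_def] VV_def[abs_def] by auto
 have conj: "(%n. HN \<sigma> (Suc k) (%j x. cU (A (n+N)) (B (n+N)) (t (n+N)) j x - cU a b t' j x)) \<longlonglongrightarrow> 0 \<and>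
  (%n. HN \<sigma> k (%j x. cV (A (n+N)) (B (n+N)) (t (n+N)) j x - cV a b t' j x)) \<longlonglongrightarrow> 0 \<and>
  HN \<sigma> (Suc k) (cU a b t') < \<infinity> \<and> HN \<sigma> k (cV a b t') < \<infinity>"
  using ks unfolding kcase_def
 proof
  assume k: "k = 0 \<and> 1/2 < \<sigma> \<and> \<sigma> < 1"
  have sg: "0 < \<sigma>" "\<sigma> < 1" using k by auto
  have fin: "nsq JJ (FK \<sigma> a) < \<infinity>" using ga k sg unfolding good_def by (simp add: HN_0 dch_def)
  have fl: "(%n. nsq JJ (FK \<sigma> (%x. A (n+N) x - a x))) \<longlonglongrightarrow> 0"
   using tendsto_0_ennreal_sandwich(2)[OF s[unfolded conjunct1[OF k] HN_0]] sg by (simp add: dch_def)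
  show ?thesis
   using u0 f.FK_UX_tendsto[OF sg fin fl] f.FK_VV_tendsto[OF sg fin fl] k sg
   by (auto simp: HN_0 HN_1[unfolded One_nat_def] cU_def cV_def intro!: tendsto_0_ennreal_add)
 next
  assume k: "k = 1 \<and> 0 \<le> \<sigma> \<and> \<sigma> < 1/2"
  have k1: "k = 1" using k by simp
  have ch: "chain 1 (dch (A n) (B n))" "chain 1 (dch a b)" for n using gA ga k1 unfolding good_def by auto
  have b1: "(%n. nsq J (%x. B (n+N) x - b x)) \<longlonglongrightarrow> 0"
   and b2: "\<sigma> > 0 ==> (%n. nsq JJ (FK \<sigma> (%x. B (n+N) x - b x))) \<longlonglongrightarrow> 0"
   using tendsto_0_ennreal_sandwich[OF tendsto_0_ennreal_sandwich(2)[OF s[unfolded k1 HN_1]]] by (simp_all add: dch_def)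
  interpret fb: flowseqB "%n. A (n + N)" a "%n. t (n + N)" t' q0 Q "%n. B (n + N)" b
  proof unfold_locales
   show "B (n+N) \<in> BM" "b \<in> BM" for n
    using chain_measurable[OF ch(1), of 1 "n+N"] chain_measurable[OF ch(2), of 1] by (auto simp: dch_def)
   show "nsq J (B (n+N)) < \<infinity>" "nsq J b < \<infinity>" for n
    using chain_finite[OF ch(1), of 1 "n+N"] chain_finite[OF ch(2), of 1] by (auto simp: dch_def)
   show "A (n+N) x = A (n+N) 0 + (LINT y:{0..x}|lborel. B (n+N) y)" if "x \<in> J" for n x
    using chain_eq[OF ch(1)[of "n+N"] _ that, of 0] by (simp add: dch_def)
   show "(%n. nsq J (%x. B (n+N) x - b x)) \<longlonglongrightarrow> 0" by (rule b1)
  qed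
  have b3: "nsq JJ (FK \<sigma> b) < \<infinity>" if "\<sigma> > 0" using ga k1 that unfolding good_def by (simp add: HN_1[unfolded One_nat_def] dch_def)
  have two: "Suc 1 = 2" "Suc (Suc 0) = 2" by auto
  show ?thesis
  proof (cases "\<sigma> > 0")
   case True
   show ?thesis using u0 fb.nsq_UXX fb.nsq_VX fb.FK_UXX_VX[OF True _ b3[OF True] b2[OF True]] k True unfolding k1 two HN_1 HN_2
    by (auto simp: cU_def cV_def intro!: tendsto_0_ennreal_add)
  next
   case False
   show ?thesis using u0 fb.nsq_UXX fb.nsq_VX False unfolding k1 two HN_1 HN_2
    by (auto simp: cU_def cV_def intro!: tendsto_0_ennreal_add)
  qed
 qed
 show "(%n. HN \<sigma> (Suc k) (%j x. cU (A n) (B n) (t n) j x - cU a b t' j x)) \<longlonglongrightarrow> 0"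
  by (rule off) (use conj in blast)
 show "(%n. HN \<sigma> k (%j x. cV (A n) (B n) (t n) j x - cV a b t' j x)) \<longlonglongrightarrow> 0"
  by (rule off) (use conj in blast)
 show "HN \<sigma> (Suc k) (cU a b t') < \<infinity>" "HN \<sigma> k (cV a b t') < \<infinity>" using conj by auto
 show "\<forall>\<^sub>F n in sequentially. t n \<in> Pos (A n)"
  unfolding eventually_sequentially using f.PosA(1) by (intro exI[of _ N]) (metis add.commute le_Suc_ex)
 show "(%n. VV (A n) (t n) y) \<longlonglongrightarrow> VV a t' y" if y: "y \<in> J" for y
 proof (rule off)
  interpret f': flowmap "gam a t'" "eta a t'" "%x. (qq a t' x)\<^sup>2" "q0\<^sup>2" "Q\<^sup>2" by (rule f.fl')
  have eJ: "eta (A (n+N)) (t (n+N)) y \<in> J" for n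
   using flowmap.eta_mem_J[OF f.fl] y by blast
  from ulim_tendsto_seq[OF uV f.lim_eta[OF y] eJ]
  show "(%n. VV (A (n+N)) (t (n+N)) y) \<longlonglongrightarrow> VV a t' y" unfolding VV_def .
 qed
qed

section \<open>The flow in Eulerian coordinates and the equation it solves\<close>

lemma eta_DERIV:
 assumes a: "adm a" and t: "t \<in> Pos a"
 shows "(eta a t has_real_derivative inverse ((qq a t (eta a t y))\<^sup>2)) (at y)"
proof -
 obtain m M where "flowmap (gam a t) (eta a t) (%x. (qq a t x)\<^sup>2) m M" using flowmap_Pos[OF a t] by metis
 then interpret flowmap "gam a t" "eta a t" "%x. (qq a t x)\<^sup>2" m M .
 show ?thesis
 proof (rule DERIV_inverse_function[of "gam a t" _ _ _ "y - 1" "y + 1"])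
  show "isCont (eta a t) y" using eta_cont by (simp add: continuous_on_eq_continuous_at)
  show "(qq a t (eta a t y))\<^sup>2 \<noteq> 0" using qq_pos[OF a t, of "eta a t y"] by simp
 qed (auto intro: deriv inv)
qed

lemma UU_DERIV:
 assumes a: "adm a" and t: "t \<in> Pos a"
 shows "(UU a t has_real_derivative UX a t y) (at y)"
proof -
 have q: "qq a t (eta a t y) \<noteq> 0" using qq_pos[OF a t, of "eta a t y"] by simp
 have "((%y. ll a t (eta a t y)) has_real_derivative ((cE a t * a (eta a t y) - 2 * En a * dE a t) * qq a t (eta a t y)) * inverse ((qq a t (eta a t y))\<^sup>2)) (at y)"
  by (rule DERIV_chain2[OF ll_DERIV_x[OF a] eta_DERIV[OF a t]])
 then show ?thesis unfolding UU_def[abs_def] UX_def Phi_qq[OF a t] using q by (simp add: power2_eq_square field_simps)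
qed

text \<open>Since \<open>kk\<close> is the acceleration, this is the differentiated equation
  \<open>(u_t + u * u_x)_x = u_x^2/2 - E\<close>.\<close>

lemma kk_eta_DERIV:
 assumes a: "adm a" and t: "t \<in> Pos a"
 shows "((%y. kk a t (eta a t y)) has_real_derivative (UX a t y)\<^sup>2 / 2 - En a) (at y)"
proof -
 have q: "qq a t (eta a t y) \<noteq> 0" using qq_pos[OF a t, of "eta a t y"] by simp
 have "((%y. kk a t (eta a t y)) has_real_derivative ((cE a t * a (eta a t y) - 2 * En a * dE a t)\<^sup>2 / 2 - En a * (qq a t (eta a t y))\<^sup>2) * inverse ((qq a t (eta a t y))\<^sup>2)) (at y)"
  by (rule DERIV_chain2[OF kk_DERIV_x[OF a] eta_DERIV[OF a t]])
 moreover have "((P * r)\<^sup>2 / 2 - e * r\<^sup>2) * inverse (r\<^sup>2) = P\<^sup>2 / 2 - e" if "r \<noteq> 0" for P r e :: real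
 proof -
  have "r\<^sup>2 * inverse (r\<^sup>2) = 1" using that by simp
  then show ?thesis by (simp add: power_mult_distrib left_diff_distrib mult.assoc)
 qed
 ultimately show ?thesis unfolding UX_def Phi_qq[OF a t] using q by simp
qed

lemma eta_ends: assumes "adm a" "t \<in> Pos a" shows "eta a t 0 = 0" "eta a t (1/2) = 1/2"
proof -
 obtain m M where "flowmap (gam a t) (eta a t) (%x. (qq a t x)\<^sup>2) m M" using flowmap_Pos[OF assms] by metis
 then interpret flowmap "gam a t" "eta a t" "%x. (qq a t x)\<^sup>2" m M .
 show "eta a t 0 = 0" "eta a t (1/2) = 1/2" by (rule eta_0 eta_half)+
qed

lemma eta_cont': assumes "adm a" "t \<in> Pos a" shows "continuous_on S (eta a t)"
 using eta_DERIV[OF assms] by (meson DERIV_isCont continuous_at_imp_continuous_on)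

lemma eta_in_J: assumes "adm a" "t \<in> Pos a" "y \<in> J" shows "eta a t y \<in> J"
proof -
 obtain m M where "flowmap (gam a t) (eta a t) (%x. (qq a t x)\<^sup>2) m M" using flowmap_Pos[OF assms(1,2)] by metis
 then show ?thesis using flowmap.eta_mem_J assms(3) by blast
qed

lemma UX_cont: assumes "adm a" "t \<in> Pos a" shows "continuous_on S (UX a t)"
 unfolding UX_def[abs_def] by (rule continuous_on_compose2[OF Phi_cont[OF assms, of UNIV] eta_cont'[OF assms]]) auto

lemma UU_cont: assumes "adm a" "t \<in> Pos a" shows "continuous_on S (UU a t)"
 using UU_DERIV[OF assms] by (meson DERIV_isCont continuous_at_imp_continuous_on)

lemma VV_eq: "VV a t y = kk a t (eta a t y) - UX a t y * UU a t y"
 unfolding VV_def UX_def UU_def ..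

lemma VV_cont: assumes "adm a" "t \<in> Pos a" shows "continuous_on S (VV a t)"
proof -
 have "continuous_on S (%y. kk a t (eta a t y))"
  by (rule continuous_on_compose2[OF kk_cont[OF assms(1), of UNIV] eta_cont'[OF assms]]) auto
 then show ?thesis unfolding VV_eq[abs_def] by (intro continuous_intros UX_cont UU_cont assms)
qed

lemma UU_VV_ends: assumes "adm a" "t \<in> Pos a"
 shows "UU a t 0 = 0" "UU a t (1/2) = 0" "VV a t 0 = 0" "VV a t (1/2) = 0"
 unfolding VV_eq UU_def eta_ends[OF assms] gam_ends[OF assms(1)] by simp_all

text \<open>The acceleration vanishes at both ends. Integrating \<open>kk_eta_DERIV\<close> over
  \<open>J\<close> therefore identifies the constant \<open>En a\<close> with the current energy,
  and integrating up to \<open>y\<close> gives the equation.\<close>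

lemma mhs_equation:
 assumes a: "adm a" and t: "t \<in> Pos a" and y: "y \<in> J"
 shows "VV a t y + UU a t y ^ 1 * deriv (UU a t) y = mhs_rhs 1 (UU a t) y"
proof -
 have d: "deriv (UU a t) = UX a t" using UU_DERIV[OF a t] by (auto intro: DERIV_imp_deriv)
 have ftc: "((%z. (UX a t z)\<^sup>2 / 2 - En a) has_integral kk a t (eta a t y) - kk a t (eta a t 0)) {0..y}" if "0 \<le> y" for y
  by (rule fundamental_theorem_of_calculus) (use that kk_eta_DERIV[OF a t] in \<open>auto simp: has_real_derivative_iff_has_vector_derivative[symmetric] intro: has_field_derivative_at_within\<close>)
 have z: "kk a t (eta a t 0) = 0" "kk a t (eta a t (1/2)) = 0" unfolding eta_ends[OF a t] gam_ends[OF a] by simp_all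
 have i: "(%z. (UX a t z)\<^sup>2) integrable_on {0..y}" for y
  by (intro integrable_continuous_interval continuous_intros UX_cont a t)
 have E: "integral J (%z. (UX a t z)\<^sup>2) = En a"
 proof -
  have "0 = integral J (%z. (UX a t z)\<^sup>2 / 2 - En a)" using ftc[of "1/2"] z by (simp add: integral_unique)
  also have "... = integral J (%z. (UX a t z)\<^sup>2 / 2) - integral J (%z. En a)"
   by (rule Henstock_Kurzweil_Integration.integral_diff) (use i[of "1/2"] in \<open>auto intro: integrable_on_divide\<close>)
  also have "... = integral J (%z. (UX a t z)\<^sup>2) / 2 - En a / 2" by simp
  finally show ?thesis by simp
 qed
 have "mhs_rhs 1 (UU a t) y = 1/2 * integral {0..y} (%z. (UX a t z)\<^sup>2 - 2 * En a)"
  unfolding mhs_rhs_def d by (simp add: E)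
 also have "... = integral {0..y} (%z. 1/2 * ((UX a t z)\<^sup>2 - 2 * En a))" by simp
 also have "... = integral {0..y} (%z. (UX a t z)\<^sup>2 / 2 - En a)" by (simp add: algebra_simps)
 also have "... = kk a t (eta a t y)" using ftc[of y] y z by (simp add: integral_unique)
 finally show ?thesis unfolding d VV_eq by simp
qed

text \<open>The label of a fixed position moves with time. The difference quotient is rewritten by
  mean values alone: \<open>gam\<close> and \<open>ll\<close> are each changed once in time and once
  in the label. As both labels are sent to the same \<open>y\<close>, the two changes of
  \<open>gam\<close> cancel, which gives the label increment; all intermediate points
  converge.\<close>

lemma UU_DERIV_t:
 assumes a: "adm a" and t: "t \<in> Pos a" and y: "y \<in> J"
 shows "((%t. UU a t y) has_real_derivative VV a t y) (at t)"
 unfolding has_field_derivative_iff tendsto_at_iff_sequentially o_def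
proof (intro allI impI)
 fix \<tau> assume \<tau>1: "\<forall>i. \<tau> i \<in> UNIV - {t}" and \<tau>2: "\<tau> \<longlonglongrightarrow> t"
 have ds: "dataseq (%_. a) a \<tau> t" by (rule dataseq_const[OF a \<tau>2])
 obtain N q0 Q where fs: "flowseq (%n. a) a (%n. \<tau> (n + N)) t q0 Q"
  using dataseq.eventually_flowseq[OF ds t] by metis
 interpret f: flowseq "%n. a" a "%n. \<tau> (n + N)" t q0 Q by (rule fs)
 define s where "s = (%n. \<tau> (n + N))"
 have s: "s n \<noteq> t" "s \<longlonglongrightarrow> t" "s n \<in> Pos a" for n
  using \<tau>1 f.tt f.PosA(1)[of n] unfolding s_def by auto
 define x where "x = (%n. eta a (s n) y)"
 define x' where "x' = eta a t y"
 have xl: "x \<longlonglongrightarrow> x'" unfolding x_def x'_def s_def by (rule f.lim_eta[OF y])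
 have xJ: "x n \<in> J" "x' \<in> J" for n unfolding x_def x'_def using eta_in_J[OF a s(3) y] eta_in_J[OF a t y] by auto
 have gx: "gam a (s n) (x n) = y" "gam a t x' = y" for n
  unfolding x_def x'_def s_def using flowmap.inv(2)[OF f.fl] flowmap.inv(2)[OF f.fl'] by auto
 have mvt: "\<exists>z. (u \<le> z \<and> z \<le> v \<or> v \<le> z \<and> z \<le> u) \<and> F v - F u = (v - u) * F' z"
  if "\<And>z. (F has_real_derivative F' z) (at z)" for F F' :: "real => real" and u v
 proof -
  consider "u < v" | "u = v" | "v < u" by linarith
  then show ?thesis
  proof cases
   case 1
   then have "\<exists>z>u. z < v \<and> F v - F u = (v - u) * F' z" by (intro MVT2) (auto intro: that)
   then obtain z where "u < z" "z < v" "F v - F u = (v - u) * F' z" by blast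
   then show ?thesis by (intro exI[of _ z]) auto
  next
   case 3
   then have "\<exists>z>v. z < u \<and> F u - F v = (u - v) * F' z" by (intro MVT2) (auto intro: that)
   then obtain z where "v < z" "z < u" "F u - F v = (u - v) * F' z" by blast
   then show ?thesis by (intro exI[of _ z]) (auto simp: algebra_simps)
  qed auto
 qed
 have "\<forall>n. \<exists>z. (t \<le> z \<and> z \<le> s n \<or> s n \<le> z \<and> z \<le> t) \<and> gam a (s n) (x n) - gam a t (x n) = (s n - t) * ll a z (x n)"
 proof
  fix n
  show "\<exists>z. (t \<le> z \<and> z \<le> s n \<or> s n \<le> z \<and> z \<le> t) \<and> gam a (s n) (x n) - gam a t (x n) = (s n - t) * ll a z (x n)"
   by (rule mvt[of "%t. gam a t (x n)" "%t. ll a t (x n)"]) (rule gam_DERIV_t)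
 qed
 then obtain z1 where z1: "\<And>n. t \<le> z1 n \<and> z1 n \<le> s n \<or> s n \<le> z1 n \<and> z1 n \<le> t" "\<And>n. gam a (s n) (x n) - gam a t (x n) = (s n - t) * ll a (z1 n) (x n)" by metis
 have "\<forall>n. \<exists>z. (t \<le> z \<and> z \<le> s n \<or> s n \<le> z \<and> z \<le> t) \<and> ll a (s n) (x n) - ll a t (x n) = (s n - t) * kk a z (x n)"
 proof
  fix n
  show "\<exists>z. (t \<le> z \<and> z \<le> s n \<or> s n \<le> z \<and> z \<le> t) \<and> ll a (s n) (x n) - ll a t (x n) = (s n - t) * kk a z (x n)"
   by (rule mvt[of "%t. ll a t (x n)" "%t. kk a t (x n)"]) (rule ll_DERIV_t)
 qed
 then obtain z2 where z2: "\<And>n. t \<le> z2 n \<and> z2 n \<le> s n \<or> s n \<le> z2 n \<and> z2 n \<le> t" "\<And>n. ll a (s n) (x n) - ll a t (x n) = (s n - t) * kk a (z2 n) (x n)" by metis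
 have "\<forall>n. \<exists>z. (x' \<le> z \<and> z \<le> x n \<or> x n \<le> z \<and> z \<le> x') \<and> gam a t (x n) - gam a t x' = (x n - x') * (qq a t z)\<^sup>2"
  by (rule allI, rule mvt[of "gam a t" "%x. (qq a t x)\<^sup>2"], rule gam_DERIV_x[OF a])
 then obtain z3 where z3: "\<And>n. x' \<le> z3 n \<and> z3 n \<le> x n \<or> x n \<le> z3 n \<and> z3 n \<le> x'" "\<And>n. gam a t (x n) - gam a t x' = (x n - x') * (qq a t (z3 n))\<^sup>2" by metis
 define lx where "lx = (%x. (cE a t * a x - 2 * En a * dE a t) * qq a t x)"
 have "\<forall>n. \<exists>z. (x' \<le> z \<and> z \<le> x n \<or> x n \<le> z \<and> z \<le> x') \<and> ll a t (x n) - ll a t x' = (x n - x') * lx z"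
  by (rule allI, rule mvt[of "ll a t" lx], unfold lx_def, rule ll_DERIV_x[OF a])
 then obtain z4 where z4: "\<And>n. x' \<le> z4 n \<and> z4 n \<le> x n \<or> x n \<le> z4 n \<and> z4 n \<le> x'" "\<And>n. ll a t (x n) - ll a t x' = (x n - x') * lx (z4 n)" by metis
 have between: "z \<longlonglongrightarrow> u" if "\<And>n. u \<le> z n \<and> z n \<le> w n \<or> w n \<le> z n \<and> z n \<le> u" "w \<longlonglongrightarrow> u" for z w :: "nat => real" and u
 proof -
  have "(%n. z n - u) \<longlonglongrightarrow> 0"
  proof (rule Lim_null_comparison)
   show "\<forall>\<^sub>F n in sequentially. norm (z n - u) \<le> \<bar>w n - u\<bar>" using that(1) by (intro always_eventually allI) (smt (verit) real_norm_def)
   show "(%n. \<bar>w n - u\<bar>) \<longlonglongrightarrow> 0" using that(2) by (simp add: LIM_zero tendsto_rabs_zero)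
  qed
  then show ?thesis by (rule LIM_zero_cancel)
 qed
 note zl = between[OF z1(1) s(2)] between[OF z2(1) s(2)] between[OF z3(1) xl] between[OF z4(1) xl]
 interpret d1: dataseq "%_. a" a z1 t by (rule dataseq_const[OF a zl(1)])
 interpret d2: dataseq "%_. a" a z2 t by (rule dataseq_const[OF a zl(2)])
 have L1: "(%n. ll a (z1 n) (x n)) \<longlonglongrightarrow> ll a t x'" by (rule ulim_tendsto_seq[OF d1.ull xl xJ(1)])
 have L2: "(%n. kk a (z2 n) (x n)) \<longlonglongrightarrow> kk a t x'" by (rule ulim_tendsto_seq[OF d2.ukk xl xJ(1)])
 have qc: "isCont (qq a t) u" for u using qq_cont[OF a, of UNIV] by (simp add: continuous_on_eq_continuous_at)
 have L3: "(%n. (qq a t (z3 n))\<^sup>2) \<longlonglongrightarrow> (qq a t x')\<^sup>2" by (intro tendsto_power isCont_tendsto_compose[OF qc] zl)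
 have "continuous_on UNIV lx" unfolding lx_def by (intro continuous_intros adm_cont qq_cont a)
 then have L4: "(%n. lx (z4 n)) \<longlonglongrightarrow> lx x'" by (intro isCont_tendsto_compose[OF _ zl(4)]) (simp add: continuous_on_eq_continuous_at)
 have qp: "(qq a t u)\<^sup>2 > 0" for u using qq_pos[OF a t, of u] by simp
 have quot: "(x n - x') = - (s n - t) * ll a (z1 n) (x n) / (qq a t (z3 n))\<^sup>2" for n
 proof -
  have "(s n - t) * ll a (z1 n) (x n) + (x n - x') * (qq a t (z3 n))\<^sup>2 = 0"
   using z1(2)[of n] z3(2)[of n] gx by simp
  then have "(x n - x') * (qq a t (z3 n))\<^sup>2 = - (s n - t) * ll a (z1 n) (x n)" by linarith
  then show ?thesis using qp[of "z3 n"] by (simp add: eq_divide_eq)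
 qed
 have "(UU a (s n) y - UU a t y) / (s n - t) = kk a (z2 n) (x n) - ll a (z1 n) (x n) / (qq a t (z3 n))\<^sup>2 * lx (z4 n)" for n
 proof -
  have "UU a (s n) y - UU a t y = (s n - t) * kk a (z2 n) (x n) + (x n - x') * lx (z4 n)"
   using z2(2)[of n] z4(2)[of n] unfolding UU_def x_def x'_def by simp
  also have "... = (s n - t) * (kk a (z2 n) (x n) - ll a (z1 n) (x n) / (qq a t (z3 n))\<^sup>2 * lx (z4 n))"
   unfolding quot by (simp add: algebra_simps diff_divide_distrib)
  finally show ?thesis using s(1)[of n] by simp
 qed
 moreover have "(%n. kk a (z2 n) (x n) - ll a (z1 n) (x n) / (qq a t (z3 n))\<^sup>2 * lx (z4 n)) \<longlonglongrightarrow> kk a t x' - ll a t x' / (qq a t x')\<^sup>2 * lx x'"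
  by (intro tendsto_intros L1 L2 L3 L4) (use qp[of x'] in auto)
 moreover have "kk a t x' - ll a t x' / (qq a t x')\<^sup>2 * lx x' = VV a t y"
  using qq_pos[OF a t, of x'] unfolding VV_def lx_def x'_def[symmetric] Phi_qq[OF a t] by (simp add: power2_eq_square)
 ultimately have "(%n. (UU a (s n) y - UU a t y) / (s n - t)) \<longlonglongrightarrow> VV a t y" by simp
 then show "(%n. (UU a (\<tau> n) y - UU a t y) / (\<tau> n - t)) \<longlonglongrightarrow> VV a t y" unfolding s_def by (rule LIMSEQ_offset)
qed

subsection \<open>Time averages\<close>

text \<open>Steps of length at most \<open>d/2\<close> telescope on both sides, so the total
  increment of \<open>H\<close> is at most \<open>e\<close> times that of \<open>\<nu>\<close>, for
  every positive \<open>e\<close>.\<close>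

lemma local_increment_const:
 fixes H \<nu> :: "real => real"
 assumes "\<And>e. e > 0 ==> \<exists>d>0. \<forall>x y. x \<in> J \<longrightarrow> y \<in> J \<longrightarrow> x \<le> y \<longrightarrow> y - x < d \<longrightarrow> \<bar>H y - H x\<bar> \<le> e * (\<nu> y - \<nu> x)"
  and "x \<in> J"
 shows "H x = H 0"
proof -
 have "\<bar>H x - H 0\<bar> \<le> e * (\<nu> x - \<nu> 0)" if e: "e > 0" for e
 proof -
  obtain d where d: "d > 0" "\<And>x y. x \<in> J ==> y \<in> J ==> x \<le> y ==> y - x < d ==> \<bar>H y - H x\<bar> \<le> e * (\<nu> y - \<nu> x)"
   using assms(1)[OF e] by blast
  have "\<bar>H y - H 0\<bar> \<le> e * (\<nu> y - \<nu> 0)" if "y \<in> J" "y \<le> real n * (d/2)" for n y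
   using that
  proof (induction n arbitrary: y)
   case 0
   then have "y = 0" by simp
   then show ?case by simp
  next
   case (Suc n)
   define z where "z = max 0 (y - d/2)"
   have z: "z \<in> J" "z \<le> y" "y - z < d" "z \<le> real n * (d/2)"
    using Suc.prems d(1) unfolding z_def by (auto simp: algebra_simps max_def)
   have "\<bar>H y - H 0\<bar> \<le> \<bar>H y - H z\<bar> + \<bar>H z - H 0\<bar>" by linarith
   also have "... \<le> e * (\<nu> y - \<nu> z) + e * (\<nu> z - \<nu> 0)"
    by (intro add_mono d(2) Suc.IH z Suc.prems)
   finally show ?case by (simp add: algebra_simps)
  qed
  moreover obtain n where "x / (d/2) \<le> real n" using real_arch_simple by blast
  then have "x \<le> real n * (d/2)" using d(1) by (simp add: field_simps)
  ultimately show ?thesis using assms(2) by blast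
 qed
 then have *: "\<bar>H x - H 0\<bar> \<le> e * \<bar>\<nu> x - \<nu> 0\<bar>" if "e > 0" for e
  using that by (meson abs_ge_self mult_left_mono order_trans less_imp_le)
 have "\<bar>H x - H 0\<bar> \<le> 0"
 proof (rule field_le_epsilon)
  fix e :: real assume e: "e > 0"
  define k where "k = \<bar>\<nu> x - \<nu> 0\<bar>"
  have "k \<ge> 0" unfolding k_def by simp
  then have "e / (k + 1) > 0" "e / (k + 1) * k \<le> e" using e by (auto simp: field_simps)
  then show "\<bar>H x - H 0\<bar> \<le> 0 + e" using *[of "e / (k+1)"] unfolding k_def[symmetric] by linarith
 qed
 then show ?thesis by simp
qed

lemma C1_integral_rep:
 assumes "\<And>x. (F has_real_derivative F' x) (at x)" "continuous_on UNIV F'" "x \<in> J"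
 shows "F x = F 0 + (LINT y:{0..x}|lborel. F' y)"
proof -
 have "(F' has_integral F x - F 0) {0..x}"
  by (rule fundamental_theorem_of_calculus) (use assms in \<open>auto simp: has_real_derivative_iff_has_vector_derivative[symmetric] intro: has_field_derivative_at_within\<close>)
 moreover have "(LINT y:{0..x}|lborel. F' y) = integral {0..x} F'"
  by (rule set_integral_J_continuous(1)) (rule continuous_on_subset[OF assms(2)], simp)
 ultimately show ?thesis by (simp add: integral_unique)
qed

lemma nsq_continuous_finite: "continuous_on UNIV f ==> nsq J f < \<infinity>"
 using continuous_bounded_J[of f] nsq_bounded_finite[OF _ emeasure_J_finite, of f] by (metis atLeastAtMost_borel)

lemma nsq_mult_continuous_finite:
 assumes "continuous_on UNIV f" "b \<in> BM" "nsq J b < \<infinity>"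
 shows "nsq J (%x. f x * b x) < \<infinity>"
proof -
 obtain K where "\<And>x. x \<in> J ==> \<bar>f x\<bar> \<le> K" using continuous_bounded_J[OF assms(1)] by metis
 then have "nsq J (%x. f x * b x) \<le> ennreal (K\<^sup>2) * nsq J b" by (intro nsq_mult_le assms) auto
 also have "... < \<infinity>" using assms(3) by (simp add: ennreal_mult_less_top)
 finally show ?thesis .
qed

text \<open>A chain rule for absolutely continuous functions that avoids differentiating almost
  everywhere. On a short interval the coefficients \<open>P\<close> and \<open>R\<close> are within
  \<open>e\<close> of their diagonal values, so the increments of \<open>f\<close> and of the
  proposed integral differ by at most \<open>e\<close> times the integral of
  \<open>\<bar>b\<bar> + \<bar>c\<bar>\<close>, and \<open>local_increment_const\<close>
  applies.\<close>

lemma integral_rep_of_difference: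
 fixes P R :: "real \<times> real => real"
 assumes P: "continuous_on JJ P" "continuous_on JJ R"
  and a: "\<And>x. x \<in> J ==> a x = a 0 + (LINT y:{0..x}|lborel. b y)" "b \<in> BM" "nsq J b < \<infinity>"
  and m: "\<And>x. x \<in> J ==> m x = m 0 + (LINT y:{0..x}|lborel. c y)" "c \<in> BM" "nsq J c < \<infinity>"
  and f: "\<And>x y. x \<in> J ==> y \<in> J ==> f x - f y = P (x,y) * (a x - a y) + R (x,y) * (m x - m y)"
  and x: "x \<in> J"
 shows "f x = f 0 + (LINT y:{0..x}|lborel. P (y,y) * b y + R (y,y) * c y)"
proof -
 define p r where "p = (%y. P (clmp y, clmp y))" and "r = (%y. R (clmp y, clmp y))"
 have pc: "continuous_on UNIV p" "continuous_on UNIV r"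
  unfolding p_def r_def
  by (rule continuous_on_compose2[OF P(1)] continuous_on_compose2[OF P(2)], intro continuous_on_Pair clmp_continuous, use clmp_mem in blast)+
 have pJ: "p y = P (y,y)" "r y = R (y,y)" if "y \<in> J" for y unfolding p_def r_def using clmp_J[OF that] by auto
 define g where "g = (%y. p y * b y + r y * c y)"
 note [measurable] = borel_measurable_continuous_onI[OF pc(1)] borel_measurable_continuous_onI[OF pc(2)] a(2) m(2)
 have bi: "set_integrable lborel J b" "set_integrable lborel J c" by (rule set_integrable_nsq_J[OF a(2,3)] set_integrable_nsq_J[OF m(2,3)])+
 have gi: "set_integrable lborel J (%y. p y * b y)" "set_integrable lborel J (%y. r y * c y)"
  using nsq_mult_continuous_finite[OF pc(1) a(2,3)] nsq_mult_continuous_finite[OF pc(2) m(2,3)]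
  by (auto intro!: set_integrable_nsq_J)
 have gi': "set_integrable lborel J g" unfolding g_def by (rule set_integral_add(1)[OF gi])
 define \<nu> where "\<nu> = (%x. LINT y:{0..x}|lborel. \<bar>b y\<bar> + \<bar>c y\<bar>)"
 have ai: "set_integrable lborel J (%y. \<bar>b y\<bar> + \<bar>c y\<bar>)"
  by (rule set_integral_add(1)) (use bi in \<open>auto intro: set_integrable_abs\<close>)
 define H where "H = (%x. f x - (LINT y:{0..x}|lborel. g y))"
 have "H x = H 0"
 proof (rule local_increment_const[OF _ x, of H \<nu>])
  fix e :: real assume e: "e > 0"
  have "uniformly_continuous_on JJ P" "uniformly_continuous_on JJ R"
   by (intro compact_uniformly_continuous P compact_Times compact_Icc)+
  then have "\<exists>d>0. \<forall>z\<in>JJ. \<forall>w\<in>JJ. dist w z < d \<longrightarrow> dist (P w) (P z) < e"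
   "\<exists>d>0. \<forall>z\<in>JJ. \<forall>w\<in>JJ. dist w z < d \<longrightarrow> dist (R w) (R z) < e"
   using e unfolding uniformly_continuous_on_def by simp_all
  then obtain d1 d2 where d1: "d1 > 0" "\<And>z w. z \<in> J\<times>J ==> w \<in> J\<times>J ==> dist w z < d1 ==> dist (P w) (P z) < e"
   and d2: "d2 > 0" "\<And>z w. z \<in> J\<times>J ==> w \<in> J\<times>J ==> dist w z < d2 ==> dist (R w) (R z) < e"
   by blast
  define d where "d = min d1 d2 / 2"
  show "\<exists>d>0. \<forall>x y. x \<in> J \<longrightarrow> y \<in> J \<longrightarrow> x \<le> y \<longrightarrow> y - x < d \<longrightarrow> \<bar>H y - H x\<bar> \<le> e * (\<nu> y - \<nu> x)"
  proof (intro exI[of _ d] conjI allI impI)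
   show "d > 0" unfolding d_def using d1(1) d2(1) by simp
   fix x y :: real assume xy: "x \<in> J" "y \<in> J" "x \<le> y" "y - x < d"
   have sub: "set_integrable lborel {x..y} F" if "set_integrable lborel J F" for F :: "real => real"
    by (rule set_integrable_subset[OF that]) (use xy in auto)
   have sp: "(LINT z:{x..y}|lborel. F z) = (LINT z:{0..y}|lborel. F z) - (LINT z:{0..x}|lborel. F z)" if "set_integrable lborel J F" for F :: "real => real"
    by (rule set_integral_split[OF that]) (use xy in auto)
   have est: "\<bar>P (y,x) - p z\<bar> \<le> e" "\<bar>R (y,x) - r z\<bar> \<le> e" if z: "z \<in> {x..y}" for z
   proof -
    have zJ: "z \<in> J" using z xy by auto
    have "dist (y,x) (z,z) \<le> \<bar>y - z\<bar> + \<bar>x - z\<bar>" unfolding dist_Pair_Pair dist_real_def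
     by (rule order_trans[OF sqrt_sum_squares_le_sum_abs]) simp
    also have "... = y - x" using z by auto
    finally have "dist (y,x) (z,z) < d1" "dist (y,x) (z,z) < d2"
     using xy(3,4) d1(1) d2(1) unfolding d_def by (auto simp: min_def split: if_splits)
    then show "\<bar>P (y,x) - p z\<bar> \<le> e" "\<bar>R (y,x) - r z\<bar> \<le> e"
     using d1(2)[of "(z,z)" "(y,x)"] d2(2)[of "(z,z)" "(y,x)"] xy zJ pJ[OF zJ] by (auto simp: dist_real_def)
   qed
   have i1: "set_integrable lborel {x..y} (%z. P (y,x) * b z)" "set_integrable lborel {x..y} (%z. R (y,x) * c z)" using sub[OF bi(1)] sub[OF bi(2)] by auto
   have i12: "set_integrable lborel {x..y} (%z. P (y,x) * b z + R (y,x) * c z)" by (rule set_integral_add(1)[OF i1])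
   have "f y - f x = P (y,x) * (LINT z:{x..y}|lborel. b z) + R (y,x) * (LINT z:{x..y}|lborel. c z)"
    unfolding sp[OF bi(1)] sp[OF bi(2)] f[OF xy(2,1)] using a(1)[OF xy(1)] a(1)[OF xy(2)] m(1)[OF xy(1)] m(1)[OF xy(2)] by simp
   also have "... = (LINT z:{x..y}|lborel. P (y,x) * b z + R (y,x) * c z)" using set_integral_add(2)[OF i1] by simp
   finally have "H y - H x = (LINT z:{x..y}|lborel. P (y,x) * b z + R (y,x) * c z) - (LINT z:{x..y}|lborel. g z)"
    unfolding H_def sp[OF gi'] by simp
   also have "... = (LINT z:{x..y}|lborel. (P (y,x) * b z + R (y,x) * c z) - g z)" by (rule set_integral_diff(2)[OF i12 sub[OF gi'], symmetric])
   finally have e1: "H y - H x = (LINT z:{x..y}|lborel. (P (y,x) * b z + R (y,x) * c z) - g z)" .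
   have i3: "set_integrable lborel {x..y} (%z. (P (y,x) * b z + R (y,x) * c z) - g z)" by (rule set_integral_diff(1)[OF i12 sub[OF gi']])
   have i4: "set_integrable lborel {x..y} (%z. e * (\<bar>b z\<bar> + \<bar>c z\<bar>))" using sub[OF ai] by simp
   have pt: "\<bar>(P (y,x) * b z + R (y,x) * c z) - g z\<bar> \<le> e * (\<bar>b z\<bar> + \<bar>c z\<bar>)" if z: "z \<in> {x..y}" for z
   proof -
    have "(P (y,x) * b z + R (y,x) * c z) - g z = (P (y,x) - p z) * b z + (R (y,x) - r z) * c z" unfolding g_def by (simp add: algebra_simps)
    then have "\<bar>(P (y,x) * b z + R (y,x) * c z) - g z\<bar> \<le> \<bar>P (y,x) - p z\<bar> * \<bar>b z\<bar> + \<bar>R (y,x) - r z\<bar> * \<bar>c z\<bar>"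
     by (metis abs_mult abs_triangle_ineq)
    also have "... \<le> e * \<bar>b z\<bar> + e * \<bar>c z\<bar>" by (intro add_mono mult_right_mono est z) auto
    finally show ?thesis by (simp add: algebra_simps)
   qed
   have "\<bar>H y - H x\<bar> \<le> (LINT z:{x..y}|lborel. e * (\<bar>b z\<bar> + \<bar>c z\<bar>))"
   proof (rule abs_leI)
    show "H y - H x \<le> (LINT z:{x..y}|lborel. e * (\<bar>b z\<bar> + \<bar>c z\<bar>))" unfolding e1
     by (rule set_integral_mono[OF i3 i4]) (use pt in \<open>fastforce simp: abs_le_iff\<close>)
    have "- (H y - H x) = (LINT z:{x..y}|lborel. - ((P (y,x) * b z + R (y,x) * c z) - g z))"
     unfolding e1 by (rule set_integral_uminus[OF i3, symmetric])
    also have "... \<le> (LINT z:{x..y}|lborel. e * (\<bar>b z\<bar> + \<bar>c z\<bar>))"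
    proof (rule set_integral_mono[OF _ i4])
     show "set_integrable lborel {x..y} (%z. - ((P (y,x) * b z + R (y,x) * c z) - g z))"
      using Bochner_Integration.integrable_minus[OF i3[unfolded set_integrable_def]] by (simp only: set_integrable_def scaleR_minus_right)
    qed (use pt in \<open>auto simp: abs_le_iff\<close>)
    finally show "- (H y - H x) \<le> (LINT z:{x..y}|lborel. e * (\<bar>b z\<bar> + \<bar>c z\<bar>))" .
   qed
   also have "... = e * (\<nu> y - \<nu> x)" unfolding \<nu>_def sp[OF ai, symmetric] by simp
   finally show "\<bar>H y - H x\<bar> \<le> e * (\<nu> y - \<nu> x)" .
  qed
 qed
 then have "f x = f 0 + (LINT y:{0..x}|lborel. g y)" unfolding H_def by (simp add: set_integral_singleton)
 also have "(LINT y:{0..x}|lborel. g y) = (LINT y:{0..x}|lborel. P (y,y) * b y + R (y,y) * c y)"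
  by (rule set_lebesgue_integral_cong) (use x in \<open>auto simp: g_def pJ\<close>)
 finally show ?thesis .
qed

section \<open>Integral representations of the second and mixed derivatives\<close>

context
 fixes a b t assumes a: "adm a" and t: "t \<in> Pos a" and ch: "chain 1 (dch a b)"
begin

lemma bfacts: "b \<in> BM" "nsq J b < \<infinity>" "x \<in> J ==> a x = a 0 + (LINT y:{0..x}|lborel. b y)"
 using chain_measurable[OF ch, of 1] chain_finite[OF ch, of 1] chain_eq[OF ch, of 0 x] by (simp_all add: dch_def)

lemma inv_q_cont: "continuous_on S (%x. inverse (qq a t x))"
 using qq_pos[OF a t] by (intro continuous_intros qq_cont a) (metis less_irrefl)

lemma q_inv: "qq a t x * inverse (qq a t x) = 1" using qq_pos[OF a t, of x] by simp

text \<open>The density \<open>b\<close> over the square of \<open>qq\<close> is written with the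
  factor \<open>(qq a t y)\<^sup>2\<close> split off, so that the substitution
  \<open>set_integral_subst\<close>, whose Jacobian this is, turns it into
  \<open>UXX\<close>.\<close>

lemma Phi_rep: "x \<in> J ==> Phi a t x = Phi a t 0 + (LINT y:{0..x}|lborel. (inverse (qq a t y) ^ 4 * b y) * (qq a t y)\<^sup>2)"
proof -
 assume x: "x \<in> J"
 have "Phi a t x = Phi a t 0 + (LINT y:{0..x}|lborel. (%z. inverse (qq a t (fst z)) * inverse (qq a t (snd z))) (y,y) * b y + (%z. 0) (y,y) * 0)"
 proof (rule integral_rep_of_difference[where a=a and m="%x. 0" and c="%x. 0", OF _ _ bfacts(3) bfacts(1,2) _ _ _ _ x])
  show "continuous_on JJ (%z. inverse (qq a t (fst z)) * inverse (qq a t (snd z)))"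
   by (intro continuous_intros continuous_on_compose2[OF inv_q_cont[of UNIV]]) auto
  show "Phi a t x - Phi a t y = inverse (qq a t (fst (x,y))) * inverse (qq a t (snd (x,y))) * (a x - a y) + 0 * (0 - 0)" for x y
   by (simp add: Phi_diff[OF a t] divide_inverse)
 qed (auto simp: nsq_def set_lebesgue_integral_def)
 also have "(LINT y:{0..x}|lborel. (%z. inverse (qq a t (fst z)) * inverse (qq a t (snd z))) (y,y) * b y + (%z. 0) (y,y) * 0) =
   (LINT y:{0..x}|lborel. (inverse (qq a t y) ^ 4 * b y) * (qq a t y)\<^sup>2)"
 proof (rule set_lebesgue_integral_cong)
  have "i * i * v + 0 * 0 = (i ^ 4 * v) * q\<^sup>2" if "q * i = 1" for q i v :: real
  proof -
   have h: "(i ^ 4 * v) * q\<^sup>2 = i * i * v * (q * i) * (q * i)" by (simp add: power2_eq_square power4_eq_xxxx)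
   show ?thesis unfolding h that by simp
  qed
  then show "\<forall>y. y \<in> {0..x} \<longrightarrow> (%z. inverse (qq a t (fst z)) * inverse (qq a t (snd z))) (y,y) * b y + (%z. 0) (y,y) * 0 = inverse (qq a t y) ^ 4 * b y * (qq a t y)\<^sup>2"
   using q_inv by simp
 qed simp
 finally show ?thesis .
qed

definition "VL = (%x. (- ((Phi a t x)\<^sup>2 * (1/2)) + - En a) + - (ll a t x * inverse (qq a t x) ^ 4) * b x)"

text \<open>\<open>kk\<close> is continuously differentiable, so only the product of
  \<open>Phi\<close> and \<open>ll\<close> goes through \<open>integral_rep_of_difference\<close>,
  with the slope and \<open>ll\<close> as the two reference functions. \<open>VL\<close> is
  \<open>VX\<close> seen at the label, and the factor \<open>(qq a t y)\<^sup>2\<close> is again the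
  Jacobian.\<close>

lemma V_rep: "x \<in> J ==> kk a t x - Phi a t x * ll a t x = 0 + (LINT y:{0..x}|lborel. VL y * (qq a t y)\<^sup>2)"
proof -
 assume x: "x \<in> J"
 define lx where "lx = (%x. (cE a t * a x - 2 * En a * dE a t) * qq a t x)"
 define kx where "kx = (%x. (cE a t * a x - 2 * En a * dE a t)\<^sup>2 / 2 - En a * (qq a t x)\<^sup>2)"
 have c: "continuous_on UNIV lx" "continuous_on UNIV kx" unfolding lx_def kx_def by (intro continuous_intros adm_cont qq_cont a; simp)+
 have k: "kk a t x = 0 + (LINT y:{0..x}|lborel. kx y)"
  using C1_integral_rep[OF kk_DERIV_x[OF a, of t] _ x] c(2) gam_ends[OF a, of t] unfolding kx_def by simp
 have l: "ll a t x = ll a t 0 + (LINT y:{0..x}|lborel. lx y)" if "x \<in> J" for x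
  using C1_integral_rep[OF ll_DERIV_x[OF a, of t] _ that] c(1) unfolding lx_def by simp
 have p: "Phi a t x * ll a t x = Phi a t 0 * ll a t 0 + (LINT y:{0..x}|lborel.
   (%z. ll a t (fst z) * (inverse (qq a t (fst z)) * inverse (qq a t (snd z)))) (y,y) * b y + (%z. Phi a t (snd z)) (y,y) * lx y)"
 proof (rule integral_rep_of_difference[where a=a and m="ll a t" and c=lx, OF _ _ bfacts(3) bfacts(1,2) l _ _ _ x])
  show "continuous_on JJ (%z. ll a t (fst z) * (inverse (qq a t (fst z)) * inverse (qq a t (snd z))))"
   by (intro continuous_intros continuous_on_compose2[OF inv_q_cont[of UNIV]] continuous_on_compose2[OF ll_cont[OF a, of UNIV]]) auto
  show "continuous_on JJ (%z. Phi a t (snd z))"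
   by (intro continuous_on_compose2[OF Phi_cont[OF a t, of UNIV]] continuous_intros) auto
  show "Phi a t x * ll a t x - Phi a t y * ll a t y = ll a t (fst (x,y)) * (inverse (qq a t (fst (x,y))) * inverse (qq a t (snd (x,y)))) * (a x - a y) + Phi a t (snd (x,y)) * (ll a t x - ll a t y)" for x y
  proof -
   have "Phi a t x * ll a t x - Phi a t y * ll a t y = ll a t x * (Phi a t x - Phi a t y) + Phi a t y * (ll a t x - ll a t y)" by (simp add: algebra_simps)
   then show ?thesis unfolding Phi_diff[OF a t] by (simp add: divide_inverse)
  qed
  show "lx \<in> BM" by (intro borel_measurable_continuous_onI c)
  show "nsq J lx < \<infinity>" by (rule nsq_continuous_finite[OF c(1)])
 qed
 define w where "w = (%y. (%z. ll a t (fst z) * (inverse (qq a t (fst z)) * inverse (qq a t (snd z)))) (y,y) * b y + (%z. Phi a t (snd z)) (y,y) * lx y)"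
 have wi: "set_integrable lborel J w"
 proof -
  have 1: "set_integrable lborel J (%y. (ll a t y * (inverse (qq a t y) * inverse (qq a t y))) * b y)"
   by (intro set_integrable_nsq_J nsq_mult_continuous_finite borel_measurable_times borel_measurable_continuous_onI bfacts continuous_intros inv_q_cont ll_cont[OF a])
  have 2: "set_integrable lborel J (%y. Phi a t y * lx y)"
   by (intro set_integral_J_continuous(2) continuous_intros Phi_cont[OF a t] continuous_on_subset[OF c(1)]) simp
  from set_integral_add(1)[OF 1 2] show ?thesis unfolding w_def by simp
 qed
 have ki: "set_integrable lborel J kx" by (rule set_integral_J_continuous(2)[OF continuous_on_subset[OF c(2)]]) simp
 have sub: "set_integrable lborel {0..x} F" if "set_integrable lborel J F" for F :: "real => real"
  by (rule set_integrable_subset[OF that]) (use x in auto)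
 have "kk a t x - Phi a t x * ll a t x = (LINT y:{0..x}|lborel. kx y) - (LINT y:{0..x}|lborel. w y)"
  using k p gam_ends[OF a, of t] unfolding w_def by simp
 also have "... = (LINT y:{0..x}|lborel. kx y - w y)" by (rule set_integral_diff(2)[OF sub[OF ki] sub[OF wi], symmetric])
 also have "... = (LINT y:{0..x}|lborel. VL y * (qq a t y)\<^sup>2)"
 proof (rule set_lebesgue_integral_cong)
  have "(P * q)\<^sup>2 / 2 - e * q\<^sup>2 - (l * (i * i) * v + P * (P * q * q)) = ((- (P\<^sup>2 * (1/2)) + - e) + - (l * i ^ 4) * v) * q\<^sup>2"
   if "q * i = 1" for P q e l i v :: real
  proof -
   have "i ^ 4 * q\<^sup>2 = (i * i) * (q * i) * (q * i)" by (simp add: power2_eq_square power4_eq_xxxx)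
   then have "i ^ 4 * q\<^sup>2 = i * i" using that by simp
   then have "l * i ^ 4 * v * q\<^sup>2 = l * (i * i) * v" by (metis mult.assoc mult.commute)
   then show ?thesis by (simp add: algebra_simps power2_eq_square)
  qed
  then show "\<forall>y. y \<in> {0..x} \<longrightarrow> kx y - w y = VL y * (qq a t y)\<^sup>2"
   using q_inv unfolding kx_def w_def lx_def VL_def Phi_qq[OF a t] by simp
 qed simp
 finally show ?thesis by simp
qed

lemma UXX_finite: "nsq J (UXX a b t) < \<infinity>" "UXX a b t \<in> BM"
 and VX_finite: "nsq J (VX a b t) < \<infinity>" "VX a b t \<in> BM"
proof -
 obtain m M where fm: "flowmap (gam a t) (eta a t) (%x. (qq a t x)\<^sup>2) m M" using flowmap_Pos[OF a t] by metis
 interpret flowmap "gam a t" "eta a t" "%x. (qq a t x)\<^sup>2" m M by (rule fm)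
 have cm: "continuous_on UNIV (%x. inverse (qq a t x) ^ 4)" "continuous_on UNIV (%x. - (ll a t x * inverse (qq a t x) ^ 4))"
  "continuous_on UNIV (%x. - ((Phi a t x)\<^sup>2 * (1/2)) + - En a)"
  by (intro continuous_intros inv_q_cont ll_cont[OF a] Phi_cont[OF a t])+
 note [measurable] = cm[THEN borel_measurable_continuous_onI] bfacts(1)
 have m1: "(%x. 0 + inverse (qq a t x) ^ 4 * b x) \<in> BM" by measurable
 have m2: "VL \<in> BM" unfolding VL_def by measurable
 have f1: "nsq J (%x. 0 + inverse (qq a t x) ^ 4 * b x) < \<infinity>" using nsq_mult_continuous_finite[OF cm(1) bfacts(1,2)] by simp
 have f2: "nsq J VL < \<infinity>" unfolding VL_def
  by (rule nsq_add_finite[OF _ _ _ nsq_continuous_finite[OF cm(3)] nsq_mult_continuous_finite[OF cm(2) bfacts(1,2)]]) measurable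
 have e: "UXX a b t = (%y. (%x. 0 + inverse (qq a t x) ^ 4 * b x) (eta a t y))" "VX a b t = (%y. VL (eta a t y))"
  unfolding UXX_def[abs_def] VX_def[abs_def] VL_def by auto
 show "UXX a b t \<in> BM" "VX a b t \<in> BM"
  unfolding e by (rule measurable_compose[OF eta_measurable m1] measurable_compose[OF eta_measurable m2])+
 show "nsq J (UXX a b t) < \<infinity>" unfolding e
  by (rule le_less_trans[OF nsq_comp_le[OF m1]]) (use f1 in \<open>simp add: ennreal_mult_less_top\<close>)
 show "nsq J (VX a b t) < \<infinity>" unfolding e
  by (rule le_less_trans[OF nsq_comp_le[OF m2]]) (use f2 in \<open>simp add: ennreal_mult_less_top\<close>)
qed

lemma UX_rep: assumes y: "y \<in> J" shows "UX a t y = UX a t 0 + (LINT z:{0..y}|lborel. UXX a b t z)"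
 and VV_rep: "VV a t y = VV a t 0 + (LINT z:{0..y}|lborel. VX a b t z)"
proof -
 obtain m M where fm: "flowmap (gam a t) (eta a t) (%x. (qq a t x)\<^sup>2) m M" using flowmap_Pos[OF a t] by metis
 interpret flowmap "gam a t" "eta a t" "%x. (qq a t x)\<^sup>2" m M by (rule fm)
 have eJ: "eta a t y \<in> J" by (rule eta_in_J[OF a t y])
 have e: "UXX a b t = (%y. (%x. inverse (qq a t x) ^ 4 * b x) (eta a t y))" "VX a b t = (%y. VL (eta a t y))"
  unfolding UXX_def[abs_def] VX_def[abs_def] VL_def by auto
 have "(LINT z:{0..y}|lborel. UXX a b t z) = (LINT x:{0..eta a t y}|lborel. inverse (qq a t x) ^ 4 * b x * (qq a t x)\<^sup>2)"
  unfolding e by (rule set_integral_subst[OF _ y]) (use set_integrable_nsq_J[OF UXX_finite(2,1)] e in simp)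
 then show "UX a t y = UX a t 0 + (LINT z:{0..y}|lborel. UXX a b t z)" using Phi_rep[OF eJ] unfolding UX_def eta_0 by simp
 have "(LINT z:{0..y}|lborel. VX a b t z) = (LINT x:{0..eta a t y}|lborel. VL x * (qq a t x)\<^sup>2)"
  unfolding e by (rule set_integral_subst[OF _ y]) (use set_integrable_nsq_J[OF VX_finite(2,1)] e in simp)
 then show "VV a t y = VV a t 0 + (LINT z:{0..y}|lborel. VX a b t z)" using V_rep[OF eJ] UU_VV_ends(3)[OF a t] unfolding VV_def by simp
qed

end

lemma chain_cU_cV:
 assumes ks: "kcase k \<sigma>" and g: "good k \<sigma> a b" and t: "t \<in> Pos a"
 shows "chain (Suc k) (cU a b t)" "chain k (cV a b t)"
proof -
 have a: "adm a" and ch: "chain k (dch a b)" using g unfolding good_def by auto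
 have c: "continuous_on UNIV (UU a t)" "continuous_on UNIV (UX a t)" "continuous_on UNIV (VV a t)"
  by (rule UU_cont[OF a t] UX_cont[OF a t] VV_cont[OF a t])+
 note f = c[THEN nsq_continuous_finite] and m = c[THEN borel_measurable_continuous_onI]
 have r: "x \<in> J ==> UU a t x = UU a t 0 + (LINT y:{0..x}|lborel. UX a t y)" for x
  by (rule C1_integral_rep[OF UU_DERIV[OF a t] c(2)])
 have "chain (Suc k) (cU a b t) \<and> chain k (cV a b t)"
 proof (cases "k = 0")
  case True
  have "j \<le> Suc 0 ==> cU a b t j \<in> BM \<and> nsq J (cU a b t j) < \<infinity>" for j
   using f m by (cases j) (auto simp: cU_def)
  moreover have "cV a b t 0 = VV a t" "cU a b t 0 = UU a t" "cU a b t (Suc 0) = UX a t" by (simp_all add: cU_def cV_def)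
  ultimately show ?thesis unfolding chain_def True using f m r by (metis less_nat_zero_code le_zero_eq less_Suc0)
 next
  case False
  then have k: "k = 1" using ks unfolding kcase_def by auto
  note ch1 = ch[unfolded k]
  have e: "cV a b t 0 = VV a t" "cV a b t (Suc 0) = VX a b t" "cU a b t 0 = UU a t" "cU a b t (Suc 0) = UX a t" "cU a b t (Suc (Suc 0)) = UXX a b t" by (simp_all add: cU_def cV_def)
  have 1: "cU a b t j \<in> BM \<and> nsq J (cU a b t j) < \<infinity>" for j
   using f m UXX_finite[OF a t ch1] by (simp add: cU_def)
  have 2: "cV a b t j \<in> BM \<and> nsq J (cV a b t j) < \<infinity>" for j
   using f m VX_finite[OF a t ch1] by (simp add: cV_def)
  have 3: "j < Suc 1 ==> x \<in> J ==> cU a b t j x = cU a b t j 0 + (LINT y:{0..x}|lborel. cU a b t (Suc j) y)" for j x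
   using r[of x] UX_rep[OF a t ch1, of x] e by (cases j) (auto simp only: less_Suc_eq_0_disj One_nat_def)
  have 4: "j < 1 ==> x \<in> J ==> cV a b t j x = cV a b t j 0 + (LINT y:{0..x}|lborel. cV a b t (Suc j) y)" for j x
   using VV_rep[OF a t ch1, of x] e by (simp only: less_one)
  show ?thesis unfolding chain_def k using 1 2 3 4 by blast
 qed
 then show "chain (Suc k) (cU a b t)" "chain k (cV a b t)" by auto
qed

section \<open>Joint continuity in time and position, and averages over time\<close>

lemma continuous_on_real_pairI:
 fixes f :: "real \<times> real => real"
 assumes "\<And>z z'. z \<longlonglongrightarrow> z' ==> (%n::nat. f (z n)) \<longlonglongrightarrow> f z'"
 shows "continuous_on UNIV f"
 unfolding continuous_on_sequentially using assms by (auto simp: o_def)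

text \<open>Times are clipped to \<open>{lo..hi}\<close> and positions to \<open>J\<close>, which
  makes the function total on the plane, so that continuity yields Borel measurability in both
  variables. The common Lipschitz constant of the inverse maps separates the two limits.\<close>

lemma eta_joint_continuous:
 assumes a: "adm a" and T: "{lo..hi} \<subseteq> Pos a" and lh: "lo \<le> hi"
 shows "continuous_on UNIV (%z::real\<times>real. eta a (max lo (min hi (fst z))) (clmp (snd z)))"
proof (rule continuous_on_real_pairI)
 fix z :: "nat => real \<times> real" and z' assume z: "z \<longlonglongrightarrow> z'"
 define \<tau> \<tau>' where "\<tau> = (%n. max lo (min hi (fst (z n))))" and "\<tau>' = max lo (min hi (fst z'))"
 define y y' where "y = (%n. clmp (snd (z n)))" and "y' = clmp (snd z')"
 have tl: "\<tau> \<longlonglongrightarrow> \<tau>'" unfolding \<tau>_def \<tau>'_def by (intro tendsto_intros z)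
 have yl: "y \<longlonglongrightarrow> y'" unfolding y_def y'_def
  by (rule continuous_on_tendsto_compose[OF clmp_continuous[of UNIV]]) (auto intro!: tendsto_intros z)
 have yJ: "y' \<in> J" unfolding y'_def by (rule clmp_mem)
 have t': "\<tau>' \<in> Pos a" using T lh unfolding \<tau>'_def by (auto simp: max_def min_def)
 obtain N q0 Q where fs: "flowseq (%n. a) a (%n. \<tau> (n + N)) \<tau>' q0 Q"
  using dataseq.eventually_flowseq[OF dataseq_const[OF a tl] t'] by metis
 interpret f: flowseq "%n. a" a "%n. \<tau> (n + N)" \<tau>' q0 Q by (rule fs)
 have yN: "(%n. y (n + N)) \<longlonglongrightarrow> y'" by (rule LIMSEQ_ignore_initial_segment[OF yl])
 have "(%n. \<bar>y (n+N) - y'\<bar> / q0\<^sup>2) \<longlonglongrightarrow> \<bar>y' - y'\<bar> / q0\<^sup>2" by (intro tendsto_intros yN) (use f.q0 in auto)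
 then have *: "(%n. \<bar>y (n+N) - y'\<bar> / q0\<^sup>2) \<longlonglongrightarrow> 0" by simp
 have "(%n. eta a (\<tau> (n+N)) (y (n+N)) - eta a (\<tau> (n+N)) y') \<longlonglongrightarrow> 0"
  by (rule Lim_null_comparison[OF _ *], rule always_eventually, rule allI) (use flowmap.eta_dist[OF f.fl] in simp)
 from tendsto_add[OF this f.lim_eta[OF yJ]]
 have "(%n. eta a (\<tau> (n+N)) (y (n+N))) \<longlonglongrightarrow> eta a \<tau>' y'" by simp
 then show "(%n. eta a (max lo (min hi (fst (z n)))) (clmp (snd (z n)))) \<longlonglongrightarrow> eta a (max lo (min hi (fst z'))) (clmp (snd z'))"
  unfolding \<tau>_def \<tau>'_def y_def y'_def by (rule LIMSEQ_offset)
qed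

lemma cE_continuous: "continuous_on S (cE a)" and dE_continuous: "continuous_on S (dE a)"
 by (meson DERIV_isCont cE_DERIV dE_DERIV continuous_at_imp_continuous_on)+

lemma joint_continuous:
 assumes a: "adm a" and T: "{lo..hi} \<subseteq> Pos a" and lh: "lo \<le> hi"
 defines "e \<equiv> %z::real\<times>real. eta a (max lo (min hi (fst z))) (clmp (snd z))" and "\<tau> \<equiv> %z::real\<times>real. max lo (min hi (fst z))"
 shows "continuous_on UNIV (%z. ll a (\<tau> z) (e z))" "continuous_on UNIV (%z. kk a (\<tau> z) (e z))"
  "continuous_on UNIV (%z. inverse (qq a (\<tau> z) (e z)))" "continuous_on UNIV (%z. Phi a (\<tau> z) (e z))" "continuous_on UNIV e"
proof -
 show e: "continuous_on UNIV e" unfolding e_def by (rule eta_joint_continuous[OF a T lh])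
 have t: "continuous_on UNIV \<tau>" unfolding \<tau>_def by (intro continuous_intros)
 have tP: "\<tau> z \<in> Pos a" for z using T lh unfolding \<tau>_def by (auto simp: max_def min_def)
 have q: "qq a (\<tau> z) (e z) \<noteq> 0" for z using qq_pos[OF a tP, of z "e z"] by simp
 note c = continuous_on_compose2[OF cE_continuous[of UNIV a] t] continuous_on_compose2[OF dE_continuous[of UNIV a] t]
  continuous_on_compose2[OF AD_cont[OF adm_cont[OF a], of UNIV] e] continuous_on_compose2[OF AD_cont[OF adm_cont_sq[OF a], of UNIV] e]
  continuous_on_compose2[OF adm_cont[OF a, of UNIV] e]
 show "continuous_on UNIV (%z. ll a (\<tau> z) (e z))" "continuous_on UNIV (%z. kk a (\<tau> z) (e z))"
  unfolding ll_def kk_def rE_def by (intro continuous_intros c e; simp)+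
 have qc: "continuous_on UNIV (%z. qq a (\<tau> z) (e z))" unfolding qq_def by (intro continuous_intros c; simp)
 show "continuous_on UNIV (%z. inverse (qq a (\<tau> z) (e z)))" using q by (intro continuous_intros qc) auto
 show "continuous_on UNIV (%z. Phi a (\<tau> z) (e z))" unfolding Phi_def using q by (intro continuous_intros c qc) auto
qed

lemma nsq_le_HN: "j \<le> k ==> nsq J (hs j) \<le> HN \<sigma> k hs"
proof -
 assume "j \<le> k"
 then have "nsq J (hs j) \<le> (\<Sum>j\<le>k. nsq J (hs j))" by (intro member_le_sum) auto
 then show ?thesis unfolding HN_def by (rule order_trans) simp
qed

lemma FK_le_HN: "0 < \<sigma> ==> nsq JJ (FK \<sigma> (hs k)) \<le> HN \<sigma> k hs"
 unfolding HN_def by simp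

lemma nn_integral_abs_le_nsq:
 assumes "f \<in> BM"
 shows "(\<integral>\<^sup>+x. ennreal \<bar>f x\<bar> * indicator J x \<partial>lborel) \<le> emeasure lborel J + nsq J f"
proof -
 have "ennreal \<bar>f x\<bar> * indicator J x \<le> indicator J x + ennreal ((f x)\<^sup>2) * indicator J x" for x
 proof -
  have "\<bar>f x\<bar> \<le> 1 + (f x)\<^sup>2" using sum_squares_bound[of 1 "\<bar>f x\<bar>"] by simp
  then have "ennreal \<bar>f x\<bar> \<le> ennreal (1 + (f x)\<^sup>2)" by (rule ennreal_leI)
  then show ?thesis by (auto simp: indicator_def ennreal_plus)
 qed
 then have "(\<integral>\<^sup>+x. ennreal \<bar>f x\<bar> * indicator J x \<partial>lborel) \<le> (\<integral>\<^sup>+x. indicator J x + ennreal ((f x)\<^sup>2) * indicator J x \<partial>lborel)"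
  by (intro nn_integral_mono)
 also have "... = emeasure lborel J + nsq J f" unfolding nsq_def using assms by (subst nn_integral_add) auto
 finally show ?thesis .
qed

text \<open>The difference quotient minus \<open>VV a t\<close> is the mean of
  \<open>VV a \<tau> - VV a t\<close> over \<open>{lo..hi}\<close>. Averaging the chain of
  \<open>VV\<close> entry by entry gives a chain for it, and \<open>nsq_average_le\<close> bounds
  each norm by \<open>B\<close>; the factor 3 counts the at most three terms of
  \<open>HN\<close>.\<close>

lemma time_average:
 assumes ks: "kcase k \<sigma>" and g: "good k \<sigma> a b" and lh: "lo < hi" and T: "{lo..hi} \<subseteq> Pos a" and t: "t \<in> {lo..hi}"
  and B: "\<And>\<tau>. \<tau> \<in> {lo..hi} ==> HN \<sigma> k (%j x. cV a b \<tau> j x - cV a b t j x) \<le> B" "B < \<infinity>"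
 shows "\<exists>hs. chain k hs \<and> (\<forall>x\<in>J. hs 0 x = (UU a hi x - UU a lo x) / (hi - lo) - VV a t x) \<and> HN \<sigma> k hs \<le> 3 * B"
proof -
 have a: "adm a" and ch: "chain k (dch a b)" using g unfolding good_def by auto
 have tP: "t \<in> Pos a" using T t by auto
 define tc where "tc = (%\<tau>. max lo (min hi \<tau>))"
 have tcI: "\<tau> \<in> {lo..hi} ==> tc \<tau> = \<tau>" "tc \<tau> \<in> {lo..hi}" for \<tau> unfolding tc_def using lh by auto
 define kf where "kf = (%j \<tau> x. cV a b (tc \<tau>) j (clmp x) - cV a b t j (clmp x))"
 have tce: "max lo (min hi \<tau>) = tc \<tau>" for \<tau> unfolding tc_def ..
 note jc = joint_continuous[OF a T less_imp_le[OF lh], unfolded tce]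
 have clm: "clmp \<in> BM" by (rule borel_measurable_continuous_onI[OF clmp_continuous])
 have bm: "b \<in> BM" if "k = 1" using chain_measurable[OF ch, of 1] that by (simp add: dch_def)
 have c0: "continuous_on UNIV (%z. kf 0 (fst z) (snd z))"
 proof -
  have 1: "continuous_on UNIV (%z::real\<times>real. VV a (tc (fst z)) (clmp (snd z)))"
   unfolding VV_def by (intro continuous_intros jc)
  have 2: "continuous_on UNIV (%z::real\<times>real. VV a t (clmp (snd z)))"
   by (intro continuous_on_compose2[OF VV_cont[OF a tP, of UNIV]] continuous_on_compose2[OF clmp_continuous[of UNIV]] continuous_intros) auto
  show ?thesis unfolding kf_def cV_def using continuous_on_diff[OF 1 2] by simp
 qed
 have km2: "(%z::real\<times>real. kf j (fst z) (snd z)) \<in> BM" if "j \<le> k" for j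
 proof (cases "j = 0")
  case True
  then show ?thesis using c0 by (simp add: borel_measurable_continuous_onI)
 next
  case False
  then have k1: "k = 1" "j = 1" using that ks unfolding kcase_def by auto
  have b1: "(%z::real\<times>real. b (eta a (tc (fst z)) (clmp (snd z)))) \<in> BM"
   using measurable_compose[OF borel_measurable_continuous_onI[OF jc(5)] bm[OF k1(1)]] .
  have "continuous_on UNIV (%z::real\<times>real. - (ll a (tc (fst z)) (eta a (tc (fst z)) (clmp (snd z))) * inverse (qq a (tc (fst z)) (eta a (tc (fst z)) (clmp (snd z)))) ^ 4))"
   "continuous_on UNIV (%z::real\<times>real. - ((Phi a (tc (fst z)) (eta a (tc (fst z)) (clmp (snd z))))\<^sup>2 * (1/2)) + - En a)"
   by (intro continuous_intros jc)+
  note cm = this[THEN borel_measurable_continuous_onI]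
  have 1: "(%z::real\<times>real. VX a b (tc (fst z)) (clmp (snd z))) \<in> BM"
   unfolding VX_def by (intro borel_measurable_add[OF cm(2)] borel_measurable_times[OF cm(1) b1])
  have 2: "(%z::real\<times>real. VX a b t (clmp (snd z))) \<in> BM"
   by (rule borel_measurable_snd_comp[OF measurable_compose[OF clm VX_finite(2)[OF a tP ch[unfolded k1(1)]]]])
  show ?thesis unfolding kf_def cV_def using borel_measurable_diff[OF 1 2] k1 by simp
 qed
 have kmP: "(%z. kf j (fst z) (snd z)) \<in> borel_measurable (borel \<Otimes>\<^sub>M borel)" if "j \<le> k" for j
  unfolding borel_prod by (rule km2[OF that])
 have km: "(%(\<tau>,x). kf j \<tau> x) \<in> borel_measurable (borel \<Otimes>\<^sub>M borel)" if "j \<le> k" for j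
  unfolding case_prod_beta' by (rule kmP[OF that])
 have kms: "(%z. kf j (snd z) (fst z)) \<in> borel_measurable (borel \<Otimes>\<^sub>M borel)" if "j \<le> k" for j
  using measurable_compose[OF measurable_Pair[OF measurable_snd measurable_fst] kmP[OF that]] by (simp only: fst_conv snd_conv)
 have kmx: "kf j \<tau> \<in> BM" if "j \<le> k" for j \<tau>
 proof -
  have "(%x. (\<tau>, x)) \<in> borel \<rightarrow>\<^sub>M borel \<Otimes>\<^sub>M borel" by (intro measurable_Pair measurable_ident_sets measurable_const) auto
  from measurable_compose[OF this kmP[OF that]] show ?thesis by simp
 qed
 have nk: "nsq J (kf j \<tau>) \<le> B" if "j \<le> k" "\<tau> \<in> {lo..hi}" for j \<tau>
 proof -
  have "nsq J (kf j \<tau>) = nsq J (%x. cV a b \<tau> j x - cV a b t j x)"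
   by (rule nsq_cong) (simp add: kf_def tcI(1)[OF that(2)] del: atLeastAtMost_iff)
  also have "... \<le> HN \<sigma> k (%j x. cV a b \<tau> j x - cV a b t j x)" by (rule nsq_le_HN[OF that(1)])
  also have "... \<le> B" by (rule B(1)[OF that(2)])
  finally show ?thesis .
 qed
 define hs where "hs = (%j x. (LINT \<tau>:{lo..hi}|lborel. kf j \<tau> x) / (hi - lo))"
 have hm: "hs j \<in> BM" if "j \<le> k" for j
 proof -
  have "(%z. indicator {lo..hi} (snd z) *\<^sub>R kf j (snd z) (fst z)) \<in> borel_measurable (borel \<Otimes>\<^sub>M borel)"
   by (intro borel_measurable_scaleR kms[OF that] measurable_compose[OF measurable_snd]) auto
  then have "(%(x,\<tau>). indicator {lo..hi} \<tau> *\<^sub>R kf j \<tau> x) \<in> borel_measurable (borel \<Otimes>\<^sub>M lborel)"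
   unfolding case_prod_beta' by (simp cong: measurable_cong_sets sets_pair_measure_cong)
  from lborel.borel_measurable_lebesgue_integral[OF this]
  show ?thesis unfolding hs_def set_lebesgue_integral_def by simp
 qed
 have nh: "nsq J (hs j) \<le> B" if "j \<le> k" for j
  unfolding hs_def by (rule nsq_average_le[OF km[OF that] _ lh nk[OF that]]) auto
 have h0: "hs 0 x = (UU a hi x - UU a lo x) / (hi - lo) - VV a t x" if x: "x \<in> J" for x
 proof -
  have c: "continuous_on {lo..hi} (%\<tau>. kf 0 \<tau> x)"
  proof -
   have "continuous_on UNIV (%\<tau>. kf 0 (fst (\<tau>,x)) (snd (\<tau>,x)))"
    by (rule continuous_on_compose2[OF c0]) (auto intro!: continuous_intros)
   from continuous_on_subset[OF this subset_UNIV, of "{lo..hi}"] show ?thesis by simp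
  qed
  have "((%\<tau>. kf 0 \<tau> x) has_integral (UU a hi x - hi * VV a t x) - (UU a lo x - lo * VV a t x)) {lo..hi}"
  proof (rule fundamental_theorem_of_calculus)
   fix \<tau> assume \<tau>: "\<tau> \<in> {lo..hi}"
   have "((%\<tau>. UU a \<tau> x - \<tau> * VV a t x) has_real_derivative VV a \<tau> x - VV a t x) (at \<tau>)"
    by (rule derivative_eq_intros UU_DERIV_t[OF a _ x] refl | use T \<tau> in blast)+ simp
   then show "((%\<tau>. UU a \<tau> x - \<tau> * VV a t x) has_vector_derivative kf 0 \<tau> x) (at \<tau> within {lo..hi})"
    unfolding kf_def cV_def tcI(1)[OF \<tau>] clmp_J[OF x]
    by (simp add: has_real_derivative_iff_has_vector_derivative[symmetric] has_field_derivative_at_within)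
  qed (use lh in simp)
  then have "(LINT \<tau>:{lo..hi}|lborel. kf 0 \<tau> x) = UU a hi x - UU a lo x - (hi - lo) * VV a t x"
   using set_integral_J_continuous(1)[OF c] by (simp add: integral_unique algebra_simps)
  then show ?thesis unfolding hs_def using lh by (simp add: diff_divide_distrib)
 qed
 have fin: "(\<integral>\<^sup>+\<tau>. (\<integral>\<^sup>+x. ennreal \<bar>kf j \<tau> x\<bar> * indicator J x \<partial>lborel) * indicator {lo..hi} \<tau> \<partial>lborel) < \<infinity>" if "j \<le> k" for j
 proof -
  have "(\<integral>\<^sup>+\<tau>. (\<integral>\<^sup>+x. ennreal \<bar>kf j \<tau> x\<bar> * indicator J x \<partial>lborel) * indicator {lo..hi} \<tau> \<partial>lborel) \<le>
   (\<integral>\<^sup>+\<tau>. (emeasure lborel J + B) * indicator {lo..hi} \<tau> \<partial>lborel)"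
  proof (rule nn_integral_mono)
   fix \<tau>
   show "(\<integral>\<^sup>+x. ennreal \<bar>kf j \<tau> x\<bar> * indicator J x \<partial>lborel) * indicator {lo..hi} \<tau> \<le> (emeasure lborel J + B) * indicator {lo..hi} \<tau>"
    using order_trans[OF nn_integral_abs_le_nsq[OF kmx[OF that]] add_left_mono[OF nk[OF that]]] by (cases "\<tau> \<in> {lo..hi}") simp_all
  qed
  also have "... = (emeasure lborel J + B) * emeasure lborel {lo..hi}" by (rule nn_integral_cmult_indicator) simp
  also have "... < \<infinity>" using emeasure_J_finite B(2) lh by (simp add: ennreal_mult_less_top)
  finally show ?thesis .
 qed
 have chh: "chain k hs" unfolding chain_def
 proof (intro conjI allI impI ballI)
  show "hs j \<in> BM" if "j \<le> k" for j by (rule hm[OF that])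
  show "nsq J (hs j) < \<infinity>" if "j \<le> k" for j by (rule le_less_trans[OF nh[OF that] B(2)])
  fix j x assume j: "j < k" and x: "x \<in> J"
  have k1: "k = 1" "j = 0" using j ks unfolding kcase_def by auto
  \<comment> \<open>Fubini: the mean of the integral representations of \<open>VV\<close> at the
    times \<open>\<tau>\<close> is an integral representation of the mean.\<close>
  have "(LINT y:{0..x}|lborel. LINT \<tau>:{lo..hi}|lborel. kf 1 \<tau> y) = (LINT \<tau>:{lo..hi}|lborel. LINT y:{0..x}|lborel. kf 1 \<tau> y)"
  proof (rule set_integral_Fubini[symmetric])
   show "(%(\<tau>,y). kf 1 \<tau> y) \<in> borel_measurable (borel \<Otimes>\<^sub>M borel)" by (rule km) (simp add: k1)
   have "(\<integral>\<^sup>+\<tau>. (\<integral>\<^sup>+y. ennreal \<bar>kf 1 \<tau> y\<bar> * indicator {0..x} y \<partial>lborel) * indicator {lo..hi} \<tau> \<partial>lborel) \<le>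
    (\<integral>\<^sup>+\<tau>. (\<integral>\<^sup>+x. ennreal \<bar>kf 1 \<tau> x\<bar> * indicator J x \<partial>lborel) * indicator {lo..hi} \<tau> \<partial>lborel)"
    by (intro nn_integral_mono mult_right_mono) (use x in \<open>auto simp: indicator_def\<close>)
   also have "... < \<infinity>" by (rule fin) (simp add: k1)
   finally show "(\<integral>\<^sup>+\<tau>. (\<integral>\<^sup>+y. ennreal \<bar>kf 1 \<tau> y\<bar> * indicator {0..x} y \<partial>lborel) * indicator {lo..hi} \<tau> \<partial>lborel) < \<infinity>" .
  qed auto
  also have "... = (LINT \<tau>:{lo..hi}|lborel. kf 0 \<tau> x)"
  proof (rule set_lebesgue_integral_cong, simp, intro allI impI)
   fix \<tau> assume \<tau>: "\<tau> \<in> {lo..hi}"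
   have P: "\<tau> \<in> Pos a" using T \<tau> by auto
   note ch1 = ch[unfolded k1(1)]
   have i: "set_integrable lborel {0..x} (VX a b \<tau>)" if "\<tau> \<in> Pos a" for \<tau>
    by (rule set_integrable_subset[OF set_integrable_nsq_J[OF VX_finite(2,1)[OF a that ch1]]]) (use x in auto)
   have "(LINT y:{0..x}|lborel. kf 1 \<tau> y) = (LINT y:{0..x}|lborel. VX a b \<tau> y - VX a b t y)"
    by (rule set_lebesgue_integral_cong) (use x in \<open>auto simp: kf_def cV_def tcI(1)[OF \<tau>]\<close>)
   also have "... = (LINT y:{0..x}|lborel. VX a b \<tau> y) - (LINT y:{0..x}|lborel. VX a b t y)"
    by (rule set_integral_diff(2)[OF i[OF P] i[OF tP]])
   also have "... = VV a \<tau> x - VV a t x"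
    using VV_rep[OF a P ch1 x] VV_rep[OF a tP ch1 x] UU_VV_ends[OF a P] UU_VV_ends[OF a tP] by simp
   finally show "(LINT y:{0..x}|lborel. kf 1 \<tau> y) = kf 0 \<tau> x" unfolding kf_def cV_def tcI(1)[OF \<tau>] clmp_J[OF x] by simp
  qed
  finally have "(LINT y:{0..x}|lborel. hs 1 y) = hs 0 x" unfolding hs_def by (simp add: set_lebesgue_integral_def)
  moreover have "hs 0 0 = 0"
  proof -
   have "hi \<in> Pos a" "lo \<in> Pos a" using T lh by auto
   then show ?thesis using h0[of 0] UU_VV_ends[OF a tP] UU_VV_ends(1)[OF a, of hi] UU_VV_ends(1)[OF a, of lo] by simp
  qed
  ultimately show "hs j x = hs j 0 + (LINT y:{0..x}|lborel. hs (Suc j) y)" using k1 by simp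
 qed
 have FKh: "nsq JJ (FK \<sigma> (hs k)) \<le> B" if s: "\<sigma> > 0"
 proof -
  \<comment> \<open>The Gagliardo kernel of a mean is the mean of the kernels where both integrals
    over \<open>\<tau>\<close> exist; a Bochner integral that does not exist is 0 by default.
    Tonelli gives existence for almost every \<open>x\<close>.\<close>
  have ii: "AE x in lborel. x \<in> J \<longrightarrow> set_integrable lborel {lo..hi} (%\<tau>. kf k \<tau> x)"
  proof -
   have G: "(%z. ennreal \<bar>kf k (snd z) (fst z)\<bar> * indicator J (fst z) * indicator {lo..hi} (snd z)) \<in> borel_measurable (lborel \<Otimes>\<^sub>M lborel)"
   proof -
    have "(%z. kf k (snd z) (fst z)) \<in> borel_measurable (lborel \<Otimes>\<^sub>M lborel)"
     using kms[OF order_refl] by (simp cong: measurable_cong_sets sets_pair_measure_cong)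
    from measurable_compose[OF this, of "%v. ennreal \<bar>v\<bar>" borel]
    show ?thesis by (intro borel_measurable_times_ennreal measurable_compose[OF measurable_fst] measurable_compose[OF measurable_snd]) auto
   qed
   have "(\<integral>\<^sup>+x. (\<integral>\<^sup>+\<tau>. ennreal \<bar>kf k \<tau> x\<bar> * indicator J x * indicator {lo..hi} \<tau> \<partial>lborel) \<partial>lborel) =
     (\<integral>\<^sup>+\<tau>. (\<integral>\<^sup>+x. ennreal \<bar>kf k \<tau> x\<bar> * indicator J x * indicator {lo..hi} \<tau> \<partial>lborel) \<partial>lborel)"
    using lborel_pair.Fubini[OF G] by simp
   also have "... = (\<integral>\<^sup>+\<tau>. (\<integral>\<^sup>+x. ennreal \<bar>kf k \<tau> x\<bar> * indicator J x \<partial>lborel) * indicator {lo..hi} \<tau> \<partial>lborel)"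
   proof (rule nn_integral_cong)
    fix \<tau>
    show "(\<integral>\<^sup>+x. ennreal \<bar>kf k \<tau> x\<bar> * indicator J x * indicator {lo..hi} \<tau> \<partial>lborel) = (\<integral>\<^sup>+x. ennreal \<bar>kf k \<tau> x\<bar> * indicator J x \<partial>lborel) * indicator {lo..hi} \<tau>"
     by (cases "\<tau> \<in> {lo..hi}") simp_all
   qed
   also have "... < \<infinity>" by (rule fin) simp
   finally have "(\<integral>\<^sup>+x. (\<integral>\<^sup>+\<tau>. ennreal \<bar>kf k \<tau> x\<bar> * indicator J x * indicator {lo..hi} \<tau> \<partial>lborel) \<partial>lborel) \<noteq> \<infinity>" by simp
   then have "AE x in lborel. (\<integral>\<^sup>+\<tau>. ennreal \<bar>kf k \<tau> x\<bar> * indicator J x * indicator {lo..hi} \<tau> \<partial>lborel) \<noteq> \<infinity>"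
    using lborel.borel_measurable_nn_integral_fst[OF G] by (intro nn_integral_noteq_infinite) simp_all
   then show ?thesis
   proof eventually_elim
    case (elim x)
    show ?case
    proof
     assume x: "x \<in> J"
     have mx: "(%\<tau>. kf k \<tau> x) \<in> BM"
     proof -
      have "(%\<tau>. (\<tau>, x)) \<in> borel \<rightarrow>\<^sub>M borel \<Otimes>\<^sub>M borel" by (intro measurable_Pair measurable_ident_sets measurable_const) auto
      from measurable_compose[OF this kmP[OF order_refl]] show ?thesis by simp
     qed
     have "(\<integral>\<^sup>+\<tau>. ennreal (norm (indicator {lo..hi} \<tau> *\<^sub>R kf k \<tau> x)) \<partial>lborel) = (\<integral>\<^sup>+\<tau>. ennreal \<bar>kf k \<tau> x\<bar> * indicator J x * indicator {lo..hi} \<tau> \<partial>lborel)"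
      using x by (intro nn_integral_cong) (auto simp: indicator_def)
     then have "(\<integral>\<^sup>+\<tau>. ennreal (norm (indicator {lo..hi} \<tau> *\<^sub>R kf k \<tau> x)) \<partial>lborel) < \<infinity>" using elim by (simp add: less_top)
     then show "set_integrable lborel {lo..hi} (%\<tau>. kf k \<tau> x)"
      unfolding set_integrable_def using mx by (intro integrableI_bounded) auto
    qed
   qed
  qed
  define kF where "kF = (%\<tau> z. FK \<sigma> (kf k \<tau>) z)"
  have kFm: "(%(\<tau>,z). kF \<tau> z) \<in> borel_measurable (borel \<Otimes>\<^sub>M (borel :: (real\<times>real) measure))"
  proof -
   have 1: "(%w. kf k (fst w) (fst (snd w))) \<in> borel_measurable (borel :: (real\<times>(real\<times>real)) measure)"
   proof -
    have "(%w::real\<times>(real\<times>real). (fst w, fst (snd w))) \<in> BM" by (intro borel_measurable_continuous_onI continuous_intros)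
    from measurable_compose[OF this km2[OF order_refl]] show ?thesis by (simp only: fst_conv snd_conv)
   qed
   have 2: "(%w. kf k (fst w) (snd (snd w))) \<in> borel_measurable (borel :: (real\<times>(real\<times>real)) measure)"
   proof -
    have "(%w::real\<times>(real\<times>real). (fst w, snd (snd w))) \<in> BM" by (intro borel_measurable_continuous_onI continuous_intros)
    from measurable_compose[OF this km2[OF order_refl]] show ?thesis by (simp only: fst_conv snd_conv)
   qed
   have 3: "(%w. \<bar>fst (snd w) - snd (snd w)\<bar> powr (1/2 + \<sigma>)) \<in> borel_measurable (borel :: (real\<times>(real\<times>real)) measure)"
   proof -
    have "(%w::real\<times>(real\<times>real). snd w) \<in> BM" by (intro borel_measurable_continuous_onI continuous_intros)
    from measurable_compose[OF this borel_measurable_abs_diff_powr] show ?thesis .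
   qed
   show ?thesis unfolding borel_prod case_prod_beta' kF_def FK_def by (intro borel_measurable_divide borel_measurable_diff 1 2 3)
  qed
  have "nsq JJ (FK \<sigma> (hs k)) = nsq JJ (%z. (LINT \<tau>:{lo..hi}|lborel. kF \<tau> z) / (hi - lo))"
  proof (rule nsq_cong_AE)
   show "AE z in lborel. z \<in> J\<times>J \<longrightarrow> FK \<sigma> (hs k) z = (LINT \<tau>:{lo..hi}|lborel. kF \<tau> z) / (hi - lo)"
    using AE_lborel_fst[OF ii] AE_lborel_snd[OF ii]
   proof eventually_elim
    case (elim z)
    show ?case
    proof
     assume z: "z \<in> J\<times>J"
     have i: "set_integrable lborel {lo..hi} (%\<tau>. kf k \<tau> (fst z))" "set_integrable lborel {lo..hi} (%\<tau>. kf k \<tau> (snd z))"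
      using elim z by (auto simp: mem_Times_iff)
     have "(LINT \<tau>:{lo..hi}|lborel. kF \<tau> z) = (LINT \<tau>:{lo..hi}|lborel. kf k \<tau> (fst z) - kf k \<tau> (snd z)) / \<bar>fst z - snd z\<bar> powr (1/2 + \<sigma>)"
      unfolding kF_def FK_def by simp
     also have "(LINT \<tau>:{lo..hi}|lborel. kf k \<tau> (fst z) - kf k \<tau> (snd z)) = (LINT \<tau>:{lo..hi}|lborel. kf k \<tau> (fst z)) - (LINT \<tau>:{lo..hi}|lborel. kf k \<tau> (snd z))"
      by (rule set_integral_diff(2)[OF i])
     finally show "FK \<sigma> (hs k) z = (LINT \<tau>:{lo..hi}|lborel. kF \<tau> z) / (hi - lo)"
      unfolding FK_def hs_def by (simp add: diff_divide_distrib mult.commute)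
    qed
   qed
  qed
  also have "... \<le> B"
  proof (rule nsq_average_le[OF kFm _ lh])
   fix \<tau> assume \<tau>: "\<tau> \<in> {lo..hi}"
   have "nsq JJ (kF \<tau>) = nsq JJ (FK \<sigma> (%x. cV a b \<tau> k x - cV a b t k x))"
   proof (rule nsq_cong)
    fix z :: "real\<times>real" assume "z \<in> J\<times>J"
    then have z: "fst z \<in> J" "snd z \<in> J" by (auto simp: mem_Times_iff)
    show "kF \<tau> z = FK \<sigma> (%x. cV a b \<tau> k x - cV a b t k x) z"
     unfolding kF_def FK_def kf_def tcI(1)[OF \<tau>] clmp_J[OF z(1)] clmp_J[OF z(2)] ..
   qed
   also have "... \<le> HN \<sigma> k (%j x. cV a b \<tau> j x - cV a b t j x)" by (rule FK_le_HN[OF s])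
   also have "... \<le> B" by (rule B(1)[OF \<tau>])
   finally show "nsq JJ (kF \<tau>) \<le> B" .
  qed simp
  finally show ?thesis .
 qed
 have "HN \<sigma> k hs \<le> B + (B + B)"
  using ks unfolding kcase_def
 proof
  assume k: "k = 0 \<and> 1/2 < \<sigma> \<and> \<sigma> < 1"
  then show ?thesis using nh[of 0] FKh unfolding conjunct1[OF k] HN_0
   using add_mono[OF _ add_increasing2[of B _ B]] by auto
 next
  assume k: "k = 1 \<and> 0 \<le> \<sigma> \<and> \<sigma> < 1/2"
  have f: "(if 0 < \<sigma> then nsq JJ (FK \<sigma> (hs 1)) else 0) \<le> B" using FKh k by auto
  show ?thesis unfolding conjunct1[OF k] HN_1 by (rule add_mono[OF nh[of 0] add_mono[OF nh[of 1] f]]) (use k in auto)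
 qed
 also have "B + (B + B) = 3 * B"
 proof -
  have "(3::ennreal) = 1 + (1 + 1)" by simp
  then show ?thesis by (simp only: distrib_right mult_1_left)
 qed
 finally show ?thesis using chh h0 by blast
qed

subsection \<open>Classical solutions\<close>

text \<open>All of \<open>{0..T}\<close> is reached in one step: in the rescaled unknown
  \<open>z t = exp (- 2 * K * t) * y t\<close> the integral operator contracts by 1/2 whatever the
  length of the interval. Clipping time to \<open>{0..T}\<close> makes its values bounded continuous
  functions on the line, where Banach's theorem applies.\<close>

lemma picard_exists:
 fixes W :: "real => real => real"
 assumes c: "continuous_on UNIV (%z. W (fst z) (snd z))" and K: "0 < K" "\<And>t x y. \<bar>W t x - W t y\<bar> \<le> K * \<bar>x - y\<bar>"
  and M: "\<And>t x. \<bar>W t x\<bar> \<le> M" and T: "0 \<le> T"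
 shows "\<exists>y. y 0 = x0 \<and> (\<forall>t\<in>{0..T}. (y has_real_derivative W t (y t)) (at t within {0..T}))"
proof -
 define tc where "tc = (%t. max 0 (min T t))"
 have tc: "tc t \<in> {0..T}" "t \<in> {0..T} ==> tc t = t" for t unfolding tc_def using T by auto
 have tcc: "continuous_on UNIV tc" unfolding tc_def by (intro continuous_intros)
 define g where "g = (%(z::real \<Rightarrow>\<^sub>C real) \<tau>. W \<tau> (exp (2 * K * \<tau>) * apply_bcontfun z \<tau>))"
 have gc: "continuous_on S (g z)" for z S
 proof -
  have "continuous_on S (%\<tau>. (\<tau>, exp (2 * K * \<tau>) * apply_bcontfun z \<tau>))"
   by (intro continuous_intros continuous_on_subset[OF continuous_on_apply_bcontfun]) auto
  from continuous_on_compose2[OF c this] show ?thesis unfolding g_def by simp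
 qed
 define F where "F = (%z t. exp (- 2 * K * tc t) * (x0 + integral {0..tc t} (g z)))"
 have gi: "g z integrable_on {0..t}" for z t by (intro integrable_continuous_interval gc)
 have Fb: "F z \<in> bcontfun" for z
 proof -
  have "continuous_on {0..T} (%t. integral {0..t} (g z))" by (rule indefinite_integral_continuous_1[OF gi])
  from continuous_on_compose2[OF this tcc] have ic: "continuous_on UNIV (%t. integral {0..tc t} (g z))" using tc(1) by blast
  have "\<bar>F z t\<bar> \<le> \<bar>x0\<bar> + \<bar>M\<bar> * T" for t
  proof -
   have t: "0 \<le> tc t" "tc t \<le> T" using tc(1)[of t] by auto
   have "norm (integral {0..tc t} (g z)) \<le> \<bar>M\<bar> * (tc t - 0)"
    by (rule integral_bound) (use t gc M in \<open>auto simp: g_def intro: order_trans[OF M]\<close>)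
   also have "... \<le> \<bar>M\<bar> * T" using t by (intro mult_left_mono) auto
   finally have "\<bar>x0 + integral {0..tc t} (g z)\<bar> \<le> \<bar>x0\<bar> + \<bar>M\<bar> * T" by (smt (verit) real_norm_def)
   moreover have "\<bar>exp (- 2 * K * tc t)\<bar> \<le> 1" using t K(1) by simp
   ultimately have "\<bar>F z t\<bar> \<le> 1 * (\<bar>x0\<bar> + \<bar>M\<bar> * T)" unfolding F_def abs_mult by (intro mult_mono) auto
   then show ?thesis by simp
  qed
  then have "bounded (range (F z))" unfolding bounded_iff by auto
  moreover have "continuous_on UNIV (F z)" unfolding F_def by (intro continuous_intros ic tcc)
  ultimately show ?thesis unfolding bcontfun_def by blast
 qed
 define \<Phi> where "\<Phi> = (%z. Bcontfun (F z))"
 have app: "apply_bcontfun (\<Phi> z) = F z" for z unfolding \<Phi>_def using Fb by (rule Bcontfun_inverse)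
 have "\<exists>!z. \<Phi> z = z"
 proof (rule banach_fix_type[of "1/2"])
  show "\<forall>z w. dist (\<Phi> z) (\<Phi> w) \<le> 1/2 * dist z w"
  proof (intro allI dist_bound)
   fix z w :: "real \<Rightarrow>\<^sub>C real" and t
   define D where "D = dist z w"
   have D: "\<bar>apply_bcontfun z \<tau> - apply_bcontfun w \<tau>\<bar> \<le> D" for \<tau> using dist_bounded[of z \<tau> w] unfolding D_def dist_real_def .
   have D0: "0 \<le> D" unfolding D_def by simp
   define s where "s = tc t"
   have s: "0 \<le> s" using tc(1)[of t] unfolding s_def by simp
   have hi: "((%\<tau>. K * D * exp (2 * K * \<tau>)) has_integral (D / 2) * exp (2 * K * s) - (D / 2) * exp (2 * K * 0)) {0..s}"
    by (rule fundamental_theorem_of_calculus[OF s])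
      (auto simp: has_real_derivative_iff_has_vector_derivative[symmetric] intro!: derivative_eq_intros)
   have I: "integral {0..s} (%\<tau>. K * D * exp (2 * K * \<tau>)) = (D/2) * (exp (2 * K * s) - 1)"
    unfolding integral_unique[OF hi] by (simp add: algebra_simps)
   have "\<bar>integral {0..s} (g z) - integral {0..s} (g w)\<bar> = \<bar>integral {0..s} (%\<tau>. g z \<tau> - g w \<tau>)\<bar>"
    using gi by (simp add: Henstock_Kurzweil_Integration.integral_diff)
   also have "... \<le> integral {0..s} (%\<tau>. K * D * exp (2 * K * \<tau>))"
    unfolding real_norm_def[symmetric]
   proof (rule integral_norm_bound_integral)
    show "(%\<tau>. g z \<tau> - g w \<tau>) integrable_on {0..s}" by (intro integrable_diff gi)
    show "norm (g z \<tau> - g w \<tau>) \<le> K * D * exp (2 * K * \<tau>)" for \<tau>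
    proof -
     have "\<bar>g z \<tau> - g w \<tau>\<bar> \<le> K * \<bar>exp (2 * K * \<tau>) * apply_bcontfun z \<tau> - exp (2 * K * \<tau>) * apply_bcontfun w \<tau>\<bar>" unfolding g_def by (rule K(2))
     also have "... = K * (exp (2 * K * \<tau>) * \<bar>apply_bcontfun z \<tau> - apply_bcontfun w \<tau>\<bar>)"
      by (simp add: abs_mult flip: right_diff_distrib)
     also have "... \<le> K * (exp (2 * K * \<tau>) * D)" using D[of \<tau>] K(1) by (intro mult_left_mono) auto
     finally show ?thesis by (simp add: ac_simps)
    qed
   qed (use hi in blast)
   finally have le: "\<bar>integral {0..s} (g z) - integral {0..s} (g w)\<bar> \<le> (D/2) * (exp (2 * K * s) - 1)" unfolding I .
   have "dist (F z t) (F w t) = exp (- 2 * K * s) * \<bar>integral {0..s} (g z) - integral {0..s} (g w)\<bar>"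
    unfolding F_def s_def[symmetric] dist_real_def by (simp add: abs_mult flip: right_diff_distrib)
   also have "... \<le> exp (- 2 * K * s) * ((D/2) * (exp (2 * K * s) - 1))" using le by (intro mult_left_mono) auto
   also have "... = (D/2) * (1 - exp (- 2 * K * s))" by (simp add: algebra_simps flip: exp_add)
   also have "... \<le> (D/2) * 1" using D0 by (intro mult_left_mono) auto
   finally show "dist (apply_bcontfun (\<Phi> z) t) (apply_bcontfun (\<Phi> w) t) \<le> 1/2 * dist z w" unfolding app D_def by simp
  qed
 qed auto
 then obtain z where z: "\<Phi> z = z" by blast
 define y where "y = (%t. x0 + integral {0..t} (g z))"
 have yz: "exp (2 * K * t) * apply_bcontfun z t = y t" if "t \<in> {0..T}" for t
 proof -
  have "apply_bcontfun z t = F z t" using app[of z] z by simp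
  then show ?thesis unfolding F_def tc(2)[OF that] y_def by (simp add: exp_minus)
 qed
 have "(y has_real_derivative W t (y t)) (at t within {0..T})" if t: "t \<in> {0..T}" for t
 proof -
  have "((%t. integral {0..t} (g z)) has_real_derivative g z t) (at t within {0..T})"
   by (rule integral_has_real_derivative[OF gc t])
  then have "(y has_real_derivative g z t) (at t within {0..T})" unfolding y_def by (auto intro!: derivative_eq_intros)
  then show ?thesis unfolding g_def yz[OF t] .
 qed
 moreover have "y 0 = x0" unfolding y_def by simp
 ultimately show ?thesis by blast
qed

text \<open>A continuously differentiable penalty for leaving an interval, used in
  \<open>flow_exists\<close>.\<close>

lemma max_sq_DERIV: "((%z::real. (max 0 z)\<^sup>2) has_real_derivative 2 * max 0 z) (at z)"
proof -
 consider "z > 0" | "z < 0" | "z = 0" by linarith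
 then show ?thesis
 proof cases
  case 1
  have "((%z. z\<^sup>2) has_real_derivative 2 * max 0 z) (at z)" using 1 by (auto intro!: derivative_eq_intros)
  then show ?thesis by (rule has_field_derivative_transform_within_open[of _ _ _ "{0<..}"]) (use 1 in auto)
 next
  case 2
  have "((%z. 0) has_real_derivative 2 * max 0 z) (at z)" using 2 by auto
  then show ?thesis by (rule has_field_derivative_transform_within_open[of _ _ _ "{..<0}"]) (use 2 in auto)
 next
  case 3
  have "((%h. ((max 0 (0 + h))\<^sup>2 - (max 0 0)\<^sup>2) / h) \<longlongrightarrow> 0) (at (0::real))"
  proof (rule Lim_null_comparison)
   show "\<forall>\<^sub>F h in at 0. norm (((max 0 (0 + h))\<^sup>2 - (max 0 0)\<^sup>2) / h) \<le> \<bar>h::real\<bar>"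
    by (auto simp: eventually_at_filter max_def power2_eq_square)
   show "((%h. \<bar>h::real\<bar>) \<longlongrightarrow> 0) (at 0)" by (rule tendsto_rabs_zero) (rule tendsto_ident_at)
  qed
  then show ?thesis using 3 by (simp add: DERIV_def)
 qed
qed

lemma const_of_zero_deriv:
 fixes f :: "real => real"
 assumes "\<And>t. t \<in> {lo..hi} ==> (f has_real_derivative 0) (at t within {lo..hi})" "t \<in> {lo..hi}"
 shows "f t = f lo"
proof -
 have "\<exists>c. \<forall>x\<in>{lo..hi}. f x = c"
  by (rule has_field_derivative_zero_constant) (use assms in auto)
 then show ?thesis using assms(2) by (metis atLeastAtMost_iff order_refl order_trans)
qed

lemma linear_ode_exp:
 fixes z b :: "real => real"
 assumes b: "continuous_on {0..T} b" and z: "\<And>t. t \<in> {0..T} ==> (z has_real_derivative b t * z t) (at t within {0..T})"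
  and t: "t \<in> {0..T}"
 shows "z t = z 0 * exp (integral {0..t} b)"
proof -
 have d: "((%t. z t * exp (- integral {0..t} b)) has_real_derivative 0) (at t within {0..T})" if "t \<in> {0..T}" for t
 proof -
  have "((%t. integral {0..t} b) has_real_derivative b t) (at t within {0..T})" by (rule integral_has_real_derivative[OF b that])
  then show ?thesis by (auto intro!: derivative_eq_intros z that simp: algebra_simps)
 qed
 have "z t * exp (- integral {0..t} b) = z 0 * exp (- integral {0..0} b)" by (rule const_of_zero_deriv[OF d t])
 then have "z t * exp (- integral {0..t} b) = z 0" by simp
 then have "z t * (exp (- integral {0..t} b) * exp (integral {0..t} b)) = z 0 * exp (integral {0..t} b)" by (simp add: mult.assoc[symmetric])
 then show ?thesis by (simp flip: exp_add)
qed

lemma DERIV_comp_within: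
 fixes f g :: "real => real"
 assumes "(g has_real_derivative D') (at x within S)" "(f has_real_derivative D) (at (g x) within R)" "\<And>y. y \<in> S ==> g y \<in> R"
 shows "((%x. f (g x)) has_real_derivative D * D') (at x within S)"
proof -
 have "(f has_real_derivative D) (at (g x) within g ` S)" by (rule has_field_derivative_subset[OF assms(2)]) (use assms(3) in blast)
 from DERIV_image_chain[OF this assms(1)] show ?thesis by (simp add: o_def)
qed

lemma uniform_joint_cont:
 fixes f :: "real => real => real"
 assumes u: "\<And>t e. t \<in> S ==> 0 < e ==> \<exists>d>0. \<forall>t'\<in>S. \<bar>t' - t\<bar> < d \<longrightarrow> (\<forall>x\<in>J. \<bar>f t' x - f t x\<bar> \<le> e)"
  and c: "\<And>t. t \<in> S ==> continuous_on J (f t)"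
 shows "continuous_on (S \<times> J) (%z. f (fst z) (snd z))"
 unfolding continuous_on_def
proof
 fix z assume z: "z \<in> S \<times> J"
 let ?F = "at z within S \<times> J"
 have 1: "((%y. f (fst y) (snd y) - f (fst z) (snd y)) \<longlongrightarrow> 0) ?F"
 proof (rule tendstoI)
  fix e :: real assume e: "0 < e"
  obtain d where d: "d > 0" "\<forall>t'\<in>S. \<bar>t' - fst z\<bar> < d \<longrightarrow> (\<forall>x\<in>J. \<bar>f t' x - f (fst z) x\<bar> \<le> e/2)"
   using u[of "fst z" "e/2"] z e by (auto simp: mem_Times_iff)
  have "((%y. \<bar>fst y - fst z\<bar>) \<longlongrightarrow> \<bar>fst z - fst z\<bar>) ?F" by (intro tendsto_intros)
  then have "\<forall>\<^sub>F y in ?F. \<bar>fst y - fst z\<bar> < d" using d(1) by (auto dest: order_tendstoD(2))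
  moreover have "\<forall>\<^sub>F y in ?F. y \<in> S \<times> J" by (simp add: eventually_at_filter)
  ultimately show "\<forall>\<^sub>F y in ?F. dist (f (fst y) (snd y) - f (fst z) (snd y)) 0 < e"
  proof eventually_elim
   case (elim y)
   then have "\<bar>f (fst y) (snd y) - f (fst z) (snd y)\<bar> \<le> e/2" using d(2) by (simp add: mem_Times_iff)
   then show ?case using e by simp
  qed
 qed
 have "continuous_on (S \<times> J) (%y. f (fst z) (snd y))"
  by (rule continuous_on_compose2[OF c continuous_on_snd[OF continuous_on_id]]) (use z in auto)
 then have "((%y. f (fst z) (snd y)) \<longlongrightarrow> f (fst z) (snd z)) ?F" using z unfolding continuous_on_def by blast
 from tendsto_add[OF 1 this] show "((%y. f (fst y) (snd y)) \<longlongrightarrow> f (fst z) (snd z)) ?F" by simp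
qed

lemma deriv_unique_Icc:
 fixes f :: "real => real"
 assumes "lo < hi" "x \<in> {lo..hi}" "(f has_real_derivative D) (at x within {lo..hi})" "(f has_real_derivative D') (at x within {lo..hi})"
 shows "D = D'"
 using vector_derivative_unique_within_closed_interval[of lo hi x f D D'] assms
 by (simp add: cbox_interval has_real_derivative_iff_has_vector_derivative)

text \<open>What a solution in the Sobolev class provides on a compact time interval:
  \<open>w\<close>, its space derivative \<open>wx\<close> and its time derivative \<open>v\<close>
  are jointly continuous up to the boundary, and the equation holds on the closed rectangle. Nothing
  is assumed about second derivatives.\<close>

locale classical =
 fixes T1 :: real and w wx v :: "real => real => real" and a :: "real => real"
 assumes T1: "0 < T1" and adma: "adm a"
  and cw: "continuous_on ({0..T1} \<times> J) (%z. w (fst z) (snd z))"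
  and cwx: "continuous_on ({0..T1} \<times> J) (%z. wx (fst z) (snd z))"
  and cv: "continuous_on ({0..T1} \<times> J) (%z. v (fst z) (snd z))"
  and dx: "\<And>t x. t \<in> {0..T1} ==> x \<in> J ==> (w t has_real_derivative wx t x) (at x within J)"
  and dt: "\<And>t x. t \<in> {0..T1} ==> x \<in> J ==> ((%t. w t x) has_real_derivative v t x) (at t within {0..T1})"
  and bc: "\<And>t. t \<in> {0..T1} ==> w t 0 = 0" "\<And>t. t \<in> {0..T1} ==> w t (1/2) = 0"
  and init: "\<And>x. x \<in> J ==> w 0 x = AD a x"
  and pde: "\<And>t x. t \<in> {0..T1} ==> x \<in> J ==> v t x + w t x * wx t x = integral {0..x} (%y. (wx t y)\<^sup>2 / 2) - x * integral J (%y. (wx t y)\<^sup>2)"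
begin

text \<open>The energy has to be carried as a function of time until \<open>EE_En\<close> shows that
  it is constant.\<close>

definition EE :: "real => real" where "EE t = integral J (%y. (wx t y)\<^sup>2)"
definition FF :: "real => real => real" where "FF t x = integral {0..x} (%y. (wx t y)\<^sup>2 / 2) - x * EE t"

lemma compD: "compact ({0..T1} \<times> J)" by (intro compact_Times compact_Icc)

lemma wx_bound: obtains K where "0 < K" "\<And>t x. t \<in> {0..T1} ==> x \<in> J ==> \<bar>wx t x\<bar> \<le> K" "\<And>t x. t \<in> {0..T1} ==> x \<in> J ==> \<bar>w t x\<bar> \<le> K"
proof -
 obtain K1 where K1: "\<forall>z\<in>{0..T1}\<times>J. norm (wx (fst z) (snd z)) \<le> K1"
  using compact_imp_bounded[OF compact_continuous_image[OF cwx compD]] unfolding bounded_iff by auto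
 obtain K2 where K2: "\<forall>z\<in>{0..T1}\<times>J. norm (w (fst z) (snd z)) \<le> K2"
  using compact_imp_bounded[OF compact_continuous_image[OF cw compD]] unfolding bounded_iff by auto
 show thesis
 proof (rule that[of "\<bar>K1\<bar> + \<bar>K2\<bar> + 1"])
  fix t x assume "t \<in> {0..T1}" "x \<in> J"
  then have z: "(t,x) \<in> {0..T1}\<times>J" by (rule SigmaI)
  show "\<bar>wx t x\<bar> \<le> \<bar>K1\<bar> + \<bar>K2\<bar> + 1" "\<bar>w t x\<bar> \<le> \<bar>K1\<bar> + \<bar>K2\<bar> + 1" using K1[rule_format, OF z] K2[rule_format, OF z] by auto
 qed simp
qed

lemma w_lip: obtains K where "0 < K" "\<And>t x y. t \<in> {0..T1} ==> x \<in> J ==> y \<in> J ==> \<bar>w t x - w t y\<bar> \<le> K * \<bar>x - y\<bar>"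
proof -
 obtain K where K: "0 < K" "\<And>t x. t \<in> {0..T1} ==> x \<in> J ==> \<bar>wx t x\<bar> \<le> K" using wx_bound by metis
 have "\<bar>w t x - w t y\<bar> \<le> K * \<bar>x - y\<bar>" if t: "t \<in> {0..T1}" and xy: "x \<in> J" "y \<in> J" for t x y
  using field_differentiable_bound[of J "w t" "wx t" K x y] dx[OF t] K(2)[OF t] xy by (simp add: convex_real_interval)
 then show thesis using that[OF K(1)] by blast
qed

text \<open>The field is extended to the plane by clipping, so by the boundary conditions it
  vanishes outside the open interval. Hence the squared excess of a trajectory above
  \<open>1/2\<close>, and likewise below 0, has zero derivative and stays zero.\<close>

lemma flow_exists:
 assumes x0: "x0 \<in> J"
 shows "\<exists>y. y 0 = x0 \<and> (\<forall>t\<in>{0..T1}. y t \<in> J) \<and> (\<forall>t\<in>{0..T1}. (y has_real_derivative w t (y t)) (at t within {0..T1}))"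
proof -
 define tc where "tc = (%t. max 0 (min T1 t))"
 have tc: "tc t \<in> {0..T1}" "t \<in> {0..T1} ==> tc t = t" for t unfolding tc_def using T1 by auto
 have tcc: "continuous_on S tc" for S unfolding tc_def by (intro continuous_intros)
 define W where "W = (%t x. w (tc t) (clmp x))"
 have cW: "continuous_on UNIV (%z. W (fst z) (snd z))"
 proof -
  have 1: "continuous_on UNIV (%z::real\<times>real. (tc (fst z), clmp (snd z)))"
   by (intro continuous_on_Pair continuous_on_compose2[OF tcc[of UNIV]] continuous_on_compose2[OF clmp_continuous[of UNIV]] continuous_intros) auto
  have 2: "(%z::real\<times>real. (tc (fst z), clmp (snd z))) ` UNIV \<subseteq> {0..T1} \<times> J" using tc(1) clmp_mem by blast
  show ?thesis unfolding W_def using continuous_on_compose2[OF cw 1 2] unfolding fst_conv snd_conv .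
 qed
 obtain K where K: "0 < K" "\<And>t x y. t \<in> {0..T1} ==> x \<in> J ==> y \<in> J ==> \<bar>w t x - w t y\<bar> \<le> K * \<bar>x - y\<bar>" using w_lip by metis
 obtain M where M: "\<And>t x. t \<in> {0..T1} ==> x \<in> J ==> \<bar>w t x\<bar> \<le> M" using wx_bound by metis
 have clip: "\<bar>clmp x - clmp y\<bar> \<le> \<bar>x - y\<bar>" for x y unfolding clmp_def by (auto simp: max_def min_def)
 have lip: "\<bar>W t x - W t y\<bar> \<le> K * \<bar>x - y\<bar>" for t x y
  using K(2)[OF tc(1) clmp_mem clmp_mem, of t x y] mult_left_mono[OF clip, of K x y] K(1) unfolding W_def by linarith
 obtain y where y: "y 0 = x0" "\<And>t. t \<in> {0..T1} ==> (y has_real_derivative W t (y t)) (at t within {0..T1})"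
  using picard_exists[OF cW K(1) lip, of M T1 x0] M[OF tc(1) clmp_mem] T1 unfolding W_def by (metis less_imp_le)
 have out: "W t x = 0" if "x \<notin> {0<..<1/2}" for t x
 proof -
  have "clmp x = 0 \<or> clmp x = 1/2" using that unfolding clmp_def by (auto simp: max_def min_def)
  then show ?thesis unfolding W_def using bc[OF tc(1)[of t]] by metis
 qed
 have up: "y t \<le> 1/2" if t: "t \<in> {0..T1}" for t
 proof -
  have "((%t. (max 0 (y t - 1/2))\<^sup>2) has_real_derivative 0) (at t within {0..T1})" if "t \<in> {0..T1}" for t
  proof -
   have "((%t. y t - 1/2) has_real_derivative W t (y t)) (at t within {0..T1})" by (auto intro!: derivative_eq_intros y that)
   from DERIV_chain2[OF max_sq_DERIV this]
   have "((%t. (max 0 (y t - 1/2))\<^sup>2) has_real_derivative 2 * max 0 (y t - 1/2) * W t (y t)) (at t within {0..T1})" .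
   moreover have "2 * max 0 (y t - 1/2) * W t (y t) = 0" using out[of "y t" t] by (cases "y t < 1/2") auto
   ultimately show ?thesis by simp
  qed
  from const_of_zero_deriv[OF this t] have "(max 0 (y t - 1/2))\<^sup>2 = 0" using y(1) x0 by simp
  then show ?thesis by simp
 qed
 have low: "0 \<le> y t" if t: "t \<in> {0..T1}" for t
 proof -
  have "((%t. (max 0 (- y t))\<^sup>2) has_real_derivative 0) (at t within {0..T1})" if "t \<in> {0..T1}" for t
  proof -
   have "((%t. - y t) has_real_derivative - W t (y t)) (at t within {0..T1})" by (auto intro!: derivative_eq_intros y that)
   from DERIV_chain2[OF max_sq_DERIV this]
   have "((%t. (max 0 (- y t))\<^sup>2) has_real_derivative 2 * max 0 (- y t) * (- W t (y t))) (at t within {0..T1})" .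
   moreover have "2 * max 0 (- y t) * (- W t (y t)) = 0" using out[of "y t" t] by (cases "y t > 0") auto
   ultimately show ?thesis by (simp only:)
  qed
  from const_of_zero_deriv[OF this t] have "(max 0 (- y t))\<^sup>2 = 0" using y(1) x0 by simp
  then show ?thesis by simp
 qed
 have yJ: "y t \<in> J" if "t \<in> {0..T1}" for t using up[OF that] low[OF that] by simp
 have "(y has_real_derivative w t (y t)) (at t within {0..T1})" if "t \<in> {0..T1}" for t
  using y(2)[OF that] unfolding W_def tc(2)[OF that] clmp_J[OF yJ[OF that]] .
 then show ?thesis using y(1) yJ by blast
qed

definition Y :: "real => real => real" where
 "Y x0 = (SOME y. y 0 = x0 \<and> (\<forall>t\<in>{0..T1}. y t \<in> J) \<and> (\<forall>t\<in>{0..T1}. (y has_real_derivative w t (y t)) (at t within {0..T1})))"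

lemma Y: assumes "x0 \<in> J"
 shows "Y x0 0 = x0" "t \<in> {0..T1} ==> Y x0 t \<in> J" "t \<in> {0..T1} ==> (Y x0 has_real_derivative w t (Y x0 t)) (at t within {0..T1})"
 using someI_ex[OF flow_exists[OF assms]] unfolding Y_def by blast+

text \<open>The mean of \<open>wx\<close> over the segment joining two trajectories. With it their
  difference solves a linear equation exactly; the exponential formula in \<open>Y_diff\<close> then
  gives Lipschitz dependence on the label, and the derivative in the label as the two labels
  merge.\<close>

definition bb :: "real => real => real => real" where
 "bb x1 x2 t = integral {0..1} (%\<theta>. wx t (Y x1 t + \<theta> * (Y x2 t - Y x1 t)))"

lemma seg_J: "p \<in> J ==> q \<in> J ==> \<theta> \<in> {0..1} ==> p + \<theta> * (q - p) \<in> J"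
 using convexD_alt[of J p q \<theta>] by (simp add: algebra_simps convex_real_interval)

lemma mean_value: assumes t: "t \<in> {0..T1}" and pq: "p \<in> J" "q \<in> J"
 shows "w t q - w t p = integral {0..1} (%\<theta>. wx t (p + \<theta> * (q - p))) * (q - p)"
proof -
 have "((%\<theta>. wx t (p + \<theta> * (q - p)) * (q - p)) has_integral w t (p + 1 * (q - p)) - w t (p + 0 * (q - p))) {0..1}"
 proof (rule fundamental_theorem_of_calculus)
  fix \<theta> :: real assume th: "\<theta> \<in> {0..1}"
  have "((%\<theta>. w t (p + \<theta> * (q - p))) has_real_derivative wx t (p + \<theta> * (q - p)) * (q - p)) (at \<theta> within {0..1})"
   by (rule DERIV_comp_within[of "%\<theta>. p + \<theta> * (q - p)", OF _ dx[OF t seg_J[OF pq th]]]) (use seg_J[OF pq] in \<open>auto intro!: derivative_eq_intros\<close>)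
  then show "((%\<theta>. w t (p + \<theta> * (q - p))) has_vector_derivative wx t (p + \<theta> * (q - p)) * (q - p)) (at \<theta> within {0..1})"
   by (simp add: has_real_derivative_iff_has_vector_derivative)
 qed simp
 from integral_unique[OF this] show ?thesis unfolding integral_mult_left by simp
qed

lemma Y_cont_t: "x0 \<in> J ==> continuous_on {0..T1} (Y x0)"
 using Y(3) by (meson has_real_derivative_imp_continuous_on DERIV_continuous continuous_on_eq_continuous_within)

lemma wx_comp:
 fixes S :: "'b::topological_space set"
 assumes "continuous_on S \<tau>" "continuous_on S P" "\<And>z. z \<in> S ==> \<tau> z \<in> {0..T1}" "\<And>z. z \<in> S ==> P z \<in> J"
 shows "continuous_on S (%z. wx (\<tau> z) (P z))"
proof -
 have "(%z. (\<tau> z, P z)) ` S \<subseteq> {0..T1} \<times> J" using assms(3,4) by blast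
 from continuous_on_compose2[OF cwx continuous_on_Pair[OF assms(1,2)] this] show ?thesis by simp
qed

lemma wx_cont: "t \<in> {0..T1} ==> continuous_on J (wx t)"
 by (intro wx_comp continuous_intros)

lemma seg_cont:
 fixes S :: "'b::topological_space set"
 assumes "continuous_on S \<tau>" "continuous_on S P" "continuous_on S R"
  "\<And>z. z \<in> S ==> \<tau> z \<in> {0..T1}" "\<And>z. z \<in> S ==> P z \<in> J" "\<And>z. z \<in> S ==> R z \<in> J"
 shows "continuous_on S (%z. integral {0..1} (%\<theta>. wx (\<tau> z) (P z + \<theta> * (R z - P z))))"
 unfolding cbox_interval[symmetric]
proof (rule integral_continuous_on_param, unfold cbox_interval case_prod_beta, rule wx_comp)
 have f: "continuous_on (S \<times> {0..1::real}) (%y. h (fst y))" if "continuous_on S h" for h :: "'b => real"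
  by (rule continuous_on_compose2[OF that continuous_on_fst[OF continuous_on_id]]) auto
 show "continuous_on (S \<times> {0..1::real}) (%y. \<tau> (fst y))" by (rule f[OF assms(1)])
 show "continuous_on (S \<times> {0..1}) (%y. P (fst y) + snd y * (R (fst y) - P (fst y)))"
  by (intro continuous_intros f assms)
qed (use assms(4) seg_J[OF assms(5,6)] in auto)

lemma Y_diff:
 assumes t: "t \<in> {0..T1}" and x: "x1 \<in> J" "x2 \<in> J"
 shows "continuous_on {0..T1} (bb x1 x2)" "Y x2 t - Y x1 t = (x2 - x1) * exp (integral {0..t} (bb x1 x2))"
proof -
 show bcont: "continuous_on {0..T1} (bb x1 x2)"
  unfolding bb_def by (intro seg_cont continuous_intros Y_cont_t x Y(2)) auto
 have zd: "((%t. Y x2 t - Y x1 t) has_real_derivative bb x1 x2 t * (Y x2 t - Y x1 t)) (at t within {0..T1})" if "t \<in> {0..T1}" for t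
  using mean_value[OF that Y(2)[OF x(1) that] Y(2)[OF x(2) that]] unfolding bb_def
  by (auto intro!: derivative_eq_intros Y(3) x that)
 show "Y x2 t - Y x1 t = (x2 - x1) * exp (integral {0..t} (bb x1 x2))"
  using linear_ode_exp[OF bcont zd t] unfolding Y(1)[OF x(1)] Y(1)[OF x(2)] .
qed

lemma Y_lip: obtains L where "\<And>t x1 x2. t \<in> {0..T1} ==> x1 \<in> J ==> x2 \<in> J ==> \<bar>Y x2 t - Y x1 t\<bar> \<le> L * \<bar>x2 - x1\<bar>"
proof -
 obtain K where K: "0 < K" "\<And>t x. t \<in> {0..T1} ==> x \<in> J ==> \<bar>wx t x\<bar> \<le> K" using wx_bound by metis
 have "\<bar>Y x2 t - Y x1 t\<bar> \<le> exp (K * T1) * \<bar>x2 - x1\<bar>" if t: "t \<in> {0..T1}" and x: "x1 \<in> J" "x2 \<in> J" for t x1 x2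
 proof -
  note bcont = Y_diff(1)[OF t x] and e = Y_diff(2)[OF t x]
  have "bb x1 x2 s \<le> K" if s: "s \<in> {0..T1}" for s
  proof -
   have "norm (bb x1 x2 s) \<le> K * (1 - 0)" unfolding bb_def
   proof (rule integral_bound)
    show "continuous_on {0..1} (%\<theta>. wx s (Y x1 s + \<theta> * (Y x2 s - Y x1 s)))"
     by (intro wx_comp continuous_intros s seg_J Y(2) x)
    show "norm (wx s (Y x1 s + \<theta> * (Y x2 s - Y x1 s))) \<le> K" if "\<theta> \<in> {0..1}" for \<theta>
     using K(2)[OF s seg_J[OF Y(2)[OF x(1) s] Y(2)[OF x(2) s] that]] by simp
   qed simp
   then show ?thesis by simp
  qed
  then have "integral {0..t} (bb x1 x2) \<le> integral {0..t} (%_. K)"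
   by (intro integral_le integrable_continuous_interval continuous_on_subset[OF bcont]) (use t in auto)
  also have "... \<le> K * T1" using t K(1) by (simp add: mult.commute)
  finally have "exp (integral {0..t} (bb x1 x2)) \<le> exp (K * T1)" by simp
  then show ?thesis unfolding e abs_mult by (subst mult.commute) (auto intro!: mult_right_mono)
 qed
 then show thesis by (rule that)
qed

lemma joint_cont:
 fixes f :: "real => real => real"
 assumes lip: "\<And>t t' x. t \<in> {0..T1} ==> t' \<in> {0..T1} ==> x \<in> J ==> \<bar>f t' x - f t x\<bar> \<le> K * \<bar>t' - t\<bar>"
  and c: "\<And>t. t \<in> {0..T1} ==> continuous_on J (f t)"
 shows "continuous_on ({0..T1} \<times> J) (%z. f (fst z) (snd z))"
proof (rule uniform_joint_cont[OF _ c])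
 fix t e :: real assume t: "t \<in> {0..T1}" and e: "0 < e"
 show "\<exists>d>0. \<forall>t'\<in>{0..T1}. \<bar>t' - t\<bar> < d \<longrightarrow> (\<forall>x\<in>J. \<bar>f t' x - f t x\<bar> \<le> e)"
 proof (intro exI[of _ "e / (\<bar>K\<bar> + 1)"] conjI ballI impI)
  fix t' x assume t': "t' \<in> {0..T1}" "\<bar>t' - t\<bar> < e / (\<bar>K\<bar> + 1)" and x: "x \<in> J"
  have "\<bar>f t' x - f t x\<bar> \<le> K * \<bar>t' - t\<bar>" by (rule lip[OF t t'(1) x])
  also have "... \<le> (\<bar>K\<bar> + 1) * \<bar>t' - t\<bar>" by (intro mult_right_mono) auto
  also have "... \<le> e" using t'(2) by (simp add: field_simps)
  finally show "\<bar>f t' x - f t x\<bar> \<le> e" .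
 qed (use e in \<open>simp add: add_pos_nonneg\<close>)
qed

lemma Y_cont: "continuous_on ({0..T1} \<times> J) (%z. Y (snd z) (fst z))"
proof -
 obtain K where K: "\<And>t x. t \<in> {0..T1} ==> x \<in> J ==> \<bar>w t x\<bar> \<le> K" using wx_bound by metis
 obtain L where L: "\<And>t x1 x2. t \<in> {0..T1} ==> x1 \<in> J ==> x2 \<in> J ==> \<bar>Y x2 t - Y x1 t\<bar> \<le> L * \<bar>x2 - x1\<bar>" using Y_lip by blast
 show ?thesis
 proof (rule joint_cont[of "%t x. Y x t" K])
  show "\<bar>Y x t' - Y x t\<bar> \<le> K * \<bar>t' - t\<bar>" if "t \<in> {0..T1}" "t' \<in> {0..T1}" "x \<in> J" for t t' x
   using field_differentiable_bound[of "{0..T1}" "Y x" "%s. w s (Y x s)" K t' t] Y[OF that(3)] K that by (simp add: convex_real_interval)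
  have "lipschitz_on \<bar>L\<bar> J (%x. Y x t)" if "t \<in> {0..T1}" for t
   unfolding lipschitz_on_def dist_real_def using L[OF that] by (meson abs_ge_self abs_ge_zero mult_right_mono order_trans)
  then show "continuous_on J (%x. Y x t)" if "t \<in> {0..T1}" for t using that lipschitz_on_continuous_on by blast
 qed
qed

lemma Y_comp:
 fixes S :: "'b::topological_space set"
 assumes "continuous_on S \<tau>" "continuous_on S P" "\<And>z. z \<in> S ==> \<tau> z \<in> {0..T1}" "\<And>z. z \<in> S ==> P z \<in> J"
 shows "continuous_on S (%z. Y (P z) (\<tau> z))"
proof -
 have "(%z. (\<tau> z, P z)) ` S \<subseteq> {0..T1} \<times> J" using assms(3,4) by blast
 from continuous_on_compose2[OF Y_cont continuous_on_Pair[OF assms(1,2)] this] show ?thesis by simp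
qed

definition Aa :: "real => real => real" where "Aa t x = wx t (Y x t)"
text \<open>The Jacobian of the flow in exponential form, with \<open>Aa\<close> the slope along the
  trajectory; \<open>Y_DERIV_x\<close> shows that it is the label derivative of
  \<open>Y\<close>.\<close>

definition Jc :: "real => real => real" where "Jc t x = exp (integral {0..t} (%\<tau>. Aa \<tau> x))"

lemma Aa_comp:
 fixes S :: "'b::topological_space set"
 assumes "continuous_on S \<tau>" "continuous_on S P" "\<And>z. z \<in> S ==> \<tau> z \<in> {0..T1}" "\<And>z. z \<in> S ==> P z \<in> J"
 shows "continuous_on S (%z. Aa (\<tau> z) (P z))"
 unfolding Aa_def by (intro wx_comp Y_comp assms Y(2))

lemma Aa_cont_t: "x \<in> J ==> continuous_on {0..T1} (%\<tau>. Aa \<tau> x)"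
 by (intro Aa_comp continuous_intros) auto

lemma Aa_integral_bound: obtains K where "\<And>t t' x. t \<in> {0..T1} ==> t' \<in> {0..T1} ==> x \<in> J ==>
  \<bar>integral {0..t'} (%\<tau>. Aa \<tau> x) - integral {0..t} (%\<tau>. Aa \<tau> x)\<bar> \<le> K * \<bar>t' - t\<bar>"
proof -
 obtain K where K: "\<And>t x. t \<in> {0..T1} ==> x \<in> J ==> \<bar>wx t x\<bar> \<le> K" using wx_bound by metis
 show thesis
 proof (rule that[of K])
  fix t t' x assume t: "t \<in> {0..T1}" "t' \<in> {0..T1}" and x: "x \<in> J"
  show "\<bar>integral {0..t'} (%\<tau>. Aa \<tau> x) - integral {0..t} (%\<tau>. Aa \<tau> x)\<bar> \<le> K * \<bar>t' - t\<bar>"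
   using field_differentiable_bound[of "{0..T1}" "%t. integral {0..t} (%\<tau>. Aa \<tau> x)" "%\<tau>. Aa \<tau> x" K t' t]
    integral_has_real_derivative[OF Aa_cont_t[OF x]] K Y(2)[OF x] t unfolding Aa_def by (simp add: convex_real_interval)
 qed
qed

lemma Jc_cont: "continuous_on ({0..T1} \<times> J) (%z. Jc (fst z) (snd z))"
proof -
 obtain K where K: "\<And>t t' x. t \<in> {0..T1} ==> t' \<in> {0..T1} ==> x \<in> J ==>
  \<bar>integral {0..t'} (%\<tau>. Aa \<tau> x) - integral {0..t} (%\<tau>. Aa \<tau> x)\<bar> \<le> K * \<bar>t' - t\<bar>" using Aa_integral_bound by blast
 have c: "continuous_on J (%x. integral {0..t} (%\<tau>. Aa \<tau> x))" if t: "t \<in> {0..T1}" for t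
  unfolding cbox_interval[symmetric]
  by (rule integral_continuous_on_param, unfold cbox_interval case_prod_beta, intro Aa_comp continuous_intros) (use t in auto)
 show ?thesis unfolding Jc_def by (intro continuous_on_exp joint_cont[OF K c])
qed

lemma Jc_comp:
 fixes S :: "'b::topological_space set"
 assumes "continuous_on S \<tau>" "continuous_on S P" "\<And>z. z \<in> S ==> \<tau> z \<in> {0..T1}" "\<And>z. z \<in> S ==> P z \<in> J"
 shows "continuous_on S (%z. Jc (\<tau> z) (P z))"
proof -
 have "(%z. (\<tau> z, P z)) ` S \<subseteq> {0..T1} \<times> J" using assms(3,4) by blast
 from continuous_on_compose2[OF Jc_cont continuous_on_Pair[OF assms(1,2)] this] show ?thesis by simp
qed

lemma Y_DERIV_x: assumes t: "t \<in> {0..T1}" and x: "x \<in> J"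
 shows "((%x. Y x t) has_real_derivative Jc t x) (at x within J)"
proof -
 have "continuous_on (J \<times> {0..t}) (%z. bb x (fst z) (snd z))"
  unfolding bb_def by (intro seg_cont Y_comp continuous_intros) (use t x Y(2) in auto)
 then have "continuous_on J (%x2. integral {0..t} (bb x x2))"
  unfolding cbox_interval[symmetric] by (intro integral_continuous_on_param) (simp add: case_prod_beta cbox_interval)
 then have "continuous_on J (%x2. exp (integral {0..t} (bb x x2)))" by (rule continuous_on_exp)
 then have "((%x2. exp (integral {0..t} (bb x x2))) \<longlongrightarrow> exp (integral {0..t} (bb x x))) (at x within J)"
  using x unfolding continuous_on_def by blast
 moreover have "bb x x = (%\<tau>. Aa \<tau> x)" unfolding bb_def Aa_def by simp
 ultimately have "((%x2. exp (integral {0..t} (bb x x2))) \<longlongrightarrow> Jc t x) (at x within J)" unfolding Jc_def by simp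
 then show ?thesis unfolding has_field_derivative_iff
 proof (rule Lim_transform_eventually)
  show "\<forall>\<^sub>F y in at x within J. exp (integral {0..t} (bb x y)) = (Y y t - Y x t) / (y - x)"
   unfolding eventually_at_filter using Y_diff(2)[OF t x] by (intro always_eventually) auto
 qed
qed

lemma Jc_DERIV: assumes t: "t \<in> {0..T1}" and x: "x \<in> J"
 shows "((%t. Jc t x) has_real_derivative Aa t x * Jc t x) (at t within {0..T1})"
 unfolding Jc_def using integral_has_real_derivative[OF Aa_cont_t[OF x] t] by (auto intro!: derivative_eq_intros)

text \<open>Only separate partial derivatives of \<open>w\<close> are given, so the increment is
  split into a change of time at the old position and a change of position at the new time. The
  latter goes through \<open>mean_value\<close>, whose coefficient is continuous in time.\<close>

lemma M_DERIV: assumes t: "t \<in> {0..T1}" and x: "x \<in> J"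
 shows "((%t. w t (Y x t)) has_real_derivative FF t (Y x t)) (at t within {0..T1})"
proof -
 let ?F = "at t within {0..T1}"
 note yt = Y(2)[OF x t]
 define G where "G = (%t'. integral {0..1} (%\<theta>. wx t' (Y x t + \<theta> * (Y x t' - Y x t))))"
 have "continuous_on {0..T1} G" unfolding G_def by (intro seg_cont continuous_intros Y_cont_t x Y(2) t) auto
 then have "(G \<longlongrightarrow> G t) ?F" using t unfolding continuous_on_def by blast
 moreover have "G t = wx t (Y x t)" unfolding G_def by simp
 ultimately have G: "(G \<longlongrightarrow> wx t (Y x t)) ?F" by simp
 have 1: "((%t'. (Y x t' - Y x t) / (t' - t)) \<longlongrightarrow> w t (Y x t)) ?F" using Y(3)[OF x t] unfolding has_field_derivative_iff .
 have 2: "((%t'. (w t' (Y x t) - w t (Y x t)) / (t' - t)) \<longlongrightarrow> v t (Y x t)) ?F" using dt[OF t yt] unfolding has_field_derivative_iff .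
 have "((%t'. (w t' (Y x t) - w t (Y x t)) / (t' - t) + G t' * ((Y x t' - Y x t) / (t' - t))) \<longlongrightarrow> v t (Y x t) + wx t (Y x t) * w t (Y x t)) ?F"
  by (intro tendsto_intros G 1 2)
 moreover have "v t (Y x t) + wx t (Y x t) * w t (Y x t) = FF t (Y x t)" using pde[OF t yt] unfolding FF_def EE_def by (simp add: mult.commute)
 ultimately have *: "((%t'. (w t' (Y x t) - w t (Y x t)) / (t' - t) + G t' * ((Y x t' - Y x t) / (t' - t))) \<longlongrightarrow> FF t (Y x t)) ?F" by simp
 have eq: "(w t' (Y x t) - w t (Y x t)) / (t' - t) + G t' * ((Y x t' - Y x t) / (t' - t)) = (w t' (Y x t') - w t (Y x t)) / (t' - t)"
  if "t' \<in> {0..T1}" for t'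
 proof -
  have "w t' (Y x t') - w t' (Y x t) = G t' * (Y x t' - Y x t)" using mean_value[OF that yt Y(2)[OF x that]] unfolding G_def .
  then show ?thesis unfolding times_divide_eq_right by (simp flip: add_divide_distrib)
 qed
 show ?thesis unfolding has_field_derivative_iff
  by (rule Lim_transform_eventually[OF *], unfold eventually_at_filter, intro always_eventually) (use eq in auto)
qed

lemma EE_cont: "continuous_on {0..T1} EE"
 unfolding EE_def cbox_interval[symmetric]
 by (rule integral_continuous_on_param, unfold cbox_interval case_prod_beta, intro continuous_intros wx_comp) auto

lemma FF_DERIV: assumes t: "t \<in> {0..T1}" and y: "y \<in> J"
 shows "(FF t has_real_derivative (wx t y)\<^sup>2 / 2 - EE t) (at y within J)"
proof -
 have "continuous_on J (%y. (wx t y)\<^sup>2 / 2)" by (intro continuous_intros wx_cont t) simp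
 from integral_has_real_derivative[OF this y] have 1: "((%x. integral {0..x} (%y. (wx t y)\<^sup>2 / 2)) has_real_derivative (wx t y)\<^sup>2 / 2) (at y within J)" .
 have "((%y. y * EE t) has_real_derivative EE t) (at y within J)" by (auto intro!: derivative_eq_intros)
 from DERIV_diff[OF 1 this] show ?thesis unfolding FF_def[abs_def] .
qed

text \<open>The equation cannot be differentiated in space, as \<open>wx\<close> is only continuous.
  Instead the velocity along a trajectory is written as its initial value plus the time integral of
  \<open>FF\<close>, which does have a space derivative, and both sides are differentiated in the
  label.\<close>

lemma Aa_Jc_eq: assumes t: "t \<in> {0..T1}" and x: "x \<in> J"
 shows "Aa t x * Jc t x = wx 0 x + integral {0..t} (%\<tau>. ((Aa \<tau> x)\<^sup>2 / 2 - EE \<tau>) * Jc \<tau> x)"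
proof -
 have sub: "\<tau> \<in> {0..T1}" if "\<tau> \<in> {0..t}" for \<tau> using that t by auto
 have hi: "((%\<tau>. FF \<tau> (Y x \<tau>)) has_integral w t (Y x t) - w 0 x) {0..t}" if x: "x \<in> J" for x
 proof -
  have "((%\<tau>. FF \<tau> (Y x \<tau>)) has_integral w t (Y x t) - w 0 (Y x 0)) {0..t}"
  proof (rule fundamental_theorem_of_calculus)
   show "((%t. w t (Y x t)) has_vector_derivative FF \<tau> (Y x \<tau>)) (at \<tau> within {0..t})" if "\<tau> \<in> {0..t}" for \<tau>
    unfolding has_real_derivative_iff_has_vector_derivative[symmetric]
    by (rule has_field_derivative_subset[OF M_DERIV[OF sub[OF that] x]]) (use t in auto)
  qed (use t in auto)
  then show ?thesis unfolding Y(1)[OF x] .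
 qed
 have L: "((%x. integral {0..t} (%\<tau>. FF \<tau> (Y x \<tau>))) has_real_derivative integral {0..t} (%\<tau>. ((Aa \<tau> x)\<^sup>2 / 2 - EE \<tau>) * Jc \<tau> x)) (at x within J)"
  unfolding cbox_interval[symmetric]
 proof (rule leibniz_rule_field_derivative, unfold cbox_interval)
  show "((%x. FF \<tau> (Y x \<tau>)) has_real_derivative ((Aa \<tau> y)\<^sup>2 / 2 - EE \<tau>) * Jc \<tau> y) (at y within J)" if "y \<in> J" "\<tau> \<in> {0..t}" for y \<tau>
   unfolding Aa_def by (rule DERIV_comp_within[OF Y_DERIV_x FF_DERIV]) (use that sub Y(2) in auto)
  show "(%\<tau>. FF \<tau> (Y y \<tau>)) integrable_on {0..t}" if "y \<in> J" for y using hi[OF that] by blast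
  show "continuous_on (J \<times> {0..t}) (%(x, \<tau>). ((Aa \<tau> x)\<^sup>2 / 2 - EE \<tau>) * Jc \<tau> x)"
   unfolding case_prod_beta
   by (intro continuous_intros Aa_comp Jc_comp continuous_on_compose2[OF EE_cont]) (use t in auto)
 qed (use x in auto)
 have "((%x. w 0 x + integral {0..t} (%\<tau>. FF \<tau> (Y x \<tau>))) has_real_derivative wx 0 x + integral {0..t} (%\<tau>. ((Aa \<tau> x)\<^sup>2 / 2 - EE \<tau>) * Jc \<tau> x)) (at x within J)"
  by (rule DERIV_add[OF dx L]) (use T1 x in auto)
 then have 1: "((%x. w t (Y x t)) has_real_derivative wx 0 x + integral {0..t} (%\<tau>. ((Aa \<tau> x)\<^sup>2 / 2 - EE \<tau>) * Jc \<tau> x)) (at x within J)"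
  by (rule has_field_derivative_transform_within[OF _ zero_less_one x]) (simp add: integral_unique[OF hi])
 have 2: "((%x. w t (Y x t)) has_real_derivative Aa t x * Jc t x) (at x within J)"
  unfolding Aa_def by (rule DERIV_comp_within[OF Y_DERIV_x dx]) (use t x Y(2) in auto)
 show ?thesis by (rule deriv_unique_Icc[OF _ x 2 1]) simp
qed

text \<open>Dividing the product in \<open>Aa_Jc_eq\<close> by \<open>Jc\<close>, whose logarithmic
  derivative is \<open>Aa\<close>, leaves the Riccati equation, with the energy still
  \<open>EE t\<close>.\<close>

lemma Aa_DERIV: assumes t: "t \<in> {0..T1}" and x: "x \<in> J"
 shows "((%t. Aa t x) has_real_derivative - (Aa t x)\<^sup>2 / 2 - EE t) (at t within {0..T1})"
proof -
 have "continuous_on {0..T1} (%\<tau>. ((Aa \<tau> x)\<^sup>2 / 2 - EE \<tau>) * Jc \<tau> x)" by (intro continuous_intros Aa_comp Jc_comp EE_cont) (use x in auto)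
 from integral_has_real_derivative[OF this t]
 have "((%t. wx 0 x + integral {0..t} (%\<tau>. ((Aa \<tau> x)\<^sup>2 / 2 - EE \<tau>) * Jc \<tau> x)) has_real_derivative ((Aa t x)\<^sup>2 / 2 - EE t) * Jc t x) (at t within {0..T1})"
  by (auto intro!: derivative_eq_intros)
 then have p: "((%t. Aa t x * Jc t x) has_real_derivative ((Aa t x)\<^sup>2 / 2 - EE t) * Jc t x) (at t within {0..T1})"
  by (rule has_field_derivative_transform_within[OF _ zero_less_one t]) (erule Aa_Jc_eq[OF _ x, symmetric])
 have J0: "Jc t x \<noteq> 0" for t unfolding Jc_def by simp
 have "((%t. (Aa t x * Jc t x) / Jc t x) has_real_derivative
   (((Aa t x)\<^sup>2 / 2 - EE t) * Jc t x * Jc t x - Aa t x * Jc t x * (Aa t x * Jc t x)) / (Jc t x * Jc t x)) (at t within {0..T1})"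
  by (rule DERIV_divide[OF p Jc_DERIV[OF t x] J0])
 moreover have "(((Aa t x)\<^sup>2 / 2 - EE t) * Jc t x * Jc t x - Aa t x * Jc t x * (Aa t x * Jc t x)) / (Jc t x * Jc t x) = - (Aa t x)\<^sup>2 / 2 - EE t"
  using J0[of t] by (simp add: field_simps power2_eq_square)
 ultimately show ?thesis using J0 by simp
qed

text \<open>\<open>Y\<close> is a trajectory picked by \<open>SOME\<close>, so the stationary ones
  have to be recognised: the displacement from a zero of the field solves a homogeneous linear
  equation and starts at zero.\<close>

lemma Y_ends: assumes t: "t \<in> {0..T1}" shows "Y 0 t = 0" "Y (1/2) t = 1/2"
proof -
 have "Y e t = e" if e: "e \<in> J" and w0: "\<And>t. t \<in> {0..T1} ==> w t e = 0" for e
 proof -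
  define B where "B = (%t. integral {0..1} (%\<theta>. wx t (e + \<theta> * (Y e t - e))))"
  have "continuous_on {0..T1} B" unfolding B_def by (intro seg_cont continuous_intros Y_cont_t e Y(2)) auto
  moreover have "((%t. Y e t - e) has_real_derivative B t * (Y e t - e)) (at t within {0..T1})" if "t \<in> {0..T1}" for t
   using mean_value[OF that e Y(2)[OF e that]] w0[OF that] unfolding B_def
   by (auto intro!: derivative_eq_intros Y(3) e that)
  ultimately have "Y e t - e = (Y e 0 - e) * exp (integral {0..t} B)" using linear_ode_exp[of T1 B "%t. Y e t - e"] t by blast
  then show ?thesis unfolding Y(1)[OF e] by simp
 qed
 then show "Y 0 t = 0" "Y (1/2) t = 1/2" using bc by auto
qed

lemma EE_eq: assumes t: "t \<in> {0..T1}" shows "((%x. (Aa t x)\<^sup>2 * Jc t x) has_integral EE t) J"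
proof -
 have c: "continuous_on J (%y. (wx t y)\<^sup>2)" by (intro continuous_intros wx_cont t)
 have "((%x. (Aa t x)\<^sup>2 * Jc t x) has_integral integral {0..Y (1/2) t} (%y. (wx t y)\<^sup>2) - integral {0..Y 0 t} (%y. (wx t y)\<^sup>2)) J"
 proof (rule fundamental_theorem_of_calculus)
  fix x :: real assume x: "x \<in> J"
  have "((%x. integral {0..Y x t} (%y. (wx t y)\<^sup>2)) has_real_derivative (Aa t x)\<^sup>2 * Jc t x) (at x within J)"
   unfolding Aa_def by (rule DERIV_comp_within[OF Y_DERIV_x integral_has_real_derivative[OF c]]) (use t x Y(2) in auto)
  then show "((%x. integral {0..Y x t} (%y. (wx t y)\<^sup>2)) has_vector_derivative (Aa t x)\<^sup>2 * Jc t x) (at x within J)"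
   by (simp add: has_real_derivative_iff_has_vector_derivative)
 qed simp
 then show ?thesis unfolding Y_ends[OF t] EE_def by simp
qed

lemma wx_0: "x \<in> J ==> wx 0 x = a x"
proof -
 assume x: "x \<in> J"
 have "(AD a has_real_derivative a x) (at x within J)"
  using AD_DERIV[OF adm_cont[OF adma], of x] by (rule has_field_derivative_at_within)
 then have "(w 0 has_real_derivative a x) (at x within J)"
  by (rule has_field_derivative_transform_within[OF _ zero_less_one x]) (simp add: init)
 then show ?thesis by (intro deriv_unique_Icc[OF _ x dx[OF _ x]]) (use T1 in auto)
qed

text \<open>By the Riccati equation the time derivative of the energy density
  \<open>Aa^2 * Jc\<close> is \<open>- 2 * EE * Aa * Jc\<close>. Its integral over the labels is
  \<open>- 2 * EE\<close> times the difference of the velocities at the endpoints, which are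
  zero.\<close>

lemma EE_En: assumes t: "t \<in> {0..T1}" shows "EE t = En a"
proof -
 have "(EE has_real_derivative 0) (at t within {0..T1})" if t: "t \<in> {0..T1}" for t
 proof -
  have L: "((%t. integral J (%x. (Aa t x)\<^sup>2 * Jc t x)) has_real_derivative integral J (%x. - 2 * EE t * (Aa t x * Jc t x))) (at t within {0..T1})"
   unfolding cbox_interval[symmetric]
  proof (rule leibniz_rule_field_derivative, unfold cbox_interval)
   show "((%t. (Aa t x)\<^sup>2 * Jc t x) has_real_derivative - 2 * EE \<tau> * (Aa \<tau> x * Jc \<tau> x)) (at \<tau> within {0..T1})" if "\<tau> \<in> {0..T1}" "x \<in> J" for \<tau> x
    by (rule derivative_eq_intros Aa_DERIV Jc_DERIV that refl)+ (simp add: power2_eq_square algebra_simps)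
   show "(%x. (Aa \<tau> x)\<^sup>2 * Jc \<tau> x) integrable_on J" if "\<tau> \<in> {0..T1}" for \<tau> using EE_eq[OF that] by blast
   show "continuous_on ({0..T1} \<times> J) (%(t, x). - 2 * EE t * (Aa t x * Jc t x))"
    unfolding case_prod_beta by (intro continuous_intros Aa_comp Jc_comp continuous_on_compose2[OF EE_cont]) auto
  qed (use t in auto)
  have "((%x. Aa t x * Jc t x) has_integral w t (Y (1/2) t) - w t (Y 0 t)) J"
  proof (rule fundamental_theorem_of_calculus)
   fix x :: real assume x: "x \<in> J"
   have "((%x. w t (Y x t)) has_real_derivative Aa t x * Jc t x) (at x within J)"
    unfolding Aa_def by (rule DERIV_comp_within[OF Y_DERIV_x dx]) (use t x Y(2) in auto)
   then show "((%x. w t (Y x t)) has_vector_derivative Aa t x * Jc t x) (at x within J)"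
    by (simp add: has_real_derivative_iff_has_vector_derivative)
  qed simp
  then have "((%x. Aa t x * Jc t x) has_integral 0) J" unfolding Y_ends[OF t] bc[OF t] by simp
  from integral_unique[OF has_integral_mult_right[OF this, of "- 2 * EE t"]]
  have I0: "integral J (%x. - 2 * EE t * (Aa t x * Jc t x)) = 0" by simp
  from L have "((%t. integral J (%x. (Aa t x)\<^sup>2 * Jc t x)) has_real_derivative 0) (at t within {0..T1})" unfolding I0 .
  then show ?thesis by (rule has_field_derivative_transform_within[OF _ zero_less_one t]) (erule integral_unique[OF EE_eq])
 qed
 from const_of_zero_deriv[OF this t] have "EE t = EE 0" .
 also have "... = integral J (%y. (a y)\<^sup>2)" unfolding EE_def by (intro integral_cong) (simp add: wx_0)
 also have "... = En a" unfolding En_def by (simp add: AD_nonneg_eq)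
 finally show ?thesis .
qed

text \<open>With \<open>q\<close> the left side, the pair of \<open>q\<close> and
  \<open>Aa * q\<close>, twice the derivative of \<open>q\<close>, solves the linear system behind
  \<open>cE\<close> and \<open>dE\<close>. Two combinations of the pair are constant in time, and
  \<open>cE_dE_identity\<close> inverts them to give \<open>q\<close>.\<close>

lemma Jc_qq: assumes t: "t \<in> {0..T1}" and x: "x \<in> J"
 shows "exp (integral {0..t} (%\<tau>. Aa \<tau> x) / 2) = qq a t x"
proof -
 let ?q = "%t. exp (integral {0..t} (%\<tau>. Aa \<tau> x) / 2)"
 let ?S = "{0..T1}"
 have q: "(?q has_real_derivative Aa t x * ?q t / 2) (at t within ?S)" if "t \<in> ?S" for t
  using integral_has_real_derivative[OF Aa_cont_t[OF x] that] by (auto intro!: derivative_eq_intros)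
 have A: "((%t. Aa t x) has_real_derivative - (Aa t x)\<^sup>2 / 2 - En a) (at t within ?S)" if "t \<in> ?S" for t
  using Aa_DERIV[OF that x] EE_En[OF that] by simp
 note c = has_field_derivative_at_within[OF cE_DERIV[of a]] and d = has_field_derivative_at_within[OF dE_DERIV[of a]]
 have "((%t. cE a t * ?q t - dE a t * (Aa t x * ?q t)) has_real_derivative 0) (at t within ?S)" if "t \<in> ?S" for t
  by (rule derivative_eq_intros c d A q that refl)+ (simp add: field_simps power2_eq_square)
 from const_of_zero_deriv[OF this t] have 1: "cE a t * ?q t - dE a t * (Aa t x * ?q t) = 1" by (simp add: cE_def dE_def)
 have "((%t. 2 * En a * dE a t * ?q t + cE a t * (Aa t x * ?q t)) has_real_derivative 0) (at t within ?S)" if "t \<in> ?S" for t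
  by (rule derivative_eq_intros c d A q that refl)+ (simp add: field_simps power2_eq_square)
 from const_of_zero_deriv[OF this t] have 2: "2 * En a * dE a t * ?q t + cE a t * (Aa t x * ?q t) = Aa 0 x" by (simp add: cE_def dE_def)
 have a0: "Aa 0 x = a x" unfolding Aa_def Y(1)[OF x] by (rule wx_0[OF x])
 have "?q t = ?q t * ((cE a t)\<^sup>2 + 2 * En a * (dE a t)\<^sup>2)" by (simp add: cE_dE_identity)
 also have "... = cE a t * (cE a t * ?q t - dE a t * (Aa t x * ?q t)) + dE a t * (2 * En a * dE a t * ?q t + cE a t * (Aa t x * ?q t))"
  by (simp add: algebra_simps power2_eq_square)
 finally show ?thesis unfolding 1 2 a0 qq_def by simp
qed

text \<open>\<open>qq\<close> is an exponential as long as the solution exists; this is the upper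
  bound for the lifespan.\<close>

lemma t_Pos: assumes "t \<in> {0..T1}" shows "t \<in> Pos a"
 unfolding Pos_def mem_Collect_eq by (rule ballI, subst Jc_qq[OF assms, symmetric]) simp_all

lemma Y_gam: assumes t: "t \<in> {0..T1}" and x: "x \<in> J" shows "Y x t = gam a t x"
proof -
 have "((%x. Y x t - gam a t x) has_real_derivative 0) (at x within J)" if x: "x \<in> J" for x
 proof -
  have "Jc t x = (qq a t x)\<^sup>2" unfolding Jc_def Jc_qq[OF t x, symmetric] by (simp add: power2_eq_square flip: exp_add)
  then show ?thesis using DERIV_diff[OF Y_DERIV_x[OF t x] has_field_derivative_at_within[OF gam_DERIV_x[OF adma, of t x]]] by simp
 qed
 from const_of_zero_deriv[OF this x] show ?thesis by (simp add: Y_ends[OF t] gam_ends[OF adma])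
qed

text \<open>The trajectory is \<open>gam\<close>, whose time derivative is \<open>ll\<close> on the
  one hand and \<open>w\<close> at the moving point on the other.\<close>

theorem classical_unique: assumes t: "t \<in> {0..T1}" and x: "x \<in> J" shows "w t x = UU a t x"
proof -
 from flowmap_Pos[OF adma t_Pos[OF t]] obtain m M where F: "flowmap (gam a t) (eta a t) (%x. (qq a t x)\<^sup>2) m M" .
 define y where "y = eta a t x"
 have y: "y \<in> J" unfolding y_def by (rule eta_in_J[OF adma t_Pos[OF t] x])
 have gx: "gam a t y = x" unfolding y_def using flowmap.inv[OF F] by simp
 have "((%t. gam a t y) has_real_derivative w t (gam a t y)) (at t within {0..T1})"
  using Y(3)[OF y t] unfolding Y_gam[OF t y]
  by (rule has_field_derivative_transform_within[OF _ zero_less_one t]) (erule Y_gam[OF _ y])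
 from deriv_unique_Icc[OF T1 t this has_field_derivative_at_within[OF gam_DERIV_t]] have "w t x = ll a t y" unfolding gx .
 then show ?thesis unfolding UU_def y_def .
qed

end

subsection \<open>Chains and limits\<close>

lemma chain_lin:
 assumes f: "chain k f" and g: "chain k g"
 shows "chain k (%j x. f j x + c * g j x)"
 unfolding chain_def
proof (intro conjI allI impI ballI)
 fix j assume j: "j \<le> k"
 have m: "f j \<in> BM" "g j \<in> BM" using chain_measurable f g j by auto
 show "(%x. f j x + c * g j x) \<in> BM" using m by measurable
 show "nsq J (%x. f j x + c * g j x) < \<infinity>"
  by (rule nsq_add_finite) (use m chain_finite[OF f j] chain_finite[OF g j] in \<open>auto simp: nsq_cmult ennreal_mult_less_top\<close>)
next
 fix j x assume j: "j < k" and x: "x \<in> J"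
 have i: "set_integrable lborel {0..x} (h (Suc j))" if "chain k h" for h
  by (rule set_integrable_subset[OF nsq_set_integrable[of "h (Suc j)" J]])
   (use chain_measurable[OF that, of "Suc j"] chain_finite[OF that, of "Suc j"] j x emeasure_J_finite in auto)
 have "set_integrable lborel {0..x} (%y. c * g (Suc j) y)" by (intro set_integrable_mult_right i[OF g])
 from set_integral_add(2)[OF i[OF f] this]
 have L: "(LINT y:{0..x}|lborel. f (Suc j) y + c * g (Suc j) y) = (LINT y:{0..x}|lborel. f (Suc j) y) + c * (LINT y:{0..x}|lborel. g (Suc j) y)"
  by simp
 have "f j x + c * g j x = (f j 0 + (LINT y:{0..x}|lborel. f (Suc j) y)) + c * (g j 0 + (LINT y:{0..x}|lborel. g (Suc j) y))"
  by (rule arg_cong2[where f = "%u v. u + c * v", OF chain_eq[OF f j x] chain_eq[OF g j x]])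
 then show "f j x + c * g j x = f j 0 + c * g j 0 + (LINT y:{0..x}|lborel. f (Suc j) y + c * g (Suc j) y)"
  unfolding L distrib_left by linarith
qed

lemma chain_diff: "chain k f ==> chain k g ==> chain k (%j x. f j x - g j x)"
 using chain_lin[of k f g "-1"] by simp

lemma HN_lin:
 assumes f: "chain k f" and g: "chain k g" and c: "\<bar>c\<bar> \<le> 1"
 shows "HN \<sigma> k (%j x. f j x + c * g j x) \<le> 2 * HN \<sigma> k f + 2 * HN \<sigma> k g"
proof -
 have L: "nsq S (%x. h1 x + c * h2 x) \<le> 2 * nsq S h1 + 2 * nsq S h2"
  if "h1 \<in> BM" "h2 \<in> BM" "S \<in> sets borel" for S :: "'a::euclidean_space set" and h1 h2
 proof -
  have "nsq S (%x. h1 x + c * h2 x) \<le> 2 * nsq S h1 + 2 * nsq S (%x. c * h2 x)" by (rule nsq_add) (use that in auto)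
  moreover have "nsq S (%x. c * h2 x) \<le> nsq S h2" by (rule nsq_mono) (use c in \<open>simp add: abs_mult mult_left_le_one_le\<close>)
  ultimately show ?thesis by (meson add_left_mono mult_left_mono order_trans zero_le)
 qed
 have "(\<Sum>j\<le>k. nsq J (%x. f j x + c * g j x)) \<le> (\<Sum>j\<le>k. 2 * nsq J (f j) + 2 * nsq J (g j))"
  by (intro sum_mono L) (use chain_measurable[OF f] chain_measurable[OF g] in auto)
 then have 1: "(\<Sum>j\<le>k. nsq J (%x. f j x + c * g j x)) \<le> 2 * (\<Sum>j\<le>k. nsq J (f j)) + 2 * (\<Sum>j\<le>k. nsq J (g j))"
  by (simp add: sum.distrib sum_distrib_left)
 have e: "FK \<sigma> (%x. f k x + c * g k x) = (%z. FK \<sigma> (f k) z + c * FK \<sigma> (g k) z)"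
  unfolding FK_def by (rule ext) (simp add: algebra_simps add_divide_distrib diff_divide_distrib)
 have 2: "nsq JJ (FK \<sigma> (%x. f k x + c * g k x)) \<le> 2 * nsq JJ (FK \<sigma> (f k)) + 2 * nsq JJ (FK \<sigma> (g k))"
  unfolding e by (intro L FK_measurable JJ_sets chain_measurable[OF f] chain_measurable[OF g]) auto
 show ?thesis
 proof (cases "\<sigma> > 0")
  case True
  show ?thesis using add_mono[OF 1 2] unfolding HN_def using True by (simp add: distrib_left ac_simps)
 qed (use 1 in \<open>simp add: HN_def\<close>)
qed

lemma HN_cong: "(\<And>j x. j \<le> k ==> x \<in> J ==> f j x = g j x) ==> HN \<sigma> k f = HN \<sigma> k g"
 unfolding HN_def by (intro arg_cong2[where f = "(+)"] sum.cong refl nsq_cong if_cong) (auto simp: FK_def)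

lemma HN_Suc: "HN \<sigma> (Suc k) hs = nsq J (hs 0) + HN \<sigma> k (%j. hs (Suc j))"
 unfolding HN_def by (simp add: sum.atMost_Suc_shift add.assoc del: sum.atMost_Suc)

lemma HN_zero: "HN \<sigma> k (%j x. 0) = 0"
 unfolding HN_def nsq_def FK_def by simp

lemma HN_imp_Hs_small:
 assumes s: "0 \<le> \<sigma>" "\<sigma> < 1" and ch: "\<forall>\<^sub>F n in sequentially. chain k (h n)" and lim: "(%n. HN \<sigma> k (h n)) \<longlonglongrightarrow> 0"
  and f: "\<And>n x. x \<in> J ==> f n x = h n 0 x" and e: "0 < e"
 shows "\<forall>\<^sub>F n in sequentially. f n \<in> Hs (real k + \<sigma>) 0 (1/2) \<and> Hs_norm (real k + \<sigma>) 0 (1/2) (f n) < e"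
proof -
 have "0 < ennreal ((e/2)\<^sup>2)" using e by simp
 from order_tendstoD(2)[OF lim this] ch show ?thesis
 proof eventually_elim
  case (elim n)
  have "f n x = h n 0 x" if "x \<in> {0<..<1/2}" for x using f[of x n] that by simp
  from chain_imp_Hs[OF elim(2) s this less_imp_le[OF elim(1)]] show ?case using e by simp
 qed
qed

lemma HN_imp_Hs:
 assumes s: "0 \<le> \<sigma>" "\<sigma> < 1" and ch: "chain k h" and fin: "HN \<sigma> k h < \<infinity>" and f: "\<And>x. x \<in> J ==> f x = h 0 x"
 shows "f \<in> Hs (real k + \<sigma>) 0 (1/2)"
proof -
 obtain r where r: "0 \<le> r" "HN \<sigma> k h = ennreal r" using fin by (cases "HN \<sigma> k h") auto
 have "f x = h 0 x" if "x \<in> {0<..<1/2}" for x using f[of x] that by simp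
 from chain_imp_Hs(1)[OF ch s this, of "sqrt r"] r show ?thesis by simp
qed

text \<open>The claims are phrased with \<epsilon> and \<delta>, the flow estimates with sequences.
  If every \<open>inverse (Suc n)\<close> failed as \<delta>, the counterexamples would form a
  sequence violating the assumption.\<close>

lemma sequence_delta:
 fixes N :: "'a => real"
 assumes "\<And>x::nat => 'a. (\<And>n. x n \<in> S) ==> (\<And>n. N (x n) < inverse (real (Suc n))) ==> \<forall>\<^sub>F n in sequentially. Q (x n)"
 shows "\<exists>d>0. \<forall>x\<in>S. N x < d \<longrightarrow> Q x"
proof (rule ccontr)
 assume *: "\<not> (\<exists>d>0. \<forall>x\<in>S. N x < d \<longrightarrow> Q x)"
 have "\<exists>x. x \<in> S \<and> N x < inverse (real (Suc n)) \<and> \<not> Q x" for n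
 proof -
  have "0 < inverse (real (Suc n))" by simp
  then show ?thesis using * by blast
 qed
 then obtain x where x: "\<And>n. x n \<in> S \<and> N (x n) < inverse (real (Suc n)) \<and> \<not> Q (x n)" by metis
 then have "\<forall>\<^sub>F n in sequentially. Q (x n)" by (intro assms) auto
 then show False using x eventually_happens'[OF sequentially_bot] by blast
qed

lemma inverse_Suc_tendsto:
 fixes x :: "nat => real" assumes "\<And>n. \<bar>x n - t\<bar> < inverse (real (Suc n))" shows "x \<longlonglongrightarrow> t"
proof -
 have "(%n. x n - t) \<longlonglongrightarrow> 0"
  by (rule Lim_null_comparison[OF _ LIMSEQ_inverse_real_of_nat]) (use assms in \<open>auto intro!: always_eventually less_imp_le\<close>)
 then show ?thesis by (rule LIM_zero_cancel)
qed

text \<open>Uniformity in time by compactness: offending times at infinitely many indices would have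
  a convergent subsequence. This is why the assumption speaks of index subsequences \<open>r\<close>
  and of moving times \<open>t n\<close>.\<close>

lemma eventually_Icc:
 fixes Q :: "nat => real => bool"
 assumes "\<And>r t t'. strict_mono r ==> (\<And>n. t n \<in> {0..T}) ==> t \<longlonglongrightarrow> t' ==> t' \<in> {0..T} ==> \<forall>\<^sub>F n in sequentially. Q (r n) (t n)"
 shows "\<forall>\<^sub>F n in sequentially. \<forall>t\<in>{0..T}. Q n t"
proof (rule ccontr)
 assume n: "\<not> ?thesis"
 define S where "S = {n. \<not> (\<forall>t\<in>{0..T}. Q n t)}"
 have "infinite S" using n unfolding S_def infinite_nat_iff_unbounded_le eventually_sequentially by blast
 from infinite_enumerate[OF this] obtain r :: "nat => nat" where r: "strict_mono r" "\<And>n. r n \<in> S" by blast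
 then have "\<forall>n. \<exists>t. t \<in> {0..T} \<and> \<not> Q (r n) t" unfolding S_def by blast
 then obtain t where t: "\<And>n. t n \<in> {0..T}" "\<And>n. \<not> Q (r n) (t n)" by metis
 obtain l r' where l: "l \<in> {0..T}" "strict_mono r'" "(t \<circ> r') \<longlonglongrightarrow> l"
  using t(1) compact_Icc[of 0 T] unfolding compact_def by blast
 have "\<forall>\<^sub>F n in sequentially. Q ((r \<circ> r') n) ((t \<circ> r') n)"
  by (rule assms[OF strict_mono_o[OF r(1) l(2)] _ l(3) l(1)]) (use t in auto)
 then show False using t(2) eventually_happens'[OF sequentially_bot] by fastforce
qed

lemma uniform_limit_subseq: "uniform_limit S A a sequentially ==> strict_mono r ==> uniform_limit S (%n. A (r n)) a sequentially"
 unfolding uniform_limit_iff using eventually_subseq by blast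

subsection \<open>The maximal time\<close>

text \<open>The whole of \<open>{0..t}\<close> has to lie in \<open>Pos a\<close>, as that set need
  not be an interval: when \<open>En a > 0\<close>, \<open>qq\<close> is identically 1 again after a
  full period of \<open>cE\<close>, even if it vanished in between.\<close>

definition Tmax :: "(real => real) => ereal" where "Tmax a = Sup (ereal ` {t. 0 \<le> t \<and> {0..t} \<subseteq> Pos a})"

lemma tint_Pos: "t \<in> tint (Tmax a) ==> {0..t} \<subseteq> Pos a"
 unfolding Tmax_def tint_def less_Sup_iff by fastforce

lemma tint_Pos': "t \<in> tint (Tmax a) ==> t \<in> Pos a"
 using tint_Pos[of t a] unfolding tint_def by auto

lemma Tmax_ge: "0 \<le> t ==> {0..t} \<subseteq> Pos a ==> ereal t \<le> Tmax a"
 unfolding Tmax_def by (intro Sup_upper) auto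

lemma Pos_0: "0 \<in> Pos a" unfolding Pos_def qq_def cE_def dE_def by simp

lemma dataseq_Pos: assumes ds: "dataseq A a t t'" and t': "t' \<in> Pos a" shows "\<forall>\<^sub>F n in sequentially. t n \<in> Pos (A n)"
proof -
 obtain N q0 Q where "flowseq (%n. A (n + N)) a (%n. t (n + N)) t' q0 Q" using dataseq.eventually_flowseq[OF ds t'] by metis
 from flowseq.PosA(1)[OF this] have "t (n + N) \<in> Pos (A (n + N))" for n .
 then show ?thesis unfolding eventually_sequentially by (metis le_add_diff_inverse2)
qed

lemma Pos_uniform:
 assumes "\<And>n. adm (A n)" "adm a" "uniform_limit J A a sequentially" "{0..T} \<subseteq> Pos a"
 shows "\<forall>\<^sub>F n in sequentially. {0..T} \<subseteq> Pos (A n)"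
proof -
 have "\<forall>\<^sub>F n in sequentially. \<forall>t\<in>{0..T}. t \<in> Pos (A n)"
 proof (rule eventually_Icc)
  fix r t t' assume r: "strict_mono (r :: nat => nat)" "t \<longlonglongrightarrow> t'" "t' \<in> {0..T}"
  have "dataseq (%n. A (r n)) a t t'" by unfold_locales (use assms r uniform_limit_subseq in auto)
  then show "\<forall>\<^sub>F n in sequentially. t n \<in> Pos (A (r n))" by (rule dataseq_Pos) (use assms(4) r(3) in blast)
 qed
 then show ?thesis by eventually_elim blast
qed

lemma Tmax_pos: assumes a: "adm a" shows "0 < Tmax a"
proof -
 have "\<exists>d>0. \<forall>t\<in>{0..}. \<bar>t\<bar> < d \<longrightarrow> t \<in> Pos a"
 proof (rule sequence_delta)
  fix t :: "nat => real" assume "\<And>n. \<bar>t n\<bar> < inverse (real (Suc n))"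
  then have "t \<longlonglongrightarrow> 0" by (intro inverse_Suc_tendsto) simp
  from dataseq_Pos[OF dataseq_const[OF a this] Pos_0] show "\<forall>\<^sub>F n in sequentially. t n \<in> Pos a" .
 qed
 then obtain d where d: "d > 0" "\<forall>t\<in>{0..}. \<bar>t\<bar> < d \<longrightarrow> t \<in> Pos a" by blast
 have "{0..d/2} \<subseteq> Pos a" using d by auto
 then have "ereal (d/2) \<le> Tmax a" using d(1) by (intro Tmax_ge) auto
 moreover have "0 < ereal (d/2)" using d(1) by simp
 ultimately show ?thesis by (rule less_le_trans[rotated])
qed

subsection \<open>Representation of the initial data\<close>

lemma kcaseD: assumes "kcase k \<sigma>" shows "0 \<le> \<sigma>" "\<sigma> < 1" "k \<ge> 1 \<or> \<sigma> > 1/2" "k \<le> 1"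
 using assms unfolding kcase_def by auto

lemma kcase_exists: assumes "3/2 < s" "s < 5/2" obtains k \<sigma> where "kcase k \<sigma>" "s = real (Suc k) + \<sigma>"
proof (cases "s < 2")
 case True
 show thesis by (rule that[of 0 "s - 1"]) (use True assms in \<open>auto simp: kcase_def\<close>)
next
 case False
 show thesis by (rule that[of 1 "s - 2"]) (use False assms in \<open>auto simp: kcase_def\<close>)
qed

text \<open>One derivative is split off the chain for \<open>f\<close> by shifting the index. The
  new bottom entry is continuous, by Morrey's embedding for \<open>k = 0\<close> and as a primitive
  for \<open>k = 1\<close>, and it is clipped so as to fit \<open>adm\<close>.\<close>

lemma Hs_derivative_chain:
 assumes ks: "kcase k \<sigma>" and f: "f \<in> Hs (real (Suc k) + \<sigma>) 0 (1/2)" "continuous_on J f" "Hs_norm (real (Suc k) + \<sigma>) 0 (1/2) f < e"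
 shows "\<exists>a b. continuous_on UNIV a \<and> (\<forall>x. a (clmp x) = a x) \<and> chain k (dch a b) \<and> HN \<sigma> k (dch a b) \<le> ennreal (e\<^sup>2) \<and> (\<forall>x\<in>J. f x = f 0 + AD a x)"
proof -
 note k = kcaseD[OF ks]
 obtain hs where ch: "chain (Suc k) hs" and h0: "\<And>x. x \<in> J ==> hs 0 x = f x" and HN: "HN \<sigma> (Suc k) hs < ennreal (e\<^sup>2)"
  and c: "\<And>j. j < Suc k ==> continuous_on UNIV (hs j)" "\<sigma> > 1/2 ==> continuous_on UNIV (hs (Suc k))"
  using Hs_imp_chain[OF f k(1,2)] by auto
 have c1: "continuous_on UNIV (hs 1)" using c ks unfolding kcase_def by auto
 define a where "a = (%x. hs 1 (clmp x))"
 define b where "b = hs 2"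
 have ac: "continuous_on UNIV a" unfolding a_def by (intro continuous_on_clmp continuous_on_subset[OF c1]) simp
 have E: "dch a b j x = hs (Suc j) x" if "j \<le> k" "x \<in> J" for j x
  using that k(4) unfolding dch_def a_def b_def by (cases "j = 0") (auto simp: numeral_2_eq_2 le_Suc_eq)
 have 1: "chain k (dch a b)" unfolding chain_def
 proof (intro conjI allI impI ballI)
  fix j assume j: "j \<le> k"
  show "dch a b j \<in> BM"
  proof (cases "j = 0")
   case True then show ?thesis using borel_measurable_continuous_onI[OF ac] by (simp add: dch_def)
  next
   case False
   then have "j = 1" using j k(4) by linarith
   then show ?thesis using chain_measurable[OF ch, of 2] j by (simp add: dch_def b_def)
  qed
  have "nsq J (dch a b j) = nsq J (hs (Suc j))" by (rule nsq_cong[OF E[OF j]])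
  then show "nsq J (dch a b j) < \<infinity>" using chain_finite[OF ch, of "Suc j"] j by simp
 next
  fix j x assume j: "j < k" and x: "x \<in> J"
  then have j0: "j = 0" "0 < k" using k(4) by auto
  have "dch a b (Suc 0) = hs (Suc (Suc 0))" by (simp add: dch_def b_def numeral_2_eq_2)
  then show "dch a b j x = dch a b j 0 + (LINT y:{0..x}|lborel. dch a b (Suc j) y)"
   using chain_eq[OF ch, of 1 x] E[of 0 x] E[of 0 0] j0 x by simp
 qed
 have 2: "HN \<sigma> k (dch a b) \<le> ennreal (e\<^sup>2)"
 proof -
  have "HN \<sigma> k (dch a b) = HN \<sigma> k (%j. hs (Suc j))" by (rule HN_cong[OF E])
  also have "... \<le> HN \<sigma> (Suc k) hs" unfolding HN_Suc by (simp add: add_increasing)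
  finally show ?thesis using HN by simp
 qed
 have 3: "f x = f 0 + AD a x" if x: "x \<in> J" for x
 proof -
  have "AD a x = (LINT y:{0..x}|lborel. a y)"
   using x set_borel_integral_eq_integral(2)[OF borel_integrable_atLeastAtMost'[OF continuous_on_subset[OF ac subset_UNIV]]]
   by (simp add: AD_nonneg_eq)
  also have "... = (LINT y:{0..x}|lborel. hs 1 y)"
   by (rule set_lebesgue_integral_cong) (use x in \<open>auto simp: a_def\<close>)
  finally show ?thesis using chain_eq[OF ch, of 0 x] h0[of x] h0[of 0] x by simp
 qed
 have "a (clmp x) = a x" for x unfolding a_def by simp
 then show ?thesis using ac 1 2 3 by blast
qed

lemma AD_deriv_J: assumes "continuous_on UNIV a" "\<And>x. x \<in> J ==> f x = c + AD a x" "x \<in> J"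
 shows "(f has_real_derivative a x) (at x within J)"
proof -
 have "((%x. c + AD a x) has_real_derivative a x) (at x within J)"
  by (auto intro!: derivative_eq_intros has_field_derivative_at_within[OF AD_DERIV[OF assms(1)]])
 then show ?thesis by (rule has_field_derivative_transform_within[OF _ zero_less_one assms(3)]) (simp add: assms(2))
qed

lemma adm_inj: assumes a: "adm a" "adm a'" and e: "\<And>x. x \<in> J ==> AD a x = AD a' x" shows "a = a'"
proof
 fix x
 have "a y = a' y" if y: "y \<in> J" for y
  using deriv_unique_Icc[OF _ y AD_deriv_J[of a "AD a" 0] AD_deriv_J[of a' "AD a" 0]] adm_cont[OF a(1)] adm_cont[OF a(2)] e y by simp
 from this[OF clmp_mem[of x]] show "a x = a' x" using a unfolding adm_def by metis
qed

lemma data_good: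
 assumes ks: "kcase k \<sigma>" and u: "u0 \<in> mhs_data (real (Suc k) + \<sigma>)"
 obtains a b where "good k \<sigma> a b" "\<And>x. x \<in> J ==> u0 x = AD a x"
proof -
 have u': "u0 \<in> Hs (real (Suc k) + \<sigma>) 0 (1/2)" "continuous_on J u0" "u0 0 = 0" "u0 (1/2) = 0" using u unfolding mhs_data_def by auto
 obtain a b where ab: "continuous_on UNIV a" "\<And>x. a (clmp x) = a x" "chain k (dch a b)"
   "HN \<sigma> k (dch a b) \<le> ennreal ((Hs_norm (real (Suc k) + \<sigma>) 0 (1/2) u0 + 1)\<^sup>2)" "\<And>x. x \<in> J ==> u0 x = u0 0 + AD a x"
  using Hs_derivative_chain[OF ks u'(1,2) less_add_one] by blast
 have "AD a (1/2) = 0" using ab(5)[of "1/2"] u' by simp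
 then have "good k \<sigma> a b" unfolding good_def adm_def using ab le_less_trans[OF ab(4) ennreal_less_top] by auto
 then show thesis using that ab(5) u'(3) by auto
qed

text \<open>The chain of \<open>w0\<close> is built as that of \<open>u0\<close> plus one for the
  difference. Its distance from the former is then bounded directly by the norm of the difference,
  with no comparison of independently chosen representatives.\<close>

lemma data_perturb:
 assumes ks: "kcase k \<sigma>" and g: "good k \<sigma> a b" and u: "u0 \<in> mhs_data (real (Suc k) + \<sigma>)" "\<And>x. x \<in> J ==> u0 x = AD a x"
  and w: "w0 \<in> mhs_data (real (Suc k) + \<sigma>)" "(%x. w0 x - u0 x) \<in> Hs (real (Suc k) + \<sigma>) 0 (1/2)" "Hs_norm (real (Suc k) + \<sigma>) 0 (1/2) (%x. w0 x - u0 x) < e"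
 shows "\<exists>a' b'. good k \<sigma> a' b' \<and> (\<forall>x\<in>J. w0 x = AD a' x) \<and> chain k (%j x. dch a' b' j x - dch a b j x) \<and> HN \<sigma> k (%j x. dch a' b' j x - dch a b j x) \<le> ennreal (e\<^sup>2)"
proof -
 have uw: "continuous_on J u0" "continuous_on J w0" "u0 0 = 0" "w0 0 = 0" "u0 (1/2) = 0" "w0 (1/2) = 0" using u w unfolding mhs_data_def by auto
 have a: "adm a" "chain k (dch a b)" "HN \<sigma> k (dch a b) < \<infinity>" using g unfolding good_def by auto
 have "continuous_on J (%x. w0 x - u0 x)" by (intro continuous_intros uw)
 from Hs_derivative_chain[OF ks w(2) this w(3)] obtain d h where d: "continuous_on UNIV d" "\<And>x. d (clmp x) = d x" "chain k (dch d h)"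
   "HN \<sigma> k (dch d h) \<le> ennreal (e\<^sup>2)" "\<And>x. x \<in> J ==> w0 x - u0 x = w0 0 - u0 0 + AD d x" by blast
 define a' where "a' = (%x. a x + d x)"
 define b' where "b' = (%x. b x + h x)"
 have dch: "dch a' b' = (%j x. dch a b j x + 1 * dch d h j x)" by (auto simp: dch_def a'_def b'_def fun_eq_iff)
 have w0: "w0 x = AD a' x" if x: "x \<in> J" for x
 proof -
  have "AD a' x = AD a x + AD d x" unfolding a'_def using x
   by (simp add: AD_nonneg_eq Henstock_Kurzweil_Integration.integral_add integrable_continuous_interval adm_cont[OF a(1)] continuous_on_subset[OF d(1)])
  then show ?thesis using d(5)[OF x] u(2)[OF x] uw by simp
 qed
 have "adm a'" unfolding adm_def
  using w0[of "1/2"] uw d(1,2) a(1) unfolding adm_def a'_def by (auto intro!: continuous_intros)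
 moreover have "chain k (dch a' b')" unfolding dch by (rule chain_lin[OF a(2) d(3)])
 moreover have "HN \<sigma> k (dch a' b') < \<infinity>" unfolding dch
  by (rule le_less_trans[OF HN_lin[OF a(2) d(3)]]) (use a(3) le_less_trans[OF d(4) ennreal_less_top] in \<open>auto simp: ennreal_mult_less_top\<close>)
 moreover have "(%j x. dch a' b' j x - dch a b j x) = dch d h" unfolding dch by simp
 ultimately show ?thesis using d(3,4) w0 unfolding good_def by (intro exI[of _ a'] exI[of _ b']) simp
qed

lemma chain_sup:
 assumes ks: "kcase k \<sigma>"
 obtains C where "0 < C" "\<And>hs e x. chain k hs ==> continuous_on J (hs 0) ==> HN \<sigma> k hs \<le> ennreal (e\<^sup>2) ==> 0 \<le> e ==> x \<in> J ==> \<bar>hs 0 x\<bar> \<le> C * e"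
proof -
 obtain C where C: "C > 0" "\<And>hs x. chain k hs ==> continuous_on J (hs 0) ==> x \<in> J ==> ennreal ((hs 0 x)\<^sup>2) \<le> ennreal C * HN \<sigma> k hs"
  using chain_sup_bound[of k \<sigma>] ks unfolding kcase_def by blast
 show thesis
 \<comment> \<open>\<open>C + 1\<close> bounds the square root of \<open>C\<close> and so serves for
   the unsquared estimate.\<close>
 proof (rule that[of "C + 1"])
  fix hs e x assume h: "chain k hs" "continuous_on J (hs 0)" "HN \<sigma> k hs \<le> ennreal (e\<^sup>2)" "0 \<le> e" "x \<in> J"
  have "ennreal ((hs 0 x)\<^sup>2) \<le> ennreal C * ennreal (e\<^sup>2)" by (rule order_trans[OF C(2)[OF h(1,2,5)] mult_left_mono[OF h(3)]]) simp
  then have "(hs 0 x)\<^sup>2 \<le> C * e\<^sup>2" using C(1) by (simp flip: ennreal_mult)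
  also have "... \<le> (C + 1)\<^sup>2 * e\<^sup>2" using C(1) by (intro mult_right_mono) (auto simp: power2_eq_square algebra_simps)
  finally have "\<bar>hs 0 x\<bar>\<^sup>2 \<le> ((C + 1) * e)\<^sup>2" by (simp add: power_mult_distrib)
  then show "\<bar>hs 0 x\<bar> \<le> (C + 1) * e" by (rule power2_le_imp_le) (use C(1) h(4) in simp)
 qed (use C(1) in simp)
qed

subsection \<open>The explicit flow is a solution\<close>

lemma UU_0: assumes "x \<in> J" shows "UU a 0 x = AD a x"
proof -
 have g: "gam a 0 = (%x. x)" unfolding gam_def cE_def dE_def by simp
 have "eta a 0 x = x" unfolding eta_def g by (simp add: inv_equality)
 then show ?thesis unfolding UU_def ll_def rE_def cE_def dE_def by simp
qed

lemma flow_continuous: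
 assumes ks: "kcase k \<sigma>" and g: "good k \<sigma> a b" and t: "t \<longlonglongrightarrow> t'" "t' \<in> Pos a"
 shows "(%n. HN \<sigma> (Suc k) (%j x. cU a b (t n) j x - cU a b t' j x)) \<longlonglongrightarrow> 0"
  "(%n. HN \<sigma> k (%j x. cV a b (t n) j x - cV a b t' j x)) \<longlonglongrightarrow> 0"
  "HN \<sigma> (Suc k) (cU a b t') < \<infinity>" "HN \<sigma> k (cV a b t') < \<infinity>"
proof -
 have a: "adm a" using g unfolding good_def by blast
 have z: "(%n::nat. HN \<sigma> k (%j x. dch a b j x - dch a b j x)) \<longlonglongrightarrow> 0" by (simp add: HN_zero)
 note F = flow_tendsto[OF ks dataseq_const[OF a t(1)] t(2) g g z]
 show "(%n. HN \<sigma> (Suc k) (%j x. cU a b (t n) j x - cU a b t' j x)) \<longlonglongrightarrow> 0"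
  "(%n. HN \<sigma> k (%j x. cV a b (t n) j x - cV a b t' j x)) \<longlonglongrightarrow> 0"
  "HN \<sigma> (Suc k) (cU a b t') < \<infinity>" "HN \<sigma> k (cV a b t') < \<infinity>" by (rule F)+
qed

lemma C_Hs_chain:
 assumes s: "0 \<le> \<sigma>" "\<sigma> < 1" and ch: "\<And>t. t \<in> tint T ==> chain k (h t)" and fin: "\<And>t. t \<in> tint T ==> HN \<sigma> k (h t) < \<infinity>"
  and lim: "\<And>\<tau> t. \<tau> \<longlonglongrightarrow> t ==> t \<in> tint T ==> (%n. HN \<sigma> k (%j x. h (\<tau> n) j x - h t j x)) \<longlonglongrightarrow> 0"
  and u: "\<And>t. h t 0 = u t"
 shows "C_Hs (real k + \<sigma>) T u"
 unfolding C_Hs_def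
proof (intro ballI conjI allI impI)
 fix t e :: real assume t: "t \<in> tint T"
 show "u t \<in> Hs (real k + \<sigma>) 0 (1/2)" by (rule HN_imp_Hs[OF s ch[OF t] fin[OF t]]) (simp add: u)
 assume e: "0 < e"
 show "\<exists>\<delta>>0. \<forall>t'\<in>tint T. \<bar>t' - t\<bar> < \<delta> \<longrightarrow>
      (%x. u t' x - u t x) \<in> Hs (real k + \<sigma>) 0 (1/2) \<and> Hs_norm (real k + \<sigma>) 0 (1/2) (%x. u t' x - u t x) < e"
 proof (rule sequence_delta)
  fix \<tau> :: "nat => real" assume \<tau>: "\<And>n. \<tau> n \<in> tint T" "\<And>n. \<bar>\<tau> n - t\<bar> < inverse (real (Suc n))"
  show "\<forall>\<^sub>F n in sequentially. (%x. u (\<tau> n) x - u t x) \<in> Hs (real k + \<sigma>) 0 (1/2) \<and> Hs_norm (real k + \<sigma>) 0 (1/2) (%x. u (\<tau> n) x - u t x) < e"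
   by (rule HN_imp_Hs_small[OF s _ lim[OF inverse_Suc_tendsto[OF \<tau>(2)] t] _ e])
     (use chain_diff[OF ch[OF \<tau>(1)] ch[OF t]] in \<open>auto simp: u intro!: always_eventually\<close>)
 qed
qed

text \<open>Continuity of \<open>VV\<close> in norm at \<open>t\<close> makes its values at all
  times between \<open>t\<close> and \<open>t'\<close> close to \<open>VV a t\<close>, and the mean
  in \<open>time_average\<close> inherits this. The two times may come in either order, hence
  \<open>lo\<close> and \<open>hi\<close>.\<close>

lemma flow_tderiv:
 assumes ks: "kcase k \<sigma>" and g: "good k \<sigma> a b"
 shows "tderiv_Hs (real k + \<sigma>) (Tmax a) (UU a) (VV a)"
 unfolding tderiv_Hs_def
proof (intro ballI allI impI)
 fix t e :: real assume t: "t \<in> tint (Tmax a)" and e: "0 < e"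
 note k = kcaseD[OF ks]
 \<comment> \<open>\<open>time_average\<close> returns \<open>3 * B\<close>, which is below
   \<open>(e/2)\<^sup>2\<close>; the norm is then at most \<open>e/2\<close>, strictly below
   \<open>e\<close>.\<close>
 define B where "B = ennreal ((e/4)\<^sup>2)"
 have "\<exists>d>0. \<forall>\<tau>\<in>tint (Tmax a). \<bar>\<tau> - t\<bar> < d \<longrightarrow> HN \<sigma> k (%j x. cV a b \<tau> j x - cV a b t j x) \<le> B"
 proof (rule sequence_delta)
  fix \<tau> :: "nat => real" assume \<tau>: "\<And>n. \<bar>\<tau> n - t\<bar> < inverse (real (Suc n))"
  have "0 < B" unfolding B_def using e by simp
  from order_tendstoD(2)[OF flow_continuous(2)[OF ks g inverse_Suc_tendsto[OF \<tau>] tint_Pos'[OF t]] this]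
  show "\<forall>\<^sub>F n in sequentially. HN \<sigma> k (%j x. cV a b (\<tau> n) j x - cV a b t j x) \<le> B" by (rule eventually_mono) simp
 qed
 then obtain d where d: "d > 0" "\<And>\<tau>. \<tau> \<in> tint (Tmax a) ==> \<bar>\<tau> - t\<bar> < d ==> HN \<sigma> k (%j x. cV a b \<tau> j x - cV a b t j x) \<le> B" by blast
 show "\<exists>\<delta>>0. \<forall>t'\<in>tint (Tmax a). t' \<noteq> t \<and> \<bar>t' - t\<bar> < \<delta> \<longrightarrow>
    (%x. (UU a t' x - UU a t x) / (t' - t) - VV a t x) \<in> Hs (real k + \<sigma>) 0 (1/2)
    \<and> Hs_norm (real k + \<sigma>) 0 (1/2) (%x. (UU a t' x - UU a t x) / (t' - t) - VV a t x) < e"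
 proof (intro exI[of _ d] conjI ballI impI d(1))
  fix t' assume t': "t' \<in> tint (Tmax a)" "t' \<noteq> t \<and> \<bar>t' - t\<bar> < d"
  define lo hi where "lo = min t t'" and "hi = max t t'"
  have lh: "lo < hi" "t \<in> {lo..hi}" unfolding lo_def hi_def using t' by auto
  have tin: "\<tau> \<in> tint (Tmax a)" if "\<tau> \<in> {lo..hi}" for \<tau>
  proof -
   have "0 \<le> \<tau>" "\<tau> \<le> t \<or> \<tau> \<le> t'" using that t t'(1) unfolding tint_def lo_def hi_def by auto
   then show ?thesis using t t'(1) unfolding tint_def by (auto intro: le_less_trans[of "ereal \<tau>" "ereal t"] le_less_trans[of "ereal \<tau>" "ereal t'"])
  qed
  have "\<exists>hs. chain k hs \<and> (\<forall>x\<in>J. hs 0 x = (UU a hi x - UU a lo x) / (hi - lo) - VV a t x) \<and> HN \<sigma> k hs \<le> 3 * B"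
  proof (rule time_average[OF ks g lh(1) _ lh(2)])
   show "{lo..hi} \<subseteq> Pos a" using tin tint_Pos' by blast
   show "HN \<sigma> k (%j x. cV a b \<tau> j x - cV a b t j x) \<le> B" if "\<tau> \<in> {lo..hi}" for \<tau>
    by (rule d(2)[OF tin[OF that]]) (use that t'(2) in \<open>auto simp: lo_def hi_def min_def max_def split: if_splits\<close>)
   show "B < \<infinity>" unfolding B_def by simp
  qed
  then obtain hs where hs: "chain k hs" "\<And>x. x \<in> J ==> hs 0 x = (UU a hi x - UU a lo x) / (hi - lo) - VV a t x" "HN \<sigma> k hs \<le> 3 * B" by blast
  have sym: "(UU a hi x - UU a lo x) / (hi - lo) = (UU a t' x - UU a t x) / (t' - t)" for x
  proof (cases "t < t'")
   case False
   then have "hi = t" "lo = t'" unfolding lo_def hi_def by auto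
   then show ?thesis by (metis minus_diff_eq minus_divide_divide)
  qed (simp add: lo_def hi_def)
  have "3 * B = ennreal (3 * (e/4)\<^sup>2)" unfolding B_def by (simp add: ennreal_mult)
  also have "... \<le> ennreal ((e/2)\<^sup>2)" by (rule ennreal_leI) (simp add: power2_eq_square)
  finally have HN: "HN \<sigma> k hs \<le> ennreal ((e/2)\<^sup>2)" using hs(3) by (rule order_trans[rotated])
  have "(UU a t' x - UU a t x) / (t' - t) - VV a t x = hs 0 x" if "x \<in> {0<..<1/2}" for x using hs(2)[of x] that sym by simp
  from chain_imp_Hs[OF hs(1) k(1,2) this HN] e
  show "(%x. (UU a t' x - UU a t x) / (t' - t) - VV a t x) \<in> Hs (real k + \<sigma>) 0 (1/2)"
    "Hs_norm (real k + \<sigma>) 0 (1/2) (%x. (UU a t' x - UU a t x) / (t' - t) - VV a t x) < e" by auto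
 qed
qed

lemma flow_solution:
 assumes ks: "kcase k \<sigma>" and g: "good k \<sigma> a b" and u0: "\<And>x. x \<in> J ==> u0 x = AD a x"
 shows "mhs_solution 1 (real (Suc k) + \<sigma>) u0 (Tmax a) (UU a) (VV a)"
proof -
 note k = kcaseD[OF ks] and P = tint_Pos'[of _ a]
 have a: "adm a" using g unfolding good_def by blast
 have e: "real (Suc k) + \<sigma> - 1 = real k + \<sigma>" by simp
 have "C_Hs (real (Suc k) + \<sigma>) (Tmax a) (UU a)"
  by (rule C_Hs_chain[OF k(1,2) chain_cU_cV(1)[OF ks g P] flow_continuous(3)[OF ks g tendsto_const P] flow_continuous(1)[OF ks g _ P]]) (auto simp: cU_def)
 moreover have "C_Hs (real k + \<sigma>) (Tmax a) (VV a)"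
  by (rule C_Hs_chain[OF k(1,2) chain_cU_cV(2)[OF ks g P] flow_continuous(4)[OF ks g tendsto_const P] flow_continuous(2)[OF ks g _ P]]) (auto simp: cV_def)
 ultimately have "sol_class (real (Suc k) + \<sigma>) (Tmax a) (UU a) (VV a)"
  unfolding sol_class_def e using flow_tderiv[OF ks g] UU_cont[OF a P] VV_cont[OF a P] by blast
 moreover have "VV a t x + UU a t x ^ 1 * deriv (UU a t) x = mhs_rhs 1 (UU a t) x" if "t \<in> tint (Tmax a)" "x \<in> {0<..<1/2}" for t x
  by (rule mhs_equation[OF a P[OF that(1)]]) (use that(2) in auto)
 ultimately show ?thesis unfolding mhs_solution_def using UU_0 u0 UU_VV_ends[OF a P] by auto
qed

subsection \<open>Every solution is a classical solution\<close>

text \<open>The embedding \<open>chain_sup\<close>, applied to differences at two times, upgrades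
  continuity in norm to uniform convergence of \<open>wx\<close> and \<open>v\<close>, and the time
  derivative in norm to a pointwise one.\<close>

lemma solution_classical:
 assumes ks: "kcase k \<sigma>" and sol: "mhs_solution 1 (real (Suc k) + \<sigma>) u0 T' w v" and a: "adm a" and u0: "\<And>x. x \<in> J ==> u0 x = AD a x"
  and T1: "0 < T1" "ereal T1 < T'"
 obtains wx where "classical T1 w wx v a"
proof -
 let ?s = "real (Suc k) + \<sigma>" and ?I = "{0..T1}"
 note k = kcaseD[OF ks]
 have e1: "?s - 1 = real k + \<sigma>" by simp
 have tin: "t \<in> tint T'" if "t \<in> ?I" for t
  using that T1(2) unfolding tint_def by (auto intro: le_less_trans[of "ereal t" "ereal T1"])
 have CU: "C_Hs ?s T' w" and CV: "C_Hs (real k + \<sigma>) T' v" and TD: "tderiv_Hs (real k + \<sigma>) T' w v"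
  and cont: "\<And>t. t \<in> ?I ==> continuous_on J (w t)" "\<And>t. t \<in> ?I ==> continuous_on J (v t)"
  and ini: "\<And>x. x \<in> J ==> w 0 x = u0 x" and bc: "\<And>t. t \<in> ?I ==> w t 0 = 0" "\<And>t. t \<in> ?I ==> w t (1/2) = 0"
  and pde: "\<And>t x. t \<in> ?I ==> 0 < t ==> x \<in> {0<..<1/2} ==> v t x + w t x * deriv (w t) x = mhs_rhs 1 (w t) x"
  using sol tin unfolding mhs_solution_def sol_class_def e1 by auto
 obtain C where C: "0 < C" "\<And>hs e x. chain k hs ==> continuous_on J (hs 0) ==> HN \<sigma> k hs \<le> ennreal (e\<^sup>2) ==> 0 \<le> e ==> x \<in> J ==> \<bar>hs 0 x\<bar> \<le> C * e"
  using chain_sup[OF ks] by blast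
 have sup: "\<bar>f x\<bar> \<le> e" if f: "f \<in> Hs (real k + \<sigma>) 0 (1/2)" "Hs_norm (real k + \<sigma>) 0 (1/2) f < e / C" "continuous_on J f" "0 < e" "x \<in> J" for f e x
 proof -
  obtain hs where hs: "chain k hs" "\<forall>x\<in>J. hs 0 x = f x" "HN \<sigma> k hs < ennreal ((e/C)\<^sup>2)"
   using Hs_imp_chain[OF f(1,3,2) k(1-3)] by blast
  have "continuous_on J (hs 0)" using continuous_on_cong[OF refl, of J "hs 0" f] hs(2) f(3) by blast
  from C(2)[OF hs(1) this less_imp_le[OF hs(3)] _ f(5)] show ?thesis using hs(2) f(4,5) C(1) by auto
 qed
 have "\<exists>D. continuous_on UNIV D \<and> (\<forall>x\<in>J. w t x = 0 + AD D x)" if t: "t \<in> ?I" for t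
 proof -
  have "w t \<in> Hs ?s 0 (1/2)" using CU tin[OF t] unfolding C_Hs_def by blast
  from Hs_derivative_chain[OF ks this cont(1)[OF t] less_add_one] bc(1)[OF t] show ?thesis by metis
 qed
 then obtain wx where wx: "\<And>t. t \<in> ?I ==> continuous_on UNIV (wx t)" "\<And>t x. t \<in> ?I ==> x \<in> J ==> w t x = 0 + AD (wx t) x" by metis
 have dx: "(w t has_real_derivative wx t x) (at x within J)" if "t \<in> ?I" "x \<in> J" for t x
  by (rule AD_deriv_J[OF wx(1)[OF that(1)] wx(2)[OF that(1)] that(2)])
 have wxc: "continuous_on J (wx t)" if "t \<in> ?I" for t by (rule continuous_on_subset[OF wx(1)[OF that]]) simp
 have uwx: "\<exists>d>0. \<forall>t'\<in>?I. \<bar>t' - t\<bar> < d \<longrightarrow> (\<forall>x\<in>J. \<bar>wx t' x - wx t x\<bar> \<le> e)" if t: "t \<in> ?I" and e: "0 < e" for t e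
 proof -
  have eC: "0 < e / C" using e C(1) by simp
  obtain d where d: "d > 0" "\<And>t'. t' \<in> tint T' ==> \<bar>t' - t\<bar> < d ==>
    (%x. w t' x - w t x) \<in> Hs ?s 0 (1/2) \<and> Hs_norm ?s 0 (1/2) (%x. w t' x - w t x) < e / C"
   using CU tin[OF t] eC unfolding C_Hs_def by blast
  have "\<bar>wx t' x - wx t x\<bar> \<le> e" if t': "t' \<in> ?I" "\<bar>t' - t\<bar> < d" and x: "x \<in> J" for t' x
  proof -
   have cd: "continuous_on J (%x. w t' x - w t x)" by (intro continuous_intros cont t t')
   obtain D b where D: "continuous_on UNIV D" "chain k (dch D b)" "HN \<sigma> k (dch D b) \<le> ennreal ((e/C)\<^sup>2)"
     "\<And>x. x \<in> J ==> w t' x - w t x = (w t' 0 - w t 0) + AD D x"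
    using Hs_derivative_chain[OF ks _ cd] d(2)[OF tin[OF t'(1)] t'(2)] by blast
   have "((%x. w t' x - w t x) has_real_derivative D x) (at x within J)" by (rule AD_deriv_J[OF D(1,4) x])
   from deriv_unique_Icc[OF _ x DERIV_diff[OF dx[OF t'(1) x] dx[OF t x]] this] have "wx t' x - wx t x = D x" by simp
   moreover have "\<bar>dch D b 0 x\<bar> \<le> C * (e / C)"
    by (rule C(2)[OF D(2) _ D(3)]) (use continuous_on_subset[OF D(1), of J] e C(1) x in \<open>auto simp: dch_def\<close>)
   ultimately show ?thesis using C(1) by (simp add: dch_def)
  qed
  then show ?thesis using d(1) by blast
 qed
 have cwx: "continuous_on (?I \<times> J) (%z. wx (fst z) (snd z))" by (rule uniform_joint_cont[OF uwx wxc])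
 have cw: "continuous_on (?I \<times> J) (%z. w (fst z) (snd z))"
 proof (rule uniform_joint_cont[OF _ cont(1)])
  fix t e :: real assume t: "t \<in> ?I" and e: "0 < e"
  from uwx[OF this] obtain d where d: "d > 0" "\<And>t' x. t' \<in> ?I ==> \<bar>t' - t\<bar> < d ==> x \<in> J ==> \<bar>wx t' x - wx t x\<bar> \<le> e" by blast
  have "\<bar>w t' x - w t x\<bar> \<le> e" if t': "t' \<in> ?I" "\<bar>t' - t\<bar> < d" and x: "x \<in> J" for t' x
  proof -
   have "norm ((%x. w t' x - w t x) x - (%x. w t' x - w t x) 0) \<le> e * norm (x - 0)"
    by (rule field_differentiable_bound[of J _ "%x. wx t' x - wx t x"])
      (use DERIV_diff[OF dx[OF t'(1)] dx[OF t]] d(2)[OF t'] x in auto)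
   also have "... \<le> e * 1" using e x by (intro mult_left_mono) auto
   finally show ?thesis using bc(1)[OF t'(1)] bc(1)[OF t] by simp
  qed
  then show "\<exists>d>0. \<forall>t'\<in>?I. \<bar>t' - t\<bar> < d \<longrightarrow> (\<forall>x\<in>J. \<bar>w t' x - w t x\<bar> \<le> e)" using d(1) by blast
 qed
 have cv: "continuous_on (?I \<times> J) (%z. v (fst z) (snd z))"
 proof (rule uniform_joint_cont[OF _ cont(2)])
  fix t e :: real assume t: "t \<in> ?I" and e: "0 < e"
  have "0 < e / C" using e C(1) by simp
  then obtain d where d: "d > 0" "\<And>t'. t' \<in> tint T' ==> \<bar>t' - t\<bar> < d ==>
    (%x. v t' x - v t x) \<in> Hs (real k + \<sigma>) 0 (1/2) \<and> Hs_norm (real k + \<sigma>) 0 (1/2) (%x. v t' x - v t x) < e / C"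
   using CV tin[OF t] unfolding C_Hs_def by blast
  have "\<bar>v t' x - v t x\<bar> \<le> e" if t': "t' \<in> ?I" "\<bar>t' - t\<bar> < d" and x: "x \<in> J" for t' x
   using d(2)[OF tin[OF t'(1)] t'(2)] by (intro sup[of "%x. v t' x - v t x"] continuous_intros cont t t' e x) auto
  then show "\<exists>d>0. \<forall>t'\<in>?I. \<bar>t' - t\<bar> < d \<longrightarrow> (\<forall>x\<in>J. \<bar>v t' x - v t x\<bar> \<le> e)" using d(1) by blast
 qed
 have dt: "((%t. w t x) has_real_derivative v t x) (at t within ?I)" if t: "t \<in> ?I" and x: "x \<in> J" for t x
  unfolding has_field_derivative_iff
 proof (rule tendstoI)
  fix e :: real assume e: "0 < e"
  have "0 < e / 2 / C" using e C(1) by simp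
  then obtain d where d: "d > 0" "\<And>t'. t' \<in> tint T' ==> t' \<noteq> t \<and> \<bar>t' - t\<bar> < d ==>
    (%x. (w t' x - w t x) / (t' - t) - v t x) \<in> Hs (real k + \<sigma>) 0 (1/2) \<and> Hs_norm (real k + \<sigma>) 0 (1/2) (%x. (w t' x - w t x) / (t' - t) - v t x) < e / 2 / C"
   using TD tin[OF t] unfolding tderiv_Hs_def by blast
  have "\<bar>(w t' x - w t x) / (t' - t) - v t x\<bar> \<le> e / 2" if t': "t' \<in> ?I" "t' \<noteq> t \<and> \<bar>t' - t\<bar> < d" for t'
   using d(2)[OF tin[OF t'(1)] t'(2)] e t'(2)
   by (intro sup[of "%x. (w t' x - w t x) / (t' - t) - v t x"] continuous_intros cont t t'(1) x) auto
  then have *: "dist ((w t' x - w t x) / (t' - t)) (v t x) < e" if "t' \<in> ?I" "t' \<noteq> t" "\<bar>t' - t\<bar> < d" for t'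
   using that e unfolding dist_real_def by fastforce
  show "\<forall>\<^sub>F t' in at t within ?I. dist ((w t' x - w t x) / (t' - t)) (v t x) < e"
   unfolding eventually_at using d(1) * by (auto simp: dist_real_def)
 qed
 have pde1: "v t x + w t x * wx t x = integral {0..x} (%y. (wx t y)\<^sup>2 / 2) - x * integral J (%y. (wx t y)\<^sup>2)"
  if t: "t \<in> ?I" "0 < t" and x: "x \<in> {0<..<1/2}" for t x
 proof -
  have dw: "deriv (w t) y = wx t y" if y: "y \<in> {0<..<1/2}" for y
  proof (rule DERIV_imp_deriv)
   have "(w t has_real_derivative wx t y) (at y within {0<..<1/2})"
    by (rule has_field_derivative_subset[OF dx[OF t(1)]]) (use y in auto)
   then show "(w t has_real_derivative wx t y) (at y)" unfolding at_within_open[OF y open_greaterThanLessThan] .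
  qed
  \<comment> \<open>\<open>deriv (w t)\<close> at 0 and at \<open>1/2\<close> depends on values
    outside \<open>J\<close>, which are arbitrary; two points are negligible under the
    integral.\<close>
  have sp: "integral {0..z} (%y. h (deriv (w t) y)) = integral {0..z} (%y. h (wx t y))" if "z \<in> J" for z and h :: "real => real"
   by (rule integral_spike[of "{0,1/2}"]) (use dw that in auto)
  have i: "(%y. (wx t y)\<^sup>2) integrable_on {0..z}" for z
   by (intro integrable_continuous_interval continuous_intros continuous_on_subset[OF wx(1)[OF t(1)]]) simp
  define E where "E = integral J (%y. (wx t y)\<^sup>2)"
  have "mhs_rhs 1 (w t) x = (1/2) * integral {0..x} (%y. (deriv (w t) y)\<^sup>2 - 2 * integral J (%z. (deriv (w t) z)\<^sup>2))"
   unfolding mhs_rhs_def by simp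
  also have "integral J (%z. (deriv (w t) z)\<^sup>2) = E" unfolding E_def using sp[of "1/2" "%u. u\<^sup>2"] by simp
  also have "integral {0..x} (%y. (deriv (w t) y)\<^sup>2 - 2 * E) = integral {0..x} (%y. (wx t y)\<^sup>2 - 2 * E)"
   using sp[of x "%u. u\<^sup>2 - 2 * E"] x by simp
  also have "... = integral {0..x} (%y. (wx t y)\<^sup>2) - x * (2 * E)"
   using x i by (subst Henstock_Kurzweil_Integration.integral_diff) auto
  finally have "mhs_rhs 1 (w t) x = integral {0..x} (%y. (wx t y)\<^sup>2 / 2) - x * E" by (simp add: field_simps)
  then show ?thesis using pde[OF t x] dw[OF x] unfolding E_def by simp
 qed
 \<comment> \<open>The equation is given for positive times; at \<open>t = 0\<close> it follows by
   continuity of both sides in time.\<close>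
 have pde2: "v t x + w t x * wx t x = integral {0..x} (%y. (wx t y)\<^sup>2 / 2) - x * integral J (%y. (wx t y)\<^sup>2)"
  if t: "t \<in> ?I" and x: "x \<in> {0<..<1/2}" for t x
 proof (cases "t = 0")
  case True
  have xJ: "x \<in> J" using x by simp
  have c1: "continuous_on ?I (%t. h t x)" if "continuous_on (?I \<times> J) (%z. h (fst z) (snd z))" for h :: "real => real => real"
  proof -
   have "(%t. (t, x)) ` ?I \<subseteq> ?I \<times> J" using xJ by blast
   from continuous_on_compose2[OF that continuous_on_Pair[OF continuous_on_id continuous_on_const] this] show ?thesis by simp
  qed
  have c2: "continuous_on ?I (%t. integral {0..z} (%y. h (wx t y)))" if "z \<in> J" "continuous_on UNIV h" for z and h :: "real => real"
  proof -
   have "continuous_on (?I \<times> {0..z}) (%y. h (wx (fst y) (snd y)))"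
    by (rule continuous_on_compose2[OF that(2) continuous_on_subset[OF cwx]]) (use that(1) in auto)
   then show ?thesis unfolding cbox_interval[symmetric]
    by (intro integral_continuous_on_param) (simp add: case_prod_beta cbox_interval)
  qed
  define g where "g = (%t. v t x + w t x * wx t x - (integral {0..x} (%y. (wx t y)\<^sup>2 / 2) - x * integral J (%y. (wx t y)\<^sup>2)))"
  have "continuous_on ?I g" unfolding g_def
   by (intro continuous_on_diff continuous_on_add continuous_on_mult continuous_on_const c1 cv cw cwx c2[of _ "%u. u\<^sup>2"] c2[of _ "%u. u\<^sup>2 / 2"])
     (use xJ in \<open>auto intro!: continuous_intros\<close>)
  then have "(g \<longlongrightarrow> g 0) (at 0 within ?I)" using T1(1) unfolding continuous_on_def by simp
  moreover have "((%_. 0) \<longlongrightarrow> (0::real)) (at 0 within ?I)" by simp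
  then have "(g \<longlongrightarrow> 0) (at 0 within ?I)"
   by (rule Lim_transform_eventually) (use pde1[OF _ _ x] in \<open>auto simp: eventually_at_filter g_def\<close>)
  moreover have "at 0 within ?I \<noteq> bot" using T1(1) by (simp add: trivial_limit_within islimpt_Icc)
  ultimately have "g 0 = 0" using tendsto_unique by blast
  then show ?thesis unfolding g_def True by simp
 qed (use pde1[OF t _ x] t in auto)
 \<comment> \<open>At the endpoints \<open>w\<close> is zero at all times, so \<open>v\<close>
   vanishes there; the right side of the equation does too, and the equation extends to the
   boundary.\<close>
 have v0: "v t x = 0" if t: "t \<in> ?I" and x: "x = 0 \<or> x = 1/2" for t x
 proof -
  have xJ: "x \<in> J" using x by auto
  have "((%t. 0) has_real_derivative v t x) (at t within ?I)"
   by (rule has_field_derivative_transform_within[OF dt[OF t xJ] zero_less_one t]) (metis bc x)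
  from deriv_unique_Icc[OF T1(1) t this DERIV_const] show ?thesis .
 qed
 have "classical T1 w wx v a"
 proof unfold_locales
  fix t x :: real assume t: "t \<in> ?I" and x: "x \<in> J"
  show "v t x + w t x * wx t x = integral {0..x} (%y. (wx t y)\<^sup>2 / 2) - x * integral J (%y. (wx t y)\<^sup>2)"
  proof (cases "x \<in> {0<..<1/2}")
   case False
   then have "x = 0 \<or> x = 1/2" using x by auto
   then show ?thesis
   proof
    assume x: "x = 0" show ?thesis unfolding x using v0[OF t, of 0] bc(1)[OF t] by simp
   next
    assume x: "x = 1/2" show ?thesis unfolding x using v0[OF t, of "1/2"] bc(2)[OF t] by simp
   qed
  qed (rule pde2[OF t])
 qed (use T1 a cw cwx cv dx dt bc ini u0 in auto)
 then show thesis by (rule that)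
qed

text \<open>A time \<open>T1\<close> between \<open>t\<close> and \<open>T'\<close> gives a compact
  interval on which the solution is classical. The first conclusion is the maximality of
  \<open>Tmax a\<close>, the second is uniqueness.\<close>

lemma solution_unique:
 assumes ks: "kcase k \<sigma>" and sol: "mhs_solution 1 (real (Suc k) + \<sigma>) u0 T' w v" and a: "adm a" and u0: "\<And>x. x \<in> J ==> u0 x = AD a x"
  and t: "0 \<le> t" "ereal t < T'"
 shows "ereal t \<le> Tmax a" "x \<in> J ==> w t x = UU a t x"
proof -
 obtain T1 where T1: "ereal t < ereal T1" "ereal T1 < T'" using ereal_dense2[OF t(2)] by blast
 then have T1': "0 < T1" "t \<in> {0..T1}" using t by auto
 obtain wx where "classical T1 w wx v a" using solution_classical[OF ks sol a u0 T1'(1) T1(2)] by blast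
 then interpret classical T1 w wx v a .
 show "ereal t \<le> Tmax a" by (rule Tmax_ge) (use t_Pos T1' in auto)
 show "x \<in> J ==> w t x = UU a t x" by (rule classical_unique[OF T1'(2)])
qed

text \<open>\<open>eventually_Icc\<close> reduces uniformity over \<open>{0..T1}\<close> to moving
  times \<open>t n\<close> tending to some \<open>t'\<close>. Both flows at time \<open>t n\<close>
  tend in norm to the unperturbed flow at \<open>t'\<close>, hence to each other. A time
  \<open>T2\<close> beyond \<open>T1\<close> yields the strict inequality for the perturbed
  lifespan.\<close>

lemma flow_data_continuous:
 assumes ks: "kcase k \<sigma>" and g: "good k \<sigma> a b" and T1: "0 \<le> T1" "ereal T1 < Tmax a" and e: "0 < e"
  and gA: "\<And>n. good k \<sigma> (A n) (B n)" and ch: "\<And>n. chain k (%j x. dch (A n) (B n) j x - dch a b j x)"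
  and HN: "\<And>n. HN \<sigma> k (%j x. dch (A n) (B n) j x - dch a b j x) \<le> ennreal ((inverse (real (Suc n)))\<^sup>2)"
 shows "\<forall>\<^sub>F n in sequentially. ereal T1 < Tmax (A n) \<and> (\<forall>t\<in>{0..T1}.
   Hs_norm (real (Suc k) + \<sigma>) 0 (1/2) (%x. UU (A n) t x - UU a t x) < e \<and> Hs_norm (real k + \<sigma>) 0 (1/2) (%x. VV (A n) t x - VV a t x) < e)"
proof -
 note k = kcaseD[OF ks]
 have a: "adm a" and A: "\<And>n. adm (A n)" using g gA unfolding good_def by auto
 obtain C where C: "0 < C" "\<And>hs e x. chain k hs ==> continuous_on J (hs 0) ==> HN \<sigma> k hs \<le> ennreal (e\<^sup>2) ==> 0 \<le> e ==> x \<in> J ==> \<bar>hs 0 x\<bar> \<le> C * e"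
  using chain_sup[OF ks] by blast
 have ul: "uniform_limit J A a sequentially"
  unfolding uniform_limit_iff
 proof (intro allI impI)
  fix r :: real assume r: "0 < r"
  have "(%n. C * inverse (real (Suc n))) \<longlonglongrightarrow> C * 0" by (intro tendsto_intros LIMSEQ_inverse_real_of_nat)
  then have "\<forall>\<^sub>F n in sequentially. C * inverse (real (Suc n)) < r" using r by (intro order_tendstoD(2)) auto
  then show "\<forall>\<^sub>F n in sequentially. \<forall>x\<in>J. dist (A n x) (a x) < r"
  proof eventually_elim
   case (elim n)
   have "\<bar>dch (A n) (B n) 0 x - dch a b 0 x\<bar> \<le> C * inverse (real (Suc n))" if "x \<in> J" for x
    by (rule C(2)[OF ch _ HN _ that]) (auto simp: dch_def intro!: continuous_on_diff adm_cont[OF A] adm_cont[OF a])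
   then show ?case using elim unfolding dch_def dist_real_def by fastforce
  qed
 qed
 have sq: "(%n. ennreal ((inverse (real (Suc n)))\<^sup>2)) \<longlonglongrightarrow> 0"
  using tendsto_ennrealI[OF tendsto_power[OF LIMSEQ_inverse_real_of_nat, of 2]] by simp
 have lim: "(%n. HN \<sigma> k (%j x. dch (A n) (B n) j x - dch a b j x)) \<longlonglongrightarrow> 0" by (rule tendsto_0_ennreal_le[OF sq HN])
 obtain T2 where T2: "ereal T1 < ereal T2" "ereal T2 < Tmax a" using ereal_dense2[OF T1(2)] by blast
 have "T2 \<in> tint (Tmax a)" using T1(1) T2 unfolding tint_def by simp
 note PT2 = tint_Pos[OF this]
 have PA: "\<forall>\<^sub>F n in sequentially. {0..T2} \<subseteq> Pos (A n)" by (rule Pos_uniform[OF A a ul PT2])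
 then have 1: "\<forall>\<^sub>F n in sequentially. ereal T1 < Tmax (A n)"
  by eventually_elim (use T1(1) T2(1) in \<open>auto intro: less_le_trans[OF _ Tmax_ge]\<close>)
 have "\<forall>\<^sub>F n in sequentially. \<forall>t\<in>{0..T1}. Hs_norm (real (Suc k) + \<sigma>) 0 (1/2) (%x. UU (A n) t x - UU a t x) < e \<and> Hs_norm (real k + \<sigma>) 0 (1/2) (%x. VV (A n) t x - VV a t x) < e"
 proof (rule eventually_Icc)
  fix r :: "nat => nat" and t t' assume r: "strict_mono r" and t: "\<And>n. t n \<in> {0..T1}" "t \<longlonglongrightarrow> t'" "t' \<in> {0..T1}"
  have tP: "t n \<in> Pos a" "t' \<in> Pos a" for n using t(1)[of n] t(3) PT2 T2(1) by auto
  have ds: "dataseq (%n. A (r n)) a t t'" by unfold_locales (use A a uniform_limit_subseq[OF ul r] t in auto)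
  have lr: "(%n. HN \<sigma> k (%j x. dch (A (r n)) (B (r n)) j x - dch a b j x)) \<longlonglongrightarrow> 0"
   using LIMSEQ_subseq_LIMSEQ[OF lim r] by (simp add: o_def)
  note F = flow_tendsto[OF ks ds tP(2) gA g lr] and G = flow_continuous[OF ks g t(2) tP(2)]
  note cA = chain_cU_cV[OF ks gA] and ca = chain_cU_cV[OF ks g tP(1)] and ca' = chain_cU_cV[OF ks g tP(2)]
  have c: "\<forall>\<^sub>F n in sequentially. chain (Suc k) (%j x. cU (A (r n)) (B (r n)) (t n) j x - cU a b (t n) j x)"
   "\<forall>\<^sub>F n in sequentially. chain k (%j x. cV (A (r n)) (B (r n)) (t n) j x - cV a b (t n) j x)"
   by (rule eventually_mono[OF F(5)], erule chain_diff[OF cA(1) ca(1)], rule eventually_mono[OF F(5)], erule chain_diff[OF cA(2) ca(2)])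
  have D: "(%n. HN \<sigma> m (%j x. X n j x - Y n j x)) \<longlonglongrightarrow> 0"
   if "(%n. HN \<sigma> m (%j x. X n j x - Z j x)) \<longlonglongrightarrow> 0" "(%n. HN \<sigma> m (%j x. Y n j x - Z j x)) \<longlonglongrightarrow> 0"
    "\<forall>\<^sub>F n in sequentially. chain m (X n)" "\<And>n. chain m (Y n)" "chain m Z" for m X Y Z
  proof (rule tendsto_sandwich[OF _ _ tendsto_const])
   show "(%n. 2 * HN \<sigma> m (%j x. X n j x - Z j x) + 2 * HN \<sigma> m (%j x. Y n j x - Z j x)) \<longlonglongrightarrow> 0"
    by (intro tendsto_0_ennreal_add tendsto_0_ennreal_cmult that(1,2)) auto
   show "\<forall>\<^sub>F n in sequentially. HN \<sigma> m (%j x. X n j x - Y n j x) \<le> 2 * HN \<sigma> m (%j x. X n j x - Z j x) + 2 * HN \<sigma> m (%j x. Y n j x - Z j x)"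
    using that(3)
   proof eventually_elim
    case (elim n)
    from HN_lin[OF chain_diff[OF elim that(5)] chain_diff[OF that(4,5)], of "-1" \<sigma> n] show ?case by simp
   qed
  qed simp
  have cX: "\<forall>\<^sub>F n in sequentially. chain (Suc k) (cU (A (r n)) (B (r n)) (t n))" "\<forall>\<^sub>F n in sequentially. chain k (cV (A (r n)) (B (r n)) (t n))"
   by (rule eventually_mono[OF F(5)], erule cA(1), rule eventually_mono[OF F(5)], erule cA(2))
  have "\<forall>\<^sub>F n in sequentially. (%x. UU (A (r n)) (t n) x - UU a (t n) x) \<in> Hs (real (Suc k) + \<sigma>) 0 (1/2) \<and> Hs_norm (real (Suc k) + \<sigma>) 0 (1/2) (%x. UU (A (r n)) (t n) x - UU a (t n) x) < e"
   by (rule HN_imp_Hs_small[OF k(1,2) c(1) D[OF F(1) G(1) cX(1) ca(1) ca'(1)] _ e]) (simp add: cU_def)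
  moreover have "\<forall>\<^sub>F n in sequentially. (%x. VV (A (r n)) (t n) x - VV a (t n) x) \<in> Hs (real k + \<sigma>) 0 (1/2) \<and> Hs_norm (real k + \<sigma>) 0 (1/2) (%x. VV (A (r n)) (t n) x - VV a (t n) x) < e"
   by (rule HN_imp_Hs_small[OF k(1,2) c(2) D[OF F(2) G(2) cX(2) ca(2) ca'(2)] _ e]) (simp add: cV_def)
  ultimately show "\<forall>\<^sub>F n in sequentially. Hs_norm (real (Suc k) + \<sigma>) 0 (1/2) (%x. UU (A (r n)) (t n) x - UU a (t n) x) < e \<and> Hs_norm (real k + \<sigma>) 0 (1/2) (%x. VV (A (r n)) (t n) x - VV a (t n) x) < e"
   by eventually_elim blast
 qed
 with 1 show ?thesis by eventually_elim blast
qed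

text \<open>Chosen without reference to \<open>s\<close>, and unique by \<open>adm_inj\<close>.
  Solution and lifespan are functions of the slope, so the same ones serve for every
  exponent.\<close>

definition slope :: "(real => real) => real => real" where
 "slope u0 = (SOME a. adm a \<and> (\<forall>x\<in>J. u0 x = AD a x))"

lemma slope_eq: assumes a: "adm a" "\<And>x. x \<in> J ==> u0 x = AD a x" shows "slope u0 = a"
 unfolding slope_def
proof (rule some_equality)
 fix a' assume a': "adm a' \<and> (\<forall>x\<in>J. u0 x = AD a' x)"
 have "AD a' x = AD a x" if "x \<in> J" for x using a' a(2)[OF that] that by metis
 then show "a' = a" using a' a(1) by (intro adm_inj) auto
qed (use a in blast)

theorem theorem3p2:
  fixes s :: real
  assumes "3/2 < s" and "s < 5/2"
  shows "\<exists>(Tm :: (real \<Rightarrow> real) \<Rightarrow> ereal) (U :: (real \<Rightarrow> real) \<Rightarrow> real \<Rightarrow> real \<Rightarrow> real)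
            (V :: (real \<Rightarrow> real) \<Rightarrow> real \<Rightarrow> real \<Rightarrow> real).
    (\<forall>u0 \<in> mhs_data s.
        Tm u0 > 0
      \<and> mhs_solution 1 s u0 (Tm u0) (U u0) (V u0)
      \<and> \<not> (\<exists>T' > Tm u0. \<exists>w w'. mhs_solution 1 s u0 T' w w')
      \<and> (\<forall>w w'. mhs_solution 1 s u0 (Tm u0) w w' \<longrightarrow>
            (\<forall>t \<in> tint (Tm u0). \<forall>x \<in> {0..1/2}. w t x = U u0 t x))
      \<and> (\<forall>s'. 3/2 < s' \<and> s' < 5/2 \<and> s' \<noteq> s \<and> u0 \<in> Hs s' 0 (1/2) \<longrightarrow>
            mhs_solution 1 s' u0 (Tm u0) (U u0) (V u0)))
    \<and> (\<forall>u0 \<in> mhs_data s. \<forall>T1. 0 \<le> T1 \<and> ereal T1 < Tm u0 \<longrightarrow>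
         (\<forall>\<epsilon>>0. \<exists>\<delta>>0. \<forall>w0 \<in> mhs_data s.
            (\<lambda>x. w0 x - u0 x) \<in> Hs s 0 (1/2) \<and> Hs_norm s 0 (1/2) (\<lambda>x. w0 x - u0 x) < \<delta> \<longrightarrow>
              ereal T1 < Tm w0
            \<and> (\<forall>t \<in> {0..T1}.
                 Hs_norm s 0 (1/2) (\<lambda>x. U w0 t x - U u0 t x) < \<epsilon>
               \<and> Hs_norm (s - 1) 0 (1/2) (\<lambda>x. V w0 t x - V u0 t x) < \<epsilon>)))"
proof -
 from kcase_exists[OF assms] obtain k \<sigma> where ks: "kcase k \<sigma>" and s: "s = real (Suc k) + \<sigma>" .
 have s1: "s - 1 = real k + \<sigma>" using s by simp
 define Tm where "Tm = (%u0. Tmax (slope u0))"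
 define U where "U = (%u0. UU (slope u0))"
 define V where "V = (%u0. VV (slope u0))"
 have rep: "\<exists>b. good k \<sigma> (slope u0) b \<and> (\<forall>x\<in>J. u0 x = AD (slope u0) x)"
  if ks: "kcase k \<sigma>" and u0: "u0 \<in> mhs_data (real (Suc k) + \<sigma>)" for u0 k \<sigma>
 proof -
  from data_good[OF ks u0] obtain a b where ab: "good k \<sigma> a b" "\<And>x. x \<in> J ==> u0 x = AD a x" by blast
  have "slope u0 = a" by (rule slope_eq[OF _ ab(2)]) (use ab(1) in \<open>auto simp: good_def\<close>)
  then show ?thesis using ab by blast
 qed
 have A: "Tm u0 > 0
   \<and> mhs_solution 1 s u0 (Tm u0) (U u0) (V u0)
   \<and> \<not> (\<exists>T' > Tm u0. \<exists>w w'. mhs_solution 1 s u0 T' w w')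
   \<and> (\<forall>w w'. mhs_solution 1 s u0 (Tm u0) w w' \<longrightarrow>
      (\<forall>t \<in> tint (Tm u0). \<forall>x \<in> {0..1/2}. w t x = U u0 t x))
   \<and> (\<forall>s'. 3/2 < s' \<and> s' < 5/2 \<and> s' \<noteq> s \<and> u0 \<in> Hs s' 0 (1/2) \<longrightarrow>
      mhs_solution 1 s' u0 (Tm u0) (U u0) (V u0))" if u0: "u0 \<in> mhs_data s" for u0
 proof -
  from rep[OF ks u0[unfolded s]] obtain b where b: "good k \<sigma> (slope u0) b" "\<And>x. x \<in> J ==> u0 x = AD (slope u0) x" by blast
  have a: "adm (slope u0)" using b(1) unfolding good_def by blast
  note uniq = solution_unique[OF ks _ a b(2)]
  have "mhs_solution 1 s u0 (Tm u0) (U u0) (V u0)" unfolding s Tm_def U_def V_def by (rule flow_solution[OF ks b])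
  moreover have "\<not> (\<exists>T' > Tm u0. \<exists>w w'. mhs_solution 1 s u0 T' w w')"
  proof
   assume "\<exists>T' > Tm u0. \<exists>w w'. mhs_solution 1 s u0 T' w w'"
   then obtain T' w w' where T': "Tm u0 < T'" "mhs_solution 1 (real (Suc k) + \<sigma>) u0 T' w w'" unfolding s by blast
   obtain t where t: "Tm u0 < ereal t" "ereal t < T'" using ereal_dense2[OF T'(1)] by blast
   have "0 < ereal t" using Tmax_pos[OF a] t(1) unfolding Tm_def by (rule less_trans)
   then have "ereal t \<le> Tmax (slope u0)" by (intro uniq(1)[OF T'(2) _ _ t(2)]) auto
   then show False using t(1) unfolding Tm_def by simp
  qed
  moreover have "w t x = U u0 t x" if "mhs_solution 1 s u0 (Tm u0) w w'" "t \<in> tint (Tm u0)" "x \<in> J" for w w' t x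
   unfolding U_def by (rule uniq(2)[OF that(1)[unfolded s]]) (use that in \<open>auto simp: tint_def\<close>)
  \<comment> \<open>The datum has one and the same slope at either exponent; going over to
    \<open>s'\<close> changes only the derivative chain, through \<open>b'\<close>.\<close>
  moreover have "mhs_solution 1 s' u0 (Tm u0) (U u0) (V u0)" if s': "3/2 < s'" "s' < 5/2" "u0 \<in> Hs s' 0 (1/2)" for s'
  proof -
   from kcase_exists[OF s'(1,2)] obtain k' \<sigma>' where ks': "kcase k' \<sigma>'" and s'': "s' = real (Suc k') + \<sigma>'" .
   have "u0 \<in> mhs_data (real (Suc k') + \<sigma>')" using u0 s'(3) unfolding mhs_data_def s'' by simp
   from rep[OF ks' this] obtain b' where "good k' \<sigma>' (slope u0) b'" by blast
   then show ?thesis unfolding s'' Tm_def U_def V_def using flow_solution[OF ks' _ b(2)] by blast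
  qed
  ultimately show ?thesis using Tmax_pos[OF a] unfolding Tm_def by blast
 qed
 have B: "\<exists>\<delta>>0. \<forall>w0 \<in> mhs_data s.
      (%x. w0 x - u0 x) \<in> Hs s 0 (1/2) \<and> Hs_norm s 0 (1/2) (%x. w0 x - u0 x) < \<delta> \<longrightarrow>
       ereal T1 < Tm w0
      \<and> (\<forall>t \<in> {0..T1}.
         Hs_norm s 0 (1/2) (%x. U w0 t x - U u0 t x) < \<epsilon>
        \<and> Hs_norm (s - 1) 0 (1/2) (%x. V w0 t x - V u0 t x) < \<epsilon>)"
  if u0: "u0 \<in> mhs_data s" and T1: "0 \<le> T1" "ereal T1 < Tm u0" and e: "0 < \<epsilon>" for u0 T1 \<epsilon>
 proof -
  from rep[OF ks u0[unfolded s]] obtain b where b: "good k \<sigma> (slope u0) b" "\<And>x. x \<in> J ==> u0 x = AD (slope u0) x" by blast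
  define S where "S = {w0 \<in> mhs_data s. (%x. w0 x - u0 x) \<in> Hs s 0 (1/2)}"
  have "\<exists>\<delta>>0. \<forall>w0\<in>S. Hs_norm s 0 (1/2) (%x. w0 x - u0 x) < \<delta> \<longrightarrow> ereal T1 < Tm w0
      \<and> (\<forall>t \<in> {0..T1}. Hs_norm s 0 (1/2) (%x. U w0 t x - U u0 t x) < \<epsilon>
        \<and> Hs_norm (s - 1) 0 (1/2) (%x. V w0 t x - V u0 t x) < \<epsilon>)"
  proof (rule sequence_delta)
   fix w :: "nat => real => real"
   assume w: "\<And>n. w n \<in> S" "\<And>n. Hs_norm s 0 (1/2) (%x. w n x - u0 x) < inverse (real (Suc n))"
   have ex: "\<exists>b'. good k \<sigma> (slope (w n)) b' \<and> chain k (%j x. dch (slope (w n)) b' j x - dch (slope u0) b j x)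
     \<and> HN \<sigma> k (%j x. dch (slope (w n)) b' j x - dch (slope u0) b j x) \<le> ennreal ((inverse (real (Suc n)))\<^sup>2)" for n
   proof -
    from data_perturb[OF ks b(1) u0[unfolded s] b(2), of "w n" "inverse (real (Suc n))"] w[of n] s
    obtain a' b' where g: "good k \<sigma> a' b'" and a': "\<And>x. x \<in> J ==> w n x = AD a' x"
     and r: "chain k (%j x. dch a' b' j x - dch (slope u0) b j x)"
      "HN \<sigma> k (%j x. dch a' b' j x - dch (slope u0) b j x) \<le> ennreal ((inverse (real (Suc n)))\<^sup>2)"
     unfolding S_def by blast
    have "slope (w n) = a'" by (rule slope_eq[OF _ a']) (use g in \<open>auto simp: good_def\<close>)
    then show ?thesis using g r by blast
   qed
   from choice[OF allI[OF ex]] obtain B where B0: "\<forall>n. good k \<sigma> (slope (w n)) (B n) \<and> chain k (%j x. dch (slope (w n)) (B n) j x - dch (slope u0) b j x)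
     \<and> HN \<sigma> k (%j x. dch (slope (w n)) (B n) j x - dch (slope u0) b j x) \<le> ennreal ((inverse (real (Suc n)))\<^sup>2)" ..
   have B: "good k \<sigma> (slope (w n)) (B n)" "chain k (%j x. dch (slope (w n)) (B n) j x - dch (slope u0) b j x)"
    "HN \<sigma> k (%j x. dch (slope (w n)) (B n) j x - dch (slope u0) b j x) \<le> ennreal ((inverse (real (Suc n)))\<^sup>2)" for n
    using spec[OF B0, of n] by blast+
   from flow_data_continuous[OF ks b(1) T1(1) T1(2)[unfolded Tm_def] e B]
   show "\<forall>\<^sub>F n in sequentially. ereal T1 < Tm (w n)
      \<and> (\<forall>t \<in> {0..T1}. Hs_norm s 0 (1/2) (%x. U (w n) t x - U u0 t x) < \<epsilon>
        \<and> Hs_norm (s - 1) 0 (1/2) (%x. V (w n) t x - V u0 t x) < \<epsilon>)"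
    unfolding s1 unfolding s Tm_def U_def V_def .
  qed
  then show ?thesis unfolding S_def by blast
 qed
 show ?thesis
  by (rule exI[of _ Tm], rule exI[of _ U], rule exI[of _ V], rule conjI, rule ballI, erule A,
    intro ballI allI impI, elim conjE, rule B; assumption)
qed

end
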